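(* Suppose that: (a) for each $n$ the operator Riccati equation $$\dot\eta_n(t)+\eta_n(t)(A_n-BB^*\Pi(t))+(A_n^*-\Pi(t)BB^* )\eta_n(t)+\eta_n(t)F_1-\eta_n(t)BB^*\eta_n(t)+\Lambda(t)=0,\qquad\eta_n(T)=-G\widehat F_2,$$ admits a strict solution $\eta_n\in C_s(\mathcal T;\mathcal L(H))$, with $\|\eta_n(t)\|$ bounded uniformly in $t\in\mathcal T$ and $n$; (b) there exists $\eta\in C_s(\mathcal T;\mathcal L(H))$ such that $\sup_{t\in\mathcal T}|\eta_n(t)x-\eta(t)x|_H\to0$ as $n\to\infty$ for all $x\in H$. Then, for any $T>0$, the coupled forward-backward stochastic evolution equation $$q(t)=S^*(T-t)G\widehat F_2\bar x(T)-\int_t^TS^*(r-t)\big(\Pi(r)BB^*q(r)+\Lambda(r)\bar x(r)+D^*\sigma\big)dr-\int_t^TS^*(r-t)\widetilde q(r)\,dW_0(r),$$ $$\bar x(t)=S(t)\bar\xi-\int_0^tS(t-r)\big((BB^*\Pi(r)-F_1)\bar x(r)-BB^*q(r)\big)dr+\int_0^tS(t-r)\sigma_0\,dW_0(r),\qquad t\in\mathcal T,$$ admits at least one mild solution $(\bar x,(q,\widetilde q))$.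
   Context: $H,U,V$ are real separable Hilbert spaces, $\mathcal T=[0,T]$ with $T>0$ arbitrary, and $(\Omega,\mathfrak F,\mathbb P)$ is a probability space. A bounded operator $P$ is positive if it is self-adjoint and $\langle Px,x\rangle\ge0$ for all $x$. $\mathcal L$ and $\mathcal L_2$ denote bounded and Hilbert–Schmidt operators. $Q,Q_0$ are positive trace class operators on $V$; $V_Q=Q^{1/2}V$ carries the inner product $\sum_{j:\lambda_j>0}\lambda_j^{-1}\langle u,e_j\rangle\langle v,e_j\rangle$, with $(\lambda_j,e_j)$ the eigenpairs of $Q$; $V_{Q_0}$ is defined likewise. Operators in $\mathcal L(V;H)$ are identified with their restrictions to $V_Q$ (or $V_{Q_0}$), which are Hilbert–Schmidt. $A$, with domain $\mathcal D(A)$, generates a $C_0$-semigroup $S(t)$ on $H$; $A_n=An(nI-A)^{-1}$ is its Yosida approximation ($n\in\mathbb N$, large enough to be in the resolvent set of $A$). $B\in\mathcal L(U;H)$, $F_1,\widehat F_1,\widehat F_2\in\mathcal L(H)$, $D,F_2\in\mathcal L(H;\mathcal L_2(V_Q;H))$, $\sigma,\sigma_0\in\mathcal L(V;H)$, $\bar\xi\in H$; $M,G\in\mathcal L(H)$ are positive. $D^*:\mathcal L_2(V_Q;H)\to H$ is the Hilbert adjoint; $\Pi Dx$ means $\Pi\circ(Dx)$, similarly $\Pi F_2x$. (In the underlying game the common-noise diffusion coefficients $D_0$ and $F_0$ are assumed to be zero; this is already built into the equations.) $W_0$ is a $V$-valued $Q_0$-Wiener process with augmented natural filtration $\mathcal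 F^0$; $\mathcal M^2_{\mathcal F^0}(\mathcal T;\mathcal X)$ is the space of $\mathcal X$-valued $\mathcal F^0$-progressively measurable processes with $\mathbb E\int_0^T|x(t)|^2dt<\infty$. A mild solution is a triple with $\bar x$ an $\mathcal F^0$-adapted process continuous from $\mathcal T$ to $L^2(\Omega;H)$ and $(q,\widetilde q)\in\mathcal M^2_{\mathcal F^0}(\mathcal T;H)\times\mathcal M^2_{\mathcal F^0}(\mathcal T;\mathcal L_2(V_{Q_0};H))$ satisfying the two integral equations. $C_s(\mathcal T;\mathcal L(H))$ is the space of strongly continuous maps $\mathcal T\to\mathcal L(H)$. A strict solution of the Riccati equation for $\eta_n$ is a map such that $t\mapsto\eta_n(t)x$ is $C^1$ for every $x\in H$ and the equation holds when applied to $x$. $\Pi\in C_s(\mathcal T;\mathcal L(H))$ is the positive-operator-valued solution of $\frac d{dt}\langle\Pi(t)x,x\rangle=-2\langle\Pi(t)x,Ax\rangle+\langle\Pi(t)BB^*\Pi(t)x,x\rangle-\langle D^*\Pi(t)Dx,x\rangle-\langle Mx,x\rangle$, $\Pi(T)=G$, $x\in\mathcal D(A)$, and $\Lambda(t)=D^*\Pi(t)F_2+\Pi(t)F_1-M\widehat F_1$. *)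

theory Defs
  imports "HOL-Probability.Probability"
begin

class separable_hilbert = real_inner + banach + second_countable_topology

instance euclidean_space \<subseteq> separable_hilbert ..

definition adj :: "('a::separable_hilbert \<Rightarrow>\<^sub>L 'b::separable_hilbert) \<Rightarrow> 'b \<Rightarrow>\<^sub>L 'a" where
  "adj L = Blinfun (adjoint (blinfun_apply L))"

definition positive_op :: "('a::separable_hilbert \<Rightarrow>\<^sub>L 'a) \<Rightarrow> bool" where
  "positive_op L \<longleftrightarrow> (\<forall>x y. L x \<bullet> y = x \<bullet> L y) \<and> (\<forall>x. 0 \<le> L x \<bullet> x)"

definition op_sqrt :: "('a::separable_hilbert \<Rightarrow>\<^sub>L 'a) \<Rightarrow> 'a \<Rightarrow>\<^sub>L 'a" where
  "op_sqrt Q = (THE R. positive_op R \<and> R o\<^sub>L R = Q)"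

definition orthonormal_basis :: "'a::separable_hilbert set \<Rightarrow> bool" where
  "orthonormal_basis E \<longleftrightarrow>
     pairwise orthogonal E \<and> (\<forall>e\<in>E. norm e = 1) \<and> closure (span E) = UNIV"

text \<open>For positive operators, being trace class means that the trace series converges
  in some (equivalently, in every) orthonormal basis.\<close>

definition positive_trace_class :: "('a::separable_hilbert \<Rightarrow>\<^sub>L 'a) \<Rightarrow> bool" where
  "positive_trace_class Q \<longleftrightarrow>
     positive_op Q \<and> (\<exists>E. orthonormal_basis E \<and> (\<lambda>e. Q e \<bullet> e) summable_on E)"

definition C0_semigroup :: "(real \<Rightarrow> 'a::separable_hilbert \<Rightarrow>\<^sub>L 'a) \<Rightarrow> bool" where
  "C0_semigroup S \<longleftrightarrow> S 0 = id_blinfun \<and>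
     (\<forall>s\<ge>0. \<forall>t\<ge>0. S (s + t) = S s o\<^sub>L S t) \<and>
     (\<forall>x. ((\<lambda>t. S t x) \<longlongrightarrow> x) (at_right 0))"

text \<open>An unbounded operator is a domain together with a function whose values outside
  the domain are irrelevant.\<close>

definition generates ::
  "'a::separable_hilbert set \<Rightarrow> ('a \<Rightarrow> 'a) \<Rightarrow> (real \<Rightarrow> 'a \<Rightarrow>\<^sub>L 'a) \<Rightarrow> bool" where
  "generates DA A S \<longleftrightarrow> C0_semigroup S \<and>
     DA = {x. \<exists>y. ((\<lambda>t. (S t x - x) /\<^sub>R t) \<longlongrightarrow> y) (at_right 0)} \<and>
     (\<forall>x\<in>DA. ((\<lambda>t. (S t x - x) /\<^sub>R t) \<longlongrightarrow> A x) (at_right 0))"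

definition resolvent_set :: "'a::separable_hilbert set \<Rightarrow> ('a \<Rightarrow> 'a) \<Rightarrow> real set" where
  "resolvent_set DA A = {l. bij_betw (\<lambda>x. l *\<^sub>R x - A x) DA UNIV \<and>
     bounded_linear (inv_into DA (\<lambda>x. l *\<^sub>R x - A x))}"

definition yosida :: "'a::separable_hilbert set \<Rightarrow> ('a \<Rightarrow> 'a) \<Rightarrow> nat \<Rightarrow> 'a \<Rightarrow>\<^sub>L 'a" where
  "yosida DA A n =
     Blinfun (\<lambda>x. A (real n *\<^sub>R inv_into DA (\<lambda>y. real n *\<^sub>R y - A y) x))"

definition Cs :: "real \<Rightarrow> (real \<Rightarrow> 'a::separable_hilbert \<Rightarrow>\<^sub>L 'a) set" where
  "Cs T = {X. \<forall>x. continuous_on {0..T} (\<lambda>t. blinfun_apply (X t) x)}"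

text \<open>By the spectral theorem such a basis exists for positive trace class \<open>Q\<close>; the inner
  product of \<open>V\<^sub>Q\<close> and the Hilbert--Schmidt norm below do not depend on its choice.\<close>

definition eigenbasis :: "('v::separable_hilbert \<Rightarrow>\<^sub>L 'v) \<Rightarrow> 'v set" where
  "eigenbasis Q = (SOME E. orthonormal_basis E \<and> (\<forall>e\<in>E. \<exists>l. Q e = l *\<^sub>R e))"

definition eigenvalue :: "('v::separable_hilbert \<Rightarrow>\<^sub>L 'v) \<Rightarrow> 'v \<Rightarrow> real" where
  "eigenvalue Q e = (THE l. Q e = l *\<^sub>R e)"

text \<open>\<open>VQ Q\<close> is \<open>V\<^sub>Q = Q\<^sup>1\<^sup>/\<^sup>2 V\<close>.\<close>

definition VQ :: "('v::separable_hilbert \<Rightarrow>\<^sub>L 'v) \<Rightarrow> 'v set" where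
  "VQ Q = range (blinfun_apply (op_sqrt Q))"

definition VQ_inner :: "('v::separable_hilbert \<Rightarrow>\<^sub>L 'v) \<Rightarrow> 'v \<Rightarrow> 'v \<Rightarrow> real" where
  "VQ_inner Q u v = (\<Sum>\<^sub>\<infinity>e\<in>{e \<in> eigenbasis Q. 0 < eigenvalue Q e}.
     inverse (eigenvalue Q e) * (u \<bullet> e) * (v \<bullet> e))"

text \<open>The vectors \<open>\<lambda>\<^sub>j\<^sup>1\<^sup>/\<^sup>2 e\<^sub>j\<close> with \<open>\<lambda>\<^sub>j > 0\<close> form an orthonormal basis of \<open>V\<^sub>Q\<close>.\<close>

definition VQ_basis :: "('v::separable_hilbert \<Rightarrow>\<^sub>L 'v) \<Rightarrow> 'v set" where
  "VQ_basis Q =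
     (\<lambda>e. sqrt (eigenvalue Q e) *\<^sub>R e) ` {e \<in> eigenbasis Q. 0 < eigenvalue Q e}"

text \<open>\<open>HS Q\<close> is \<open>\<L>\<^sub>2(V\<^sub>Q; H)\<close>: bounded linear maps on \<open>V\<^sub>Q\<close> (for the \<open>V\<^sub>Q\<close> norm) that are
  Hilbert--Schmidt. They are represented by functions on all of \<open>V\<close> which vanish outside
  \<open>V\<^sub>Q\<close>, so that equal operators are equal functions.\<close>

definition HS :: "('v::separable_hilbert \<Rightarrow>\<^sub>L 'v) \<Rightarrow> ('v \<Rightarrow> 'h::separable_hilbert) set" where
  "HS Q = {\<Phi>. (\<forall>v. v \<notin> VQ Q \<longrightarrow> \<Phi> v = 0) \<and>
     (\<forall>u\<in>VQ Q. \<forall>v\<in>VQ Q. \<Phi> (u + v) = \<Phi> u + \<Phi> v) \<and>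
     (\<forall>c. \<forall>u\<in>VQ Q. \<Phi> (c *\<^sub>R u) = c *\<^sub>R \<Phi> u) \<and>
     (\<exists>C. \<forall>u\<in>VQ Q. norm (\<Phi> u) \<le> C * sqrt (VQ_inner Q u u)) \<and>
     (\<lambda>f. (norm (\<Phi> f))\<^sup>2) summable_on VQ_basis Q}"

definition HS_inner ::
  "('v::separable_hilbert \<Rightarrow>\<^sub>L 'v) \<Rightarrow> ('v \<Rightarrow> 'h::separable_hilbert) \<Rightarrow> ('v \<Rightarrow> 'h) \<Rightarrow> real" where
  "HS_inner Q \<Phi> \<Psi> = (\<Sum>\<^sub>\<infinity>f\<in>VQ_basis Q. \<Phi> f \<bullet> \<Psi> f)"

definition HS_norm :: "('v::separable_hilbert \<Rightarrow>\<^sub>L 'v) \<Rightarrow> ('v \<Rightarrow> 'h::separable_hilbert) \<Rightarrow> real" where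
  "HS_norm Q \<Phi> = sqrt (HS_inner Q \<Phi> \<Phi>)"

definition HS_borel ::
  "('v::separable_hilbert \<Rightarrow>\<^sub>L 'v) \<Rightarrow> ('v \<Rightarrow> 'h::separable_hilbert) measure" where
  "HS_borel Q = sigma (HS Q) {U. U \<subseteq> HS Q \<and>
     (\<forall>\<Phi>\<in>U. \<exists>\<epsilon>>0. \<forall>\<Psi>\<in>HS Q. HS_norm Q (\<lambda>v. \<Psi> v - \<Phi> v) < \<epsilon> \<longrightarrow> \<Psi> \<in> U)}"

definition restrict_VQ ::
  "('v::separable_hilbert \<Rightarrow>\<^sub>L 'v) \<Rightarrow> ('v \<Rightarrow>\<^sub>L 'h::separable_hilbert) \<Rightarrow> 'v \<Rightarrow> 'h" where
  "restrict_VQ Q L = (\<lambda>v. if v \<in> VQ Q then L v else 0)"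

definition bounded_into_HS ::
  "('v::separable_hilbert \<Rightarrow>\<^sub>L 'v) \<Rightarrow> ('h::separable_hilbert \<Rightarrow> 'v \<Rightarrow> 'h) \<Rightarrow> bool" where
  "bounded_into_HS Q D \<longleftrightarrow> (\<forall>x. D x \<in> HS Q) \<and>
     (\<forall>x y v. D (x + y) v = D x v + D y v) \<and>
     (\<forall>c x v. D (c *\<^sub>R x) v = c *\<^sub>R D x v) \<and>
     (\<exists>C. \<forall>x. HS_norm Q (D x) \<le> C * norm x)"

definition HS_adj ::
  "('v::separable_hilbert \<Rightarrow>\<^sub>L 'v) \<Rightarrow> ('h::separable_hilbert \<Rightarrow> 'v \<Rightarrow> 'h) \<Rightarrow> ('v \<Rightarrow> 'h) \<Rightarrow> 'h" where
  "HS_adj Q D \<Phi> = (THE y. \<forall>x. y \<bullet> x = HS_inner Q \<Phi> (D x))"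

definition real_gaussian :: "real \<Rightarrow> real measure" where
  "real_gaussian s2 = (if 0 < s2 then density lborel (normal_density 0 (sqrt s2)) else return borel 0)"

text \<open>A \<open>V\<close>-valued random variable has law \<open>N(0, R)\<close> if its scalar product with each \<open>v\<close> has
  law \<open>N(0, \<langle>R v, v\<rangle>)\<close>.\<close>

definition Q_wiener :: "real \<Rightarrow> 'w measure \<Rightarrow> ('v::separable_hilbert \<Rightarrow>\<^sub>L 'v) \<Rightarrow>
    (real \<Rightarrow> 'w \<Rightarrow> 'v) \<Rightarrow> bool" where
  "Q_wiener T P Q W \<longleftrightarrow>
     (\<forall>t\<in>{0..T}. W t \<in> borel_measurable P) \<and>
     (AE \<omega> in P. W 0 \<omega> = 0) \<and>
     (AE \<omega> in P. continuous_on {0..T} (\<lambda>t. W t \<omega>)) \<and>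
     (\<forall>n \<tau>. (\<forall>i\<le>n. \<tau> i \<in> {0..T}) \<and> (\<forall>i<n. \<tau> i \<le> \<tau> (Suc i)) \<longrightarrow>
        prob_space.indep_vars P (\<lambda>_. borel) (\<lambda>i \<omega>. W (\<tau> (Suc i)) \<omega> - W (\<tau> i) \<omega>) {..<n::nat}) \<and>
     (\<forall>s t v. 0 \<le> s \<and> s \<le> t \<and> t \<le> T \<longrightarrow>
        distr P borel (\<lambda>\<omega>. (W t \<omega> - W s \<omega>) \<bullet> v) = real_gaussian ((t - s) * (Q v \<bullet> v)))"

definition aug_filtration ::
  "'w measure \<Rightarrow> (real \<Rightarrow> 'w \<Rightarrow> 'v::separable_hilbert) \<Rightarrow> real \<Rightarrow> 'w measure" where
  "aug_filtration P W t = sigma (space P)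
     ({W s -` B \<inter> space P | s B. s \<in> {0..t} \<and> B \<in> sets borel} \<union> null_sets P)"

text \<open>\<open>M2 a b P F X nrm\<close> is the space \<open>\<M>\<^sup>2\<^sub>F([a,b]; \<X>)\<close> for a normed space \<open>\<X>\<close> whose Borel
  \<open>\<sigma>\<close>-algebra is \<open>X\<close> and whose norm is \<open>nrm\<close>.\<close>

definition M2 :: "real \<Rightarrow> real \<Rightarrow> 'w measure \<Rightarrow> (real \<Rightarrow> 'w measure) \<Rightarrow>
    'x measure \<Rightarrow> ('x \<Rightarrow> real) \<Rightarrow> (real \<Rightarrow> 'w \<Rightarrow> 'x) set" where
  "M2 a b P F X nrm = {Y.
     (\<forall>t\<in>{a..b}. (\<lambda>(r, \<omega>). Y r \<omega>) \<in> restrict_space borel {a..t} \<Otimes>\<^sub>M F t \<rightarrow>\<^sub>M X) \<and>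
     (\<integral>\<^sup>+\<omega>. (\<integral>\<^sup>+r\<in>{a..b}. ennreal ((nrm (Y r \<omega>))\<^sup>2) \<partial>lborel) \<partial>P) < \<infinity>}"

definition adapted_L2_continuous :: "real \<Rightarrow> 'w measure \<Rightarrow> (real \<Rightarrow> 'w measure) \<Rightarrow>
    (real \<Rightarrow> 'w \<Rightarrow> 'h::separable_hilbert) \<Rightarrow> bool" where
  "adapted_L2_continuous T P F X \<longleftrightarrow>
     (\<forall>t\<in>{0..T}. X t \<in> borel_measurable (F t)) \<and>
     (\<forall>t\<in>{0..T}. (\<integral>\<^sup>+\<omega>. ennreal ((norm (X t \<omega>))\<^sup>2) \<partial>P) < \<infinity>) \<and>
     (\<forall>t\<in>{0..T}. ((\<lambda>s. \<integral>\<^sup>+\<omega>. ennreal ((norm (X s \<omega> - X t \<omega>))\<^sup>2) \<partial>P) \<longlongrightarrow> 0) (at t within {0..T}))"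

text \<open>A list of quadruples \<open>(a, b, A, L)\<close> encodes the elementary operator-valued process
  \<open>\<Sum> 1\<^bsub>(a,b]\<^esub>(r) 1\<^bsub>A\<^esub>(\<omega>) L\<close>. The Ito integral over \<open>[s,t]\<close> is the mean-square limit of the
  integrals of elementary processes approximating the integrand; it is unique up to
  null sets.\<close>

type_synonym ('w, 'v, 'h) elementary = "(real \<times> real \<times> 'w set \<times> ('v \<Rightarrow>\<^sub>L 'h)) list"

definition elementary_on :: "real \<Rightarrow> real \<Rightarrow> (real \<Rightarrow> 'w measure) \<Rightarrow>
    ('w, 'v::separable_hilbert, 'h::separable_hilbert) elementary \<Rightarrow> bool" where
  "elementary_on s t F E \<longleftrightarrow>
     (\<forall>(a, b, A, L)\<in>set E. s \<le> a \<and> a \<le> b \<and> b \<le> t \<and> A \<in> sets (F a))"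

definition elementary_process ::
  "('w, 'v::separable_hilbert, 'h::separable_hilbert) elementary \<Rightarrow> real \<Rightarrow> 'w \<Rightarrow> 'v \<Rightarrow>\<^sub>L 'h" where
  "elementary_process E r \<omega> =
     (\<Sum>(a, b, A, L)\<leftarrow>E. (indicator {a<..b} r * indicator A \<omega>) *\<^sub>R L)"

definition elementary_integral :: "(real \<Rightarrow> 'w \<Rightarrow> 'v) \<Rightarrow>
    ('w, 'v::separable_hilbert, 'h::separable_hilbert) elementary \<Rightarrow> 'w \<Rightarrow> 'h" where
  "elementary_integral W E \<omega> =
     (\<Sum>(a, b, A, L)\<leftarrow>E. indicator A \<omega> *\<^sub>R L (W b \<omega> - W a \<omega>))"

definition has_ito_integral :: "'w measure \<Rightarrow> (real \<Rightarrow> 'w measure) \<Rightarrow>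
    ('v::separable_hilbert \<Rightarrow>\<^sub>L 'v) \<Rightarrow> (real \<Rightarrow> 'w \<Rightarrow> 'v) \<Rightarrow> real \<Rightarrow> real \<Rightarrow>
    (real \<Rightarrow> 'w \<Rightarrow> 'v \<Rightarrow> 'h::separable_hilbert) \<Rightarrow> ('w \<Rightarrow> 'h) \<Rightarrow> bool" where
  "has_ito_integral P F Q W s t \<Phi> I \<longleftrightarrow>
     \<Phi> \<in> M2 s t P F (HS_borel Q) (HS_norm Q) \<and> I \<in> borel_measurable P \<and>
     (\<exists>E. (\<forall>n. elementary_on s t F (E n)) \<and>
        (\<lambda>n. \<integral>\<^sup>+\<omega>. (\<integral>\<^sup>+r\<in>{s..t}. ennreal ((HS_norm Q
           (\<lambda>v. restrict_VQ Q (elementary_process (E n) r \<omega>) v - \<Phi> r \<omega> v))\<^sup>2) \<partial>lborel) \<partial>P)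
          \<longlonglongrightarrow> 0 \<and>
        (\<lambda>n. \<integral>\<^sup>+\<omega>. ennreal ((norm (elementary_integral W (E n) \<omega> - I \<omega>))\<^sup>2) \<partial>P) \<longlonglongrightarrow> 0)"

end

(* The coupling is removed by the ansatz q = - (eta x + phi). The limit eta of the eta_n satisfies
the Riccati equation in integrated (mild) form, since the Yosida approximations converge
strongly. Substituting the ansatz, x becomes a linear forward equation driven by W0 with
additive noise and drift K = F1 - B B* (Pi + eta), while phi solves a deterministic backward
equation and the martingale integrand is - eta sigma0.

No Ito formula is needed. Replacing W0 by its dyadic increments, the forward process becomes
a deterministic evolution with finitely many jumps, for which the forward and backward
equations follow pathwise from the mild Riccati equation, each jump v at time p contributing
S(p - t)* eta(p) v. The Ito isometry lets the mesh tend to zero in mean square. *)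
theory Submission
  imports Defs
begin

section \<open>Operators on Hilbert spaces\<close>

text \<open>\<open>A\<close> is unbounded and the approximations converge only strongly, so the
  limit \<open>eta\<close> is not known to be differentiable. The product rule for the Riccati
  solution is therefore applied to the Yosida approximations, along orbits of vectors in the domain
  of \<open>A\<close>, and only integrated identities reach the limit. The correction
  \<open>phi\<close> is deterministic because the coefficients are deterministic and the noise is
  additive; hence every stochastic integrand is a deterministic, strongly continuous family of
  bounded operators. Two facts turn this into mean-square estimates: the trace condition makes
  Hilbert-Schmidt tails uniformly small, so strong continuity becomes continuity in the
  Hilbert-Schmidt norm on \<open>VQ\<close>; and this norm controls dyadic sums with deterministic
  operators. \<Lambda> enters as a mere function; that it is a strongly continuous family of bounded
  operators is read off the Riccati equation of one approximation. The forward process is an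
  explicit pointwise limit along one subsequence common to all times, so that progressive
  measurability passes to it.\<close>

lemma uniform_boundedness:
  fixes L :: "'i \<Rightarrow> 'a::banach \<Rightarrow>\<^sub>L 'b::real_normed_vector"
  assumes "\<And>x. \<exists>C. \<forall>i\<in>I. norm (L i x) \<le> C"
  shows "\<exists>C\<ge>0. \<forall>i\<in>I. norm (L i) \<le> C"
proof -
  define E where "E k = {x. \<forall>i\<in>I. norm (L i x) \<le> real k}" for k
  have cl: "closed (E k)" for k
    unfolding E_def Collect_ball_eq
    by (intro closed_INT ballI closed_Collect_le continuous_intros)
  have UN: "\<Union>(range E) = UNIV"
  proof -
    have "\<exists>k. x \<in> E k" for x
    proof -
      obtain C where "\<forall>i\<in>I. norm (L i x) \<le> C" using assms by blast
      moreover obtain k where "C \<le> real k" using real_arch_simple by blast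
      ultimately have "x \<in> E k" unfolding E_def by force
      then show ?thesis by blast
    qed
    then show ?thesis by blast
  qed
  \<comment> \<open>Baire: the whole space is a countable union of the closed sets
    \<open>E k\<close>, so one of them contains a ball; linearity then moves the bound from that
    ball to the unit ball.\<close>
  have "\<exists>k. interior (E k) \<noteq> {}"
  proof (rule ccontr)
    assume "\<not> ?thesis"
    then have "euclidean interior_of \<Union>(range E) = {}"
      by (intro Baire_category_alt) (auto simp: completely_metrizable_space_euclidean cl)
    with UN show False by simp
  qed
  then obtain k x0 where "x0 \<in> interior (E k)" by blast
  then obtain e where e: "e > 0" "cball x0 e \<subseteq> E k"
    by (auto simp: mem_interior_cball)
  have "norm (L i) \<le> 2 * real k / e" if i: "i \<in> I" for i
  proof (rule norm_blinfun_bound)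
    show "0 \<le> 2 * real k / e" using e by simp
    fix x
    show "norm (L i x) \<le> 2 * real k / e * norm x"
    proof (cases "x = 0")
      case False
      define c where "c = e / norm x"
      have c: "c > 0" using e False by (simp add: c_def)
      have "x0 + c *\<^sub>R x \<in> cball x0 e" using False e by (simp add: dist_norm c_def)
      moreover have "x0 \<in> cball x0 e" using e by simp
      ultimately have "norm (L i (x0 + c *\<^sub>R x)) \<le> k" "norm (L i x0) \<le> k"
        using e i unfolding E_def by blast+
      then have "norm (L i (x0 + c *\<^sub>R x) - L i x0) \<le> 2 * k"
        using norm_triangle_ineq4[of "L i (x0 + c *\<^sub>R x)" "L i x0"] by simp
      then have "c * norm (L i x) \<le> 2 * k"
        using c by (simp add: blinfun.bilinear_simps)
      then show ?thesis using False e by (simp add: c_def field_simps)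
    qed simp
  qed
  then show ?thesis using e by (intro exI[of _ "2 * real k / e"]) auto
qed

text \<open>Projection theorem. The parallelogram law makes a minimising sequence for the distance
  from \<open>x\<close> to \<open>M\<close> Cauchy, completeness and closedness give a nearest point
  \<open>p\<close>, and minimality along each line through \<open>p\<close> in \<open>M\<close>
  forces \<open>x - p\<close> to be orthogonal to \<open>M\<close>.\<close>

lemma closed_subspace_orthogonal_vector:
  fixes M :: "'a::{real_inner,banach} set"
  assumes M: "subspace M" "closed M" and x: "x \<notin> M"
  obtains z where "z \<noteq> 0" "\<And>m. m \<in> M \<Longrightarrow> z \<bullet> m = 0"
proof -
  define d where "d = infdist x M"
  have ne: "M \<noteq> {}" using M(1) subspace_0 by blast
  have d_le: "d \<le> norm (x - m)" if "m \<in> M" for m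
    using infdist_le[OF that, of x] by (simp add: d_def dist_norm)
  have d0: "0 \<le> d" by (simp add: d_def infdist_nonneg)
  have "\<exists>m\<in>M. norm (x - m) < d + inverse (real (Suc n))" for n
  proof -
    have "(INF a\<in>M. dist x a) < d + inverse (real (Suc n))"
      using ne by (simp add: d_def infdist_notempty)
    then show ?thesis using ne by (subst (asm) cINF_less_iff) (auto simp: dist_norm intro!: bdd_belowI2[of _ 0])
  qed
  then obtain m where m: "\<And>n. m n \<in> M" "\<And>n. norm (x - m n) < d + inverse (real (Suc n))"
    by metis
  \<comment> \<open>The excess of the squared distance over its infimum. The midpoint of
    \<open>m n\<close> and \<open>m k\<close> lies in \<open>M\<close>, so the parallelogram law
    bounds the squared distance of these points by the two excesses.\<close>
  define a where "a n = (d + inverse (real (Suc n)))\<^sup>2 - d\<^sup>2" for n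
  have a_lim: "a \<longlonglongrightarrow> 0"
  proof -
    have "a \<longlonglongrightarrow> (d + 0)\<^sup>2 - d\<^sup>2"
      unfolding a_def by (intro tendsto_intros LIMSEQ_inverse_real_of_nat)
    then show ?thesis by simp
  qed
  have diff: "(norm (m n - m k))\<^sup>2 \<le> 2 * (a n + a k)" for n k :: nat
  proof -
    have "(1/2) *\<^sub>R (m n + m k) \<in> M" using m(1) M(1) by (simp add: subspace_add subspace_scale)
    then have "d\<^sup>2 \<le> (norm (x - (1/2) *\<^sub>R (m n + m k)))\<^sup>2" using d_le d0 by (intro power_mono) auto
    moreover have "(norm (x - m i))\<^sup>2 \<le> a i + d\<^sup>2" for i
      unfolding a_def using m(2)[of i] by (simp add: power_mono less_imp_le)
    moreover have "(norm (m n - m k))\<^sup>2 = 2 * (norm (x - m n))\<^sup>2 + 2 * (norm (x - m k))\<^sup>2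
        - 4 * (norm (x - (1/2) *\<^sub>R (m n + m k)))\<^sup>2"
      by (simp add: power2_norm_eq_inner inner_diff inner_add algebra_simps inner_commute)
    ultimately show ?thesis by (smt (verit))
  qed
  have "Cauchy m"
  proof (rule metric_CauchyI)
    fix e :: real assume e: "e > 0"
    have "eventually (\<lambda>n. a n < e\<^sup>2 / 4) sequentially"
      using e by (intro order_tendstoD(2)[OF a_lim]) simp
    then obtain N where N: "\<And>n. n \<ge> N \<Longrightarrow> a n < e\<^sup>2 / 4" by (auto simp: eventually_sequentially)
    have "dist (m n) (m k) < e" if "n \<ge> N" "k \<ge> N" for n k
    proof -
      have "(norm (m n - m k))\<^sup>2 < e\<^sup>2" using diff[of n k] N[OF that(1)] N[OF that(2)] by (simp add: field_simps)
      then show ?thesis using e by (simp add: dist_norm power2_less_imp_less)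
    qed
    then show "\<exists>N. \<forall>n\<ge>N. \<forall>k\<ge>N. dist (m n) (m k) < e" by blast
  qed
  then obtain p where p: "m \<longlonglongrightarrow> p" using Cauchy_convergent convergent_def by blast
  have pM: "p \<in> M" using M(2) m(1) p closed_sequentially by blast
  have "norm (x - p) \<le> d"
  proof (rule LIMSEQ_le)
    show "(\<lambda>n. norm (x - m n)) \<longlonglongrightarrow> norm (x - p)" by (intro tendsto_intros p)
    show "(\<lambda>n. d + inverse (real (Suc n))) \<longlonglongrightarrow> d"
      using tendsto_add[OF tendsto_const LIMSEQ_inverse_real_of_nat, of d] by simp
    show "\<exists>N. \<forall>n\<ge>N. norm (x - m n) \<le> d + inverse (real (Suc n))" using m(2) less_imp_le by blast
  qed
  define z where "z = x - p"
  have "z \<noteq> 0" using x pM by (auto simp: z_def)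
  moreover have "z \<bullet> w = 0" if w: "w \<in> M" for w
  proof (cases "w = 0")
    case False
    \<comment> \<open>The minimiser of the norm of \<open>z - t *\<^sub>R w\<close>; inserting it
      leaves minus the squared inner product over \<open>w \<bullet> w\<close>.\<close>
    define t where "t = (z \<bullet> w) / (w \<bullet> w)"
    have ww: "w \<bullet> w > 0" using False by simp
    have "p + t *\<^sub>R w \<in> M" using pM w M(1) by (simp add: subspace_add subspace_scale)
    then have "norm z \<le> norm (z - t *\<^sub>R w)"
      using d_le[of "p + t *\<^sub>R w"] \<open>norm (x - p) \<le> d\<close> by (simp add: z_def algebra_simps)
    then have "z \<bullet> z \<le> (z - t *\<^sub>R w) \<bullet> (z - t *\<^sub>R w)" by (simp add: norm_le)
    then have "0 \<le> - 2 * t * (z \<bullet> w) + t * t * (w \<bullet> w)"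
      by (simp add: inner_diff algebra_simps inner_commute)
    also have "\<dots> = - (z \<bullet> w)\<^sup>2 / (w \<bullet> w)" using ww by (simp add: t_def power2_eq_square field_simps)
    finally have "(z \<bullet> w)\<^sup>2 \<le> 0" using ww by (simp add: divide_nonneg_pos divide_le_0_iff zero_le_divide_iff)
    then show ?thesis by simp
  qed simp
  ultimately show ?thesis using that by blast
qed

text \<open>The orthogonal complement of the kernel is at most a line: a vector \<open>z\<close>
  orthogonal to the kernel determines \<open>f\<close>, because
  \<open>x - (f x / f z) *\<^sub>R z\<close> lies in the kernel for every \<open>x\<close>.\<close>

lemma riesz_representation:
  fixes f :: "'a::{real_inner,banach} \<Rightarrow> real"
  assumes "bounded_linear f"
  shows "\<exists>y. \<forall>x. f x = y \<bullet> x"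
proof (cases "\<forall>x. f x = 0")
  case True
  then show ?thesis by (intro exI[of _ 0]) simp
next
  case False
  interpret bounded_linear f by fact
  obtain x where x: "f x \<noteq> 0" using False by blast
  have "subspace {x. f x = 0}" by (auto simp: subspace_def add scale)
  moreover have "closed {x. f x = 0}"
    by (intro closed_Collect_eq continuous_on_const linear_continuous_on assms)
  ultimately obtain z where z: "z \<noteq> 0" "\<And>m. f m = 0 \<Longrightarrow> z \<bullet> m = 0"
    using closed_subspace_orthogonal_vector[of "{x. f x = 0}" x] x by auto
  have fz: "f z \<noteq> 0" using z(2)[of z] z(1) by auto
  have "f x = ((f z / (z \<bullet> z)) *\<^sub>R z) \<bullet> x" for x
  proof -
    have "f (x - (f x / f z) *\<^sub>R z) = 0" using fz by (simp add: diff scale)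
    then have "z \<bullet> (x - (f x / f z) *\<^sub>R z) = 0" by (rule z(2))
    then show ?thesis using fz z(1) by (simp add: inner_diff field_simps)
  qed
  then show ?thesis by blast
qed

text \<open>\<open>adjoint\<close> is a choice, and \<open>Blinfun\<close> is meaningful only for
  bounded linear arguments. The Riesz vectors \<open>g y\<close> satisfy the adjoint relation,
  uniqueness identifies them with \<open>adjoint\<close>, and testing with \<open>g y\<close> itself
  bounds them, which licenses \<open>Blinfun\<close>.\<close>

lemma adj_inner:
  fixes L :: "'a::separable_hilbert \<Rightarrow>\<^sub>L 'b::separable_hilbert"
  shows "x \<bullet> adj L y = L x \<bullet> y"
    and "adj L y \<bullet> x = y \<bullet> L x"
    and "norm (adj L) \<le> norm L"
proof -
  have "\<exists>z. \<forall>x. L x \<bullet> y = z \<bullet> x" for y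
    by (intro riesz_representation bounded_linear_compose[OF bounded_linear_inner_left] blinfun.bounded_linear_right)
  then obtain g where g: "\<And>x y. L x \<bullet> y = g y \<bullet> x" by metis
  have adg: "adjoint (blinfun_apply L) = g"
    by (rule adjoint_unique) (metis g inner_commute)
  have bnd: "norm (g y) \<le> norm y * norm L" for y
  proof (cases "g y = 0")
    case False
    have "norm (g y) * norm (g y) = L (g y) \<bullet> y"
      by (simp add: g power2_norm_eq_inner flip: power2_eq_square)
    also have "\<dots> \<le> norm (L (g y)) * norm y" by (rule norm_cauchy_schwarz)
    also have "\<dots> \<le> norm L * norm (g y) * norm y" by (intro mult_right_mono norm_blinfun) auto
    finally show ?thesis using False by (simp add: ac_simps)
  qed simp
  have bl: "bounded_linear g"
  proof (rule bounded_linear_intro[OF _ _ bnd])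
    fix x y r
    have "g (x + y) \<bullet> w = (g x + g y) \<bullet> w" for w by (simp flip: g add: inner_add)
    then show "g (x + y) = g x + g y" by (metis vector_eq_rdot)
    have "g (r *\<^sub>R x) \<bullet> w = (r *\<^sub>R g x) \<bullet> w" for w by (simp flip: g)
    then show "g (r *\<^sub>R x) = r *\<^sub>R g x" by (metis vector_eq_rdot)
  qed
  have ap: "blinfun_apply (adj L) = g" unfolding adj_def adg using bl by (rule bounded_linear_Blinfun_apply)
  show "adj L y \<bullet> x = y \<bullet> L x" by (metis ap g inner_commute)
  then show "x \<bullet> adj L y = L x \<bullet> y" by (simp add: inner_commute)
  show "norm (adj L) \<le> norm L"
    by (rule norm_blinfun_bound) (use bnd in \<open>auto simp: ap ac_simps\<close>)
qed

text \<open>Cauchy-Schwarz for the semi-inner product \<open>Q x \<bullet> y\<close>, from the sign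
  of a quadratic in \<open>t\<close>. When \<open>Q y \<bullet> y = 0\<close> the quadratic is
  affine and its slope must vanish, which is a separate case.\<close>

lemma positive_op_inner_le:
  assumes "positive_op Q"
  shows "(Q x \<bullet> y)\<^sup>2 \<le> (Q x \<bullet> x) * (Q y \<bullet> y)"
proof -
  have sym: "Q y \<bullet> x = Q x \<bullet> y" using assms by (metis positive_op_def inner_commute)
  have pos: "0 \<le> Q z \<bullet> z" for z using assms unfolding positive_op_def by blast
  have q: "0 \<le> Q x \<bullet> x + 2 * t * (Q x \<bullet> y) + t * t * (Q y \<bullet> y)" for t
    using pos[of "x + t *\<^sub>R y"]
    by (simp add: blinfun.bilinear_simps inner_add algebra_simps sym)
  show ?thesis
  proof (cases "Q y \<bullet> y = 0")
    case True
    have "Q x \<bullet> y = 0"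
    proof (rule ccontr)
      assume "Q x \<bullet> y \<noteq> 0"
      then show False using q[of "- (Q x \<bullet> x + 1) / (2 * (Q x \<bullet> y))"] True by (simp add: field_simps)
    qed
    then show ?thesis using True by simp
  next
    case False
    then have "Q y \<bullet> y > 0" using pos[of y] by simp
    then show ?thesis
      using q[of "- (Q x \<bullet> y) / (Q y \<bullet> y)"] by (simp add: field_simps power2_eq_square)
  qed
qed

section \<open>Orthonormal systems: Bessel, best approximation, Parseval\<close>

lemma orthonormal_finite_sum_inner:
  assumes "finite F" "pairwise orthogonal F" "\<forall>e\<in>F. norm e = 1" "e \<in> F"
  shows "(\<Sum>f\<in>F. c f *\<^sub>R f) \<bullet> e = c e"
proof -
  have "(\<Sum>f\<in>F. c f *\<^sub>R f) \<bullet> e = (\<Sum>f\<in>F. if f = e then c e else 0)"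
    unfolding inner_sum_left
    by (rule sum.cong) (use assms in \<open>auto simp: pairwise_def orthogonal_def norm_eq_1\<close>)
  then show ?thesis using assms by simp
qed

lemma bessel_identity:
  fixes F :: "'a::real_inner set"
  assumes "finite F" "pairwise orthogonal F" "\<forall>e\<in>F. norm e = 1"
  shows "(norm (x - (\<Sum>e\<in>F. (x \<bullet> e) *\<^sub>R e)))\<^sup>2 = (norm x)\<^sup>2 - (\<Sum>e\<in>F. (x \<bullet> e)\<^sup>2)"
proof -
  define p where "p = (\<Sum>e\<in>F. (x \<bullet> e) *\<^sub>R e)"
  have "p \<bullet> e = x \<bullet> e" if "e \<in> F" for e
    unfolding p_def by (rule orthonormal_finite_sum_inner[OF assms that])
  then have "p \<bullet> p = (\<Sum>e\<in>F. (x \<bullet> e)\<^sup>2)"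
    by (subst (2) p_def) (simp add: inner_sum_right power2_eq_square)
  moreover have "x \<bullet> p = (\<Sum>e\<in>F. (x \<bullet> e)\<^sup>2)"
    by (simp add: p_def inner_sum_right power2_eq_square)
  ultimately show ?thesis
    unfolding p_def[symmetric] power2_norm_eq_inner inner_diff by (simp add: inner_commute)
qed

lemma bessel_inequality:
  fixes F :: "'a::real_inner set"
  assumes "finite F" "pairwise orthogonal F" "\<forall>e\<in>F. norm e = 1"
  shows "(\<Sum>e\<in>F. (x \<bullet> e)\<^sup>2) \<le> (norm x)\<^sup>2"
  using bessel_identity[OF assms, of x] by (metis diff_ge_0_iff_ge zero_le_power2)

lemma orthonormal_best_approximation:
  fixes F :: "'a::real_inner set"
  assumes "finite F" "pairwise orthogonal F" "\<forall>e\<in>F. norm e = 1"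
  shows "(norm (x - (\<Sum>e\<in>F. (x \<bullet> e) *\<^sub>R e)))\<^sup>2 \<le> (norm (x - (\<Sum>e\<in>F. c e *\<^sub>R e)))\<^sup>2"
proof -
  define y where "y = (\<Sum>e\<in>F. c e *\<^sub>R e)"
  have "y \<bullet> e = c e" if "e \<in> F" for e
    unfolding y_def by (rule orthonormal_finite_sum_inner[OF assms that])
  then have yy: "y \<bullet> y = (\<Sum>e\<in>F. (c e)\<^sup>2)"
    by (subst (2) y_def) (simp add: inner_sum_right power2_eq_square)
  have xy: "x \<bullet> y = (\<Sum>e\<in>F. c e * (x \<bullet> e))" by (simp add: y_def inner_sum_right)
  have "0 \<le> (\<Sum>e\<in>F. ((x \<bullet> e) - c e)\<^sup>2)" by (intro sum_nonneg) simp
  also have "\<dots> = (\<Sum>e\<in>F. (x \<bullet> e)\<^sup>2) - 2 * (x \<bullet> y) + y \<bullet> y"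
    by (simp add: xy yy power2_diff sum.distrib sum_subtractf sum_distrib_left algebra_simps)
  finally show ?thesis
    unfolding bessel_identity[OF assms]
    unfolding y_def[symmetric] power2_norm_eq_inner inner_diff by (simp add: inner_commute)
qed

text \<open>Bessel bounds the finite sums from above. Conversely \<open>x\<close> is approximated
  within \<open>sqrt d\<close> by a finite combination of basis vectors, and the Fourier sum over
  the same finite set is at least as close, so its squared coefficients miss at most
  \<open>d\<close>.\<close>

lemma parseval:
  fixes E :: "'a::separable_hilbert set"
  assumes E: "orthonormal_basis E"
  shows "((\<lambda>e. (x \<bullet> e)\<^sup>2) has_sum (norm x)\<^sup>2) E"
proof -
  have fin: "pairwise orthogonal F \<and> (\<forall>e\<in>F. norm e = 1)" if "F \<subseteq> E" for F
    using E that pairwise_subset[of orthogonal E F] unfolding orthonormal_basis_def by blast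
  have bound: "finite F \<Longrightarrow> F \<subseteq> E \<Longrightarrow> (\<Sum>e\<in>F. (x \<bullet> e)\<^sup>2) \<le> (norm x)\<^sup>2" for F
    using fin bessel_inequality[of F x] by simp
  have sm: "(\<lambda>e. (x \<bullet> e)\<^sup>2) summable_on E"
    by (rule nonneg_bdd_above_summable_on) (use bound in \<open>auto intro!: bdd_aboveI\<close>)
  have "infsum (\<lambda>e. (x \<bullet> e)\<^sup>2) E \<le> (norm x)\<^sup>2"
    by (rule infsum_le_finite_sums[OF sm]) (use bound in auto)
  moreover have "(norm x)\<^sup>2 \<le> infsum (\<lambda>e. (x \<bullet> e)\<^sup>2) E + d" if d: "d > 0" for d
  proof -
    have "x \<in> closure (span E)" using E by (simp add: orthonormal_basis_def)
    then obtain y where y: "y \<in> span E" "dist y x < sqrt d"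
      using d by (meson closure_approachable real_sqrt_gt_zero)
    obtain t r where t: "finite t" "t \<subseteq> E" "y = (\<Sum>a\<in>t. r a *\<^sub>R a)"
      using y(1) unfolding span_explicit by blast
    have "(norm x)\<^sup>2 - (\<Sum>e\<in>t. (x \<bullet> e)\<^sup>2) \<le> (norm (x - y))\<^sup>2"
      using orthonormal_best_approximation[OF t(1), of x r] bessel_identity[OF t(1), of x] fin[OF t(2)]
      unfolding t(3) by simp
    also have "\<dots> \<le> (sqrt d)\<^sup>2" using y(2) by (intro power_mono) (auto simp: dist_norm norm_minus_commute)
    also have "\<dots> = d" using d by simp
    finally have "(norm x)\<^sup>2 \<le> (\<Sum>e\<in>t. (x \<bullet> e)\<^sup>2) + d" by simp
    also have "(\<Sum>e\<in>t. (x \<bullet> e)\<^sup>2) \<le> infsum (\<lambda>e. (x \<bullet> e)\<^sup>2) E"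
      by (rule finite_sum_le_infsum[OF sm t(1,2)]) simp
    finally show ?thesis by simp
  qed
  then have "(norm x)\<^sup>2 \<le> infsum (\<lambda>e. (x \<bullet> e)\<^sup>2) E" by (rule field_le_epsilon)
  ultimately have "infsum (\<lambda>e. (x \<bullet> e)\<^sup>2) E = (norm x)\<^sup>2" by simp
  then show ?thesis using sm by (metis has_sum_infsum)
qed

text \<open>Distinct orthonormal vectors are at distance \<open>sqrt 2\<close>, so choosing for each
  of them a point within 1/2 from a countable dense set is injective.\<close>

lemma orthonormal_countable:
  fixes E :: "'a::separable_hilbert set"
  assumes "pairwise orthogonal E" "\<forall>e\<in>E. norm e = 1"
  shows "countable E"
proof -
  obtain D :: "'a set" where D: "countable D" "\<And>X. open X \<Longrightarrow> X \<noteq> {} \<Longrightarrow> \<exists>d\<in>D. d \<in> X"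
    using countable_dense_setE by auto
  have "\<exists>d\<in>D. dist e d < 1/2" for e
    using D(2)[of "ball e (1/2)"] by (auto simp: mem_ball)
  then obtain g where g: "\<And>e. g e \<in> D" "\<And>e. dist e (g e) < 1/2" by metis
  have "inj_on g E"
  proof (rule inj_onI, rule ccontr)
    fix x y assume xy: "x \<in> E" "y \<in> E" "g x = g y" "x \<noteq> y"
    have "dist x y < 1" using g(2)[of x] g(2)[of y] dist_triangle2[of x y "g x"] xy(3) by simp
    then have "(norm (x - y))\<^sup>2 < 1" by (simp add: dist_norm power_less_one_iff)
    moreover have "(norm (x - y))\<^sup>2 = 2"
      using assms xy unfolding power2_norm_eq_inner
      by (simp add: inner_diff pairwise_def orthogonal_def norm_eq_1)
    ultimately show False by simp
  qed
  moreover have "countable (g ` E)" using D(1) g(1) by (meson countable_subset image_subsetI)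
  ultimately show ?thesis using countable_image_inj_on by blast
qed

section \<open>Spectral theorem for positive trace class operators\<close>

lemma subspace_closure:
  fixes M :: "'a::real_normed_vector set"
  assumes "subspace M"
  shows "subspace (closure M)"
proof (rule subspaceI)
  show "0 \<in> closure M" using assms closure_subset subspace_0 by blast
  fix x y c assume x: "x \<in> closure M"
  obtain u where u: "\<And>n. u n \<in> M" "u \<longlonglongrightarrow> x" using x unfolding closure_sequential by blast
  have "(\<lambda>n. c *\<^sub>R u n) \<longlonglongrightarrow> c *\<^sub>R x" "\<And>n. c *\<^sub>R u n \<in> M"
    using u assms by (auto intro!: tendsto_intros subspace_scale)
  then show "c *\<^sub>R x \<in> closure M" unfolding closure_sequential by (intro exI[of _ "\<lambda>n. c *\<^sub>R u n"]) auto
  assume y: "y \<in> closure M"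
  obtain v where v: "\<And>n. v n \<in> M" "v \<longlonglongrightarrow> y" using y unfolding closure_sequential by blast
  have "(\<lambda>n. u n + v n) \<longlonglongrightarrow> x + y" "\<And>n. u n + v n \<in> M"
    using u v assms by (auto intro!: tendsto_intros subspace_add)
  then show "x + y \<in> closure M" unfolding closure_sequential by (intro exI[of _ "\<lambda>n. u n + v n"]) auto
qed

text \<open>A maximal orthonormal set of eigenvectors exists by Zorn. If its span were not dense,
  its orthogonal complement \<open>N\<close> would be a nonzero closed \<open>Q\<close>-invariant
  subspace; the supremum \<open>l\<close> of the Rayleigh quotient over the unit sphere of
  \<open>N\<close> is attained by compactness, which yields one more eigenvector and contradicts
  maximality.\<close>

lemma compact_positive_op_eigenbasis:
  fixes Q :: "'a::separable_hilbert \<Rightarrow>\<^sub>L 'a"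
  assumes Q: "positive_op Q" and K: "compact K" "blinfun_apply Q ` cball 0 1 \<subseteq> K"
  shows "\<exists>E. orthonormal_basis E \<and> (\<forall>e\<in>E. \<exists>l. Q e = l *\<^sub>R e)"
proof -
  define good where
    "good E \<longleftrightarrow> pairwise orthogonal E \<and> (\<forall>e\<in>E. norm e = 1 \<and> (\<exists>l. Q e = l *\<^sub>R e))" for E
  have "\<exists>U\<in>Collect good. \<forall>X\<in>c. X \<subseteq> U" if c: "subset.chain (Collect good) c" for c
  proof
    have cg: "\<And>X. X \<in> c \<Longrightarrow> good X" and ch: "\<And>X Y. X \<in> c \<Longrightarrow> Y \<in> c \<Longrightarrow> X \<subseteq> Y \<or> Y \<subseteq> X"
      using c unfolding subset_chain_def by blast+
    have "pairwise orthogonal (\<Union>c)"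
    proof (rule pairwiseI)
      fix x y assume xy: "x \<in> \<Union>c" "y \<in> \<Union>c" "x \<noteq> y"
      then obtain X Y where XY: "X \<in> c" "x \<in> X" "Y \<in> c" "y \<in> Y" by blast
      from ch[OF XY(1,3)] obtain Z where "Z \<in> c" "x \<in> Z" "y \<in> Z" using XY by blast
      then show "orthogonal x y" using cg xy(3) unfolding good_def pairwise_def by blast
    qed
    moreover have "norm e = 1 \<and> (\<exists>l. Q e = l *\<^sub>R e)" if "e \<in> \<Union>c" for e
      using that cg unfolding good_def by blast
    ultimately have "good (\<Union>c)" unfolding good_def by blast
    then show "\<Union>c \<in> Collect good" by simp
  qed blast
  then obtain E where E: "good E" "\<And>X. good X \<Longrightarrow> E \<subseteq> X \<Longrightarrow> X = E"
    using subset_Zorn[of "Collect good"] by auto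
  have sym: "Q x \<bullet> y = x \<bullet> Q y" and pos: "0 \<le> Q x \<bullet> x" for x y
    using Q unfolding positive_op_def by blast+
  have "closure (span E) = UNIV"
  proof (rule ccontr)
    assume "closure (span E) \<noteq> UNIV"
    then obtain x where "x \<notin> closure (span E)" by blast
    then obtain z where z: "z \<noteq> 0" "\<And>m. m \<in> closure (span E) \<Longrightarrow> z \<bullet> m = 0"
      using closed_subspace_orthogonal_vector[OF subspace_closure[OF subspace_span] closed_closure] by blast
    define N where "N = {x. \<forall>e\<in>E. x \<bullet> e = 0}"
    have "e \<in> closure (span E)" if "e \<in> E" for e
      using that closure_subset[of "span E"] span_base[of e E] by blast
    then have zN: "z \<in> N" using z(2) by (simp add: N_def)
    have NQ: "Q x \<in> N" if x: "x \<in> N" for x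
    proof -
      have "Q x \<bullet> e = 0" if e: "e \<in> E" for e
      proof -
        obtain l where "Q e = l *\<^sub>R e" using E(1) e unfolding good_def by blast
        then show ?thesis using x e by (simp add: sym N_def)
      qed
      then show ?thesis by (simp add: N_def)
    qed
    have Nsc: "c *\<^sub>R x \<in> N" if "x \<in> N" for c x using that by (simp add: N_def)
    have clN: "closed N"
      unfolding N_def Collect_ball_eq by (intro closed_INT ballI closed_Collect_eq continuous_intros)
    define u where "u = z /\<^sub>R norm z"
    have u: "u \<in> N" "norm u = 1" using z(1) by (auto simp: u_def intro: Nsc zN)
    define S where "S = (\<lambda>x. Q x \<bullet> x) ` (N \<inter> {x. norm x = 1})"
    define l where "l = Sup S"
    have bdd: "bdd_above S"
    proof (rule bdd_aboveI)
      fix s assume "s \<in> S"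
      then obtain x where x: "s = Q x \<bullet> x" "norm x = 1" unfolding S_def by blast
      have "s \<le> norm (Q x) * norm x" unfolding x(1) by (rule norm_cauchy_schwarz)
      also have "\<dots> \<le> norm Q * norm x * norm x" by (intro mult_right_mono norm_blinfun) auto
      finally show "s \<le> norm Q" using x by simp
    qed
    have lub: "Q x \<bullet> x \<le> l * (norm x)\<^sup>2" if "x \<in> N" for x
    proof (cases "x = 0")
      case False
      have "x /\<^sub>R norm x \<in> N \<inter> {x. norm x = 1}" using False Nsc[OF that] by simp
      then have "Q (x /\<^sub>R norm x) \<bullet> (x /\<^sub>R norm x) \<in> S" unfolding S_def by (rule imageI)
      then have "Q (x /\<^sub>R norm x) \<bullet> (x /\<^sub>R norm x) \<le> l" unfolding l_def by (rule cSup_upper[OF _ bdd])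
      then show ?thesis using False by (simp add: blinfun.bilinear_simps field_simps power2_eq_square)
    qed simp
    \<comment> \<open>Cauchy-Schwarz for the form of \<open>Q\<close> at \<open>x\<close> and
      \<open>Q x\<close>, followed by the Rayleigh bound at \<open>Q x\<close>. This estimate turns
      almost-maximisers into almost-eigenvectors.\<close>
    have Qle: "(norm (Q x))\<^sup>2 \<le> l * (Q x \<bullet> x)" if x: "x \<in> N" for x
    proof (cases "Q x = 0")
      case False
      have "(norm (Q x))\<^sup>2 * (norm (Q x))\<^sup>2 = (Q x \<bullet> Q x)\<^sup>2"
        by (simp only: power2_norm_eq_inner power2_eq_square[of "Q x \<bullet> Q x"])
      also have "\<dots> \<le> (Q x \<bullet> x) * (Q (Q x) \<bullet> Q x)" by (rule positive_op_inner_le[OF Q])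
      also have "\<dots> \<le> (Q x \<bullet> x) * (l * (norm (Q x))\<^sup>2)"
        by (intro mult_left_mono lub NQ x pos)
      finally have "(norm (Q x))\<^sup>2 * (norm (Q x))\<^sup>2 \<le> (l * (Q x \<bullet> x)) * (norm (Q x))\<^sup>2"
        by (simp only: ac_simps)
      then show ?thesis using False
        by (subst (asm) mult_le_cancel_right) (simp add: zero_less_power2)
    qed (use pos[of x] in simp)
    have "\<exists>x\<in>N. norm x = 1 \<and> (\<exists>l. Q x = l *\<^sub>R x)"
    \<comment> \<open>For \<open>l \<le> 0\<close> the preceding estimate makes \<open>Q\<close>
      vanish on \<open>N\<close>, so any unit vector there has eigenvalue 0; the limit argument of
      the other case divides by \<open>l\<close>.\<close>
    proof (cases "l \<le> 0")
      case True
      have "(norm (Q u))\<^sup>2 \<le> 0" using Qle[OF u(1)] True pos[of u] mult_nonpos_nonneg[of l "Q u \<bullet> u"] by linarith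
      then show ?thesis using u by (intro bexI[of _ u]) (auto intro: exI[of _ 0])
    next
      case False
      have "\<exists>x. x \<in> N \<and> norm x = 1 \<and> l - inverse (real (Suc n)) < Q x \<bullet> x" for n
      proof -
        have "\<exists>s\<in>S. l - inverse (real (Suc n)) < s"
          using u bdd unfolding l_def by (intro less_cSupD) (auto simp: S_def)
        then show ?thesis unfolding S_def by blast
      qed
      then obtain x where x: "\<And>n. x n \<in> N" "\<And>n. norm (x n) = 1"
        "\<And>n. l - inverse (real (Suc n)) < Q (x n) \<bullet> x n" by metis
      have "\<forall>n. Q (x n) \<in> K" using K(2) x(2) by (auto simp: image_subset_iff)
      then obtain y r where r: "strict_mono r" "((\<lambda>n. Q (x n)) \<circ> r) \<longlonglongrightarrow> y"
        using K(1)[unfolded compact_def, rule_format, of "\<lambda>n. Q (x n)"] by blast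
      have "(norm (Q (x n) - l *\<^sub>R x n))\<^sup>2 \<le> l * inverse (real (Suc n))" for n
      proof -
        have "(norm (Q (x n) - l *\<^sub>R x n))\<^sup>2 = (norm (Q (x n)))\<^sup>2 - 2 * l * (Q (x n) \<bullet> x n) + l\<^sup>2"
          using x(2)[of n] unfolding power2_norm_eq_inner norm_eq_1
          by (simp add: inner_diff inner_commute power2_eq_square)
        also have "\<dots> \<le> l * (l - Q (x n) \<bullet> x n)" using Qle[OF x(1)[of n]] by (simp add: algebra_simps power2_eq_square)
        also have "\<dots> \<le> l * inverse (real (Suc n))"
          using False x(3)[of n] by (intro mult_left_mono) auto
        finally show ?thesis .
      qed
      note bnd = this
      have lim0: "(\<lambda>n. l * inverse (real (Suc n))) \<longlonglongrightarrow> 0"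
        by (rule tendsto_mult_right_zero[OF LIMSEQ_inverse_real_of_nat])
      have "(\<lambda>n. (norm (Q (x n) - l *\<^sub>R x n))\<^sup>2) \<longlonglongrightarrow> 0"
        by (rule tendsto_sandwich[OF _ _ tendsto_const lim0]) (use bnd in auto)
      then have "(\<lambda>n. sqrt ((norm (Q (x n) - l *\<^sub>R x n))\<^sup>2)) \<longlonglongrightarrow> sqrt 0" by (rule tendsto_real_sqrt)
      then have "(\<lambda>n. Q (x n) - l *\<^sub>R x n) \<longlonglongrightarrow> 0" by (simp add: tendsto_norm_zero_iff)
      from LIMSEQ_subseq_LIMSEQ[OF this r(1)]
      have "(\<lambda>n. Q (x (r n)) - l *\<^sub>R x (r n)) \<longlonglongrightarrow> 0" by (simp add: o_def)
      then have "(\<lambda>n. Q (x (r n)) - (Q (x (r n)) - l *\<^sub>R x (r n))) \<longlonglongrightarrow> y - 0"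
        using r(2) by (intro tendsto_diff) (auto simp: o_def)
      then have "(\<lambda>n. (1/l) *\<^sub>R (l *\<^sub>R x (r n))) \<longlonglongrightarrow> (1/l) *\<^sub>R y"
        by (intro tendsto_scaleR tendsto_const) simp
      then have lim: "(\<lambda>n. x (r n)) \<longlonglongrightarrow> (1/l) *\<^sub>R y" using False by simp
      have "(1/l) *\<^sub>R y \<in> N" using closed_sequentially[OF clN _ lim] x(1) by blast
      moreover have "norm ((1/l) *\<^sub>R y) = 1"
        using tendsto_norm[OF lim] unfolding x(2) LIMSEQ_const_iff by metis
      moreover have "Q ((1/l) *\<^sub>R y) = y"
        using r(2) by (intro LIMSEQ_unique[of "\<lambda>n. Q (x (r n))"] blinfun.tendsto tendsto_const lim) (simp add: o_def)
      moreover have "y = l *\<^sub>R ((1/l) *\<^sub>R y)" using False by simp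
      ultimately show ?thesis by metis
    qed
    then obtain x l where x: "x \<in> N" "norm x = 1" "Q x = l *\<^sub>R x" by blast
    have "good (insert x E)"
      using E(1) x unfolding good_def by (auto simp: pairwise_insert N_def orthogonal_def inner_commute[of _ x])
    then have "x \<in> E" using E(2) by blast
    then have "x \<bullet> x = 0" using x(1) unfolding N_def by blast
    then show False using x(2) by simp
  qed
  then show ?thesis using E(1) unfolding good_def orthonormal_basis_def by blast
qed

text \<open>Every vector is an eigenvector of the zero operator, so this is a special case of the
  spectral theorem.\<close>

lemma orthonormal_basis_exists: "\<exists>E::'a::separable_hilbert set. orthonormal_basis E"
  using compact_positive_op_eigenbasis[of "0 :: 'a \<Rightarrow>\<^sub>L 'a" "{0}"]
  by (auto simp: positive_op_def)

lemma compact_bounded_combinations: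
  fixes F :: "'a::real_normed_vector set"
  assumes "finite F"
  shows "\<exists>K. compact K \<and> (\<forall>c. (\<forall>e\<in>F. \<bar>c e\<bar> \<le> C) \<longrightarrow> (\<Sum>e\<in>F. c e *\<^sub>R e) \<in> K)"
  using assms
proof induction
  case empty
  then show ?case by (intro exI[of _ "{0}"]) auto
next
  case (insert x F)
  then obtain K where K: "compact K" "\<And>c. (\<forall>e\<in>F. \<bar>c e\<bar> \<le> C) \<Longrightarrow> (\<Sum>e\<in>F. c e *\<^sub>R e) \<in> K" by blast
  have "compact {a + b |a b. a \<in> (\<lambda>c. c *\<^sub>R x) ` {-C..C} \<and> b \<in> K}"
    by (intro compact_sums compact_continuous_image K(1) continuous_intros) auto
  moreover have "(\<Sum>e\<in>insert x F. c e *\<^sub>R e) \<in> {a + b |a b. a \<in> (\<lambda>c. c *\<^sub>R x) ` {-C..C} \<and> b \<in> K}"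
    if "\<forall>e\<in>insert x F. \<bar>c e\<bar> \<le> C" for c
  proof -
    have "c x *\<^sub>R x \<in> (\<lambda>c. c *\<^sub>R x) ` {-C..C}" using that by (intro imageI) (auto simp: abs_le_iff)
    moreover have "(\<Sum>e\<in>F. c e *\<^sub>R e) \<in> K" using that by (intro K(2)) auto
    ultimately show ?thesis using insert(1,2) by auto
  qed
  ultimately show ?case by blast
qed

text \<open>Total boundedness of the image of the unit ball. Cutting \<open>Q x\<close> off to a
  finite part \<open>F\<close> of the basis costs the sum of the squares of
  \<open>Q x \<bullet> e\<close> outside \<open>F\<close>, which by Cauchy-Schwarz for the form is
  at most \<open>Q x \<bullet> x\<close> times a tail of the trace; the cut-off images lie in a
  compact set of bounded combinations.\<close>

lemma positive_trace_class_compact: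
  fixes Q :: "'a::separable_hilbert \<Rightarrow>\<^sub>L 'a"
  assumes "positive_trace_class Q"
  shows "compact (closure (blinfun_apply Q ` cball 0 1))"
proof -
  obtain E where Q: "positive_op Q" and E: "orthonormal_basis E" and sm: "(\<lambda>e. Q e \<bullet> e) summable_on E"
    using assms unfolding positive_trace_class_def by blast
  have sym: "Q x \<bullet> y = x \<bullet> Q y" and pos: "0 \<le> Q x \<bullet> x" for x y
    using Q unfolding positive_op_def by blast+
  have "\<exists>k. finite k \<and> closure (blinfun_apply Q ` cball 0 1) \<subseteq> (\<Union>x\<in>k. ball x \<epsilon>)" if "\<epsilon> > 0" for \<epsilon>
  proof -
    define d where "d = \<epsilon> / 3"
    have d: "d > 0" using that by (simp add: d_def)
    \<comment> \<open>Makes \<open>norm Q * c\<close> at most the square of \<open>d\<close>, also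
      when \<open>Q = 0\<close>. Three errors of size \<open>d\<close> add up to
      \<open>\<epsilon>\<close>: the cut-off, the finite net, and the passage to the
      closure.\<close>
    define c where "c = d\<^sup>2 / (norm Q + 1)"
    have c: "c > 0" using d by (simp add: c_def add_nonneg_pos)
    have "((\<lambda>e. Q e \<bullet> e) has_sum (infsum (\<lambda>e. Q e \<bullet> e) E)) E" using sm by (rule has_sum_infsum)
    then have "\<forall>\<^sub>F G in finite_subsets_at_top E. dist (sum (\<lambda>e. Q e \<bullet> e) G) (infsum (\<lambda>e. Q e \<bullet> e) E) < c/2"
      using c unfolding has_sum_def tendsto_iff by (meson half_gt_zero)
    from this[unfolded eventually_finite_subsets_at_top]
    obtain F where F': "finite F \<and> F \<subseteq> E \<and> (\<forall>G. finite G \<and> F \<subseteq> G \<and> G \<subseteq> E \<longrightarrow>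
      dist (sum (\<lambda>e. Q e \<bullet> e) G) (infsum (\<lambda>e. Q e \<bullet> e) E) < c/2)" by (rule exE)
    note F = F'[THEN conjunct1] F'[THEN conjunct2, THEN conjunct1]
      F'[THEN conjunct2, THEN conjunct2, rule_format, OF conjI[OF _ conjI]]
    have tail: "(\<Sum>e\<in>G. Q e \<bullet> e) \<le> c" if G: "finite G" "G \<subseteq> E - F" for G
    proof -
      have "F \<union> G \<subseteq> E" using F(2) G by blast
      then have "dist (sum (\<lambda>e. Q e \<bullet> e) (F \<union> G)) (sum (\<lambda>e. Q e \<bullet> e) F) < c"
        using F(1,2) G(1) by (intro dist_triangle_half_l[OF F(3) F(3)]) simp_all
      moreover have "sum (\<lambda>e. Q e \<bullet> e) (F \<union> G) = sum (\<lambda>e. Q e \<bullet> e) F + sum (\<lambda>e. Q e \<bullet> e) G"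
        using G by (intro sum.union_disjoint F(1)) blast+
      ultimately show ?thesis by (simp add: dist_real_def)
    qed
    have on: "pairwise orthogonal F" "\<forall>e\<in>F. norm e = 1"
      using E F(2) pairwise_subset[of orthogonal E F] unfolding orthonormal_basis_def by blast+
    obtain K where K: "compact K" "\<And>c. (\<forall>e\<in>F. \<bar>c e\<bar> \<le> norm Q) \<Longrightarrow> (\<Sum>e\<in>F. c e *\<^sub>R e) \<in> K"
      using compact_bounded_combinations[OF F(1)] by blast
    obtain k where k: "finite k" "K \<subseteq> (\<Union>x\<in>k. ball x d)"
      using K(1) d unfolding compact_eq_totally_bounded by blast
    have "dist (Q x) (\<Sum>e\<in>F. (Q x \<bullet> e) *\<^sub>R e) \<le> d" if x: "norm x \<le> 1" for x
    proof -
      have Qx: "norm (Q x) \<le> norm Q" using norm_blinfun[of Q x] mult_left_le[OF x, of "norm Q"] by simp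
      have Qxx: "Q x \<bullet> x \<le> norm Q"
        using norm_cauchy_schwarz[of "Q x" x] Qx mult_left_le[OF x, of "norm (Q x)"] by simp
      have *: "(\<lambda>e. (Q x \<bullet> e)\<^sup>2) summable_on E" "infsum (\<lambda>e. (Q x \<bullet> e)\<^sup>2) E = (norm (Q x))\<^sup>2"
        using parseval[OF E, of "Q x"] by (auto simp: summable_on_def infsumI)
      have sm': "(\<lambda>e. (Q x \<bullet> e)\<^sup>2) summable_on (E - F)" by (rule summable_on_subset_banach[OF *(1)]) auto
      have "(norm (Q x - (\<Sum>e\<in>F. (Q x \<bullet> e) *\<^sub>R e)))\<^sup>2 = (norm (Q x))\<^sup>2 - (\<Sum>e\<in>F. (Q x \<bullet> e)\<^sup>2)"
        by (rule bessel_identity[OF F(1) on])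
      also have "\<dots> = infsum (\<lambda>e. (Q x \<bullet> e)\<^sup>2) (E - F)"
        using F(1,2) * by (subst infsum_Diff) (auto simp: summable_on_finite)
      also have "\<dots> \<le> norm Q * c"
      proof (rule infsum_le_finite_sums[OF sm'])
        fix G assume G: "finite G" "G \<subseteq> E - F"
        have "(\<Sum>e\<in>G. (Q x \<bullet> e)\<^sup>2) \<le> (\<Sum>e\<in>G. (Q x \<bullet> x) * (Q e \<bullet> e))"
          by (intro sum_mono positive_op_inner_le[OF Q])
        also have "\<dots> = (Q x \<bullet> x) * (\<Sum>e\<in>G. Q e \<bullet> e)" by (simp add: sum_distrib_left)
        also have "\<dots> \<le> norm Q * c"
          by (intro mult_mono Qxx tail G sum_nonneg pos) auto
        finally show "(\<Sum>e\<in>G. (Q x \<bullet> e)\<^sup>2) \<le> norm Q * c" .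
      qed
      also have "\<dots> \<le> d\<^sup>2" unfolding c_def
        by (simp add: divide_le_eq add_nonneg_pos mult.commute[of "norm Q"] mult_left_mono)
      finally show ?thesis using d by (simp add: dist_norm)
    qed
    moreover have "\<exists>y\<in>k. dist y (\<Sum>e\<in>F. (Q x \<bullet> e) *\<^sub>R e) < d" if x: "norm x \<le> 1" for x
    proof -
      have "\<bar>Q x \<bullet> e\<bar> \<le> norm Q" if "e \<in> F" for e
      proof -
        have "\<bar>Q x \<bullet> e\<bar> \<le> norm (Q x) * norm e" by (rule Cauchy_Schwarz_ineq2)
        also have "\<dots> \<le> norm Q * norm x * 1" using on that norm_blinfun[of Q x] by simp
        also have "\<dots> \<le> norm Q" using x by (simp add: mult_left_le)
        finally show ?thesis .
      qed
      then have "(\<Sum>e\<in>F. (Q x \<bullet> e) *\<^sub>R e) \<in> K" by (intro K(2)) auto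
      then have "(\<Sum>e\<in>F. (Q x \<bullet> e) *\<^sub>R e) \<in> (\<Union>x\<in>k. ball x d)" using k(2) by blast
      then show ?thesis by (simp only: UN_iff mem_ball)
    qed
    ultimately have near: "\<exists>y\<in>k. dist y (Q x) < 2 * d" if "norm x \<le> 1" for x
    proof -
      let ?p = "\<Sum>e\<in>F. (Q x \<bullet> e) *\<^sub>R e"
      assume *: "\<And>x. norm x \<le> 1 \<Longrightarrow> dist (Q x) (\<Sum>e\<in>F. (Q x \<bullet> e) *\<^sub>R e) \<le> d"
        "\<And>x. norm x \<le> 1 \<Longrightarrow> \<exists>y\<in>k. dist y (\<Sum>e\<in>F. (Q x \<bullet> e) *\<^sub>R e) < d"
      from *(2)[OF that] obtain y where y: "y \<in> k" "dist y ?p < d" by (rule bexE)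
      have "dist y (Q x) < 2 * d" using *(1)[OF that] y(2) dist_triangle2[of y "Q x" ?p] by linarith
      then show ?thesis using y(1) by blast
    qed
    have "z \<in> (\<Union>x\<in>k. ball x \<epsilon>)" if z: "z \<in> closure (blinfun_apply Q ` cball 0 1)" for z
    proof -
      obtain x where x: "norm x \<le> 1" "dist (Q x) z < d"
        using z d unfolding closure_approachable by auto
      obtain y where "y \<in> k" "dist y (Q x) < 2 * d" using near[OF x(1)] by blast
      then have "dist y z < \<epsilon>" using dist_triangle[of y z "Q x"] x(2) by (simp add: d_def)
      then show ?thesis using \<open>y \<in> k\<close> by auto
    qed
    then show ?thesis using k(1) by blast
  qed
  then show ?thesis unfolding compact_eq_totally_bounded by (simp add: complete_eq_closed)
qed

text \<open>Licenses the choice in \<open>eigenbasis\<close> and the description in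
  \<open>eigenvalue\<close>: compactness supplies a basis of eigenvectors, and a unit vector
  determines its eigenvalue.\<close>

lemma eigenbasis:
  fixes Q :: "'a::separable_hilbert \<Rightarrow>\<^sub>L 'a"
  assumes "positive_trace_class Q"
  shows "orthonormal_basis (eigenbasis Q)"
    and "\<And>e. e \<in> eigenbasis Q \<Longrightarrow> Q e = eigenvalue Q e *\<^sub>R e"
    and "\<And>e. e \<in> eigenbasis Q \<Longrightarrow> 0 \<le> eigenvalue Q e"
proof -
  have Q: "positive_op Q" using assms unfolding positive_trace_class_def by blast
  have "\<exists>E. orthonormal_basis E \<and> (\<forall>e\<in>E. \<exists>l. Q e = l *\<^sub>R e)"
    using compact_positive_op_eigenbasis[OF Q positive_trace_class_compact[OF assms] closure_subset] .
  then have *: "orthonormal_basis (eigenbasis Q) \<and> (\<forall>e\<in>eigenbasis Q. \<exists>l. Q e = l *\<^sub>R e)"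
    unfolding eigenbasis_def by (rule someI_ex)
  then show "orthonormal_basis (eigenbasis Q)" ..
  fix e assume e: "e \<in> eigenbasis Q"
  then have n: "norm e = 1" using * unfolding orthonormal_basis_def by blast
  obtain l where l: "Q e = l *\<^sub>R e" using * e by blast
  have "eigenvalue Q e = l" unfolding eigenvalue_def
  proof (rule the_equality, rule l)
    fix l' assume "Q e = l' *\<^sub>R e"
    with l n show "l' = l" by auto
  qed
  with l show ev: "Q e = eigenvalue Q e *\<^sub>R e" by simp
  have "0 \<le> Q e \<bullet> e" using Q unfolding positive_op_def by blast
  then show "0 \<le> eigenvalue Q e" using n unfolding ev by (simp add: norm_eq_1)
qed

section \<open>Hilbert--Schmidt operators on the reproducing space\<close>

lemma blinfun_eq_on_orthonormal_basis:
  fixes L M :: "'a::separable_hilbert \<Rightarrow>\<^sub>L 'b::real_normed_vector"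
  assumes "orthonormal_basis E" "\<And>e. e \<in> E \<Longrightarrow> L e = M e"
  shows "L = M"
proof (rule blinfun_eqI)
  fix x
  have "subspace {x. L x = M x}" by (auto simp: subspace_def blinfun.bilinear_simps)
  then have "span E \<subseteq> {x. L x = M x}" using assms(2) by (intro span_minimal) auto
  moreover have "closed {x. L x = M x}" by (intro closed_Collect_eq continuous_intros)
  ultimately have "closure (span E) \<subseteq> {x. L x = M x}" by (rule closure_minimal)
  then show "L x = M x" using assms(1) unfolding orthonormal_basis_def by blast
qed

lemma has_sum_finite_sum:
  fixes f :: "'i \<Rightarrow> 'a \<Rightarrow> real"
  assumes "finite I" "\<And>i. i \<in> I \<Longrightarrow> (f i has_sum s i) A"
  shows "((\<lambda>x. \<Sum>i\<in>I. f i x) has_sum (\<Sum>i\<in>I. s i)) A"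
  using assms
proof (induction I)
  case (insert j J)
  then have "((\<lambda>x. f j x + (\<Sum>i\<in>J. f i x)) has_sum (s j + (\<Sum>i\<in>J. s i))) A"
    by (intro has_sum_add) auto
  then show ?case using insert by simp
qed simp

section \<open>The positive square root of a trace class operator\<close>

context
  fixes Q :: "'v::separable_hilbert \<Rightarrow>\<^sub>L 'v"
  assumes Q: "positive_trace_class Q"
begin

lemma eigenbasis_norm: "e \<in> eigenbasis Q \<Longrightarrow> norm e = 1"
  using eigenbasis(1)[OF Q] unfolding orthonormal_basis_def by blast

lemma eigenvalue_le_norm: "e \<in> eigenbasis Q \<Longrightarrow> eigenvalue Q e \<le> norm Q"
  using norm_blinfun[of Q e] eigenbasis_norm[of e] eigenbasis(3)[OF Q, of e]
  by (simp add: eigenbasis(2)[OF Q, of e])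

text \<open>With \<open>s\<close> the root of the eigenvalue, \<open>R + s\<close> annihilates
  \<open>R e - s *\<^sub>R e\<close>. For \<open>s > 0\<close> positivity makes \<open>R + s\<close>
  injective; for \<open>s = 0\<close> symmetry turns \<open>R (R e) = 0\<close> into
  \<open>R e = 0\<close>. All positive roots thus act alike on the eigenbasis.\<close>

lemma positive_square_root_eigenvector:
  assumes R: "positive_op R" "R o\<^sub>L R = Q" and e: "e \<in> eigenbasis Q"
  shows "R e = sqrt (eigenvalue Q e) *\<^sub>R e"
proof -
  define s where "s = sqrt (eigenvalue Q e)"
  have s: "s \<ge> 0" "s * s = eigenvalue Q e" using eigenbasis(3)[OF Q e] by (simp_all add: s_def)
  have RR: "R (R x) = Q x" for x using R(2) by (metis blinfun_apply_blinfun_compose)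
  have sym: "R x \<bullet> y = x \<bullet> R y" and pos: "0 \<le> R x \<bullet> x" for x y
    using R(1) unfolding positive_op_def by blast+
  have "R e - s *\<^sub>R e = 0"
  proof (cases "s = 0")
    case True
    then have "R (R e) = 0" using s(2) by (simp add: RR eigenbasis(2)[OF Q e])
    then have "R e \<bullet> R e = 0" by (simp add: sym)
    then show ?thesis using True by simp
  next
    case False
    define w where "w = R e - s *\<^sub>R e"
    have "R w + s *\<^sub>R w = 0"
      by (simp add: w_def blinfun.bilinear_simps RR eigenbasis(2)[OF Q e] s(2) algebra_simps)
    then have "0 = (R w + s *\<^sub>R w) \<bullet> w" by simp
    also have "\<dots> = R w \<bullet> w + s * (w \<bullet> w)" by (simp add: inner_add_left)
    finally have "s * (w \<bullet> w) = 0"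
      using pos[of w] mult_nonneg_nonneg[OF s(1) inner_ge_zero[of w]] by linarith
    then show ?thesis using False by (simp add: w_def)
  qed
  then show ?thesis by (simp add: s_def)
qed

text \<open>The root is built from its bilinear form \<open>b\<close>, diagonal in the eigenbasis
  with entries \<open>s e\<close>. Parseval makes the series converge, and Riesz turns the bounded
  form into an operator.\<close>

lemma positive_square_root_exists: "\<exists>R. positive_op R \<and> R o\<^sub>L R = Q"
proof -
  define E where "E = eigenbasis Q"
  define s where "s e = sqrt (eigenvalue Q e)" for e
  define c where "c = sqrt (norm Q)"
  have s: "0 \<le> s e" "s e \<le> c" "s e * s e = eigenvalue Q e" if "e \<in> E" for e
    using that eigenbasis(3)[OF Q, of e] eigenvalue_le_norm[of e] by (auto simp: E_def s_def c_def)
  have c: "c \<ge> 0" by (simp add: c_def)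
  have E: "orthonormal_basis E" by (simp add: E_def eigenbasis(1)[OF Q])
  define b where "b x y = infsum (\<lambda>e. s e * (x \<bullet> e) * (y \<bullet> e)) E" for x y
  have sq: "(\<lambda>e. (x \<bullet> e)\<^sup>2) summable_on E" "infsum (\<lambda>e. (x \<bullet> e)\<^sup>2) E = (norm x)\<^sup>2" for x
    using parseval[OF E, of x] by (auto simp: summable_on_def infsumI)
  have maj: "(\<lambda>e. c * ((x \<bullet> e)\<^sup>2 + (y \<bullet> e)\<^sup>2)) summable_on E" for x y
    by (intro summable_on_cmult_right summable_on_add sq)
  have le: "norm (s e * (x \<bullet> e) * (y \<bullet> e)) \<le> c * ((x \<bullet> e)\<^sup>2 + (y \<bullet> e)\<^sup>2)" if "e \<in> E" for x y e
  proof -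
    have "2 * (\<bar>x \<bullet> e\<bar> * \<bar>y \<bullet> e\<bar>) \<le> (x \<bullet> e)\<^sup>2 + (y \<bullet> e)\<^sup>2"
      using sum_squares_bound[of "\<bar>x \<bullet> e\<bar>" "\<bar>y \<bullet> e\<bar>"] by simp
    moreover have "0 \<le> \<bar>x \<bullet> e\<bar> * \<bar>y \<bullet> e\<bar>" by simp
    ultimately have "\<bar>x \<bullet> e\<bar> * \<bar>y \<bullet> e\<bar> \<le> (x \<bullet> e)\<^sup>2 + (y \<bullet> e)\<^sup>2" by linarith
    then have "s e * (\<bar>x \<bullet> e\<bar> * \<bar>y \<bullet> e\<bar>) \<le> c * ((x \<bullet> e)\<^sup>2 + (y \<bullet> e)\<^sup>2)"
      using s(1,2)[OF that] c by (intro mult_mono) auto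
    then show ?thesis using s(1)[OF that] by (simp add: abs_mult)
  qed
  have abs: "(\<lambda>e. norm (s e * (x \<bullet> e) * (y \<bullet> e))) summable_on E" for x y
    by (rule summable_on_comparison_test[OF maj[of x y]]) (use le in auto)
  have sm: "(\<lambda>e. s e * (x \<bullet> e) * (y \<bullet> e)) summable_on E" for x y
    using abs by (rule abs_summable_summable)
  have add: "b x (y + z) = b x y + b x z" for x y z
  proof -
    have "b x (y + z) = infsum (\<lambda>e. s e * (x \<bullet> e) * (y \<bullet> e) + s e * (x \<bullet> e) * (z \<bullet> e)) E"
      unfolding b_def by (simp add: inner_add_left distrib_left)
    also have "\<dots> = b x y + b x z" unfolding b_def by (rule infsum_add[OF sm sm])
    finally show ?thesis .
  qed
  have scale: "b x (r *\<^sub>R y) = r * b x y" for x y r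
  proof -
    have "b x (r *\<^sub>R y) = infsum (\<lambda>e. r * (s e * (x \<bullet> e) * (y \<bullet> e))) E"
      unfolding b_def by (simp add: mult_ac)
    also have "\<dots> = r * b x y" unfolding b_def by (rule infsum_cmult_right[OF sm])
    finally show ?thesis .
  qed
  have comm: "b x y = b y x" for x y
    unfolding b_def by (intro infsum_cong) simp
  \<comment> \<open>The termwise estimate only gives \<open>c\<close> times the sum of the squared
    norms, which is not homogeneous; on unit vectors it reads \<open>2 * c\<close>, and scaling
    recovers the bilinear bound.\<close>
  have unit: "\<bar>b x y\<bar> \<le> 2 * c" if "norm x = 1" "norm y = 1" for x y
  proof -
    have "\<bar>b x y\<bar> \<le> infsum (\<lambda>e. norm (s e * (x \<bullet> e) * (y \<bullet> e))) E"
      unfolding b_def using norm_infsum_bound[OF abs] by simp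
    also have "\<dots> \<le> infsum (\<lambda>e. c * ((x \<bullet> e)\<^sup>2 + (y \<bullet> e)\<^sup>2)) E"
      by (rule infsum_mono[OF abs maj le])
    also have "\<dots> = c * ((norm x)\<^sup>2 + (norm y)\<^sup>2)"
      by (subst infsum_cmult_right) (auto simp: infsum_add sq intro!: summable_on_add)
    finally show ?thesis using that by simp
  qed
  have bound: "\<bar>b x y\<bar> \<le> norm y * (2 * c * norm x)" for x y
  proof (cases "x = 0 \<or> y = 0")
    case True
    then show ?thesis by (auto simp: b_def)
  next
    case False
    have "b x y = norm x * (norm y * b (x /\<^sub>R norm x) (y /\<^sub>R norm y))"
      using False by (simp add: scale comm[of _ y] field_simps)
    then show ?thesis using unit[of "x /\<^sub>R norm x" "y /\<^sub>R norm y"] False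
      by (simp add: abs_mult mult_left_mono ac_simps)
  qed
  have "bounded_linear (b x)" for x
    by (rule bounded_linear_intro[OF add _ ]) (use scale bound in auto)
  then have "\<exists>z. \<forall>y. b x y = z \<bullet> y" for x by (rule riesz_representation)
  then obtain g where g: "\<And>x y. b x y = g x \<bullet> y" by metis
  have nrm: "norm (g x) \<le> norm x * (2 * c)" for x
  proof (cases "g x = 0")
    case False
    have "norm (g x) * norm (g x) = b x (g x)" by (simp add: g power2_norm_eq_inner flip: power2_eq_square)
    also have "\<dots> \<le> norm (g x) * (2 * c * norm x)" using bound[of x "g x"] by linarith
    finally show ?thesis using False by (simp add: ac_simps)
  qed (simp add: c)
  have bl: "bounded_linear g"
  proof (rule bounded_linear_intro[OF _ _ nrm])
    fix x y r
    have "g (x + y) \<bullet> w = (g x + g y) \<bullet> w" for w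
      unfolding inner_add_left g[symmetric] comm[of _ w] add ..
    then show "g (x + y) = g x + g y" by (metis vector_eq_rdot)
    have "g (r *\<^sub>R x) \<bullet> w = (r *\<^sub>R g x) \<bullet> w" for w
      unfolding inner_scaleR_left g[symmetric] comm[of _ w] scale ..
    then show "g (r *\<^sub>R x) = r *\<^sub>R g x" by (metis vector_eq_rdot)
  qed
  define R where "R = Blinfun g"
  have R: "blinfun_apply R = g" unfolding R_def using bl by (rule bounded_linear_Blinfun_apply)
  have "positive_op R" unfolding positive_op_def R
  proof (intro conjI allI)
    show "g x \<bullet> y = x \<bullet> g y" for x y by (metis g comm inner_commute)
    show "0 \<le> g x \<bullet> x" for x
      unfolding g[symmetric] b_def using s(1) by (intro infsum_nonneg) (simp add: mult.assoc)
  qed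
  moreover have Re: "R e = s e *\<^sub>R e" if e: "e \<in> E" for e
  proof -
    have "g e \<bullet> y = (s e *\<^sub>R e) \<bullet> y" for y
    proof -
      have "b e y = infsum (\<lambda>e'. s e' * (e \<bullet> e') * (y \<bullet> e')) {e}"
        unfolding b_def
      proof (rule infsum_cong_neutral)
        fix e' assume "e' \<in> E - {e}"
        then have "orthogonal e e'"
          using E e pairwiseD[of orthogonal E e e'] unfolding orthonormal_basis_def by force
        then have "e \<bullet> e' = 0" by (simp add: orthogonal_def)
        then show "s e' * (e \<bullet> e') * (y \<bullet> e') = 0" by simp
      qed (use e in auto)
      also have "\<dots> = (s e *\<^sub>R e) \<bullet> y"
        using eigenbasis_norm[of e] e by (simp add: E_def norm_eq_1 inner_commute)
      finally show ?thesis by (simp add: g)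
    qed
    then show ?thesis unfolding R by (metis vector_eq_rdot)
  qed
  have "R o\<^sub>L R = Q"
    by (rule blinfun_eq_on_orthonormal_basis[OF E])
      (simp add: Re blinfun.bilinear_simps s(3) eigenbasis(2)[OF Q] E_def[symmetric])
  ultimately show ?thesis by blast
qed

text \<open>Two positive roots agree on the eigenbasis, hence everywhere, so the description in
  \<open>op_sqrt\<close> denotes.\<close>

lemma op_sqrt: "positive_op (op_sqrt Q)" "op_sqrt Q o\<^sub>L op_sqrt Q = Q"
proof -
  have "\<exists>!R. positive_op R \<and> R o\<^sub>L R = Q"
  proof (rule ex_ex1I[OF positive_square_root_exists])
    fix R R' assume "positive_op R \<and> R o\<^sub>L R = Q" "positive_op R' \<and> R' o\<^sub>L R' = Q"
    then show "R = R'"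
      by (intro blinfun_eq_on_orthonormal_basis[OF eigenbasis(1)[OF Q]])
        (simp add: positive_square_root_eigenvector)
  qed
  from theI'[OF this] show "positive_op (op_sqrt Q)" "op_sqrt Q o\<^sub>L op_sqrt Q = Q"
    unfolding op_sqrt_def by blast+
qed

lemmas op_sqrt_eigenvector = positive_square_root_eigenvector[OF op_sqrt]

lemma op_sqrt_inner: "op_sqrt Q x \<bullet> y = x \<bullet> op_sqrt Q y"
  using op_sqrt(1) unfolding positive_op_def by blast

lemma inner_eq_norm_op_sqrt: "Q x \<bullet> x = (norm (op_sqrt Q x))\<^sup>2"
proof -
  have "Q x = op_sqrt Q (op_sqrt Q x)" by (metis op_sqrt(2) blinfun_apply_blinfun_compose)
  then show ?thesis by (simp add: op_sqrt_inner power2_norm_eq_inner)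
qed

text \<open>The left side is a partial trace of \<open>L\<close> times \<open>Q\<close> times the
  adjoint of \<open>L\<close>. Parseval over \<open>B\<close> expands each summand into the squares
  of \<open>L (op_sqrt Q e) \<bullet> h\<close>; exchanging the sums and applying Bessel over
  \<open>F\<close> leaves the Hilbert-Schmidt sum.\<close>

lemma sum_gram_le:
  fixes L :: "'v \<Rightarrow>\<^sub>L 'h::separable_hilbert"
  assumes B: "orthonormal_basis B" and F: "finite F" "pairwise orthogonal F" "\<forall>h\<in>F. norm h = 1"
    and sm: "(\<lambda>e. (norm (L (op_sqrt Q e)))\<^sup>2) summable_on B"
  shows "(\<Sum>h\<in>F. Q (adj L h) \<bullet> adj L h) \<le> infsum (\<lambda>e. (norm (L (op_sqrt Q e)))\<^sup>2) B"
proof -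
  have eq: "op_sqrt Q (adj L h) \<bullet> e = L (op_sqrt Q e) \<bullet> h" for h e
    by (metis op_sqrt_inner adj_inner(2) inner_commute)
  have "((\<lambda>e. (L (op_sqrt Q e) \<bullet> h)\<^sup>2) has_sum (Q (adj L h) \<bullet> adj L h)) B" for h
    using parseval[OF B, of "op_sqrt Q (adj L h)"] unfolding eq inner_eq_norm_op_sqrt .
  then have "((\<lambda>e. \<Sum>h\<in>F. (L (op_sqrt Q e) \<bullet> h)\<^sup>2) has_sum (\<Sum>h\<in>F. Q (adj L h) \<bullet> adj L h)) B"
    using F(1) by (intro has_sum_finite_sum) auto
  then show ?thesis
    by (rule has_sum_mono[OF _ has_sum_infsum[OF sm]]) (use bessel_inequality[OF F] in blast)
qed

text \<open>Trace class is given through some basis \<open>B\<close>; the Gram inequality for the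
  identity operator, with finite parts of the eigenbasis as \<open>F\<close>, carries the
  summability over.\<close>

lemma eigenvalue_summable: "eigenvalue Q summable_on eigenbasis Q"
proof -
  obtain B where B: "orthonormal_basis B" and sm: "(\<lambda>e. Q e \<bullet> e) summable_on B"
    using Q unfolding positive_trace_class_def by blast
  let ?E = "eigenbasis Q"
  have on: "pairwise orthogonal F" "\<forall>e\<in>F. norm e = 1" if "F \<subseteq> ?E" for F
    using eigenbasis(1)[OF Q] pairwise_subset[OF _ that] that unfolding orthonormal_basis_def by blast+
  have I: "adj id_blinfun e = e" for e :: 'v
    by (rule vector_eq_ldot[THEN iffD1, rule_format]) (simp add: adj_inner)
  have ev: "Q e \<bullet> e = eigenvalue Q e" if "e \<in> ?E" for e
    using eigenbasis_norm[OF that] by (simp add: eigenbasis(2)[OF Q that] norm_eq_1)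
  have "sum (eigenvalue Q) F \<le> infsum (\<lambda>e. Q e \<bullet> e) B" if F: "finite F" "F \<subseteq> ?E" for F
  proof -
    have "sum (eigenvalue Q) F = (\<Sum>h\<in>F. Q (adj id_blinfun h) \<bullet> adj id_blinfun h)"
      using F(2) by (intro sum.cong refl) (auto simp: I ev)
    also have "\<dots> \<le> infsum (\<lambda>e. Q e \<bullet> e) B"
      using sum_gram_le[OF B F(1) on[OF F(2)], of id_blinfun] sm
      by (simp add: inner_eq_norm_op_sqrt)
    finally show ?thesis .
  qed
  then show ?thesis
    using eigenbasis(3)[OF Q] by (intro nonneg_bdd_above_summable_on bdd_aboveI2) auto
qed

section \<open>Hilbert-Schmidt norms of restrictions to the reproducing space\<close>

lemma VQ_basis_inj: "inj_on (\<lambda>e. sqrt (eigenvalue Q e) *\<^sub>R e) {e \<in> eigenbasis Q. 0 < eigenvalue Q e}"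
proof (rule inj_onI, rule ccontr)
  fix x y assume xy: "x \<in> {e \<in> eigenbasis Q. 0 < eigenvalue Q e}" "y \<in> {e \<in> eigenbasis Q. 0 < eigenvalue Q e}"
    "sqrt (eigenvalue Q x) *\<^sub>R x = sqrt (eigenvalue Q y) *\<^sub>R y" "x \<noteq> y"
  have "x \<bullet> y = 0"
    using eigenbasis(1)[OF Q] xy(1,2,4) unfolding orthonormal_basis_def pairwise_def orthogonal_def by blast
  then have "(sqrt (eigenvalue Q x) *\<^sub>R x) \<bullet> x = 0" unfolding xy(3) by (simp add: inner_commute)
  then show False using xy(1) eigenbasis_norm[of x] by (simp add: norm_eq_1)
qed

lemma VQ_basis_op_sqrt: "f \<in> VQ_basis Q \<Longrightarrow> \<exists>e\<in>eigenbasis Q. f = op_sqrt Q e"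
  unfolding VQ_basis_def using op_sqrt_eigenvector by force

lemma VQ_basis_subset: "VQ_basis Q \<subseteq> VQ Q"
  using VQ_basis_op_sqrt unfolding VQ_def by blast

lemma VQ_basis_summable:
  fixes L :: "'v \<Rightarrow>\<^sub>L 'h::separable_hilbert"
  shows "(\<lambda>f. (norm (L f))\<^sup>2) summable_on VQ_basis Q"
proof (rule summable_on_comparison_test)
  show "(\<lambda>f. (norm L)\<^sup>2 * (norm f)\<^sup>2) summable_on VQ_basis Q"
  proof (rule summable_on_cmult_right)
    have "eigenvalue Q summable_on {e \<in> eigenbasis Q. 0 < eigenvalue Q e}"
      by (rule summable_on_subset_banach[OF eigenvalue_summable]) auto
    then show "(\<lambda>f. (norm f)\<^sup>2) summable_on VQ_basis Q"
      unfolding VQ_basis_def summable_on_reindex[OF VQ_basis_inj]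
      by (rule summable_on_cong[THEN iffD1, rotated]) (auto simp: eigenbasis_norm power_mult_distrib)
  qed
  show "(norm (L f))\<^sup>2 \<le> (norm L)\<^sup>2 * (norm f)\<^sup>2" for f
    unfolding power_mult_distrib[symmetric] by (intro power_mono norm_blinfun) auto
qed auto

text \<open>The squared Hilbert-Schmidt norm on \<open>VQ Q\<close> of the restriction of
  \<open>L\<close>. Keeping \<open>L\<close> a bounded operator on all of \<open>V\<close> leaves
  sums, compositions and adjoints at the operator level; \<open>HS_norm_restrict_VQ\<close> is the
  bridge to the representation by functions.\<close>

definition hs_sq :: "('v \<Rightarrow>\<^sub>L 'h::separable_hilbert) \<Rightarrow> real" where
  "hs_sq L = (\<Sum>\<^sub>\<infinity>f\<in>VQ_basis Q. (norm (L f))\<^sup>2)"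

lemma hs_sq_nonneg: "0 \<le> hs_sq L"
  unfolding hs_sq_def by (intro infsum_nonneg) simp

text \<open>Eigenvectors with eigenvalue 0 are annihilated by the root, so \<open>VQ_basis Q\<close>
  may be traded for the image of the full eigenbasis, the form in which \<open>sum_gram_le\<close>
  applies.\<close>

lemma has_sum_hs_sq:
  fixes L :: "'v \<Rightarrow>\<^sub>L 'h::separable_hilbert"
  shows "((\<lambda>e. (norm (L (op_sqrt Q e)))\<^sup>2) has_sum hs_sq L) (eigenbasis Q)"
proof -
  have "((\<lambda>f. (norm (L f))\<^sup>2) has_sum hs_sq L) (VQ_basis Q)"
    unfolding hs_sq_def by (intro has_sum_infsum VQ_basis_summable)
  then have "((\<lambda>e. (norm (L (sqrt (eigenvalue Q e) *\<^sub>R e)))\<^sup>2) has_sum hs_sq L) {e \<in> eigenbasis Q. 0 < eigenvalue Q e}"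
    unfolding VQ_basis_def has_sum_reindex[OF VQ_basis_inj] by (simp add: o_def)
  then show ?thesis
  proof (rule has_sum_cong_neutral[THEN iffD1, rotated -1])
    fix e assume "e \<in> eigenbasis Q - {e \<in> eigenbasis Q. 0 < eigenvalue Q e}"
    then have "e \<in> eigenbasis Q" "eigenvalue Q e = 0" using eigenbasis(3)[OF Q, of e] by auto
    then show "(norm (L (op_sqrt Q e)))\<^sup>2 = 0" by (simp add: op_sqrt_eigenvector)
  qed (auto simp: op_sqrt_eigenvector)
qed

lemma sum_gram_le_hs_sq:
  fixes L :: "'v \<Rightarrow>\<^sub>L 'h::separable_hilbert"
  assumes F: "finite F" "pairwise orthogonal F" "\<forall>h\<in>F. norm h = 1"
  shows "(\<Sum>h\<in>F. Q (adj L h) \<bullet> adj L h) \<le> hs_sq L"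
  using sum_gram_le[OF eigenbasis(1)[OF Q] F has_sum_imp_summable[OF has_sum_hs_sq]]
  by (simp add: infsumI[OF has_sum_hs_sq])

lemma hs_sq_compose_le:
  fixes L :: "'v \<Rightarrow>\<^sub>L 'g::separable_hilbert" and M :: "'g \<Rightarrow>\<^sub>L 'h::separable_hilbert"
  shows "hs_sq (M o\<^sub>L L) \<le> (norm M)\<^sup>2 * hs_sq L"
proof -
  have "hs_sq (M o\<^sub>L L) \<le> (\<Sum>\<^sub>\<infinity>f\<in>VQ_basis Q. (norm M)\<^sup>2 * (norm (L f))\<^sup>2)"
    unfolding hs_sq_def
  proof (rule infsum_mono[OF VQ_basis_summable])
    show "(\<lambda>f. (norm M)\<^sup>2 * (norm (L f))\<^sup>2) summable_on VQ_basis Q"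
      by (intro summable_on_cmult_right VQ_basis_summable)
    show "(norm ((M o\<^sub>L L) f))\<^sup>2 \<le> (norm M)\<^sup>2 * (norm (L f))\<^sup>2" for f
      unfolding power_mult_distrib[symmetric] by (intro power_mono) (auto simp: norm_blinfun)
  qed
  then show ?thesis by (simp add: hs_sq_def infsum_cmult_right VQ_basis_summable)
qed

text \<open>The constant is \<open>hs_sq\<close> of the identity, that is, the trace of
  \<open>Q\<close>.\<close>

lemma hs_sq_bound: "\<exists>C\<ge>0. \<forall>L::'v \<Rightarrow>\<^sub>L 'h::separable_hilbert. hs_sq L \<le> C * (norm L)\<^sup>2"
proof (intro exI conjI allI)
  show "0 \<le> hs_sq (id_blinfun :: 'v \<Rightarrow>\<^sub>L 'v)" by (rule hs_sq_nonneg)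
  fix L :: "'v \<Rightarrow>\<^sub>L 'h"
  have "L o\<^sub>L id_blinfun = L" by (rule blinfun_eqI) simp
  then show "hs_sq L \<le> hs_sq (id_blinfun :: 'v \<Rightarrow>\<^sub>L 'v) * (norm L)\<^sup>2"
    using hs_sq_compose_le[of L id_blinfun] by (simp add: mult.commute)
qed

text \<open>On a norm-bounded set of operators the tail of the Hilbert-Schmidt series is dominated
  by \<open>C\<^sup>2\<close> times a tail of the trace, hence uniformly small. Finitely many
  vectors then control the norm, which is how strong continuity is upgraded to Hilbert-Schmidt
  continuity.\<close>

lemma hs_sq_tail:
  assumes "\<epsilon> > 0"
  shows "\<exists>F. finite F \<and> (\<forall>L::'v \<Rightarrow>\<^sub>L 'h::separable_hilbert. norm L \<le> C \<longrightarrow> hs_sq L \<le> (\<Sum>f\<in>F. (norm (L f))\<^sup>2) + \<epsilon>)"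
proof -
  define B where "B = VQ_basis Q"
  have sm0: "(\<lambda>f. (norm f)\<^sup>2) summable_on B"
    using VQ_basis_summable[of id_blinfun] by (simp add: B_def)
  define d where "d = \<epsilon> / (C\<^sup>2 + 1)"
  have d: "d > 0" using assms by (simp add: d_def add_nonneg_pos)
  obtain F where F: "finite F" "F \<subseteq> B" "dist (sum (\<lambda>f. (norm f)\<^sup>2) F) (infsum (\<lambda>f. (norm f)\<^sup>2) B) \<le> d"
    using has_sum_finite_approximation[OF has_sum_infsum[OF sm0] d] by blast
  have tail: "infsum (\<lambda>f. (norm f)\<^sup>2) (B - F) \<le> d"
    using F by (subst infsum_Diff) (auto simp: sm0 dist_real_def)
  have "hs_sq L \<le> (\<Sum>f\<in>F. (norm (L f))\<^sup>2) + \<epsilon>" if L: "norm L \<le> C" for L :: "'v \<Rightarrow>\<^sub>L 'h"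
  proof -
    have sm: "(\<lambda>f. (norm (L f))\<^sup>2) summable_on B" unfolding B_def by (rule VQ_basis_summable)
    have "infsum (\<lambda>f. (norm (L f))\<^sup>2) (B - F) \<le> infsum (\<lambda>f. C\<^sup>2 * (norm f)\<^sup>2) (B - F)"
    proof (rule infsum_mono)
      show "(\<lambda>f. (norm (L f))\<^sup>2) summable_on B - F" by (rule summable_on_subset_banach[OF sm]) auto
      show "(\<lambda>f. C\<^sup>2 * (norm f)\<^sup>2) summable_on B - F"
        by (intro summable_on_cmult_right summable_on_subset_banach[OF sm0]) auto
      show "(norm (L f))\<^sup>2 \<le> C\<^sup>2 * (norm f)\<^sup>2" for f
        unfolding power_mult_distrib[symmetric]
        by (intro power_mono order_trans[OF norm_blinfun] mult_right_mono L) auto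
    qed
    also have "\<dots> = C\<^sup>2 * infsum (\<lambda>f. (norm f)\<^sup>2) (B - F)"
      by (intro infsum_cmult_right summable_on_subset_banach[OF sm0]) auto
    also have "\<dots> \<le> C\<^sup>2 * d" by (intro mult_left_mono tail) auto
    also have "\<dots> \<le> \<epsilon>"
      using assms unfolding d_def by (simp add: divide_le_eq add_nonneg_pos mult.commute[of \<epsilon>] mult_right_mono)
    finally have "infsum (\<lambda>f. (norm (L f))\<^sup>2) (B - F) \<le> \<epsilon>" .
    moreover have "infsum (\<lambda>f. (norm (L f))\<^sup>2) (B - F) = hs_sq L - (\<Sum>f\<in>F. (norm (L f))\<^sup>2)"
      using F by (subst infsum_Diff) (auto simp: sm hs_sq_def B_def[symmetric])
    ultimately show ?thesis by simp
  qed
  then show ?thesis using F(1) by blast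
qed

lemma restrict_VQ_HS:
  fixes L :: "'v \<Rightarrow>\<^sub>L 'h::separable_hilbert"
  shows "restrict_VQ Q L \<in> HS Q"
proof -
  have sub: "subspace (VQ Q)"
    unfolding VQ_def
    by (intro linear_subspace_image bounded_linear.linear blinfun.bounded_linear_right) simp
  \<comment> \<open>Eigenvalues are at most \<open>norm Q\<close>, so
    \<open>1 \<le> norm Q / eigenvalue Q e\<close> compares the norm of \<open>V\<close> with that
    of \<open>VQ Q\<close>; the components of \<open>u\<close> along eigenvalue 0 vanish because
    \<open>u\<close> is in the range of the root.\<close>
  have bd: "norm (L u) \<le> (norm L * sqrt (norm Q)) * sqrt (VQ_inner Q u u)" if u: "u \<in> VQ Q" for u
  proof -
    obtain w where w: "u = op_sqrt Q w" using u unfolding VQ_def by blast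
    let ?P = "{e \<in> eigenbasis Q. 0 < eigenvalue Q e}"
    have ue: "u \<bullet> e = sqrt (eigenvalue Q e) * (w \<bullet> e)" if "e \<in> eigenbasis Q" for e
      unfolding w op_sqrt_inner op_sqrt_eigenvector[OF that] by simp
    have sm: "(\<lambda>e. inverse (eigenvalue Q e) * (u \<bullet> e) * (u \<bullet> e)) summable_on ?P"
    proof (rule summable_on_cong[THEN iffD1])
      show "(\<lambda>e. (w \<bullet> e)\<^sup>2) summable_on ?P"
        by (rule summable_on_subset_banach[OF has_sum_imp_summable[OF parseval[OF eigenbasis(1)[OF Q]]]]) auto
      fix e assume "e \<in> ?P"
      then show "(w \<bullet> e)\<^sup>2 = inverse (eigenvalue Q e) * (u \<bullet> e) * (u \<bullet> e)"
        using real_sqrt_mult_self[of "eigenvalue Q e"] by (simp add: ue power2_eq_square field_simps)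
    qed
    have "(norm u)\<^sup>2 = infsum (\<lambda>e. (u \<bullet> e)\<^sup>2) (eigenbasis Q)"
      by (rule sym, rule infsumI, rule parseval[OF eigenbasis(1)[OF Q]])
    also have "\<dots> \<le> infsum (\<lambda>e. norm Q * (inverse (eigenvalue Q e) * (u \<bullet> e) * (u \<bullet> e))) ?P"
    proof (rule infsum_mono_neutral)
      show "(\<lambda>e. (u \<bullet> e)\<^sup>2) summable_on eigenbasis Q"
        by (rule has_sum_imp_summable[OF parseval[OF eigenbasis(1)[OF Q]]])
      show "(\<lambda>e. norm Q * (inverse (eigenvalue Q e) * (u \<bullet> e) * (u \<bullet> e))) summable_on ?P"
        by (intro summable_on_cmult_right sm)
      fix e assume "e \<in> eigenbasis Q \<inter> ?P"
      then have e: "e \<in> eigenbasis Q" "0 < eigenvalue Q e" by auto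
      have "1 \<le> norm Q * inverse (eigenvalue Q e)" using eigenvalue_le_norm[OF e(1)] e(2) by (simp add: field_simps)
      then have "1 * (u \<bullet> e)\<^sup>2 \<le> norm Q * inverse (eigenvalue Q e) * (u \<bullet> e)\<^sup>2" by (intro mult_right_mono) auto
      then show "(u \<bullet> e)\<^sup>2 \<le> norm Q * (inverse (eigenvalue Q e) * (u \<bullet> e) * (u \<bullet> e))"
        by (simp add: power2_eq_square ac_simps)
    next
      fix e assume "e \<in> eigenbasis Q - ?P"
      then have "e \<in> eigenbasis Q" "eigenvalue Q e = 0" using eigenbasis(3)[OF Q, of e] by auto
      then show "(u \<bullet> e)\<^sup>2 \<le> 0" by (simp add: ue)
    qed auto
    also have "\<dots> = norm Q * VQ_inner Q u u"
      unfolding VQ_inner_def by (intro infsum_cmult_right sm)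
    finally have "norm u \<le> sqrt (norm Q * VQ_inner Q u u)" by (rule real_le_rsqrt)
    then have "norm L * norm u \<le> norm L * sqrt (norm Q * VQ_inner Q u u)" by (intro mult_left_mono) auto
    then show ?thesis using norm_blinfun[of L u] by (simp add: real_sqrt_mult ac_simps)
  qed
  have "(\<lambda>f. (norm (restrict_VQ Q L f))\<^sup>2) summable_on VQ_basis Q"
    using VQ_basis_summable[of L] VQ_basis_subset
    by (subst summable_on_cong[where g = "\<lambda>f. (norm (L f))\<^sup>2"]) (auto simp: restrict_VQ_def)
  then show ?thesis
    unfolding HS_def using sub bd
    by (auto simp: restrict_VQ_def blinfun.bilinear_simps subspace_add subspace_scale)
qed

lemma HS_norm_restrict_VQ:
  fixes L :: "'v \<Rightarrow>\<^sub>L 'h::separable_hilbert"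
  shows "(HS_norm Q (restrict_VQ Q L))\<^sup>2 = hs_sq L"
proof -
  have "HS_inner Q (restrict_VQ Q L) (restrict_VQ Q L) = hs_sq L"
    unfolding HS_inner_def hs_sq_def using VQ_basis_subset
    by (intro infsum_cong) (auto simp: restrict_VQ_def power2_norm_eq_inner)
  then show ?thesis by (simp add: HS_norm_def hs_sq_nonneg)
qed

lemma restrict_VQ_diff:
  fixes L M :: "'v \<Rightarrow>\<^sub>L 'h::separable_hilbert"
  shows "(\<lambda>v. restrict_VQ Q L v - restrict_VQ Q M v) = restrict_VQ Q (L - M)"
  by (auto simp: restrict_VQ_def blinfun.bilinear_simps)

text \<open>\<open>HS_borel\<close> is generated by the open sets of the Hilbert-Schmidt norm.
  Continuity in that norm makes the preimage of each generator the trace on \<open>S\<close> of a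
  union of balls, hence measurable in the restricted space.\<close>

lemma restrict_VQ_measurable:
  fixes \<Phi> :: "real \<Rightarrow> 'v \<Rightarrow>\<^sub>L 'h::separable_hilbert"
  assumes "\<And>r \<epsilon>. r \<in> S \<Longrightarrow> \<epsilon> > 0 \<Longrightarrow> \<exists>\<delta>>0. \<forall>r'\<in>S. \<bar>r' - r\<bar> < \<delta> \<longrightarrow> hs_sq (\<Phi> r' - \<Phi> r) < \<epsilon>"
  shows "(\<lambda>r. restrict_VQ Q (\<Phi> r)) \<in> restrict_space borel S \<rightarrow>\<^sub>M HS_borel Q"
  unfolding HS_borel_def
proof (rule measurable_measure_of)
  show "(\<lambda>r. restrict_VQ Q (\<Phi> r)) \<in> space (restrict_space borel S) \<rightarrow> HS Q"
    using restrict_VQ_HS by auto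
  fix U :: "('v \<Rightarrow> 'h) set"
  assume U: "U \<in> {U. U \<subseteq> HS Q \<and> (\<forall>\<Phi>\<in>U. \<exists>\<epsilon>>0. \<forall>\<Psi>\<in>HS Q. HS_norm Q (\<lambda>v. \<Psi> v - \<Phi> v) < \<epsilon> \<longrightarrow> \<Psi> \<in> U)}"
  have "\<exists>\<delta>>0. \<forall>r'\<in>S. \<bar>r' - r\<bar> < \<delta> \<longrightarrow> restrict_VQ Q (\<Phi> r') \<in> U"
    if r: "r \<in> S" "restrict_VQ Q (\<Phi> r) \<in> U" for r
  proof -
    obtain \<epsilon> where e: "\<epsilon> > 0" "\<And>\<Psi>. \<Psi> \<in> HS Q \<Longrightarrow> HS_norm Q (\<lambda>v. \<Psi> v - restrict_VQ Q (\<Phi> r) v) < \<epsilon> \<Longrightarrow> \<Psi> \<in> U"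
      using U r(2) by blast
    obtain \<delta> where d: "\<delta> > 0" "\<And>r'. r' \<in> S \<Longrightarrow> \<bar>r' - r\<bar> < \<delta> \<Longrightarrow> hs_sq (\<Phi> r' - \<Phi> r) < \<epsilon>\<^sup>2"
      using assms[OF r(1), of "\<epsilon>\<^sup>2"] e(1) by auto
    have "restrict_VQ Q (\<Phi> r') \<in> U" if "r' \<in> S" "\<bar>r' - r\<bar> < \<delta>" for r'
    proof (rule e(2)[OF restrict_VQ_HS])
      have "(HS_norm Q (restrict_VQ Q (\<Phi> r' - \<Phi> r)))\<^sup>2 < \<epsilon>\<^sup>2"
        unfolding HS_norm_restrict_VQ by (rule d(2)[OF that])
      then show "HS_norm Q (\<lambda>v. restrict_VQ Q (\<Phi> r') v - restrict_VQ Q (\<Phi> r) v) < \<epsilon>"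
        unfolding restrict_VQ_diff using e(1) by (intro power2_less_imp_less[of _ \<epsilon>]) auto
    qed
    then show ?thesis using d(1) by blast
  qed
  then obtain \<delta> where d: "\<And>r. r \<in> S \<Longrightarrow> restrict_VQ Q (\<Phi> r) \<in> U \<Longrightarrow> \<delta> r > 0"
    "\<And>r r'. r \<in> S \<Longrightarrow> restrict_VQ Q (\<Phi> r) \<in> U \<Longrightarrow> r' \<in> S \<Longrightarrow> \<bar>r' - r\<bar> < \<delta> r \<Longrightarrow> restrict_VQ Q (\<Phi> r') \<in> U"
    by metis
  define O' where "O' = (\<Union>r\<in>{r\<in>S. restrict_VQ Q (\<Phi> r) \<in> U}. ball r (\<delta> r))"
  have "(\<lambda>r. restrict_VQ Q (\<Phi> r)) -` U \<inter> space (restrict_space borel S) = O' \<inter> S"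
  proof (intro equalityI subsetI)
    fix r assume "r \<in> (\<lambda>r. restrict_VQ Q (\<Phi> r)) -` U \<inter> space (restrict_space borel S)"
    then have r: "r \<in> S" "restrict_VQ Q (\<Phi> r) \<in> U" by (auto simp: space_restrict_space)
    then have "r \<in> ball r (\<delta> r)" using d(1) by simp
    then show "r \<in> O' \<inter> S" using r by (auto simp: O'_def)
  next
    fix r' assume "r' \<in> O' \<inter> S"
    then obtain r where "r \<in> S" "restrict_VQ Q (\<Phi> r) \<in> U" "r' \<in> ball r (\<delta> r)" "r' \<in> S"
      by (auto simp: O'_def)
    moreover from this have "\<bar>r' - r\<bar> < \<delta> r" by (simp add: dist_real_def abs_minus_commute)
    ultimately have "r' \<in> S" "restrict_VQ Q (\<Phi> r') \<in> U" using d(2) by blast+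
    then show "r' \<in> (\<lambda>r. restrict_VQ Q (\<Phi> r)) -` U \<inter> space (restrict_space borel S)"
      by (auto simp: space_restrict_space)
  qed
  moreover have "open O'" by (auto simp: O'_def)
  ultimately show "(\<lambda>r. restrict_VQ Q (\<Phi> r)) -` U \<inter> space (restrict_space borel S) \<in> sets (restrict_space borel S)"
    by (auto simp: sets_restrict_space intro!: image_eqI[of _ _ O'])
qed blast

end

section \<open>Semigroups and Yosida approximations\<close>

lemma C0_semigroup_add: "C0_semigroup S \<Longrightarrow> 0 \<le> s \<Longrightarrow> 0 \<le> t \<Longrightarrow> S (s + t) x = S s (S t x)"
  unfolding C0_semigroup_def by (metis blinfun_apply_blinfun_compose)

lemma C0_semigroup_0: "C0_semigroup S \<Longrightarrow> S 0 x = x"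
  unfolding C0_semigroup_def by simp

lemma C0_semigroup_near_0:
  assumes "C0_semigroup S" "\<epsilon> > 0"
  shows "\<exists>\<delta>>0. \<forall>t. 0 \<le> t \<and> t < \<delta> \<longrightarrow> norm (S t x - x) < \<epsilon>"
proof -
  have "((\<lambda>t. S t x) \<longlongrightarrow> x) (at_right 0)" using assms(1) unfolding C0_semigroup_def by blast
  then have "eventually (\<lambda>t. dist (S t x) x < \<epsilon>) (at_right 0)" using assms(2) by (rule tendstoD)
  then obtain \<delta> where d: "\<delta> > 0" "\<And>t. 0 < t \<Longrightarrow> t < \<delta> \<Longrightarrow> dist (S t x) x < \<epsilon>"
    unfolding eventually_at_right_field by blast
  have "norm (S t x - x) < \<epsilon>" if "0 \<le> t \<and> t < \<delta>" for t
    using d(2)[of t] that assms by (cases "t = 0") (auto simp: dist_norm C0_semigroup_0)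
  then show ?thesis using d(1) by blast
qed

text \<open>Strong continuity is given at 0 only. Were the norms unbounded near 0, they would be
  unbounded along some \<open>t n\<close> tending to 0, although \<open>S (t n) x\<close> converges
  for each \<open>x\<close>; uniform boundedness forbids this, and the semigroup law spreads the
  local bound.\<close>

lemma C0_semigroup_bound:
  fixes S :: "real \<Rightarrow> 'a::separable_hilbert \<Rightarrow>\<^sub>L 'a"
  assumes S: "C0_semigroup S"
  shows "\<exists>C\<ge>1. \<forall>t\<in>{0..T}. norm (S t) \<le> C"
proof -
  have "\<exists>\<delta>>0. \<exists>M. \<forall>t\<in>{0..\<delta>}. norm (S t) \<le> M"
  proof (rule ccontr)
    assume neg: "\<not> ?thesis"
    have "\<exists>t\<in>{0..inverse (real (Suc n))}. norm (S t) > real n" for n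
    proof (rule ccontr)
      assume "\<not> (\<exists>t\<in>{0..inverse (real (Suc n))}. norm (S t) > real n)"
      then have "\<forall>t\<in>{0..inverse (real (Suc n))}. norm (S t) \<le> real n" by (simp add: not_less)
      moreover have "inverse (real (Suc n)) > 0" by simp
      ultimately show False using neg by blast
    qed
    then obtain t where t: "\<And>n. t n \<in> {0..inverse (real (Suc n))}" "\<And>n. norm (S (t n)) > real n" by metis
    have t0: "t \<longlonglongrightarrow> 0"
      by (rule tendsto_sandwich[OF _ _ tendsto_const LIMSEQ_inverse_real_of_nat]) (use t(1) in auto)
    have "\<exists>C. \<forall>n\<in>UNIV. norm (S (t n) x) \<le> C" for x
    proof -
      have "(\<lambda>n. S (t n) x) \<longlonglongrightarrow> x"
      proof (rule tendstoI)
        fix \<epsilon> :: real assume "\<epsilon> > 0"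
        then obtain \<delta> where d: "\<delta> > 0" "\<And>t. 0 \<le> t \<and> t < \<delta> \<Longrightarrow> norm (S t x - x) < \<epsilon>"
          using C0_semigroup_near_0[OF S] by blast
        have "eventually (\<lambda>n. t n < \<delta>) sequentially" using order_tendstoD(2)[OF t0 d(1)] .
        then show "eventually (\<lambda>n. dist (S (t n) x) x < \<epsilon>) sequentially"
          by eventually_elim (use t(1) d(2) in \<open>auto simp: dist_norm\<close>)
      qed
      then have "Bseq (\<lambda>n. S (t n) x)" using convergent_def convergent_imp_Bseq by blast
      then show ?thesis unfolding Bseq_def by blast
    qed
    then obtain C where "\<And>n. norm (S (t n)) \<le> C"
      using uniform_boundedness[of UNIV "\<lambda>n. S (t n)"] by blast
    moreover obtain n where "C \<le> real n" using real_arch_simple by blast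
    ultimately show False using t(2)[of n] by (meson not_le order_trans)
  qed
  then obtain \<delta> M0 where d: "\<delta> > 0" "\<And>t. t \<in> {0..\<delta>} \<Longrightarrow> norm (S t) \<le> M0" by blast
  define M where "M = max 1 M0"
  have M: "M \<ge> 1" "\<And>t. t \<in> {0..\<delta>} \<Longrightarrow> norm (S t) \<le> M" using d(2) by (fastforce simp: M_def)+
  \<comment> \<open>Splitting off one step of length \<open>\<delta>\<close> costs one factor
    \<open>M\<close>; taking \<open>M\<close> at least 1 keeps the powers increasing.\<close>
  have *: "\<forall>t\<in>{0..real k * \<delta>}. norm (S t) \<le> M ^ Suc k" for k
  proof (induction k)
    case 0
    then show ?case using M(2)[of 0] d(1) by simp
  next
    case (Suc k)
    show ?case
    proof
      fix t assume t: "t \<in> {0..real (Suc k) * \<delta>}"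
      show "norm (S t) \<le> M ^ Suc (Suc k)"
      proof (cases "t \<le> \<delta>")
        case True
        then have "norm (S t) \<le> M ^ 1" using t M(2)[of t] by simp
        also have "\<dots> \<le> M ^ Suc (Suc k)" by (rule power_increasing[OF _ M(1)]) simp
        finally show ?thesis .
      next
        case False
        then have "S t = S \<delta> o\<^sub>L S (t - \<delta>)"
          using S d(1) unfolding C0_semigroup_def by (metis add.commute diff_add_cancel diff_ge_0_iff_ge less_imp_le not_le)
        then have "norm (S t) \<le> norm (S \<delta>) * norm (S (t - \<delta>))" using norm_blinfun_compose by metis
        also have "\<dots> \<le> M * M ^ Suc k"
          using M(2)[of \<delta>] M(1) d(1) Suc False t by (intro mult_mono) (auto simp: algebra_simps)
        finally show ?thesis by simp
      qed
    qed
  qed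
  obtain k where k: "T \<le> real k * \<delta>" using d(1) reals_Archimedean3[of \<delta>] less_imp_le by blast
  have "M ^ Suc k \<ge> 1" using M(1) by (rule one_le_power)
  moreover have "\<forall>t\<in>{0..T}. norm (S t) \<le> M ^ Suc k" using *[of k] k by auto
  ultimately show ?thesis by blast
qed

text \<open>The factor of the earlier time is pulled out,
  \<open>S b x - S a x = S a (S (b - a) x - x)\<close>, so continuity at 0 and the local bound
  settle both one-sided limits at once.\<close>

lemma C0_semigroup_continuous:
  fixes S :: "real \<Rightarrow> 'a::separable_hilbert \<Rightarrow>\<^sub>L 'a"
  assumes S: "C0_semigroup S"
  shows "continuous_on {0..T} (\<lambda>t. S t x)"
proof (rule continuous_onI)
  fix s \<epsilon> :: real assume s: "s \<in> {0..T}" and e: "\<epsilon> > 0"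
  obtain C where C: "C \<ge> 1" "\<And>t. t \<in> {0..T} \<Longrightarrow> norm (S t) \<le> C" using C0_semigroup_bound[OF S] by blast
  obtain \<delta> where d: "\<delta> > 0" "\<And>t. 0 \<le> t \<and> t < \<delta> \<Longrightarrow> norm (S t x - x) < \<epsilon> / C"
    using C0_semigroup_near_0[OF S, of "\<epsilon> / C"] e C(1) by fastforce
  have *: "dist (S b x) (S a x) \<le> \<epsilon>" if "a \<in> {0..T}" "a \<le> b" "b - a < \<delta>" for a b
  proof -
    have "S b x - S a x = S a (S (b - a) x - x)"
      using C0_semigroup_add[OF S, of a "b - a" x] that by (simp add: blinfun.bilinear_simps)
    then have "norm (S b x - S a x) \<le> C * norm (S (b - a) x - x)"
      using norm_blinfun[of "S a" "S (b - a) x - x"] C(2)[OF that(1)] by (simp add: order_trans mult_right_mono)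
    also have "\<dots> \<le> C * (\<epsilon> / C)"
      using d(2)[of "b - a"] that C(1) by (intro mult_left_mono) auto
    finally show ?thesis using C(1) by (simp add: dist_norm)
  qed
  show "\<exists>\<delta>>0. \<forall>t\<in>{0..T}. dist t s < \<delta> \<longrightarrow> dist (S t x) (S s x) \<le> \<epsilon>"
  proof (intro exI conjI ballI impI)
    fix t assume t: "t \<in> {0..T}" "dist t s < \<delta>"
    show "dist (S t x) (S s x) \<le> \<epsilon>"
      using *[of s t] *[of t s] s t by (cases "s \<le> t") (auto simp: dist_real_def dist_commute)
  qed (rule d(1))
qed

lemma adj_compose: "adj (L o\<^sub>L M) = adj M o\<^sub>L adj L"
proof (rule blinfun_eqI)
  fix y
  have "adj (L o\<^sub>L M) y \<bullet> x = (adj M o\<^sub>L adj L) y \<bullet> x" for x by (simp add: adj_inner)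
  then show "adj (L o\<^sub>L M) y = (adj M o\<^sub>L adj L) y" by (metis vector_eq_rdot)
qed

lemma adj_id: "adj id_blinfun = id_blinfun"
proof (rule blinfun_eqI)
  fix y :: 'a
  have "adj id_blinfun y \<bullet> x = id_blinfun y \<bullet> x" for x by (simp add: adj_inner)
  then show "adj id_blinfun y = id_blinfun y" by (metis vector_eq_rdot)
qed

text \<open>Strong continuity does not pass to adjoints by itself. The vectors with continuous
  adjoint orbit at 0 form a closed subspace \<open>Y\<close>. A nonzero \<open>z\<close> orthogonal
  to \<open>Y\<close> would be orthogonal to the averages of its adjoint orbit over
  \<open>{0..h}\<close>, which belong to \<open>Y\<close>; then the integral of
  \<open>S s z \<bullet> z\<close> over \<open>{0..h}\<close> vanishes, although for small
  \<open>h\<close> the integrand stays above half of \<open>z \<bullet> z\<close>.\<close>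

lemma C0_semigroup_adj:
  fixes S :: "real \<Rightarrow> 'a::separable_hilbert \<Rightarrow>\<^sub>L 'a"
  assumes S: "C0_semigroup S"
  shows "C0_semigroup (\<lambda>t. adj (S t))"
proof -
  obtain C where C: "C \<ge> 1" "\<And>t. t \<in> {0..2} \<Longrightarrow> norm (S t) \<le> C" using C0_semigroup_bound[OF S] by blast
  define Y where "Y = {x. ((\<lambda>t. adj (S t) x) \<longlongrightarrow> x) (at_right 0)}"
  have Cadj: "norm (adj (S t)) \<le> C" if "t \<in> {0..2}" for t
    using adj_inner(3)[of "S t"] C(2)[OF that] by linarith
  have sub: "subspace Y"
    unfolding subspace_def Y_def by (auto simp: blinfun.bilinear_simps intro!: tendsto_intros)
  have cl: "closed Y"
  proof (rule closed_sequential_limits[THEN iffD2], intro allI impI)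
    fix u l assume u: "(\<forall>n. u n \<in> Y) \<and> u \<longlonglongrightarrow> l"
    have "((\<lambda>t. adj (S t) l) \<longlongrightarrow> l) (at_right 0)"
    proof (rule tendstoI)
      fix \<epsilon> :: real assume e: "\<epsilon> > 0"
      have "eventually (\<lambda>n. dist (u n) l < \<epsilon> / (3 * C)) sequentially"
        using u e C(1) by (intro tendstoD[of u]) auto
      then obtain n where n: "norm (l - u n) < \<epsilon> / (3 * C)"
        by (auto simp: eventually_sequentially dist_norm norm_minus_commute)
      have small: "norm (l - u n) < \<epsilon> / 3"
      proof -
        have "\<epsilon> / (3 * C) \<le> \<epsilon> / 3" using e C(1) by (intro divide_left_mono) auto
        then show ?thesis using n by linarith
      qed
      have "eventually (\<lambda>t. dist (adj (S t) (u n)) (u n) < \<epsilon> / 3) (at_right 0)"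
        using u e by (intro tendstoD) (auto simp: Y_def)
      moreover have "eventually (\<lambda>t::real. t \<in> {0<..<2}) (at_right 0)"
        by (rule eventually_at_right_real) simp
      ultimately show "eventually (\<lambda>t. dist (adj (S t) l) l < \<epsilon>) (at_right 0)"
      proof eventually_elim
        case (elim t)
        have "norm (adj (S t) (l - u n)) \<le> C * norm (l - u n)"
          using elim(2) by (intro order_trans[OF norm_blinfun] mult_right_mono Cadj) auto
        also have "\<dots> < \<epsilon> / 3" using n C(1) by (simp add: field_simps)
        finally have "norm (adj (S t) (l - u n)) < \<epsilon> / 3" .
        moreover have "adj (S t) l - l = adj (S t) (l - u n) + (adj (S t) (u n) - u n) + (u n - l)"
          by (simp add: blinfun.bilinear_simps)
        ultimately show ?case
          using elim(1) small norm_triangle_ineq[of "adj (S t) (l - u n) + (adj (S t) (u n) - u n)" "u n - l"]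
            norm_triangle_ineq[of "adj (S t) (l - u n)" "adj (S t) (u n) - u n"]
          by (simp add: dist_norm norm_minus_commute)
      qed
    qed
    then show "l \<in> Y" by (simp add: Y_def)
  qed
  have "Y = UNIV"
  proof (rule ccontr)
    assume "Y \<noteq> UNIV"
    then obtain x where "x \<notin> Y" by blast
    then obtain z where z: "z \<noteq> 0" "\<And>m. m \<in> Y \<Longrightarrow> z \<bullet> m = 0"
      using closed_subspace_orthogonal_vector[OF sub cl] by blast
    have cont: "continuous_on {a..b} (\<lambda>s. S s y \<bullet> z)" if "0 \<le> a" "b \<le> 2" for y a b
      by (rule continuous_on_subset[OF continuous_on_inner[OF C0_semigroup_continuous[OF S, of 2] continuous_on_const]])
        (use that in auto)
    have bnd: "\<bar>S s y \<bullet> z\<bar> \<le> (C * norm z) * norm y" if "s \<in> {0..2}" for s y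
    proof -
      have "\<bar>S s y \<bullet> z\<bar> \<le> norm (S s y) * norm z" by (rule Cauchy_Schwarz_ineq2)
      also have "\<dots> \<le> (C * norm y) * norm z"
        by (intro mult_right_mono order_trans[OF norm_blinfun] C(2) that) auto
      finally show ?thesis by (simp add: ac_simps)
    qed
    have avg0: "integral {0..h} (\<lambda>s. S s z \<bullet> z) = 0" if h: "0 < h" "h < 1" for h
    proof -
      have ib: "norm (integral {a..b} (\<lambda>s. S s y \<bullet> z)) \<le> (C * norm z) * norm y * (b - a)"
        if "0 \<le> a" "a \<le> b" "b \<le> 2" for a b y
        by (rule integral_bound[OF that(2) cont]) (use that bnd in auto)
      \<comment> \<open>The average of the adjoint orbit of \<open>z\<close> is obtained weakly, as
        the Riesz vector of an averaged functional, since that orbit is not yet known to be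
        continuous.\<close>
      have "bounded_linear (\<lambda>y. integral {0..h} (\<lambda>s. S s y \<bullet> z))"
      proof (rule bounded_linear_intro)
        show "integral {0..h} (\<lambda>s. S s (x + y) \<bullet> z) =
            integral {0..h} (\<lambda>s. S s x \<bullet> z) + integral {0..h} (\<lambda>s. S s y \<bullet> z)" for x y
          using h by (subst integral_add[symmetric])
            (auto intro!: integrable_continuous_real cont simp: blinfun.bilinear_simps inner_add_left)
        show "integral {0..h} (\<lambda>s. S s (r *\<^sub>R x) \<bullet> z) = r *\<^sub>R integral {0..h} (\<lambda>s. S s x \<bullet> z)" for r x
          by (simp add: blinfun.bilinear_simps)
        show "norm (integral {0..h} (\<lambda>s. S s y \<bullet> z)) \<le> norm y * (C * norm z * h)" for y
          using ib[of 0 h y] h by (simp add: ac_simps)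
      qed
      then obtain x where x: "\<And>y. integral {0..h} (\<lambda>s. S s y \<bullet> z) = x \<bullet> y"
        using riesz_representation by blast
      have diff: "norm (adj (S t) x - x) \<le> 2 * C * norm z * t" if t: "0 < t" "t < 1" for t
      proof -
        define w where "w = adj (S t) x - x"
        have "w \<bullet> w = x \<bullet> S t w - x \<bullet> w" by (simp add: w_def inner_diff_left adj_inner)
        also have "x \<bullet> S t w = integral {0..h} (\<lambda>s. S (s + t) w \<bullet> z)"
          using t by (subst x[symmetric]) (auto intro!: integral_cong simp: C0_semigroup_add[OF S])
        also have "\<dots> = integral {0+t..h+t} (\<lambda>s. S s w \<bullet> z)"
          using integral_shift[OF cont[of "0 + t" "h + t" w]] t h by (simp add: o_def)
        \<comment> \<open>Shifting the window by \<open>t\<close> changes the integral only on two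
          intervals of length \<open>t\<close>, which yields a bound linear in
          \<open>t\<close>.\<close>
        also have "\<dots> - x \<bullet> w = integral {h..h+t} (\<lambda>s. S s w \<bullet> z) - integral {0..t} (\<lambda>s. S s w \<bullet> z)"
        proof -
          have i: "(\<lambda>s. S s w \<bullet> z) integrable_on {0..h+t}"
            using t h by (intro integrable_continuous_real cont) auto
          have "integral {0..t} (\<lambda>s. S s w \<bullet> z) + integral {t..h+t} (\<lambda>s. S s w \<bullet> z) = integral {0..h+t} (\<lambda>s. S s w \<bullet> z)"
            by (rule Henstock_Kurzweil_Integration.integral_combine[OF _ _ i]) (use t h in auto)
          moreover have "integral {0..h} (\<lambda>s. S s w \<bullet> z) + integral {h..h+t} (\<lambda>s. S s w \<bullet> z) = integral {0..h+t} (\<lambda>s. S s w \<bullet> z)"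
            by (rule Henstock_Kurzweil_Integration.integral_combine[OF _ _ i]) (use t h in auto)
          ultimately show ?thesis unfolding x[symmetric] by simp
        qed
        also have "\<dots> \<le> (2 * C * norm z * t) * norm w"
          using ib[of h "h+t" w] ib[of 0 t w] t h by (simp add: algebra_simps abs_le_iff)
        finally have "norm w * norm w \<le> (2 * C * norm z * t) * norm w"
          by (simp add: power2_norm_eq_inner flip: power2_eq_square)
        then have "norm w \<le> 2 * C * norm z * t" using t C(1) by (cases "w = 0") auto
        then show ?thesis by (simp add: w_def)
      qed
      have "((\<lambda>t. adj (S t) x - x) \<longlongrightarrow> 0) (at_right 0)"
      proof (rule Lim_null_comparison)
        show "eventually (\<lambda>t. norm (adj (S t) x - x) \<le> 2 * C * norm z * t) (at_right 0)"
          using eventually_at_right_real[of 0 1] by (rule eventually_mono) (use diff in auto)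
        show "((\<lambda>t. 2 * C * norm z * t) \<longlongrightarrow> 0) (at_right 0)"
          by (rule tendsto_eq_intros refl | simp)+
      qed
      then have "x \<in> Y" unfolding Y_def by (simp add: LIM_zero_iff)
      then have "z \<bullet> x = 0" by (rule z(2))
      then show ?thesis using x[of z] by (simp add: inner_commute)
    qed
    have zz: "z \<bullet> z > 0" using z(1) by simp
    obtain \<delta> where d: "\<delta> > 0" "\<And>t. 0 \<le> t \<and> t < \<delta> \<Longrightarrow> norm (S t z - z) < norm z / 2"
      using C0_semigroup_near_0[OF S, of "norm z / 2" z] z(1) by auto
    define h where "h = min \<delta> 1 / 2"
    have h: "0 < h" "h < 1" "h < \<delta>" using d(1) by (auto simp: h_def min_def)
    have "S s z \<bullet> z \<ge> (z \<bullet> z) / 2" if "s \<in> {0..h}" for s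
    proof -
      have "\<bar>(S s z - z) \<bullet> z\<bar> \<le> norm (S s z - z) * norm z" by (rule Cauchy_Schwarz_ineq2)
      also have "\<dots> \<le> norm z / 2 * norm z" using d(2)[of s] that h by (intro mult_right_mono) auto
      also have "\<dots> = (z \<bullet> z) / 2" by (simp add: power2_norm_eq_inner flip: power2_eq_square)
      finally show ?thesis unfolding inner_diff_left by linarith
    qed
    then have "integral {0..h} (\<lambda>s. (z \<bullet> z) / 2) \<le> integral {0..h} (\<lambda>s. S s z \<bullet> z)"
      using h by (intro integral_le integrable_continuous_real cont continuous_on_const) auto
    then have "h * ((z \<bullet> z) / 2) \<le> 0" using avg0[OF h(1,2)] h by simp
    moreover have "h * ((z \<bullet> z) / 2) > 0" using zz h by (intro mult_pos_pos) auto
    ultimately show False by linarith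
  qed
  then have lim: "((\<lambda>t. adj (S t) x) \<longlongrightarrow> x) (at_right 0)" for x unfolding Y_def by blast
  have "adj (S (s + t)) = adj (S s) o\<^sub>L adj (S t)" if "0 \<le> s" "0 \<le> t" for s t
    using S that unfolding C0_semigroup_def by (metis adj_compose add.commute)
  moreover have "adj (S 0) = id_blinfun" using S unfolding C0_semigroup_def by (simp add: adj_id)
  ultimately show ?thesis using lim unfolding C0_semigroup_def by blast
qed

section \<open>Strongly continuous operator families\<close>

lemma continuous_on_blinfun_apply_strong:
  fixes K :: "'p::topological_space \<Rightarrow> 'a::real_normed_vector \<Rightarrow>\<^sub>L 'b::real_normed_vector"
  assumes K: "\<And>v. continuous_on X (\<lambda>p. K p v)" and C: "\<And>p. p \<in> X \<Longrightarrow> norm (K p) \<le> C"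
    and z: "continuous_on X z"
  shows "continuous_on X (\<lambda>p. K p (z p))"
  unfolding continuous_on_def
proof
  fix p assume p: "p \<in> X"
  \<comment> \<open>Joint continuity from strong continuity and a norm bound: the increment of the
    argument is estimated through \<open>C\<close>, while the increment of the operator acts on the
    fixed vector \<open>z p\<close>.\<close>
  have "((\<lambda>q. K q (z q - z p)) \<longlongrightarrow> 0) (at p within X)"
  proof (rule Lim_null_comparison)
    show "\<forall>\<^sub>F q in at p within X. norm (K q (z q - z p)) \<le> C * norm (z q - z p)"
      unfolding eventually_at_filter
      by (intro always_eventually allI impI order_trans[OF norm_blinfun] mult_right_mono C) auto
    have "(z \<longlongrightarrow> z p) (at p within X)" using z p unfolding continuous_on_def by blast
    then have "((\<lambda>q. C * norm (z q - z p)) \<longlongrightarrow> C * norm (z p - z p)) (at p within X)"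
      by (intro tendsto_intros)
    then show "((\<lambda>q. C * norm (z q - z p)) \<longlongrightarrow> 0) (at p within X)" by simp
  qed
  moreover have "((\<lambda>q. K q (z p)) \<longlongrightarrow> K p (z p)) (at p within X)"
    using K p unfolding continuous_on_def by blast
  ultimately have "((\<lambda>q. K q (z q - z p) + K q (z p)) \<longlongrightarrow> 0 + K p (z p)) (at p within X)"
    by (rule tendsto_add)
  then show "((\<lambda>q. K q (z q)) \<longlongrightarrow> K p (z p)) (at p within X)"
    by (simp add: blinfun.bilinear_simps)
qed

text \<open>Orbits are continuous on a compact interval, hence bounded; uniform boundedness turns
  this into a bound on the operator norms, which are not known to be continuous in time.\<close>

lemma Cs_bound:
  assumes "X \<in> Cs T"
  shows "\<exists>C\<ge>0. \<forall>t\<in>{0..T}. norm (X t) \<le> C"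
proof (rule uniform_boundedness)
  fix x
  have "compact ((\<lambda>t. X t x) ` {0..T})"
    using assms unfolding Cs_def by (intro compact_continuous_image) auto
  then have "bounded ((\<lambda>t. X t x) ` {0..T})" by (rule compact_imp_bounded)
  then show "\<exists>C. \<forall>t\<in>{0..T}. norm (X t x) \<le> C" unfolding bounded_iff by blast
qed

lemma Cs_apply:
  assumes X: "X \<in> Cs T" and z: "continuous_on I z" and I: "I \<subseteq> {0..T}"
  shows "continuous_on I (\<lambda>t. X t (z t))"
proof -
  obtain C where C: "\<forall>t\<in>{0..T}. norm (X t) \<le> C" using Cs_bound[OF X] by blast
  show ?thesis
  proof (rule continuous_on_blinfun_apply_strong[OF _ _ z])
    show "continuous_on I (\<lambda>t. X t v)" for v
      using X I unfolding Cs_def by (auto intro: continuous_on_subset)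
    show "t \<in> I \<Longrightarrow> norm (X t) \<le> C" for t using C I by blast
  qed
qed

lemma Cs_compose:
  assumes "X \<in> Cs T" "Y \<in> Cs T" shows "(\<lambda>t. X t o\<^sub>L Y t) \<in> Cs T"
  using Cs_apply[OF assms(1), of "{0..T}"] assms(2) unfolding Cs_def by auto

lemma Cs_const: "(\<lambda>t. L) \<in> Cs T" by (simp add: Cs_def)

lemma Cs_add: "X \<in> Cs T \<Longrightarrow> Y \<in> Cs T \<Longrightarrow> (\<lambda>t. X t + Y t) \<in> Cs T"
  by (auto simp: Cs_def blinfun.bilinear_simps intro: continuous_intros)

lemma Cs_diff: "X \<in> Cs T \<Longrightarrow> Y \<in> Cs T \<Longrightarrow> (\<lambda>t. X t - Y t) \<in> Cs T"
  by (auto simp: Cs_def blinfun.bilinear_simps intro: continuous_intros)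

lemma C0_semigroup_Cs: "C0_semigroup S \<Longrightarrow> S \<in> Cs T"
  using C0_semigroup_continuous by (auto simp: Cs_def)

lemma has_vector_derivative_within_eps:
  "(f has_vector_derivative d) (at t within X) \<longleftrightarrow>
    (\<forall>e>0. \<forall>\<^sub>F s in at t within X. norm (f s - f t - (s - t) *\<^sub>R d) \<le> e * \<bar>s - t\<bar>)"
  unfolding has_vector_derivative_def has_derivative_within_alt2
  by (simp add: bounded_linear_scaleR_left)

lemma has_vector_derivative_epsD:
  assumes "(f has_vector_derivative d) (at t within X)" "e > 0"
  shows "\<forall>\<^sub>F s in at t within X. norm (f s - f t - (s - t) *\<^sub>R d) \<le> e * \<bar>s - t\<bar>"
  using assms unfolding has_vector_derivative_within_eps by blast

text \<open>Product rule for a strongly continuous family differentiated only along the fixed vector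
  \<open>z t\<close>. The error splits into the remainder along that vector, the remainder of
  \<open>z\<close> estimated through \<open>C\<close>, and \<open>K s z' - K t z'\<close>, small by
  strong continuity.\<close>

lemma has_vector_derivative_blinfun_apply_strong:
  fixes K :: "real \<Rightarrow> 'a::real_normed_vector \<Rightarrow>\<^sub>L 'b::real_normed_vector"
  assumes d: "((\<lambda>s. K s (z t)) has_vector_derivative d) (at t within X)"
    and K: "\<And>v. continuous_on X (\<lambda>s. K s v)" and C: "\<And>s. s \<in> X \<Longrightarrow> norm (K s) \<le> C"
    and z: "(z has_vector_derivative z') (at t within X)" and t: "t \<in> X"
  shows "((\<lambda>s. K s (z s)) has_vector_derivative d + K t z') (at t within X)"
  unfolding has_vector_derivative_within_eps
proof (intro allI impI)
  fix e :: real assume e: "e > 0"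
  define c where "c = e / (3 * (\<bar>C\<bar> + 1))"
  have c: "c > 0" using e by (simp add: c_def)
  have Cc: "\<bar>C\<bar> * c \<le> e / 3" using e by (simp add: c_def field_simps)
  have "\<forall>\<^sub>F s in at t within X. norm (K s (z t) - K t (z t) - (s - t) *\<^sub>R d) \<le> e / 3 * \<bar>s - t\<bar>"
    using e by (intro has_vector_derivative_epsD[OF d]) simp
  moreover have "\<forall>\<^sub>F s in at t within X. norm (z s - z t - (s - t) *\<^sub>R z') \<le> c * \<bar>s - t\<bar>"
    by (rule has_vector_derivative_epsD[OF z c])
  moreover have "\<forall>\<^sub>F s in at t within X. dist (K s z') (K t z') < e / 3"
    using K[of z'] t e unfolding continuous_on_def by (intro tendstoD) auto
  moreover have "\<forall>\<^sub>F s in at t within X. s \<in> X" by (simp add: eventually_at_filter)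
  ultimately show "\<forall>\<^sub>F s in at t within X. norm (K s (z s) - K t (z t) - (s - t) *\<^sub>R (d + K t z')) \<le> e * \<bar>s - t\<bar>"
  proof eventually_elim
    case (elim s)
    define a1 where "a1 = K s (z t) - K t (z t) - (s - t) *\<^sub>R d"
    define a2 where "a2 = K s (z s - z t - (s - t) *\<^sub>R z')"
    define a3 where "a3 = (s - t) *\<^sub>R (K s z' - K t z')"
    have eq: "K s (z s) - K t (z t) - (s - t) *\<^sub>R (d + K t z') = a1 + a2 + a3"
      by (simp add: a1_def a2_def a3_def blinfun.bilinear_simps algebra_simps)
    have "norm a2 \<le> \<bar>C\<bar> * (c * \<bar>s - t\<bar>)"
      unfolding a2_def using C[OF elim(4)] elim(2)
      by (intro order_trans[OF norm_blinfun] mult_mono) auto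
    also have "\<dots> \<le> e / 3 * \<bar>s - t\<bar>" using mult_right_mono[OF Cc, of "\<bar>s - t\<bar>"] by simp
    finally have 2: "norm a2 \<le> e / 3 * \<bar>s - t\<bar>" .
    have 3: "norm a3 \<le> e / 3 * \<bar>s - t\<bar>"
      unfolding a3_def norm_scaleR using elim(3) unfolding dist_norm
    by (subst mult.commute) (intro mult_right_mono, simp_all)
    have "norm (a1 + a2 + a3) \<le> norm a1 + norm a2 + norm a3"
      using norm_triangle_ineq[of "a1 + a2" a3] norm_triangle_ineq[of a1 a2] by linarith
    also have "\<dots> \<le> e * \<bar>s - t\<bar>" using elim(1) 2 3 unfolding a1_def[symmetric] by linarith
    finally show ?case unfolding eq .
  qed
qed

section \<open>The generator, its resolvent and the Yosida approximations\<close>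

context
  fixes DA :: "'h::separable_hilbert set" and A :: "'h \<Rightarrow> 'h" and S :: "real \<Rightarrow> 'h \<Rightarrow>\<^sub>L 'h"
  assumes gen: "generates DA A S"
begin

lemma generates_semigroup: "C0_semigroup S" using gen unfolding generates_def by blast

lemma generator_lim: "x \<in> DA \<Longrightarrow> ((\<lambda>t. (S t x - x) /\<^sub>R t) \<longlongrightarrow> A x) (at_right 0)"
  using gen unfolding generates_def by blast

lemma generatorI:
  assumes "((\<lambda>t. (S t x - x) /\<^sub>R t) \<longlongrightarrow> y) (at_right 0)"
  shows "x \<in> DA" "A x = y"
proof -
  show x: "x \<in> DA" using gen assms unfolding generates_def by blast
  show "A x = y" by (rule tendsto_unique[OF _ generator_lim[OF x] assms]) simp
qed

lemma generator_scale: "x \<in> DA \<Longrightarrow> c *\<^sub>R x \<in> DA \<and> A (c *\<^sub>R x) = c *\<^sub>R A x"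
  using generatorI[of "c *\<^sub>R x"] tendsto_scaleR[OF tendsto_const generator_lim[of x], of c]
  by (simp add: blinfun.bilinear_simps scaleR_diff_right mult.commute)

text \<open>\<open>S t\<close> commutes with the difference quotients of the semigroup and is
  continuous, so it carries their limit at \<open>x\<close> to their limit at
  \<open>S t x\<close>.\<close>

lemma generator_invariant:
  assumes x: "x \<in> DA" and t: "0 \<le> t"
  shows "S t x \<in> DA" "A (S t x) = S t (A x)"
proof -
  have "((\<lambda>h. S t ((S h x - x) /\<^sub>R h)) \<longlongrightarrow> S t (A x)) (at_right 0)"
    by (intro blinfun.tendsto tendsto_const generator_lim x)
  moreover have "eventually (\<lambda>h. S t ((S h x - x) /\<^sub>R h) = (S h (S t x) - S t x) /\<^sub>R h) (at_right 0)"
    unfolding eventually_at_filter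
  proof (intro always_eventually allI impI)
    fix h :: real assume "h \<in> {0<..}"
    then have "S t (S h x) = S h (S t x)"
      using C0_semigroup_add[OF generates_semigroup] t by (metis add.commute greaterThan_iff less_imp_le)
    then show "S t ((S h x - x) /\<^sub>R h) = (S h (S t x) - S t x) /\<^sub>R h"
      by (simp add: blinfun.bilinear_simps)
  qed
  ultimately have "((\<lambda>h. (S h (S t x) - S t x) /\<^sub>R h) \<longlongrightarrow> S t (A x)) (at_right 0)"
    using tendsto_cong by fast
  from generatorI[OF this] show "S t x \<in> DA" "A (S t x) = S t (A x)" .
qed

lemma generator_near_0:
  assumes x: "x \<in> DA" and e: "e > 0"
  shows "\<exists>\<delta>>0. \<forall>h. 0 \<le> h \<and> h < \<delta> \<longrightarrow> norm (S h x - x - h *\<^sub>R A x) \<le> e * h"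
proof -
  have "eventually (\<lambda>h. dist ((S h x - x) /\<^sub>R h) (A x) < e) (at_right 0)"
    by (rule tendstoD[OF generator_lim[OF x] e])
  then obtain \<delta> where d: "\<delta> > 0" "\<And>h. 0 < h \<Longrightarrow> h < \<delta> \<Longrightarrow> dist ((S h x - x) /\<^sub>R h) (A x) < e"
    unfolding eventually_at_right_field by blast
  have "norm (S h x - x - h *\<^sub>R A x) \<le> e * h" if "0 \<le> h \<and> h < \<delta>" for h
  proof (cases "h = 0")
    case True
    then show ?thesis by (simp add: C0_semigroup_0[OF generates_semigroup])
  next
    case False
    then have h: "h > 0" using that by simp
    have "S h x - x - h *\<^sub>R A x = h *\<^sub>R ((S h x - x) /\<^sub>R h - A x)"
      using h by (simp add: scaleR_diff_right)
    then have "norm (S h x - x - h *\<^sub>R A x) = h * norm ((S h x - x) /\<^sub>R h - A x)" using h by simp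
    also have "\<dots> \<le> h * e" using d(2)[OF h] that h by (intro mult_left_mono) (auto simp: dist_norm)
    finally show ?thesis by (simp add: mult.commute)
  qed
  then show ?thesis using d(1) by blast
qed

text \<open>The definition gives a right derivative at 0. To the right of \<open>t\<close> the
  factor \<open>S t\<close> is pulled out; to the left it is \<open>S s\<close>, which produces
  \<open>S s (A x)\<close> in place of \<open>S t (A x)\<close>, a difference controlled by strong
  continuity.\<close>

lemma generator_has_vector_derivative:
  assumes x: "x \<in> DA" and t: "t \<in> {0..T}"
  shows "((\<lambda>s. S s x) has_vector_derivative S t (A x)) (at t within {0..T})"
  unfolding has_vector_derivative_within_eps
proof (intro allI impI)
  fix e :: real assume e: "e > 0"
  obtain C where C: "C \<ge> 1" "\<And>t. t \<in> {0..T} \<Longrightarrow> norm (S t) \<le> C"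
    using C0_semigroup_bound[OF generates_semigroup] by blast
  obtain \<delta> where d: "\<delta> > 0" "\<And>h. 0 \<le> h \<and> h < \<delta> \<Longrightarrow> norm (S h x - x - h *\<^sub>R A x) \<le> e / (2 * C) * h"
    using generator_near_0[OF x, of "e / (2 * C)"] e C(1) by auto
  have Ce: "C * (e / (2 * C)) = e / 2" using C(1) by simp
  have *: "norm (S a (S h x - x - h *\<^sub>R A x)) \<le> e / 2 * h" if "a \<in> {0..T}" "0 \<le> h" "h < \<delta>" for a h
  proof -
    have "norm (S a (S h x - x - h *\<^sub>R A x)) \<le> C * (e / (2 * C) * h)"
      using C(2)[OF that(1)] d(2)[of h] that(2,3) C(1) by (intro order_trans[OF norm_blinfun] mult_mono) auto
    also have "\<dots> = e / 2 * h" using Ce by (simp only: mult.assoc[symmetric])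
    finally show ?thesis .
  qed
  have "((\<lambda>s. S s (A x)) \<longlongrightarrow> S t (A x)) (at t within {0..T})"
    using C0_semigroup_continuous[OF generates_semigroup, of T "A x"] t unfolding continuous_on_def by blast
  then have "\<forall>\<^sub>F s in at t within {0..T}. dist (S s (A x)) (S t (A x)) < e / 2"
    using e by (intro tendstoD) auto
  moreover have "\<forall>\<^sub>F s in at t within {0..T}. \<bar>s - t\<bar> < \<delta>"
    unfolding eventually_at using d(1) by (auto simp: dist_real_def)
  moreover have "\<forall>\<^sub>F s in at t within {0..T}. s \<in> {0..T}" by (simp add: eventually_at_filter)
  ultimately show "\<forall>\<^sub>F s in at t within {0..T}. norm (S s x - S t x - (s - t) *\<^sub>R S t (A x)) \<le> e * \<bar>s - t\<bar>"
  proof eventually_elim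
    case (elim s)
    show ?case
    proof (cases "t \<le> s")
      case True
      have "S s x - S t x - (s - t) *\<^sub>R S t (A x) = S t (S (s - t) x - x - (s - t) *\<^sub>R A x)"
        using C0_semigroup_add[OF generates_semigroup, of t "s - t" x] t True by (simp add: blinfun.bilinear_simps)
      then have "norm (S s x - S t x - (s - t) *\<^sub>R S t (A x)) \<le> e / 2 * (s - t)"
        using *[OF t, of "s - t"] True elim(2) by simp
      also have "\<dots> \<le> e * \<bar>s - t\<bar>" using e True by (intro mult_mono) auto
      finally show ?thesis .
    next
      case False
      have eq: "S s x - S t x - (s - t) *\<^sub>R S t (A x)
          = - S s (S (t - s) x - x - (t - s) *\<^sub>R A x) - (t - s) *\<^sub>R (S s (A x) - S t (A x))"
        using C0_semigroup_add[OF generates_semigroup, of s "t - s" x] elim(3) False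
        by (simp add: blinfun.bilinear_simps algebra_simps)
      have "norm (S s (S (t - s) x - x - (t - s) *\<^sub>R A x)) \<le> e / 2 * (t - s)"
        using *[OF elim(3), of "t - s"] False elim(2) by simp
      moreover have "norm ((t - s) *\<^sub>R (S s (A x) - S t (A x))) \<le> e / 2 * (t - s)"
        using elim(1) False by (simp add: dist_norm mult.commute mult_left_mono)
      ultimately show ?thesis
        unfolding eq using False norm_triangle_ineq4[of "- S s (S (t - s) x - x - (t - s) *\<^sub>R A x)" "(t - s) *\<^sub>R (S s (A x) - S t (A x))"]
        by (simp add: field_simps)
    qed
  qed
qed

text \<open>The integrals \<open>J h\<close> of an orbit over \<open>{0..h}\<close> lie in the
  domain: since \<open>S t (J h) = J (h + t) - J t\<close>, the difference quotient at
  \<open>J h\<close> is a difference of two quotients of the antiderivative, with limit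
  \<open>S h x - S 0 x\<close>. Divided by \<open>h\<close>, they tend to \<open>x\<close>.\<close>

lemma generator_dense: "closure DA = UNIV"
proof -
  have "x \<in> closure DA" for x
  proof -
    have cont: "continuous_on {a..b} (\<lambda>s. S s x)" if "0 \<le> a" for a b
      by (rule continuous_on_subset[OF C0_semigroup_continuous[OF generates_semigroup, of b]]) (use that in auto)
    define J where "J b = integral {0..b} (\<lambda>s. S s x)" for b
    have J': "(J has_vector_derivative S t x) (at t within {0..2})" if "t \<in> {0..2}" for t
      unfolding J_def using that by (intro integral_has_vector_derivative cont) auto
    have right: "((\<lambda>h. (J (t + h) - J t) /\<^sub>R h) \<longlongrightarrow> S t x) (at_right 0)" if t: "t \<in> {0..<2}" for t
    proof (rule tendstoI)
      fix e :: real assume e: "e > 0"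
      have "\<forall>\<^sub>F s in at t within {0..2}. norm (J s - J t - (s - t) *\<^sub>R S t x) \<le> e / 2 * \<bar>s - t\<bar>"
        using t e by (intro has_vector_derivative_epsD[OF J']) auto
      then obtain \<delta> where d: "\<delta> > 0" "\<And>s. s \<in> {0..2} \<Longrightarrow> s \<noteq> t \<Longrightarrow> \<bar>s - t\<bar> < \<delta> \<Longrightarrow>
          norm (J s - J t - (s - t) *\<^sub>R S t x) \<le> e / 2 * \<bar>s - t\<bar>"
        unfolding eventually_at dist_real_def by blast
      have "dist ((J (t + h) - J t) /\<^sub>R h) (S t x) < e" if h: "0 < h" "h < min \<delta> (2 - t)" for h
      proof -
        have "(J (t + h) - J t) /\<^sub>R h - S t x = (J (t + h) - J t - h *\<^sub>R S t x) /\<^sub>R h"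
          using h by (simp add: scaleR_diff_right)
        then have "dist ((J (t + h) - J t) /\<^sub>R h) (S t x) = norm (J (t + h) - J t - h *\<^sub>R S t x) / h"
          using h by (simp add: dist_norm divide_inverse mult.commute)
        also have "\<dots> \<le> e / 2" using d(2)[of "t + h"] h t by (simp add: divide_le_eq)
        finally show ?thesis using e by simp
      qed
      then show "\<forall>\<^sub>F h in at_right 0. dist ((J (t + h) - J t) /\<^sub>R h) (S t x) < e"
        unfolding eventually_at_right_field using d(1) t by (intro exI[of _ "min \<delta> (2 - t)"]) auto
    qed
    have JD: "J h \<in> DA" if h: "0 < h" "h < 1" for h
    proof (rule generatorI(1))
      have "eventually (\<lambda>t. ((J (h + t) - J h) /\<^sub>R t - (J (0 + t) - J 0) /\<^sub>R t) = (S t (J h) - J h) /\<^sub>R t) (at_right 0)"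
        using eventually_at_right_real[of 0 1]
      proof (rule eventually_mono)
        show "(0::real) < 1" by simp
        fix t :: real assume t: "t \<in> {0<..<1}"
        have int: "(\<lambda>s. S s x) integrable_on {a..b}" if "0 \<le> a" for a b
          by (intro integrable_continuous_real cont that)
        have "S t (J h) = integral {0..h} (\<lambda>s. S t (S s x))"
          unfolding J_def using integral_linear[OF int blinfun.bounded_linear_right[of "S t"], of 0 h]
          by (simp add: o_def)
        also have "\<dots> = integral {0..h} (\<lambda>s. S (s + t) x)"
          using t by (intro integral_cong) (auto simp: C0_semigroup_add[OF generates_semigroup, symmetric] add.commute)
        also have "\<dots> = integral {0 + t..h + t} (\<lambda>s. S s x)"
        proof -
          have "((\<lambda>s. S s x) has_integral integral {0 + t..h + t} (\<lambda>s. S s x)) (cbox t (h + t))"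
            using integrable_integral[OF int[of "0 + t" "h + t"]] t by simp
          from has_integral_affinity[OF this, of 1 t]
          have "((\<lambda>s. S (s + t) x) has_integral integral {0 + t..h + t} (\<lambda>s. S s x)) {0..h}"
            by (simp add: image_minus_const_atLeastAtMost')
          then show ?thesis by (rule integral_unique)
        qed
        also have "\<dots> = J (h + t) - J t"
          unfolding J_def
          using Henstock_Kurzweil_Integration.integral_combine[OF _ _ int, of 0 t "h + t"] t h
          by (simp add: algebra_simps)
        finally have Jeq: "S t (J h) = J (h + t) - J t" .
        have "J 0 = 0" by (simp add: J_def)
        then show "((J (h + t) - J h) /\<^sub>R t - (J (0 + t) - J 0) /\<^sub>R t) = (S t (J h) - J h) /\<^sub>R t"
          unfolding Jeq by (simp add: scaleR_diff_right)
      qed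
      moreover have "((\<lambda>t. (J (h + t) - J h) /\<^sub>R t - (J (0 + t) - J 0) /\<^sub>R t) \<longlongrightarrow> S h x - S 0 x) (at_right 0)"
        by (intro tendsto_diff right) (use h in auto)
      ultimately show "((\<lambda>t. (S t (J h) - J h) /\<^sub>R t) \<longlongrightarrow> S h x - S 0 x) (at_right 0)"
        using tendsto_cong by fast
    qed
    have "((\<lambda>h. (J (0 + h) - J 0) /\<^sub>R h) \<longlongrightarrow> S 0 x) (at_right 0)" by (rule right) simp
    then have lim: "((\<lambda>h. J h /\<^sub>R h) \<longlongrightarrow> x) (at_right 0)"
      by (simp add: J_def C0_semigroup_0[OF generates_semigroup])
    have "eventually (\<lambda>h. J h /\<^sub>R h \<in> closure DA) (at_right 0)"
      using eventually_at_right_real[of 0 1]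
    proof (rule eventually_mono)
      fix h :: real assume "h \<in> {0<..<1}"
      then have "J h /\<^sub>R h \<in> DA" using JD[of h] generator_scale by auto
      then show "J h /\<^sub>R h \<in> closure DA" using closure_subset by blast
    qed simp
    then show ?thesis by (rule Lim_in_closed_set[OF closed_closure _ _ lim]) simp
  qed
  then show ?thesis by blast
qed

abbreviation "resolv n \<equiv> inv_into DA (\<lambda>y. real n *\<^sub>R y - A y)"

lemma resolv:
  assumes "real n \<in> resolvent_set DA A"
  shows "resolv n y \<in> DA" "real n *\<^sub>R resolv n y - A (resolv n y) = y"
    "x \<in> DA \<Longrightarrow> resolv n (real n *\<^sub>R x - A x) = x"
    "bounded_linear (resolv n)"
proof -
  have b: "bij_betw (\<lambda>x. real n *\<^sub>R x - A x) DA UNIV" and l: "bounded_linear (resolv n)"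
    using assms unfolding resolvent_set_def by blast+
  show "bounded_linear (resolv n)" by (rule l)
  show "resolv n y \<in> DA" using b by (metis UNIV_I bij_betw_def inv_into_into)
  show "real n *\<^sub>R resolv n y - A (resolv n y) = y"
    using bij_betw_inv_into_right[OF b, of y] by simp
  show "x \<in> DA \<Longrightarrow> resolv n (real n *\<^sub>R x - A x) = x"
    using bij_betw_inv_into_left[OF b] by simp
qed

lemma resolv_generator:
  assumes n: "real n \<in> resolvent_set DA A" and x: "x \<in> DA"
  shows "resolv n (A x) = real n *\<^sub>R resolv n x - x"
proof -
  interpret bounded_linear "resolv n" by (rule resolv(4)[OF n])
  have "real n *\<^sub>R resolv n x - resolv n (A x) = x"
    using resolv(3)[OF n x] by (simp add: diff scale)
  then show ?thesis by (simp add: algebra_simps)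
qed

text \<open>\<open>A\<close> after the resolvent is \<open>n\<close> times the resolvent minus the
  identity; this makes the argument of \<open>Blinfun\<close> in \<open>yosida\<close> bounded, and
  on the domain it allows the resolvent to be moved in front of \<open>A\<close>.\<close>

lemma yosida_apply:
  assumes n: "real n \<in> resolvent_set DA A" and x: "x \<in> DA"
  shows "yosida DA A n x = real n *\<^sub>R resolv n (A x)"
proof -
  have AR: "A (real n *\<^sub>R resolv n y) = real n *\<^sub>R (real n *\<^sub>R resolv n y - y)" for y
  proof -
    have "A (resolv n y) = real n *\<^sub>R resolv n y - y"
      using resolv(2)[OF n, of y] by (simp add: algebra_simps)
    then show ?thesis using generator_scale[OF resolv(1)[OF n, of y], of "real n"] by simp
  qed
  have "bounded_linear (\<lambda>y. A (real n *\<^sub>R resolv n y))"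
    unfolding AR using resolv(4)[OF n]
    by (intro bounded_linear_const_scaleR bounded_linear_sub bounded_linear_ident)
  then show ?thesis
    unfolding yosida_def using AR resolv_generator[OF n x] by (simp add: bounded_linear_Blinfun_apply)
qed

text \<open>Integrating the derivative of \<open>e\<^sup>-\<^sup>n\<^sup>s S s z\<close> over the unit interval only; this avoids the
  improper integral representing the resolvent.\<close>

lemma resolv_bound:
  "\<exists>C\<ge>0. \<exists>N>0. \<forall>n\<ge>N. real n \<in> resolvent_set DA A \<longrightarrow> (\<forall>y. norm (real n *\<^sub>R resolv n y) \<le> C * norm y)"
proof -
  obtain C where C: "C \<ge> 1" "\<And>t. t \<in> {0..1} \<Longrightarrow> norm (S t) \<le> C"
    using C0_semigroup_bound[OF generates_semigroup, of 1] by blast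
  have "(\<lambda>n. exp (- 1) ^ n :: real) \<longlonglongrightarrow> 0" by (intro LIMSEQ_power_zero) simp
  then have "(\<lambda>n. exp (- real n)) \<longlonglongrightarrow> 0" by (simp add: exp_of_nat_mult[symmetric])
  then have "eventually (\<lambda>n. exp (- real n) < 1 / (2 * C)) sequentially"
    by (rule order_tendstoD) (use C(1) in simp)
  then obtain N0 where N0: "\<And>n. n \<ge> N0 \<Longrightarrow> exp (- real n) < 1 / (2 * C)" by (auto simp: eventually_sequentially)
  have "norm (real n *\<^sub>R resolv n y) \<le> (2 * C) * norm y"
    if n: "n \<ge> Suc N0" and res: "real n \<in> resolvent_set DA A" for n y
  proof -
    have n0: "real n > 0" using n by simp
    define z where "z = resolv n y"
    have z: "z \<in> DA" "real n *\<^sub>R z - A z = y" using resolv(1,2)[OF res] by (auto simp: z_def)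
    have der: "((\<lambda>s. exp (- real n * s) *\<^sub>R S s z) has_vector_derivative (- exp (- real n * s)) *\<^sub>R S s y) (at s within {0..1})"
      if "s \<in> {0..1}" for s
    proof -
      have "((\<lambda>s. exp (- real n * s) *\<^sub>R S s z) has_vector_derivative
          exp (- real n * s) *\<^sub>R S s (A z) + (- real n * exp (- real n * s)) *\<^sub>R S s z) (at s within {0..1})"
        by (rule has_vector_derivative_scaleR[OF _ generator_has_vector_derivative[OF z(1) that]])
          (auto intro!: derivative_eq_intros)
      also have "exp (- real n * s) *\<^sub>R S s (A z) + (- real n * exp (- real n * s)) *\<^sub>R S s z
          = (- exp (- real n * s)) *\<^sub>R S s y"
        by (simp add: z(2)[symmetric] blinfun.bilinear_simps algebra_simps)
      finally show ?thesis .
    qed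
    have int: "((\<lambda>s. (- exp (- real n * s)) *\<^sub>R S s y) has_integral
        (exp (- real n * 1) *\<^sub>R S 1 z - exp (- real n * 0) *\<^sub>R S 0 z)) {0..1}"
      by (rule fundamental_theorem_of_calculus[OF _ der]) auto
    have int2: "((\<lambda>s. exp (- real n * s) * (C * norm y)) has_integral
        ((- exp (- real n * 1) / n) * (C * norm y) - (- exp (- real n * 0) / n) * (C * norm y))) {0..1}"
      using n0 by (intro fundamental_theorem_of_calculus)
        (auto intro!: derivative_eq_intros simp flip: has_real_derivative_iff_has_vector_derivative)
    have "norm (exp (- real n * 1) *\<^sub>R S 1 z - exp (- real n * 0) *\<^sub>R S 0 z)
        \<le> (- exp (- real n * 1) / n) * (C * norm y) - (- exp (- real n * 0) / n) * (C * norm y)"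
      unfolding integral_unique[OF int, symmetric] integral_unique[OF int2, symmetric]
    proof (rule integral_norm_bound_integral)
      fix s :: real assume s: "s \<in> {0..1}"
      have "norm (S s y) \<le> C * norm y"
        by (intro order_trans[OF norm_blinfun] mult_right_mono C(2) s) auto
      then show "norm ((- exp (- real n * s)) *\<^sub>R S s y) \<le> exp (- real n * s) * (C * norm y)"
        by simp
    qed (use int int2 in blast)+
    also have "\<dots> \<le> C * norm y / n"
      using n0 C(1) by (simp add: field_simps)
    finally have "norm (z - exp (- real n) *\<^sub>R S 1 z) \<le> C * norm y / n"
      by (simp add: C0_semigroup_0[OF generates_semigroup] norm_minus_commute)
    \<comment> \<open>Stopping at time 1 leaves a boundary term; the choice of \<open>N0\<close>
      makes it at most half of \<open>norm z\<close>, so it is absorbed on the left at the price of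
      the factor 2 in \<open>2 * C\<close>.\<close>
    moreover have "norm (exp (- real n) *\<^sub>R S 1 z) \<le> norm z / 2"
    proof -
      have "norm (exp (- real n) *\<^sub>R S 1 z) \<le> 1 / (2 * C) * (C * norm z)"
        unfolding norm_scaleR using N0[of n] n C
        by (intro mult_mono order_trans[OF norm_blinfun] mult_right_mono C(2)) auto
      then show ?thesis using C(1) by simp
    qed
    ultimately have "norm z / 2 \<le> C * norm y / n"
      using norm_triangle_ineq2[of z "exp (- real n) *\<^sub>R S 1 z"] by linarith
    then have "norm z / 2 * real n \<le> C * norm y" using n0 by (simp only: pos_le_divide_eq)
    then show ?thesis using n0 unfolding z_def[symmetric] norm_scaleR by (simp add: algebra_simps)
  qed
  then have "\<forall>n\<ge>Suc N0. real n \<in> resolvent_set DA A \<longrightarrow> (\<forall>y. norm (real n *\<^sub>R resolv n y) \<le> (2 * C) * norm y)"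
    by blast
  moreover have "Suc N0 > 0" "0 \<le> 2 * C" using C(1) by auto
  ultimately show ?thesis by blast
qed

text \<open>On the domain the error is the resolvent applied to \<open>A x\<close>, of order
  \<open>1/n\<close> by the uniform bound; density of the domain and the same bound carry the
  convergence to all vectors.\<close>

lemma resolv_lim:
  assumes n0: "\<And>n. n \<ge> n0 \<Longrightarrow> real n \<in> resolvent_set DA A"
  shows "(\<lambda>n. real n *\<^sub>R resolv n y) \<longlonglongrightarrow> y"
proof -
  obtain C N where C: "C \<ge> 0" "N > 0" "\<And>n y. n \<ge> N \<Longrightarrow> real n \<in> resolvent_set DA A \<Longrightarrow> norm (real n *\<^sub>R resolv n y) \<le> C * norm y"
    using resolv_bound by metis
  have dense: "(\<lambda>n. real n *\<^sub>R resolv n x) \<longlonglongrightarrow> x" if x: "x \<in> DA" for x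
  proof -
    have "(\<lambda>n. real n *\<^sub>R resolv n x - x) \<longlonglongrightarrow> 0"
    proof (rule Lim_null_comparison)
      show "\<forall>\<^sub>F n in sequentially. norm (real n *\<^sub>R resolv n x - x) \<le> C * norm (A x) * inverse (real n)"
        unfolding eventually_sequentially
      proof (intro exI allI impI)
        fix n assume n: "n \<ge> max N n0"
        then have n: "n \<ge> N" "real n \<in> resolvent_set DA A" "real n > 0" using n0 C(2) by auto
        have "norm (real n *\<^sub>R resolv n (A x)) \<le> C * norm (A x)" by (rule C(3)[OF n(1,2)])
        then show "norm (real n *\<^sub>R resolv n x - x) \<le> C * norm (A x) * inverse (real n)"
          using n(3) unfolding resolv_generator[OF n(2) x] norm_scaleR by (simp add: field_simps del: scaleR_scaleR)
      qed
      show "(\<lambda>n. C * norm (A x) * inverse (real n)) \<longlonglongrightarrow> 0"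
        by (intro tendsto_mult_right_zero lim_inverse_n)
    qed
    then show ?thesis by (rule LIM_zero_cancel)
  qed
  show ?thesis
  proof (rule tendstoI)
    fix e :: real assume e: "e > 0"
    have "y \<in> closure DA" using generator_dense by blast
    moreover have "e / (2 * (C + 2)) > 0" using e C(1) by simp
    ultimately obtain x where x: "x \<in> DA" "dist x y < e / (2 * (C + 2))"
      unfolding closure_approachable by blast
    have "\<forall>\<^sub>F n in sequentially. dist (real n *\<^sub>R resolv n x) x < e / 2"
      by (rule tendstoD[OF dense[OF x(1)]]) (use e in simp)
    moreover have "\<forall>\<^sub>F n in sequentially. n \<ge> max N n0" by (rule eventually_ge_at_top)
    ultimately show "\<forall>\<^sub>F n in sequentially. dist (real n *\<^sub>R resolv n y) y < e"
    proof eventually_elim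
      case (elim n)
      then have n: "n \<ge> N" "real n \<in> resolvent_set DA A" using n0 by auto
      interpret bounded_linear "resolv n" by (rule resolv(4)[OF n(2)])
      have "norm (real n *\<^sub>R resolv n (y - x)) \<le> C * norm (y - x)" by (rule C(3)[OF n])
      note le = this
      have eq: "real n *\<^sub>R resolv n y - y = real n *\<^sub>R resolv n (y - x) + (real n *\<^sub>R resolv n x - x) + (x - y)"
        by (simp add: diff scaleR_diff_right)
      have "norm (real n *\<^sub>R resolv n y - y) \<le> C * norm (y - x) + norm (real n *\<^sub>R resolv n x - x) + norm (x - y)"
        unfolding eq
        using le norm_triangle_ineq[of "real n *\<^sub>R resolv n (y - x) + (real n *\<^sub>R resolv n x - x)" "x - y"]
          norm_triangle_ineq[of "real n *\<^sub>R resolv n (y - x)" "real n *\<^sub>R resolv n x - x"] by linarith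
      also have "\<dots> = (C + 1) * dist x y + dist (real n *\<^sub>R resolv n x) x"
        by (simp add: dist_norm norm_minus_commute algebra_simps)
      also have "\<dots> < e"
      proof -
        have "(C + 1) * dist x y \<le> (C + 2) * (e / (2 * (C + 2)))"
          using x(2) C(1) by (intro mult_mono) auto
        also have "(C + 2) * (e / (2 * (C + 2))) = (C + 2) * (e / 2 / (C + 2))" by simp
        also have "\<dots> = e / 2" using C(1) by (intro nonzero_mult_div_cancel_left[of "C + 2", unfolded times_divide_eq_right[symmetric]]) simp
        finally show ?thesis using elim(1) by linarith
      qed
      finally show ?case by (simp add: dist_norm)
    qed
  qed
qed

end

section \<open>Interval integrals and Volterra equations\<close>

abbreviation bint :: "real \<Rightarrow> real \<Rightarrow> (real \<Rightarrow> 'a::{banach, second_countable_topology}) \<Rightarrow> 'a" where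
  "bint a b f \<equiv> set_lebesgue_integral lborel {a..b} f"

lemma continuous_set_integrable:
  fixes f :: "real \<Rightarrow> 'a::{banach, second_countable_topology}"
  shows "continuous_on {a..b} f \<Longrightarrow> set_integrable lborel {a..b} f"
  by (rule borel_integrable_atLeastAtMost')

lemma set_integral_linear:
  fixes f :: "real \<Rightarrow> 'a::{banach, second_countable_topology}" and g :: "'a \<Rightarrow> 'b::{banach, second_countable_topology}"
  assumes g: "bounded_linear g" and f: "set_integrable lborel X f"
  shows "set_integrable lborel X (\<lambda>r. g (f r))" "g (set_lebesgue_integral lborel X f) = set_lebesgue_integral lborel X (\<lambda>r. g (f r))"
proof -
  interpret bounded_linear g by (rule g)
  have eq: "(\<lambda>r. indicator X r *\<^sub>R g (f r)) = (\<lambda>r. g (indicator X r *\<^sub>R f r))" by (simp add: scale)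
  show "set_integrable lborel X (\<lambda>r. g (f r))"
    using f unfolding set_integrable_def eq by (intro integrable_bounded_linear[OF g])
  show "g (set_lebesgue_integral lborel X f) = set_lebesgue_integral lborel X (\<lambda>r. g (f r))"
    using f unfolding set_integrable_def set_lebesgue_integral_def eq by (intro integral_bounded_linear[OF g, symmetric])
qed

lemmas set_integral_blinfun = set_integral_linear[OF blinfun.bounded_linear_right]
lemmas set_integral_inner = set_integral_linear[OF bounded_linear_inner_left]

lemma bint_split:
  fixes f :: "real \<Rightarrow> 'a::{banach, second_countable_topology}"
  assumes "a \<le> b" "b \<le> c" "set_integrable lborel {a..c} f"
  shows "bint a c f = bint a b f + bint b c f"
proof -
  have "bint a c f = set_lebesgue_integral lborel ({a..b} \<union> {b..c}) f"
    using assms(1,2) by (simp add: ivl_disj_un_two_touch)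
  also have "\<dots> = bint a b f + bint b c f"
  proof (rule set_integral_Un_AE)
    show "AE r in lborel. \<not> (r \<in> {a..b} \<and> r \<in> {b..c})"
      using AE_lborel_singleton[of b] by eventually_elim auto
  qed (use assms in \<open>auto intro: set_integrable_subset\<close>)
  finally show ?thesis .
qed

lemma bint_const: "a \<le> b \<Longrightarrow> bint a b (\<lambda>r. c::real) = (b - a) * c"
  by (simp add: set_lebesgue_integral_def)

lemma bint_norm_le:
  fixes f :: "real \<Rightarrow> 'a::{banach, second_countable_topology}"
  assumes "set_integrable lborel {a..b} f" "set_integrable lborel {a..b} h"
    "\<And>r. r \<in> {a..b} \<Longrightarrow> norm (f r) \<le> h r"
  shows "norm (bint a b f) \<le> bint a b h"
proof -
  have "norm (bint a b f) \<le> bint a b (\<lambda>r. norm (f r))"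
    by (rule set_integral_norm_bound[OF assms(1)])
  also have "\<dots> \<le> bint a b h"
    by (intro set_integral_mono set_integrable_norm assms)
  finally show ?thesis .
qed

lemma bint_norm_le_const:
  fixes f :: "real \<Rightarrow> 'a::{banach, second_countable_topology}"
  assumes "a \<le> b" "set_integrable lborel {a..b} f" "\<And>r. r \<in> {a..b} \<Longrightarrow> norm (f r) \<le> C"
  shows "norm (bint a b f) \<le> (b - a) * C"
  using bint_norm_le[OF assms(2) continuous_set_integrable[OF continuous_on_const] assms(3)] bint_const[OF assms(1)]
  by simp

lemma bint_cong: "(\<And>r. r \<in> {a..b} \<Longrightarrow> f r = h r) \<Longrightarrow> bint a b f = bint a b h"
  by (intro set_lebesgue_integral_cong) auto

lemma bint_exp_le:
  assumes "l > 0" "a \<le> t"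
  shows "bint a t (\<lambda>r. exp (l * r)) \<le> exp (l * t) / l"
proof -
  have "((\<lambda>r. exp (l * r)) has_integral exp (l * t) / l - exp (l * a) / l) {a..t}"
    using assms by (intro fundamental_theorem_of_calculus)
      (auto intro!: derivative_eq_intros simp flip: has_real_derivative_iff_has_vector_derivative)
  moreover have "bint a t (\<lambda>r. exp (l * r)) = integral {a..t} (\<lambda>r. exp (l * r))"
    by (intro set_borel_integral_eq_integral continuous_set_integrable continuous_intros)
  ultimately show ?thesis using assms(1) by (simp add: integral_unique)
qed

text \<open>Dominated convergence along sequences: the integrands with moving upper limit converge
  except possibly at \<open>r = t\<close>, a null set, and compactness of the triangle provides a
  constant majorant.\<close>

lemma continuous_on_triangle_bint:
  fixes f :: "real \<Rightarrow> real \<Rightarrow> 'a::{banach, second_countable_topology}"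
  assumes f: "continuous_on {(t, r). s \<le> r \<and> r \<le> t \<and> t \<le> T} (\<lambda>(t, r). f t r)"
  shows "continuous_on {s..T} (\<lambda>t. bint s t (f t))"
proof (rule continuous_on_sequentiallyI)
  let ?D = "{(t, r). s \<le> r \<and> r \<le> t \<and> t \<le> T}"
  fix u t assume u: "\<forall>n. u n \<in> {s..T}" "t \<in> {s..T}" "u \<longlonglongrightarrow> t"
  have "closed ?D" unfolding split_def
    by (intro closed_Collect_conj closed_Collect_le continuous_intros)
  moreover have "bounded ?D" by (rule bounded_subset[of "{s..T} \<times> {s..T}"]) (auto intro: bounded_Times)
  ultimately have "compact ?D" by (simp add: compact_eq_bounded_closed)
  then have "bounded ((\<lambda>(t, r). f t r) ` ?D)" by (intro compact_imp_bounded compact_continuous_image f)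
  then obtain M0 where M0: "\<And>p. p \<in> ?D \<Longrightarrow> norm ((\<lambda>(t, r). f t r) p) \<le> M0" unfolding bounded_iff by blast
  define M where "M = max 0 M0"
  have M: "s \<le> r \<Longrightarrow> r \<le> t \<Longrightarrow> t \<le> T \<Longrightarrow> norm (f t r) \<le> M" for t r using M0[of "(t, r)"] by (auto simp: M_def)
  have cont: "continuous_on {s..t} (f t)" if "t \<le> T" for t
  proof -
    have "continuous_on {s..t} ((\<lambda>(t, r). f t r) \<circ> (\<lambda>r. (t, r)))"
      by (intro continuous_on_compose continuous_intros continuous_on_subset[OF f]) (use that in auto)
    then show ?thesis by (simp add: o_def)
  qed
  have "(\<lambda>n. LINT r|lborel. indicator {s..u n} r *\<^sub>R f (u n) r) \<longlonglongrightarrow> (LINT r|lborel. indicator {s..t} r *\<^sub>R f t r)"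
  proof (rule integral_dominated_convergence)
    show "(\<lambda>r. indicator {s..t} r *\<^sub>R f t r) \<in> borel_measurable lborel"
      using continuous_set_integrable[OF cont[of t]] u(2) unfolding set_integrable_def by auto
    show "(\<lambda>r. indicator {s..u n} r *\<^sub>R f (u n) r) \<in> borel_measurable lborel" for n
      using continuous_set_integrable[OF cont[of "u n"]] u(1) unfolding set_integrable_def by auto
    show "integrable lborel (\<lambda>r. indicator {s..T} r *\<^sub>R M)"
      using continuous_set_integrable[of s T "\<lambda>_. M"] unfolding set_integrable_def by auto
    show "AE r in lborel. norm (indicator {s..u n} r *\<^sub>R f (u n) r) \<le> indicator {s..T} r *\<^sub>R M" for n
      using u(1)[rule_format, of n] M[of _ "u n"] by (auto simp: indicator_def M_def)
    show "AE r in lborel. (\<lambda>n. indicator {s..u n} r *\<^sub>R f (u n) r) \<longlonglongrightarrow> indicator {s..t} r *\<^sub>R f t r"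
      using AE_lborel_singleton[of t]
    proof eventually_elim
      fix r assume r: "r \<noteq> t"
      consider "r < s" | "t < r" | "s \<le> r" "r < t" using r by linarith
      then show "(\<lambda>n. indicator {s..u n} r *\<^sub>R f (u n) r) \<longlonglongrightarrow> indicator {s..t} r *\<^sub>R f t r"
      proof cases
        case 1
        then show ?thesis by simp
      next
        case 2
        have "eventually (\<lambda>n. u n < r) sequentially" by (rule order_tendstoD(2)[OF u(3) 2])
        then have "eventually (\<lambda>n. indicator {s..u n} r *\<^sub>R f (u n) r = 0) sequentially"
          by eventually_elim auto
        then show ?thesis using 2 by (simp add: tendsto_eventually)
      next
        case 3
        have ev: "eventually (\<lambda>n. r < u n) sequentially" by (rule order_tendstoD(1)[OF u(3) 3(2)])
        have "(t, r) \<in> ?D" using 3 u(2) by auto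
        moreover have "((\<lambda>n. (u n, r)) \<longlonglongrightarrow> (t, r))" by (intro tendsto_Pair u(3) tendsto_const)
        moreover have "eventually (\<lambda>n. (u n, r) \<in> ?D) sequentially"
          using ev by eventually_elim (use u(1) 3 in auto)
        ultimately have "(\<lambda>n. (\<lambda>(t, r). f t r) (u n, r)) \<longlonglongrightarrow> (\<lambda>(t, r). f t r) (t, r)"
          using continuous_on_tendsto_compose[OF f, of "\<lambda>n. (u n, r)" "(t, r)" sequentially] by blast
        then have "(\<lambda>n. f (u n) r) \<longlonglongrightarrow> f t r" by simp
        moreover have "eventually (\<lambda>n. indicator {s..u n} r *\<^sub>R f (u n) r = f (u n) r) sequentially"
          using ev by eventually_elim (use 3 in auto)
        ultimately show ?thesis using 3 by (simp add: tendsto_cong)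
      qed
    qed
  qed
  then show "(\<lambda>n. bint s (u n) (f (u n))) \<longlonglongrightarrow> bint s t (f t)" by (simp add: set_lebesgue_integral_def)
qed

lemma triangle_fubini:
  fixes f :: "real \<Rightarrow> real \<Rightarrow> real"
  assumes f: "continuous_on {(u, r). a \<le> u \<and> u \<le> r \<and> r \<le> b} (\<lambda>(u, r). f u r)"
  shows "bint a b (\<lambda>u. bint u b (f u)) = bint a b (\<lambda>r. bint a r (\<lambda>u. f u r))"
proof -
  let ?D = "{(u, r). a \<le> u \<and> u \<le> r \<and> r \<le> b}"
  have "closed ?D" unfolding split_def
    by (intro closed_Collect_conj closed_Collect_le continuous_intros)
  moreover have "bounded ?D" by (rule bounded_subset[of "{a..b} \<times> {a..b}"]) (auto intro: bounded_Times)
  ultimately have "compact ?D" by (simp add: compact_eq_bounded_closed)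
  then have "integrable (lborel :: (real \<times> real) measure) (\<lambda>p. indicator ?D p *\<^sub>R (\<lambda>(u, r). f u r) p)"
    by (rule borel_integrable_compact[OF _ f])
  then have int: "integrable (lborel \<Otimes>\<^sub>M lborel) (\<lambda>(u, r). indicator ?D (u, r) *\<^sub>R f u r)"
    by (simp add: lborel_prod split_def)
  have "(LINT u|lborel. LINT r|lborel. indicator ?D (u, r) *\<^sub>R f u r)
      = (LINT r|lborel. LINT u|lborel. indicator ?D (u, r) *\<^sub>R f u r)"
    by (rule lborel_pair.Fubini_integral[OF int, symmetric])
  also have "(LINT u|lborel. LINT r|lborel. indicator ?D (u, r) *\<^sub>R f u r) = bint a b (\<lambda>u. bint u b (f u))"
    unfolding set_lebesgue_integral_def
  proof (intro Bochner_Integration.integral_cong refl)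
    fix u
    show "(LINT r|lborel. indicator ?D (u, r) *\<^sub>R f u r) = indicator {a..b} u *\<^sub>R (LINT r|lborel. indicator {u..b} r *\<^sub>R f u r)"
    proof (cases "u \<in> {a..b}")
      case True
      then have "indicator ?D (u, r) *\<^sub>R f u r = indicator {u..b} r *\<^sub>R f u r" for r by (auto simp: indicator_def)
      then show ?thesis using True by (simp only: indicator_simps scaleR_one)
    next
      case False
      then have "indicator ?D (u, r) *\<^sub>R f u r = 0" for r by (auto simp: indicator_def)
      then show ?thesis using False
        by (simp only: indicator_simps not_False_eq_True scaleR_zero_left Bochner_Integration.integral_zero)
    qed
  qed
  also have "(LINT r|lborel. LINT u|lborel. indicator ?D (u, r) *\<^sub>R f u r) = bint a b (\<lambda>r. bint a r (\<lambda>u. f u r))"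
    unfolding set_lebesgue_integral_def
  proof (intro Bochner_Integration.integral_cong refl)
    fix r
    show "(LINT u|lborel. indicator ?D (u, r) *\<^sub>R f u r) = indicator {a..b} r *\<^sub>R (LINT u|lborel. indicator {a..r} u *\<^sub>R f u r)"
    proof (cases "r \<in> {a..b}")
      case True
      then have "indicator ?D (u, r) *\<^sub>R f u r = indicator {a..r} u *\<^sub>R f u r" for u by (auto simp: indicator_def)
      then show ?thesis using True by (simp only: indicator_simps scaleR_one)
    next
      case False
      then have "indicator ?D (u, r) *\<^sub>R f u r = 0" for u by (auto simp: indicator_def)
      then show ?thesis using False
        by (simp only: indicator_simps not_False_eq_True scaleR_zero_left Bochner_Integration.integral_zero)
    qed
  qed
  finally show ?thesis .
qed

text \<open>A weight \<open>exp (- l * t)\<close> replaces iteration: at the maximum of the weighted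
  norm the integral term contributes at most \<open>C / l \<le> 1/2\<close> of that maximum and is
  absorbed, which produces the factor 2.\<close>

lemma gronwall_bound:
  fixes z :: "real \<Rightarrow> 'a::{banach, second_countable_topology}"
  assumes z: "continuous_on {s..T} z" and a: "0 \<le> a" and C: "0 \<le> C"
    and le: "\<And>t. t \<in> {s..T} \<Longrightarrow> norm (z t) \<le> a + C * bint s t (\<lambda>r. norm (z r))"
    and t: "t \<in> {s..T}"
  shows "norm (z t) \<le> 2 * a * exp ((2 * C + 1) * (T - s))"
proof -
  \<comment> \<open>\<open>2 * C + 1\<close> instead of \<open>2 * C\<close> keeps \<open>l\<close>
    positive when \<open>C = 0\<close>.\<close>
  define l where "l = 2 * C + 1"
  have l: "l > 0" "C / l \<le> 1/2" using C by (auto simp: l_def field_simps)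
  define f where "f t = exp (- l * t) * norm (z t)" for t
  have "continuous_on {s..T} f" unfolding f_def by (intro continuous_intros z)
  then obtain m where m: "m \<in> {s..T}" "\<And>t. t \<in> {s..T} \<Longrightarrow> f t \<le> f m"
    using continuous_attains_sup[of "{s..T}" f] t by (metis compact_Icc empty_iff)
  have zf: "norm (z r) = exp (l * r) * f r" for r by (simp add: f_def exp_minus field_simps)
  have f0: "0 \<le> f m" by (simp add: f_def)
  have c: "continuous_on {s..m} z" by (rule continuous_on_subset[OF z]) (use m in auto)
  have "bint s m (\<lambda>r. norm (z r)) \<le> bint s m (\<lambda>r. f m * exp (l * r))"
  proof (rule set_integral_mono)
    show "set_integrable lborel {s..m} (\<lambda>r. norm (z r))" by (intro continuous_set_integrable continuous_intros c)
    show "set_integrable lborel {s..m} (\<lambda>r. f m * exp (l * r))" by (intro continuous_set_integrable continuous_intros)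
    fix r assume "r \<in> {s..m}"
    then have "f r \<le> f m" using m by auto
    then show "norm (z r) \<le> f m * exp (l * r)" unfolding zf by (simp add: mult.commute)
  qed
  also have "\<dots> = f m * bint s m (\<lambda>r. exp (l * r))" by simp
  also have "\<dots> \<le> f m * (exp (l * m) / l)"
    using m(1) by (intro mult_left_mono bint_exp_le f0 l) auto
  finally have "norm (z m) \<le> a + C * (f m * (exp (l * m) / l))"
    using le[OF m(1)] mult_left_mono[OF _ C] by fastforce
  then have "exp (- l * m) * norm (z m) \<le> exp (- l * m) * (a + C * (f m * (exp (l * m) / l)))"
    by (intro mult_left_mono) auto
  also have "\<dots> = exp (- l * m) * a + (C / l) * f m"
    by (simp add: algebra_simps exp_minus)
  also have "\<dots> \<le> exp (- l * s) * a + (1/2) * f m"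
    using a l m(1) f0 by (intro add_mono mult_right_mono) auto
  finally have fm: "f m \<le> 2 * exp (- l * s) * a" by (simp add: f_def)
  have "norm (z t) \<le> exp (l * t) * (2 * exp (- l * s) * a)"
    unfolding zf using m(2)[OF t] fm by (intro mult_left_mono) auto
  also have "\<dots> = 2 * a * exp (l * (t - s))" by (simp add: exp_minus exp_diff field_simps)
  also have "\<dots> \<le> 2 * a * exp (l * (T - s))" using a l t by (intro mult_left_mono) auto
  finally show ?thesis by (simp add: l_def)
qed

text \<open>Contraction in a weighted sup norm. The fixed point is sought for
  \<open>w t = exp (- l * t) *\<^sub>R z t\<close>, for which the Volterra operator has Lipschitz
  constant at most 1/2 on the whole interval, without subdivision.\<close>

lemma volterra_solution:
  fixes k :: "real \<Rightarrow> real \<Rightarrow> 'a::{banach, second_countable_topology} \<Rightarrow>\<^sub>L 'a"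
  assumes sT: "s \<le> T" and C: "\<And>t r. s \<le> r \<Longrightarrow> r \<le> t \<Longrightarrow> t \<le> T \<Longrightarrow> norm (k t r) \<le> C"
    and k: "\<And>v. continuous_on {(t, r). s \<le> r \<and> r \<le> t \<and> t \<le> T} (\<lambda>(t, r). k t r v)"
    and g: "continuous_on {s..T} g"
  shows "\<exists>z. continuous_on {s..T} z \<and> (\<forall>t\<in>{s..T}. z t = g t + bint s t (\<lambda>r. k t r (z r)))"
proof -
  let ?D = "{(t, r). s \<le> r \<and> r \<le> t \<and> t \<le> T}"
  have C0: "0 \<le> C" using C[of s s] sT norm_ge_zero order_trans by blast
  define l where "l = 2 * C + 1"
  have l: "l > 0" "C / l \<le> 1/2" using C0 by (auto simp: l_def field_simps)
  \<comment> \<open>Clamping time to \<open>{s..T}\<close> extends the iterates to bounded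
    continuous functions on the whole line, so that the complete space of such functions can be
    used.\<close>
  define c where "c t = max s (min T t)" for t
  have c: "continuous_on UNIV c" "\<And>t. c t \<in> {s..T}" "\<And>t. t \<in> {s..T} \<Longrightarrow> c t = t"
    using sT unfolding c_def by (auto intro!: continuous_intros)
  have kz: "continuous_on ?D (\<lambda>p. k (fst p) (snd p) (z (snd p)))" if "continuous_on {s..T} z" for z
  proof (rule continuous_on_blinfun_apply_strong)
    show "continuous_on ?D (\<lambda>p. k (fst p) (snd p) v)" for v using k[of v] by (simp add: split_def)
    show "p \<in> ?D \<Longrightarrow> norm (k (fst p) (snd p)) \<le> C" for p using C by auto
    show "continuous_on ?D (\<lambda>p. z (snd p))"
      by (rule continuous_on_compose2[OF that continuous_on_snd[OF continuous_on_id]]) auto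
  qed
  define h where "h w t = exp (- l * t) *\<^sub>R g t + bint s t (\<lambda>r. exp (- l * (t - r)) *\<^sub>R k t r (w r))" for w t
  have ik: "continuous_on ?D (\<lambda>(t, r). exp (- l * (t - r)) *\<^sub>R k t r (z r))" if "continuous_on {s..T} z" for z
    using kz[OF that] unfolding split_def
    by (intro continuous_on_scaleR[OF _ ]) (auto intro!: continuous_intros)
  have hc: "continuous_on {s..T} (h w)" if "continuous_on {s..T} w" for w
    unfolding h_def by (intro continuous_intros g continuous_on_triangle_bint ik that)
  have hcB: "(\<lambda>t. h w (c t)) \<in> bcontfun" if "continuous_on {s..T} w" for w
  proof -
    have "bounded (h w ` {s..T})" by (intro compact_imp_bounded compact_continuous_image hc that) auto
    then have "bounded (range (\<lambda>t. h w (c t)))" by (rule bounded_subset) (use c(2) in auto)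
    moreover have "continuous_on UNIV (\<lambda>t. h w (c t))"
      by (rule continuous_on_compose2[OF hc[OF that] c(1)]) (use c(2) in auto)
    ultimately show ?thesis by (simp add: bcontfun_def)
  qed
  define \<Phi> where "\<Phi> w = Bcontfun (\<lambda>t. h (apply_bcontfun w) (c t))" for w
  have wc: "continuous_on X (apply_bcontfun w)" for w :: "real \<Rightarrow>\<^sub>C 'a" and X
    by (rule continuous_on_subset[OF continuous_on_apply_bcontfun subset_UNIV])
  have \<Phi>: "apply_bcontfun (\<Phi> w) t = h (apply_bcontfun w) (c t)" for w t
    unfolding \<Phi>_def by (subst Bcontfun_inverse[OF hcB[OF wc]]) simp
  have "dist (\<Phi> v) (\<Phi> w) \<le> 1/2 * dist v w" for v w
  proof (rule dist_bound)
    fix t0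
    define t where "t = c t0"
    have t: "t \<in> {s..T}" unfolding t_def by (rule c(2))
    have ci: "continuous_on {s..t} (\<lambda>r. exp (- l * (t - r)) *\<^sub>R k t r (z r))" if "continuous_on {s..T} z" for z
    proof -
      have "continuous_on {s..t} ((\<lambda>(t, r). exp (- l * (t - r)) *\<^sub>R k t r (z r)) \<circ> (\<lambda>r. (t, r)))"
        by (intro continuous_on_compose continuous_intros continuous_on_subset[OF ik[OF that]]) (use t in auto)
      then show ?thesis by (simp add: o_def)
    qed
    have "dist (apply_bcontfun (\<Phi> v) t0) (apply_bcontfun (\<Phi> w) t0) =
      norm (bint s t (\<lambda>r. exp (- l * (t - r)) *\<^sub>R k t r (v r)) - bint s t (\<lambda>r. exp (- l * (t - r)) *\<^sub>R k t r (w r)))"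
      by (simp add: \<Phi> h_def dist_norm t_def)
    also have "\<dots> = norm (bint s t (\<lambda>r. exp (- l * (t - r)) *\<^sub>R k t r (v r) - exp (- l * (t - r)) *\<^sub>R k t r (w r)))"
      by (subst set_integral_diff(2)[OF continuous_set_integrable[OF ci[OF wc]] continuous_set_integrable[OF ci[OF wc]]]) (rule refl)
    also have "\<dots> \<le> bint s t (\<lambda>r. (C * dist v w * exp (- l * t)) * exp (l * r))"
    proof (rule bint_norm_le)
      show "set_integrable lborel {s..t} (\<lambda>r. exp (- l * (t - r)) *\<^sub>R k t r (v r) - exp (- l * (t - r)) *\<^sub>R k t r (w r))"
        by (intro set_integral_diff(1) continuous_set_integrable ci wc)
      show "set_integrable lborel {s..t} (\<lambda>r. (C * dist v w * exp (- l * t)) * exp (l * r))"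
        by (intro continuous_set_integrable continuous_intros)
      fix r assume r: "r \<in> {s..t}"
      have "norm (k t r (v r - w r)) \<le> C * dist v w"
        using C[of r t] r t dist_bounded[of v r w]
        by (intro order_trans[OF norm_blinfun] mult_mono) (auto simp: dist_norm C0)
      then have le: "exp (- l * t) * exp (l * r) * norm (k t r (v r - w r)) \<le> exp (- l * t) * exp (l * r) * (C * dist v w)"
        by (intro mult_left_mono) auto
      have ec: "exp (- l * (t - r)) = exp (- l * t) * exp (l * r)"
        by (simp add: algebra_simps flip: exp_add)
      have "exp (- l * (t - r)) *\<^sub>R k t r (v r) - exp (- l * (t - r)) *\<^sub>R k t r (w r)
          = exp (- l * (t - r)) *\<^sub>R k t r (v r - w r)"
        by (simp add: blinfun.bilinear_simps scaleR_diff_right)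
      then show "norm (exp (- l * (t - r)) *\<^sub>R k t r (v r) - exp (- l * (t - r)) *\<^sub>R k t r (w r))
          \<le> (C * dist v w * exp (- l * t)) * exp (l * r)"
        using le by (simp only: norm_scaleR abs_mult abs_exp_cancel ec mult_ac)
    qed
    also have "\<dots> = (C * dist v w * exp (- l * t)) * bint s t (\<lambda>r. exp (l * r))" by simp
    also have "\<dots> \<le> (C * dist v w * exp (- l * t)) * (exp (l * t) / l)"
      using t C0 by (intro mult_left_mono bint_exp_le l) auto
    also have "\<dots> = (C / l) * dist v w" by (simp add: exp_minus)
    also have "\<dots> \<le> 1/2 * dist v w" by (intro mult_right_mono l) auto
    finally show "dist (apply_bcontfun (\<Phi> v) t0) (apply_bcontfun (\<Phi> w) t0) \<le> 1/2 * dist v w" .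
  qed
  then obtain w where w: "\<Phi> w = w" using banach_fix_type[of "1/2" \<Phi>] by auto
  define z where "z t = exp (l * t) *\<^sub>R apply_bcontfun w t" for t
  have "continuous_on {s..T} z" unfolding z_def by (intro continuous_intros wc)
  moreover have "z t = g t + bint s t (\<lambda>r. k t r (z r))" if t: "t \<in> {s..T}" for t
  proof -
    have "apply_bcontfun w t = h (apply_bcontfun w) t" using \<Phi>[of w t] c(3)[OF t] w by simp
    then have "z t = exp (l * t) *\<^sub>R h (apply_bcontfun w) t" by (simp add: z_def)
    also have "\<dots> = g t + bint s t (\<lambda>r. exp (l * t) *\<^sub>R exp (- l * (t - r)) *\<^sub>R k t r (w r))"
      unfolding h_def scaleR_add_right set_integral_scaleR_right by (simp add: exp_minus)
    also have "(\<lambda>r. exp (l * t) *\<^sub>R exp (- l * (t - r)) *\<^sub>R k t r (w r)) = (\<lambda>r. k t r (z r))"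
      by (simp add: z_def blinfun.bilinear_simps algebra_simps flip: exp_add)
    finally show ?thesis .
  qed
  ultimately show ?thesis by blast
qed

section \<open>Evolution operators\<close>

lemma Cs_shift:
  assumes S: "S \<in> Cs T" and X: "continuous_on D p" "\<And>x. x \<in> D \<Longrightarrow> p x \<in> {0..T}"
    and z: "continuous_on D z"
  shows "continuous_on D (\<lambda>x. S (p x) (z x))"
proof -
  obtain C where C: "\<And>t. t \<in> {0..T} \<Longrightarrow> norm (S t) \<le> C" using Cs_bound[OF S] by blast
  show ?thesis
  proof (rule continuous_on_blinfun_apply_strong[OF _ _ z])
    show "continuous_on D (\<lambda>x. S (p x) v)" for v
      by (rule continuous_on_compose2[OF _ X(1)]) (use S X(2) in \<open>auto simp: Cs_def\<close>)
    show "x \<in> D \<Longrightarrow> norm (S (p x)) \<le> C" for x using C X(2) by blast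
  qed
qed

lemma bint_refl:
  fixes f :: "real \<Rightarrow> 'a::{banach, second_countable_topology}"
  shows "bint a a f = 0"
  unfolding set_lebesgue_integral_def
proof (rule integral_eq_zero_AE)
  show "AE r in lborel. indicator {a..a} r *\<^sub>R f r = 0"
    using AE_lborel_singleton[of a] by eventually_elim simp
qed

context
  fixes T :: real and S :: "real \<Rightarrow> 'h::separable_hilbert \<Rightarrow>\<^sub>L 'h" and K :: "real \<Rightarrow> 'h \<Rightarrow>\<^sub>L 'h"
  assumes T: "0 \<le> T" and S: "C0_semigroup S" and K: "K \<in> Cs T"
begin

lemma S_Cs: "S \<in> Cs T" by (rule C0_semigroup_Cs[OF S])

definition mild :: "real \<Rightarrow> (real \<Rightarrow> 'h) \<Rightarrow> 'h \<Rightarrow> (real \<Rightarrow> 'h) \<Rightarrow> bool" where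
  "mild s f v z \<longleftrightarrow> continuous_on {s..T} z \<and>
    (\<forall>t\<in>{s..T}. z t = S (t - s) v + bint s t (\<lambda>r. S (t - r) (K r (z r) + f r)))"

lemma forcing_continuous:
  assumes "0 \<le> s" "continuous_on {s..T} z" "continuous_on {s..T} f" "t \<le> T"
  shows "continuous_on {s..t} (\<lambda>r. S (t - r) (K r (z r) + f r))"
    and "continuous_on {s..T} (\<lambda>r. K r (z r) + f r)"
proof -
  show g: "continuous_on {s..T} (\<lambda>r. K r (z r) + f r)"
    by (intro continuous_intros Cs_apply[OF K] assms) (use assms in auto)
  show "continuous_on {s..t} (\<lambda>r. S (t - r) (K r (z r) + f r))"
    by (rule Cs_shift[OF S_Cs _ _ continuous_on_subset[OF g]]) (use assms in \<open>auto intro!: continuous_intros\<close>)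
qed

text \<open>A Volterra equation with kernel \<open>S (t - r) o\<^sub>L K r\<close>; initial value
  and forcing are collected in the free term \<open>g\<close>.\<close>

lemma mild_exists:
  assumes s: "0 \<le> s" "s \<le> T" and f: "continuous_on {s..T} f"
  shows "\<exists>z. mild s f v z"
proof -
  let ?D = "{(t, r). s \<le> r \<and> r \<le> t \<and> t \<le> T}"
  obtain C where C: "C \<ge> 1" "\<And>t. t \<in> {0..T} \<Longrightarrow> norm (S t) \<le> C" using C0_semigroup_bound[OF S] by blast
  obtain CK where CK: "CK \<ge> 0" "\<And>t. t \<in> {0..T} \<Longrightarrow> norm (K t) \<le> CK" using Cs_bound[OF K] by blast
  have Sz: "continuous_on ?D (\<lambda>p. S (fst p - snd p) (z (snd p)))" if "continuous_on {s..T} z" for z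
    by (rule Cs_shift[OF S_Cs]) (use s in \<open>auto intro!: continuous_intros continuous_on_compose2[OF that]\<close>)
  define g where "g t = S (t - s) v + bint s t (\<lambda>r. S (t - r) (f r))" for t
  have "continuous_on {s..T} (\<lambda>t. S (t - s) v)"
    by (rule Cs_shift[OF S_Cs]) (use s in \<open>auto intro!: continuous_intros\<close>)
  moreover have "continuous_on {s..T} (\<lambda>t. bint s t (\<lambda>r. S (t - r) (f r)))"
    by (rule continuous_on_triangle_bint) (use Sz[OF f] in \<open>simp add: split_def\<close>)
  ultimately have g: "continuous_on {s..T} g" unfolding g_def by (rule continuous_on_add)
  have "\<exists>z. continuous_on {s..T} z \<and> (\<forall>t\<in>{s..T}. z t = g t + bint s t (\<lambda>r. (S (t - r) o\<^sub>L K r) (z r)))"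
  proof (rule volterra_solution[OF s(2) _ _ g])
    fix t r assume tr: "s \<le> r" "r \<le> t" "t \<le> T"
    show "norm (S (t - r) o\<^sub>L K r) \<le> C * CK"
      by (rule order_trans[OF norm_blinfun_compose])
        (use tr s C(1) CK in \<open>auto intro!: mult_mono C(2) CK(2)\<close>)
  next
    fix w
    have "continuous_on {s..T} (\<lambda>r. K r w)" using K s(1) by (auto simp: Cs_def intro: continuous_on_subset)
    from Sz[OF this] show "continuous_on ?D (\<lambda>(t, r). (S (t - r) o\<^sub>L K r) w)" by (simp add: split_def)
  qed
  then obtain z where z: "continuous_on {s..T} z"
    "\<And>t. t \<in> {s..T} \<Longrightarrow> z t = g t + bint s t (\<lambda>r. S (t - r) (K r (z r)))" by auto
  have "z t = S (t - s) v + bint s t (\<lambda>r. S (t - r) (K r (z r) + f r))" if t: "t \<in> {s..T}" for t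
  proof -
    have c0: "continuous_on {s..T} (\<lambda>r. 0::'h)" by (rule continuous_on_const)
    have 1: "continuous_on {s..t} (\<lambda>r. S (t - r) (K r (z r)))"
      using forcing_continuous(1)[OF s(1) z(1) c0, of t] t by simp
    have 2: "continuous_on {s..t} (\<lambda>r. S (t - r) (f r))"
      by (rule Cs_shift[OF S_Cs _ _ continuous_on_subset[OF f]]) (use s t in \<open>auto intro!: continuous_intros\<close>)
    have "bint s t (\<lambda>r. S (t - r) (K r (z r) + f r)) = bint s t (\<lambda>r. S (t - r) (K r (z r))) + bint s t (\<lambda>r. S (t - r) (f r))"
      by (subst set_integral_add(2)[symmetric]) (auto intro!: continuous_set_integrable 1 2 simp: blinfun.bilinear_simps)
    then show ?thesis unfolding z(2)[OF t] g_def by simp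
  qed
  then show ?thesis using z(1) unfolding mild_def by blast
qed

text \<open>Gronwall with the horizon \<open>T\<close> in place of \<open>T - s\<close>: the
  constant does not depend on the starting time, which later bounds the whole evolution family at
  once.\<close>

lemma mild_bound:
  "\<exists>C\<ge>0. \<forall>s v z t. 0 \<le> s \<longrightarrow> mild s (\<lambda>_. 0) v z \<longrightarrow> t \<in> {s..T} \<longrightarrow> norm (z t) \<le> C * norm v"
proof -
  obtain C where C: "C \<ge> 1" "\<And>t. t \<in> {0..T} \<Longrightarrow> norm (S t) \<le> C" using C0_semigroup_bound[OF S] by blast
  obtain CK where CK: "CK \<ge> 0" "\<And>t. t \<in> {0..T} \<Longrightarrow> norm (K t) \<le> CK" using Cs_bound[OF K] by blast
  have "norm (z t) \<le> (2 * C * exp ((2 * (C * CK) + 1) * T)) * norm v"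
    if s: "0 \<le> s" and m: "mild s (\<lambda>_. 0) v z" and t: "t \<in> {s..T}" for s v z t
  proof -
    have z: "continuous_on {s..T} z" "\<And>t. t \<in> {s..T} \<Longrightarrow> z t = S (t - s) v + bint s t (\<lambda>r. S (t - r) (K r (z r)))"
      using m unfolding mild_def by auto
    have "norm (z t) \<le> 2 * (C * norm v) * exp ((2 * (C * CK) + 1) * (T - s))"
    proof (rule gronwall_bound[OF z(1) _ _ _ t])
      fix t assume t: "t \<in> {s..T}"
      have "norm (bint s t (\<lambda>r. S (t - r) (K r (z r)))) \<le> bint s t (\<lambda>r. (C * CK) * norm (z r))"
      proof (rule bint_norm_le)
        show "set_integrable lborel {s..t} (\<lambda>r. S (t - r) (K r (z r)))"
          using forcing_continuous(1)[OF s z(1) continuous_on_const[of _ 0], of t] t by (simp add: continuous_set_integrable)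
        show "set_integrable lborel {s..t} (\<lambda>r. (C * CK) * norm (z r))"
          by (intro continuous_set_integrable continuous_intros continuous_on_subset[OF z(1)]) (use t in auto)
        fix r assume r: "r \<in> {s..t}"
        have "norm (S (t - r) (K r (z r))) \<le> C * (CK * norm (z r))"
          by (intro order_trans[OF norm_blinfun] mult_mono C(2) CK(2)) (use r s t C(1) CK(1) in auto)
        then show "norm (S (t - r) (K r (z r))) \<le> (C * CK) * norm (z r)" by simp
      qed
      moreover have "norm (S (t - s) v) \<le> C * norm v"
        by (intro order_trans[OF norm_blinfun] mult_right_mono C(2)) (use s t in auto)
      ultimately show "norm (z t) \<le> C * norm v + (C * CK) * bint s t (\<lambda>r. norm (z r))"
        unfolding z(2)[OF t] by (intro order_trans[OF norm_triangle_ineq]) simp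
    qed (use C(1) CK(1) in auto)
    also have "\<dots> \<le> 2 * (C * norm v) * exp ((2 * (C * CK) + 1) * T)"
      using s C(1) CK(1) by (intro mult_left_mono) (auto intro!: mult_left_mono)
    finally show ?thesis by (simp add: mult_ac)
  qed
  moreover have "0 \<le> 2 * C * exp ((2 * (C * CK) + 1) * T)" using C(1) by simp
  ultimately show ?thesis by blast
qed

lemma mild_add_scale:
  assumes s: "0 \<le> s" and z: "mild s (\<lambda>_. 0) v z" and w: "mild s (\<lambda>_. 0) u w"
  shows "mild s (\<lambda>_. 0) (v + c *\<^sub>R u) (\<lambda>t. z t + c *\<^sub>R w t)"
proof -
  have zc: "continuous_on {s..T} z" and wc: "continuous_on {s..T} w"
    using z w unfolding mild_def by auto
  have "z t + c *\<^sub>R w t = S (t - s) (v + c *\<^sub>R u) + bint s t (\<lambda>r. S (t - r) (K r (z r + c *\<^sub>R w r) + 0))"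
    if t: "t \<in> {s..T}" for t
  proof -
    have "bint s t (\<lambda>r. S (t - r) (K r (z r + c *\<^sub>R w r) + 0))
        = bint s t (\<lambda>r. S (t - r) (K r (z r) + 0) + c *\<^sub>R S (t - r) (K r (w r) + 0))"
      by (simp add: blinfun.bilinear_simps)
    also have "\<dots> = bint s t (\<lambda>r. S (t - r) (K r (z r) + 0)) + c *\<^sub>R bint s t (\<lambda>r. S (t - r) (K r (w r) + 0))"
      using forcing_continuous(1)[OF s zc continuous_on_const[of _ 0], of t]
        forcing_continuous(1)[OF s wc continuous_on_const[of _ 0], of t] t
      by (subst set_integral_add(2)) (auto intro!: continuous_set_integrable continuous_intros)
    finally show ?thesis using z w t unfolding mild_def by (simp add: blinfun.bilinear_simps scaleR_add_right)
  qed
  moreover have "continuous_on {s..T} (\<lambda>t. z t + c *\<^sub>R w t)" by (intro continuous_intros zc wc)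
  ultimately show ?thesis unfolding mild_def by blast
qed

lemma mild_unique:
  assumes s: "0 \<le> s" and z: "mild s (\<lambda>_. 0) v z" and w: "mild s (\<lambda>_. 0) v w" and t: "t \<in> {s..T}"
  shows "z t = w t"
proof -
  have "mild s (\<lambda>_. 0) (v + (- 1) *\<^sub>R v) (\<lambda>t. z t + (- 1) *\<^sub>R w t)" by (rule mild_add_scale[OF s z w])
  then have "mild s (\<lambda>_. 0) 0 (\<lambda>t. z t + (- 1) *\<^sub>R w t)" by simp
  moreover obtain C where "\<And>s v z t. 0 \<le> s \<Longrightarrow> mild s (\<lambda>_. 0) v z \<Longrightarrow> t \<in> {s..T} \<Longrightarrow> norm (z t) \<le> C * norm v"
    using mild_bound by blast
  ultimately have "norm (z t + (- 1) *\<^sub>R w t) \<le> C * norm (0::'h)" using s t by blast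
  then show ?thesis by simp
qed

text \<open>The semigroup law moves \<open>S (t - s')\<close> under the integral up to
  \<open>s'\<close>. This gives the flow property of \<open>evol\<close> and lets backward
  identities begin at an arbitrary time.\<close>

lemma mild_restart:
  assumes s: "0 \<le> s" "s \<le> s'" "s' \<le> T" and f: "continuous_on {s..T} f" and z: "mild s f v z"
  shows "mild s' f (z s') z"
proof -
  have zc: "continuous_on {s..T} z" and ze: "\<And>t. t \<in> {s..T} \<Longrightarrow> z t = S (t - s) v + bint s t (\<lambda>r. S (t - r) (K r (z r) + f r))"
    using z unfolding mild_def by auto
  have "z t = S (t - s') (z s') + bint s' t (\<lambda>r. S (t - r) (K r (z r) + f r))" if t: "t \<in> {s'..T}" for t
  proof -
    let ?g = "\<lambda>r. K r (z r) + f r"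
    have c: "set_integrable lborel {s..s'} (\<lambda>r. S (s' - r) (?g r))"
      using forcing_continuous(1)[OF s(1) zc f s(3)] by (rule continuous_set_integrable)
    have "S (t - s') (z s') = S (t - s') (S (s' - s) v) + S (t - s') (bint s s' (\<lambda>r. S (s' - r) (?g r)))"
      using ze[of s'] s by (simp add: blinfun.bilinear_simps)
    also have "S (t - s') (S (s' - s) v) = S (t - s) v"
      using C0_semigroup_add[OF S, of "t - s'" "s' - s" v] s t by simp
    also have "S (t - s') (bint s s' (\<lambda>r. S (s' - r) (?g r))) = bint s s' (\<lambda>r. S (t - s') (S (s' - r) (?g r)))"
      by (rule set_integral_blinfun(2)[OF c])
    also have "\<dots> = bint s s' (\<lambda>r. S (t - r) (?g r))"
    proof (rule bint_cong)
      fix r assume "r \<in> {s..s'}"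
      then show "S (t - s') (S (s' - r) (?g r)) = S (t - r) (?g r)"
        using C0_semigroup_add[OF S, of "t - s'" "s' - r" "?g r"] s t by simp
    qed
    finally have "S (t - s') (z s') + bint s' t (\<lambda>r. S (t - r) (?g r))
        = S (t - s) v + (bint s s' (\<lambda>r. S (t - r) (?g r)) + bint s' t (\<lambda>r. S (t - r) (?g r)))" by simp
    also have "bint s s' (\<lambda>r. S (t - r) (?g r)) + bint s' t (\<lambda>r. S (t - r) (?g r)) = bint s t (\<lambda>r. S (t - r) (?g r))"
      using forcing_continuous(1)[OF s(1) zc f, of t] s t
      by (intro bint_split[symmetric] continuous_set_integrable) auto
    finally show ?thesis using ze[of t] s t by simp
  qed
  moreover have "continuous_on {s'..T} z" by (rule continuous_on_subset[OF zc]) (use s in auto)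
  ultimately show ?thesis unfolding mild_def by blast
qed

text \<open>A solution is picked for each start and each \<open>v\<close>; uniqueness makes the
  choice linear in \<open>v\<close> and \<open>mild_bound\<close> makes it bounded, so it can be
  packed into a bounded operator.\<close>

lemma evolution_exists:
  "\<exists>U. \<forall>s v. 0 \<le> s \<and> s \<le> T \<longrightarrow> mild s (\<lambda>_. 0) v (\<lambda>t. blinfun_apply (U t s) v)"
proof -
  have "\<exists>z. \<forall>v. mild s (\<lambda>_. 0) v (z v)" if "0 \<le> s \<and> s \<le> T" for s
  proof -
    have "\<exists>z. mild s (\<lambda>_. 0) v z" for v using mild_exists[of s "\<lambda>_. 0" v] that by simp
    then show ?thesis by (intro choice allI)
  qed
  then obtain z where z: "\<And>s v. 0 \<le> s \<and> s \<le> T \<Longrightarrow> mild s (\<lambda>_. 0) v (z s v)" by metis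
  obtain C where C: "\<And>s v z t. 0 \<le> s \<Longrightarrow> mild s (\<lambda>_. 0) v z \<Longrightarrow> t \<in> {s..T} \<Longrightarrow> norm (z t) \<le> C * norm v"
    using mild_bound by blast
  define U where "U t s = Blinfun (\<lambda>v. z s v t)" for t s
  have U: "U t s v = z s v t" if st: "0 \<le> s \<and> s \<le> T" "t \<in> {s..T}" for t s v
  proof -
    have lin: "z s (v + c *\<^sub>R u) t = z s v t + c *\<^sub>R z s u t" for v u c
      using mild_unique[OF _ z[OF st(1), of "v + c *\<^sub>R u"] mild_add_scale[OF _ z[OF st(1), of v] z[OF st(1), of u]] st(2)] st(1) by simp
    have z0: "z s 0 t = 0" using C[OF _ z[OF st(1), of 0] st(2)] st(1) by simp
    have "bounded_linear (\<lambda>v. z s v t)"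
    proof (rule bounded_linear_intro)
      show "z s (x + y) t = z s x t + z s y t" for x y using lin[of x 1 y] by simp
      show "z s (r *\<^sub>R x) t = r *\<^sub>R z s x t" for r x using lin[of 0 r x] z0 by simp
      show "norm (z s x t) \<le> norm x * C" for x
        using C[OF _ z[OF st(1), of x] st(2)] st(1) by (simp add: mult.commute)
    qed
    then show ?thesis unfolding U_def by (simp add: bounded_linear_Blinfun_apply)
  qed
  have "mild s (\<lambda>_. 0) v (\<lambda>t. U t s v)" if s: "0 \<le> s \<and> s \<le> T" for s v
  proof -
    have "mild s (\<lambda>_. 0) v (z s v)" by (rule z[OF s])
    moreover have "bint s t (\<lambda>r. S (t - r) (K r (U r s v) + 0)) = bint s t (\<lambda>r. S (t - r) (K r (z s v r) + 0))"
      if "t \<in> {s..T}" for t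
      by (rule bint_cong) (use U[OF s] that in auto)
    moreover have "continuous_on {s..T} (\<lambda>t. U t s v) \<longleftrightarrow> continuous_on {s..T} (z s v)"
      by (rule continuous_on_cong) (use U[OF s] in auto)
    ultimately show ?thesis using U[OF s] unfolding mild_def by simp
  qed
  then show ?thesis by blast
qed

text \<open>The evolution family of the semigroup \<open>S\<close> perturbed by \<open>K\<close>,
  with the end time as first argument. Its values are determined only for start times in
  \<open>{0..T}\<close> and end times between the start and \<open>T\<close>.\<close>

definition evol :: "real \<Rightarrow> real \<Rightarrow> 'h \<Rightarrow>\<^sub>L 'h" where
  "evol = (SOME U. \<forall>s v. 0 \<le> s \<and> s \<le> T \<longrightarrow> mild s (\<lambda>_. 0) v (\<lambda>t. blinfun_apply (U t s) v))"

lemma evol_mild: "0 \<le> s \<Longrightarrow> s \<le> T \<Longrightarrow> mild s (\<lambda>_. 0) v (\<lambda>t. evol t s v)"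
  using someI_ex[OF evolution_exists] unfolding evol_def by blast

lemma evol_continuous: "0 \<le> s \<Longrightarrow> s \<le> T \<Longrightarrow> continuous_on {s..T} (\<lambda>t. evol t s v)"
  using evol_mild unfolding mild_def by blast

lemma evol_eq: "0 \<le> s \<Longrightarrow> t \<in> {s..T} \<Longrightarrow> evol t s v = S (t - s) v + bint s t (\<lambda>r. S (t - r) (K r (evol r s v)))"
  using evol_mild[of s v] unfolding mild_def by auto

lemma evol_refl: "0 \<le> s \<Longrightarrow> s \<le> T \<Longrightarrow> evol s s v = v"
  using evol_eq[of s s v] C0_semigroup_0[OF S] by (simp add: bint_refl[of s, simplified])

lemma evol_bound: "\<exists>C\<ge>1. \<forall>s t. 0 \<le> s \<longrightarrow> t \<in> {s..T} \<longrightarrow> norm (evol t s) \<le> C"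
proof -
  from mild_bound obtain C where C0: "C \<ge> 0"
    and C1: "\<forall>s v z t. 0 \<le> s \<longrightarrow> mild s (\<lambda>_. 0) v z \<longrightarrow> t \<in> {s..T} \<longrightarrow> norm (z t) \<le> C * norm v"
    by (elim exE conjE)
  note C = C0 C1[rule_format]
  have "norm (evol t s) \<le> max 1 C" if "0 \<le> s" "t \<in> {s..T}" for s t
  proof (rule norm_blinfun_bound)
    fix v
    have "s \<le> T" using that(2) by simp
    then have "norm (evol t s v) \<le> C * norm v" using C(2)[OF that(1) evol_mild[OF that(1)] that(2)] by blast
    also have "\<dots> \<le> max 1 C * norm v" by (intro mult_right_mono) auto
    finally show "norm (evol t s v) \<le> max 1 C * norm v" .
  qed simp
  then have "\<forall>s t. 0 \<le> s \<longrightarrow> t \<in> {s..T} \<longrightarrow> norm (evol t s) \<le> max 1 C" by blast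
  then show ?thesis using max.cobounded1 by blast
qed

lemma evol_evol:
  assumes "0 \<le> s" "s \<le> s'" "t \<in> {s'..T}"
  shows "evol t s' (evol s' s v) = evol t s v"
proof (rule mild_unique[of s' "evol s' s v" "\<lambda>t. evol t s' (evol s' s v)" "\<lambda>t. evol t s v"])
  show "mild s' (\<lambda>_. 0) (evol s' s v) (\<lambda>t. evol t s v)"
    by (rule mild_restart[OF _ _ _ _ evol_mild]) (use assms in auto)
  show "mild s' (\<lambda>_. 0) (evol s' s v) (\<lambda>t. evol t s' (evol s' s v))"
    by (rule evol_mild) (use assms in auto)
qed (use assms in auto)

text \<open>Uniform in both times for fixed \<open>v\<close>: the semigroup part depends on
  \<open>s' - s\<close> alone and the integral is at most a constant times \<open>s' - s\<close>.
  With the flow property this yields continuity in the start time, which the mild equation does not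
  exhibit.\<close>

lemma evol_near_diagonal:
  assumes e: "e > 0"
  shows "\<exists>\<delta>>0. \<forall>s s'. 0 \<le> s \<and> s \<le> s' \<and> s' \<le> T \<and> s' - s < \<delta> \<longrightarrow> norm (evol s' s v - v) < e"
proof -
  obtain C where C: "C \<ge> 1" "\<And>t. t \<in> {0..T} \<Longrightarrow> norm (S t) \<le> C" using C0_semigroup_bound[OF S] by blast
  obtain CK where CK: "CK \<ge> 0" "\<And>t. t \<in> {0..T} \<Longrightarrow> norm (K t) \<le> CK" using Cs_bound[OF K] by blast
  obtain CU where CU: "CU \<ge> 1" "\<And>s t. 0 \<le> s \<Longrightarrow> t \<in> {s..T} \<Longrightarrow> norm (evol t s) \<le> CU" using evol_bound by blast
  define M where "M = C * (CK * (CU * norm v)) + 1"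
  have M: "M > 0" using C(1) CK(1) CU(1) by (simp add: M_def add_nonneg_pos)
  obtain \<delta> where d: "\<delta> > 0" "\<And>t. 0 \<le> t \<and> t < \<delta> \<Longrightarrow> norm (S t v - v) < e / 2"
    using C0_semigroup_near_0[OF S, of "e / 2" v] e by auto
  have "norm (evol s' s v - v) < e" if s: "0 \<le> s \<and> s \<le> s' \<and> s' \<le> T \<and> s' - s < min \<delta> (e / (2 * M))" for s s'
  proof -
    have "norm (bint s s' (\<lambda>r. S (s' - r) (K r (evol r s v)))) \<le> (s' - s) * M"
    proof (rule bint_norm_le_const)
      show "set_integrable lborel {s..s'} (\<lambda>r. S (s' - r) (K r (evol r s v)))"
        using forcing_continuous(1)[OF _ evol_continuous continuous_on_const[of _ 0], of s s' v] s
        by (simp add: continuous_set_integrable)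
      fix r assume r: "r \<in> {s..s'}"
      have "norm (S (s' - r) (K r (evol r s v))) \<le> C * (CK * (CU * norm v))"
        by (intro order_trans[OF norm_blinfun] mult_mono C(2) CK(2) CU(2)) (use r s C(1) CK(1) CU(1) in auto)
      then show "norm (S (s' - r) (K r (evol r s v))) \<le> M" by (simp add: M_def)
    qed (use s in auto)
    also have "(s' - s) * M \<le> e / 2" using s M by (simp add: field_simps)
    finally have "norm (bint s s' (\<lambda>r. S (s' - r) (K r (evol r s v)))) \<le> e / 2" .
    moreover have "norm (S (s' - s) v - v) < e / 2" using d(2)[of "s' - s"] s by auto
    moreover have eq: "evol s' s v - v = (S (s' - s) v - v) + bint s s' (\<lambda>r. S (s' - r) (K r (evol r s v)))"
      using evol_eq[of s s' v] s by simp
    ultimately show ?thesis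
      using norm_triangle_ineq[of "S (s' - s) v - v" "bint s s' (\<lambda>r. S (s' - r) (K r (evol r s v)))"] unfolding eq by linarith
  qed
  moreover have "min \<delta> (e / (2 * M)) > 0" using d(1) e M by simp
  ultimately show ?thesis by blast
qed

end

section \<open>Limits of Riccati equations\<close>

text \<open>Makes the integral term of the weak Riccati identity bounded linear in either argument,
  so that the identity extends from the dense domain to the whole space.\<close>

lemma bint_bounded_linear:
  fixes p :: "real \<Rightarrow> 'a::{banach,second_countable_topology} \<Rightarrow>\<^sub>L 'b::separable_hilbert"
  assumes p: "\<And>x. continuous_on {a..b} (\<lambda>r. p r x)" "\<And>r. r \<in> {a..b} \<Longrightarrow> norm (p r) \<le> C"
    and q: "continuous_on {a..b} q" and ab: "a \<le> b"
  shows "bounded_linear (\<lambda>x. bint a b (\<lambda>r. p r x \<bullet> q r))"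
proof -
  have c: "set_integrable lborel {a..b} (\<lambda>r. p r x \<bullet> q r)" for x
    by (intro continuous_set_integrable continuous_intros p q)
  have "bounded (q ` {a..b})" by (intro compact_imp_bounded compact_continuous_image q) auto
  then obtain M where M: "\<And>r. r \<in> {a..b} \<Longrightarrow> norm (q r) \<le> M" unfolding bounded_iff by blast
  have "norm (p a) \<le> C" "norm (q a) \<le> M" using ab by (auto intro: p(2) M)
  then have CM: "0 \<le> C" "0 \<le> M" using norm_ge_zero[of "p a"] norm_ge_zero[of "q a"] by linarith+
  show ?thesis
  proof (rule bounded_linear_intro)
    show "bint a b (\<lambda>r. p r (x + y) \<bullet> q r) = bint a b (\<lambda>r. p r x \<bullet> q r) + bint a b (\<lambda>r. p r y \<bullet> q r)" for x y
      by (subst set_integral_add(2)[OF c c, symmetric]) (simp add: blinfun.bilinear_simps inner_add_left)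
    show "bint a b (\<lambda>r. p r (u *\<^sub>R x) \<bullet> q r) = u *\<^sub>R bint a b (\<lambda>r. p r x \<bullet> q r)" for u x
      by (simp add: blinfun.bilinear_simps)
    fix x
    have "norm (bint a b (\<lambda>r. p r x \<bullet> q r)) \<le> (b - a) * (C * norm x * M)"
    proof (rule bint_norm_le_const[OF ab c])
      fix r assume r: "r \<in> {a..b}"
      have "norm (p r x \<bullet> q r) \<le> norm (p r x) * norm (q r)" by (simp add: Cauchy_Schwarz_ineq2)
      also have "\<dots> \<le> (C * norm x) * M"
        by (intro mult_mono order_trans[OF norm_blinfun] mult_right_mono p(2) M r) (use CM in auto)
      finally show "norm (p r x \<bullet> q r) \<le> C * norm x * M" .
    qed
    then show "norm (bint a b (\<lambda>r. p r x \<bullet> q r)) \<le> norm x * ((b - a) * C * M)" by (simp add: mult_ac)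
  qed
qed

lemma tendsto_blinfun_strong:
  fixes L :: "nat \<Rightarrow> 'a::real_normed_vector \<Rightarrow>\<^sub>L 'b::real_normed_vector"
  assumes L: "\<And>v. (\<lambda>n. L n v) \<longlonglongrightarrow> L' v" and C: "\<And>n. norm (L n) \<le> C" and v: "v \<longlonglongrightarrow> v'"
  shows "(\<lambda>n. L n (v n)) \<longlonglongrightarrow> L' v'"
proof -
  have "(\<lambda>n. L n (v n - v')) \<longlonglongrightarrow> 0"
  proof (rule Lim_null_comparison)
    show "\<forall>\<^sub>F n in sequentially. norm (L n (v n - v')) \<le> C * norm (v n - v')"
      by (intro always_eventually allI order_trans[OF norm_blinfun] mult_right_mono C) auto
    have "(\<lambda>n. C * norm (v n - v')) \<longlonglongrightarrow> C * norm (v' - v')" by (intro tendsto_intros v)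
    then show "(\<lambda>n. C * norm (v n - v')) \<longlonglongrightarrow> 0" by simp
  qed
  then have "(\<lambda>n. L n (v n - v') + L n v') \<longlonglongrightarrow> 0 + L' v'" by (intro tendsto_add L)
  then show ?thesis by (simp add: blinfun.bilinear_simps)
qed

lemma generator_shift_derivative:
  assumes gen: "generates DA A S" and x: "x \<in> DA" and r: "r \<in> {t..T}" "0 \<le> t"
  shows "((\<lambda>r. S (r - t) x) has_vector_derivative S (r - t) (A x)) (at r within {t..T})"
proof -
  have "((\<lambda>r. r - t) has_vector_derivative 1) (at r within {t..T})"
    by (auto intro!: derivative_eq_intros)
  moreover have "((\<lambda>s. S s x) has_vector_derivative S (r - t) (A x)) (at (r - t) within (\<lambda>r. r - t) ` {t..T})"
    by (rule has_vector_derivative_within_subset[OF generator_has_vector_derivative[OF gen x, of _ T]]) (use r in auto)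
  ultimately have "((\<lambda>s. S s x) \<circ> (\<lambda>r. r - t) has_vector_derivative 1 *\<^sub>R S (r - t) (A x)) (at r within {t..T})"
    by (rule vector_diff_chain_within)
  then show ?thesis by (simp add: o_def)
qed

text \<open>Fundamental theorem of calculus for
  \<open>eta r (S (r - t) x) \<bullet> S (r - t) y\<close> in \<open>r\<close>. The equation carries
  the bounded operator \<open>Y\<close> while the orbits carry \<open>A\<close>; these do not
  cancel, and their differences, one for each orbit, stay under the integral.\<close>

lemma riccati_weak_identity:
  fixes DA :: "'h::separable_hilbert set" and eta :: "real \<Rightarrow> 'h \<Rightarrow>\<^sub>L 'h" and Y :: "'h \<Rightarrow>\<^sub>L 'h"
  assumes gen: "generates DA A S" and eta: "eta \<in> Cs T" and Psi: "Psi \<in> Cs T"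
    and eq: "\<And>x r. r \<in> {0..T} \<Longrightarrow> ((\<lambda>s. eta s x) has_vector_derivative
      - (eta r (Y x) + adj Y (eta r x) + Psi r x)) (at r within {0..T})"
    and x: "x \<in> DA" and y: "y \<in> DA" and t: "t \<in> {0..T}"
  shows "eta t x \<bullet> y = eta T (S (T - t) x) \<bullet> S (T - t) y + bint t T (\<lambda>r. Psi r (S (r - t) x) \<bullet> S (r - t) y
    - eta r (S (r - t) (A x) - Y (S (r - t) x)) \<bullet> S (r - t) y - eta r (S (r - t) x) \<bullet> (S (r - t) (A y) - Y (S (r - t) y)))"
proof -
  have S: "C0_semigroup S" by (rule generates_semigroup[OF gen])
  define z where "z r = S (r - t) x" for r
  define w where "w r = S (r - t) y" for r
  define z' where "z' r = S (r - t) (A x)" for r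
  define w' where "w' r = S (r - t) (A y)" for r
  have sh: "continuous_on {t..T} (\<lambda>r. S (r - t) v)" for v
    by (rule Cs_shift[OF C0_semigroup_Cs[OF S, of T]]) (use t in \<open>auto intro!: continuous_intros\<close>)
  note zc = sh[of x, folded z_def] sh[of y, folded w_def] sh[of "A x", folded z'_def] sh[of "A y", folded w'_def]
  have sub: "{t..T} \<subseteq> {0..T}" using t by auto
  obtain C where C: "\<And>r. r \<in> {0..T} \<Longrightarrow> norm (eta r) \<le> C" using Cs_bound[OF eta] by blast
  define G where "G r = Psi r (z r) \<bullet> w r - eta r (z' r - Y (z r)) \<bullet> w r - eta r (z r) \<bullet> (w' r - Y (w r))" for r
  have Gc: "continuous_on {t..T} G"
    unfolding G_def by (intro continuous_intros Cs_apply[OF Psi _ sub] Cs_apply[OF eta _ sub] zc)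
  have der: "((\<lambda>r. eta r (z r) \<bullet> w r) has_vector_derivative - G r) (at r within {t..T})" if r: "r \<in> {t..T}" for r
  proof -
    have r0: "r \<in> {0..T}" using r sub by blast
    have "((\<lambda>r. eta r (z r)) has_vector_derivative
        - (eta r (Y (z r)) + adj Y (eta r (z r)) + Psi r (z r)) + eta r (z' r)) (at r within {t..T})"
    proof (rule has_vector_derivative_blinfun_apply_strong[OF _ _ _ _ r])
      show "((\<lambda>s. eta s (z r)) has_vector_derivative - (eta r (Y (z r)) + adj Y (eta r (z r)) + Psi r (z r))) (at r within {t..T})"
        by (rule has_vector_derivative_within_subset[OF eq[OF r0] sub])
      show "continuous_on {t..T} (\<lambda>s. eta s v)" for v by (intro Cs_apply[OF eta _ sub] continuous_intros)
      show "s \<in> {t..T} \<Longrightarrow> norm (eta s) \<le> C" for s using C sub by blast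
      show "(z has_vector_derivative z' r) (at r within {t..T})"
        unfolding z_def z'_def by (rule generator_shift_derivative[OF gen x r]) (use t in auto)
    qed
    moreover have "(w has_vector_derivative w' r) (at r within {t..T})"
      unfolding w_def w'_def by (rule generator_shift_derivative[OF gen y r]) (use t in auto)
    ultimately have "((\<lambda>r. eta r (z r) \<bullet> w r) has_vector_derivative
        eta r (z r) \<bullet> w' r + (- (eta r (Y (z r)) + adj Y (eta r (z r)) + Psi r (z r)) + eta r (z' r)) \<bullet> w r) (at r within {t..T})"
      by (rule bounded_bilinear.has_vector_derivative[OF bounded_bilinear_inner])
    moreover have "eta r (z r) \<bullet> w' r + (- (eta r (Y (z r)) + adj Y (eta r (z r)) + Psi r (z r)) + eta r (z' r)) \<bullet> w r = - G r"
      unfolding G_def by (simp add: inner_add_left inner_diff_left inner_diff_right adj_inner blinfun.bilinear_simps)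
    ultimately show ?thesis by simp
  qed
  have "((\<lambda>r. - G r) has_integral (eta T (z T) \<bullet> w T - eta t (z t) \<bullet> w t)) {t..T}"
    by (rule fundamental_theorem_of_calculus[OF _ der]) (use t in auto)
  from has_integral_neg[OF this] have "integral {t..T} G = - (eta T (z T) \<bullet> w T - eta t (z t) \<bullet> w t)"
    by (intro integral_unique) (simp add: minus_diff_eq)
  moreover have "bint t T G = integral {t..T} G"
    by (intro set_borel_integral_eq_integral continuous_set_integrable Gc)
  moreover have "z t = x" "w t = y" by (simp_all add: z_def w_def C0_semigroup_0[OF S])
  ultimately have "eta t x \<bullet> y = eta T (z T) \<bullet> w T + bint t T G" by simp
  then show ?thesis unfolding G_def z_def w_def z'_def w'_def .
qed

text \<open>What has to disappear is the difference between \<open>A\<close> and its Yosida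
  approximations. On the orbit of a vector of the domain it is \<open>e n\<close> applied to the
  orbit of \<open>A x\<close>, where \<open>e n\<close> tends strongly to 0 and is uniformly bounded
  for large \<open>n\<close>. Dominated convergence gives the identity on the domain; density, first
  in \<open>x\<close> and then in \<open>y\<close>, gives it everywhere.\<close>

lemma riccati_limit:
  fixes DA :: "'h::separable_hilbert set" and etan Psin :: "nat \<Rightarrow> real \<Rightarrow> 'h \<Rightarrow>\<^sub>L 'h"
  assumes gen: "generates DA A S"
    and res: "\<And>n. n \<ge> n0 \<Longrightarrow> real n \<in> resolvent_set DA A"
    and etan: "\<And>n. n \<ge> n0 \<Longrightarrow> etan n \<in> Cs T" and Psin: "\<And>n. n \<ge> n0 \<Longrightarrow> Psin n \<in> Cs T"
    and eq: "\<And>n x r. n \<ge> n0 \<Longrightarrow> r \<in> {0..T} \<Longrightarrow> ((\<lambda>s. etan n s x) has_vector_derivative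
      - (etan n r (yosida DA A n x) + adj (yosida DA A n) (etan n r x) + Psin n r x)) (at r within {0..T})"
    and C: "\<And>n r. n \<ge> n0 \<Longrightarrow> r \<in> {0..T} \<Longrightarrow> norm (etan n r) \<le> C"
    and C': "\<And>n r. n \<ge> n0 \<Longrightarrow> r \<in> {0..T} \<Longrightarrow> norm (Psin n r) \<le> C'"
    and eta: "eta \<in> Cs T" and Psi: "Psi \<in> Cs T"
    and lim: "\<And>r x. r \<in> {0..T} \<Longrightarrow> (\<lambda>n. etan n r x) \<longlonglongrightarrow> eta r x"
    and lim': "\<And>r x. r \<in> {0..T} \<Longrightarrow> (\<lambda>n. Psin n r x) \<longlonglongrightarrow> Psi r x"
    and t: "t \<in> {0..T}"
  shows "eta t x \<bullet> y = eta T (S (T - t) x) \<bullet> S (T - t) y + bint t T (\<lambda>r. Psi r (S (r - t) x) \<bullet> S (r - t) y)"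
proof -
  have S: "C0_semigroup S" by (rule generates_semigroup[OF gen])
  have sh: "continuous_on {t..T} (\<lambda>r. S (r - t) v)" for v
    by (rule Cs_shift[OF C0_semigroup_Cs[OF S, of T]]) (use t in \<open>auto intro!: continuous_intros\<close>)
  have sub: "{t..T} \<subseteq> {0..T}" using t by auto
  obtain CS where CS: "CS \<ge> 1" "\<And>r. r \<in> {0..T} \<Longrightarrow> norm (S r) \<le> CS" using C0_semigroup_bound[OF S] by blast
  obtain CR N where R: "CR \<ge> 0" "\<And>n y. n \<ge> N \<Longrightarrow> real n \<in> resolvent_set DA A \<Longrightarrow>
      norm (real n *\<^sub>R inv_into DA (\<lambda>y. real n *\<^sub>R y - A y) y) \<le> CR * norm y"
    using resolv_bound[OF gen] by metis
  have "norm (etan n0 t) \<le> C" "norm (Psin n0 t) \<le> C'" using t by (auto intro: C C')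
  then have C0: "C \<ge> 0" "C' \<ge> 0" using norm_ge_zero[of "etan n0 t"] norm_ge_zero[of "Psin n0 t"] by linarith+
  define e where "e n v = v - real n *\<^sub>R inv_into DA (\<lambda>y. real n *\<^sub>R y - A y) v" for n v
  have e_lim: "(\<lambda>n. e n v) \<longlonglongrightarrow> 0" for v
    using tendsto_diff[OF tendsto_const resolv_lim[OF gen res, of n0 v], of v] by (simp add: e_def)
  have e_bd: "norm (e n v) \<le> (1 + CR) * norm v" if "n \<ge> max N n0" for n v
    using norm_triangle_ineq4[of v "real n *\<^sub>R inv_into DA (\<lambda>y. real n *\<^sub>R y - A y) v"] R(2)[of n v] res[of n] that
    by (simp add: e_def algebra_simps)
  have dense: "eta t x \<bullet> y = eta T (S (T - t) x) \<bullet> S (T - t) y + bint t T (\<lambda>r. Psi r (S (r - t) x) \<bullet> S (r - t) y)"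
    if x: "x \<in> DA" and y: "y \<in> DA" for x y
  proof -
    define z where "z r = S (r - t) x" for r
    define w where "w r = S (r - t) y" for r
    define z' where "z' r = S (r - t) (A x)" for r
    define w' where "w' r = S (r - t) (A y)" for r
    note zc = sh[of x, folded z_def] sh[of y, folded w_def] sh[of "A x", folded z'_def] sh[of "A y", folded w'_def]
    define G where "G n r = Psin n r (z r) \<bullet> w r - etan n r (e n (z' r)) \<bullet> w r - etan n r (z r) \<bullet> e n (w' r)" for n r
    define g where "g r = Psi r (z r) \<bullet> w r" for r
    \<comment> \<open>Here the domain enters: the orbit stays in it, so the Yosida approximation of
      the orbit is the scaled resolvent applied to the orbit of \<open>A v\<close>.\<close>
    have yz: "S (r - t) (A v) - yosida DA A n (S (r - t) v) = e n (S (r - t) (A v))"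
      if "v \<in> DA" "r \<in> {t..T}" "n \<ge> n0" for v r n
      using yosida_apply[OF gen res[OF that(3)], of "S (r - t) v"] generator_invariant[OF gen that(1), of "r - t"] that(2)
      by (simp add: e_def)
    have idn: "etan n t x \<bullet> y = etan n T (z T) \<bullet> w T + bint t T (G n)" if n: "n \<ge> n0" for n
    proof -
      have "bint t T (\<lambda>r. Psin n r (S (r - t) x) \<bullet> S (r - t) y
          - etan n r (S (r - t) (A x) - yosida DA A n (S (r - t) x)) \<bullet> S (r - t) y
          - etan n r (S (r - t) x) \<bullet> (S (r - t) (A y) - yosida DA A n (S (r - t) y))) = bint t T (G n)"
        by (rule bint_cong) (simp add: G_def yz[OF x _ n] yz[OF y _ n] z_def w_def z'_def w'_def)
      then show ?thesis
        using riccati_weak_identity[OF gen etan[OF n] Psin[OF n] eq[OF n] x y t] by (simp add: z_def w_def)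
    qed
    have ec: "continuous_on {t..T} (\<lambda>r. e n (u r))" if "continuous_on {t..T} u" "n \<ge> n0" for u n
      unfolding e_def
      by (intro continuous_intros that(1) bounded_linear.continuous_on[OF resolv(4)[OF gen res[OF that(2)]]])
    have Gc: "continuous_on {t..T} (G n)" if "n \<ge> n0" for n
      unfolding G_def using that
      by (intro continuous_intros Cs_apply[OF Psin _ sub] Cs_apply[OF etan _ sub] zc ec)
    define B where "B = C' * (CS * norm x) * (CS * norm y) + C * ((1 + CR) * (CS * norm (A x))) * (CS * norm y)
      + C * (CS * norm x) * ((1 + CR) * (CS * norm (A y)))"
    have nS: "norm (S (r - t) v) \<le> CS * norm v" if "r \<in> {t..T}" for r v
      by (intro order_trans[OF norm_blinfun] mult_right_mono CS(2)) (use that t in auto)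
    have GB: "norm (G n r) \<le> B" if n: "n \<ge> max N n0" and r: "r \<in> {t..T}" for n r
    proof -
      have r0: "r \<in> {0..T}" using r sub by blast
      have nn: "n \<ge> n0" using n by simp
      have 1: "norm (Psin n r (z r) \<bullet> w r) \<le> C' * (CS * norm x) * (CS * norm y)"
        by (rule order_trans[OF Cauchy_Schwarz_ineq2[folded real_norm_def]],
            intro mult_mono order_trans[OF norm_blinfun] C' nn r0)
          (use nS[OF r] CS(1) C0 in \<open>auto simp: z_def w_def\<close>)
      have 2: "norm (etan n r (e n (z' r)) \<bullet> w r) \<le> C * ((1 + CR) * (CS * norm (A x))) * (CS * norm y)"
        by (rule order_trans[OF Cauchy_Schwarz_ineq2[folded real_norm_def]],
            intro mult_mono order_trans[OF norm_blinfun] order_trans[OF e_bd[OF n]] C nn r0)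
          (use nS[OF r] CS(1) C0 R(1) in \<open>auto simp: z'_def w_def\<close>)
      have 3: "norm (etan n r (z r) \<bullet> e n (w' r)) \<le> C * (CS * norm x) * ((1 + CR) * (CS * norm (A y)))"
        by (rule order_trans[OF Cauchy_Schwarz_ineq2[folded real_norm_def]],
            intro mult_mono order_trans[OF norm_blinfun] order_trans[OF e_bd[OF n]] C nn r0)
          (use nS[OF r] CS(1) C0 R(1) in \<open>auto simp: z_def w'_def\<close>)
      show ?thesis using 1 2 3 unfolding G_def B_def real_norm_def by linarith
    qed
    have Glim: "(\<lambda>n. G n r) \<longlonglongrightarrow> g r" if r: "r \<in> {t..T}" for r
    proof -
      have r0: "r \<in> {0..T}" using r sub by blast
      have "(\<lambda>n. etan (n + n0) r (e (n + n0) (z' r))) \<longlonglongrightarrow> eta r 0"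
        by (rule tendsto_blinfun_strong[where C = C, OF LIMSEQ_ignore_initial_segment[OF lim[OF r0]] _ LIMSEQ_ignore_initial_segment[OF e_lim]])
          (use C r0 in auto)
      then have "(\<lambda>n. etan n r (e n (z' r))) \<longlonglongrightarrow> 0"
        by (intro LIMSEQ_offset[of "\<lambda>n. etan n r (e n (z' r))" n0]) simp
      then have "(\<lambda>n. G n r) \<longlonglongrightarrow> Psi r (z r) \<bullet> w r - 0 \<bullet> w r - eta r (z r) \<bullet> 0"
        unfolding G_def by (intro tendsto_intros lim[OF r0] lim'[OF r0] e_lim)
      then show ?thesis by (simp add: g_def)
    qed
    \<comment> \<open>Equations and bounds hold only from \<open>max N n0\<close> on, so the
      sequence is shifted before dominated convergence is applied.\<close>
    define m where "m = max N n0"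
    have "(\<lambda>n. LINT r|lborel. indicator {t..T} r *\<^sub>R G (n + m) r) \<longlonglongrightarrow> (LINT r|lborel. indicator {t..T} r *\<^sub>R g r)"
    proof (rule integral_dominated_convergence)
      show "(\<lambda>r. indicator {t..T} r *\<^sub>R g r) \<in> borel_measurable lborel"
      proof -
        have "continuous_on {t..T} g" unfolding g_def by (intro continuous_intros Cs_apply[OF Psi _ sub] zc)
        from continuous_set_integrable[OF this] show ?thesis unfolding set_integrable_def by auto
      qed
      show "(\<lambda>r. indicator {t..T} r *\<^sub>R G (n + m) r) \<in> borel_measurable lborel" for n
        using continuous_set_integrable[OF Gc[of "n + m"]] unfolding set_integrable_def m_def by auto
      show "integrable lborel (\<lambda>r. indicator {t..T} r *\<^sub>R B)"
        using continuous_set_integrable[of t T "\<lambda>_. B"] unfolding set_integrable_def by auto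
      show "AE r in lborel. norm (indicator {t..T} r *\<^sub>R G (n + m) r) \<le> indicator {t..T} r *\<^sub>R B" for n
        using GB[of "n + m"] by (auto simp: indicator_def m_def)
      show "AE r in lborel. (\<lambda>n. indicator {t..T} r *\<^sub>R G (n + m) r) \<longlonglongrightarrow> indicator {t..T} r *\<^sub>R g r"
        using LIMSEQ_ignore_initial_segment[OF Glim] by (auto simp: indicator_def intro!: AE_I2)
    qed
    then have "(\<lambda>n. etan (n + m) T (z T) \<bullet> w T + bint t T (G (n + m))) \<longlonglongrightarrow> eta T (z T) \<bullet> w T + bint t T g"
      unfolding set_lebesgue_integral_def
      using t by (intro tendsto_intros LIMSEQ_ignore_initial_segment[OF lim]) auto
    moreover have "(\<lambda>n. etan (n + m) t x \<bullet> y) \<longlonglongrightarrow> eta t x \<bullet> y"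
      using t by (intro tendsto_intros LIMSEQ_ignore_initial_segment[OF lim]) auto
    moreover have "etan (n + m) t x \<bullet> y = etan (n + m) T (z T) \<bullet> w T + bint t T (G (n + m))" for n
      by (rule idn) (simp add: m_def)
    ultimately have "eta t x \<bullet> y = eta T (z T) \<bullet> w T + bint t T g"
      using LIMSEQ_unique by simp
    then show ?thesis unfolding g_def z_def w_def .
  qed
  let ?p = "\<lambda>r. Psi r o\<^sub>L S (r - t)"
  obtain CP where CP0: "CP \<ge> 0" and CP: "\<And>r. r \<in> {0..T} \<Longrightarrow> norm (Psi r) \<le> CP" using Cs_bound[OF Psi] by blast
  have pc: "continuous_on {t..T} (\<lambda>r. ?p r x)" for x
    using Cs_apply[OF Psi sh sub] by simp
  have pb: "norm (?p r) \<le> CP * CS" if r: "r \<in> {t..T}" for r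
    by (rule order_trans[OF norm_blinfun_compose], intro mult_mono CP CS(2))
      (use r t CP0 in auto)
  have tT: "t \<le> T" using t by simp
  have bl1: "bounded_linear (\<lambda>x. bint t T (\<lambda>r. Psi r (S (r - t) x) \<bullet> S (r - t) y))" for y
    using bint_bounded_linear[of t T ?p, OF pc pb sh tT] by simp
  have bl2: "bounded_linear (\<lambda>y. bint t T (\<lambda>r. Psi r (S (r - t) x) \<bullet> S (r - t) y))" for x
    unfolding inner_commute[of "Psi _ _"]
    by (rule bint_bounded_linear[of t T "\<lambda>r. S (r - t)" CS]) (use sh CS(2) t Cs_apply[OF Psi sh sub] in auto)
  have 1: "eta t x \<bullet> y = eta T (S (T - t) x) \<bullet> S (T - t) y + bint t T (\<lambda>r. Psi r (S (r - t) x) \<bullet> S (r - t) y)"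
    if y: "y \<in> DA" for x y
  proof -
    have "closed {x. eta t x \<bullet> y = eta T (S (T - t) x) \<bullet> S (T - t) y + bint t T (\<lambda>r. Psi r (S (r - t) x) \<bullet> S (r - t) y)}"
      by (intro closed_Collect_eq continuous_intros linear_continuous_on bl1)
    then have "closure DA \<subseteq> {x. eta t x \<bullet> y = eta T (S (T - t) x) \<bullet> S (T - t) y + bint t T (\<lambda>r. Psi r (S (r - t) x) \<bullet> S (r - t) y)}"
      using dense[OF _ y] by (intro closure_minimal) auto
    then show ?thesis unfolding generator_dense[OF gen] by blast
  qed
  have "closed {y. eta t x \<bullet> y = eta T (S (T - t) x) \<bullet> S (T - t) y + bint t T (\<lambda>r. Psi r (S (r - t) x) \<bullet> S (r - t) y)}"
    by (intro closed_Collect_eq continuous_intros linear_continuous_on bl2)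
  then have "closure DA \<subseteq> {y. eta t x \<bullet> y = eta T (S (T - t) x) \<bullet> S (T - t) y + bint t T (\<lambda>r. Psi r (S (r - t) x) \<bullet> S (r - t) y)}"
    using 1 by (intro closure_minimal) auto
  then show ?thesis unfolding generator_dense[OF gen] by blast
qed

lemma bint_if_ge:
  fixes g :: "real \<Rightarrow> 'a::{banach, second_countable_topology}"
  assumes "set_integrable lborel {max a p..b} g"
  shows "set_integrable lborel {a..b} (\<lambda>r. if p \<le> r then g r else 0)"
    and "bint a b (\<lambda>r. if p \<le> r then g r else 0) = bint (max a p) b g"
proof -
  have "(\<lambda>r. indicator {a..b} r *\<^sub>R (if p \<le> r then g r else 0)) = (\<lambda>r. indicator {max a p..b} r *\<^sub>R g r)"
    by (auto simp: indicator_def)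
  then show "set_integrable lborel {a..b} (\<lambda>r. if p \<le> r then g r else 0)"
    "bint a b (\<lambda>r. if p \<le> r then g r else 0) = bint (max a p) b g"
    using assms unfolding set_integrable_def set_lebesgue_integral_def by simp_all
qed

section \<open>The Riccati identity along solutions of the forward equation\<close>

context
  fixes T :: real and S :: "real \<Rightarrow> 'h::separable_hilbert \<Rightarrow>\<^sub>L 'h" and K eta Theta :: "real \<Rightarrow> 'h \<Rightarrow>\<^sub>L 'h"
  assumes T: "0 \<le> T" and S: "C0_semigroup S" and K: "K \<in> Cs T" and eta: "eta \<in> Cs T" and Theta: "Theta \<in> Cs T"
    and weak: "\<And>x y t. t \<in> {0..T} \<Longrightarrow> eta t x \<bullet> y = eta T (S (T - t) x) \<bullet> S (T - t) y
      + bint t T (\<lambda>r. (Theta r (S (r - t) x) + eta r (K r (S (r - t) x))) \<bullet> S (r - t) y)"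
begin

lemma adj_shift_continuous:
  assumes "0 \<le> t" "continuous_on {p..T} g" "t \<le> p"
  shows "continuous_on {p..T} (\<lambda>r. adj (S (r - t)) (g r))"
  by (rule Cs_shift[OF C0_semigroup_Cs[OF C0_semigroup_adj[OF S], of T]]) (use assms in \<open>auto intro!: continuous_intros\<close>)

text \<open>The identity \<open>weak\<close> concerns free orbits of \<open>S\<close>; here it is
  carried over to solutions of the perturbed equation. It is applied to \<open>z t\<close> and to
  each forcing value \<open>g u\<close> on \<open>{u..T}\<close>; integrating over \<open>u\<close>
  and exchanging the integrals reassembles \<open>z r\<close> by its mild equation, and the terms
  with \<open>K\<close> cancel against those in \<open>g\<close>.\<close>

lemma riccati_mild_solution:
  assumes s: "0 \<le> s" and f: "continuous_on {s..T} f" and z: "mild T S K s f v z" and t: "t \<in> {s..T}"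
  shows "continuous_on {t..T} (\<lambda>r. adj (S (r - t)) (Theta r (z r) - eta r (f r)))"
    and "eta t (z t) = adj (S (T - t)) (eta T (z T)) + bint t T (\<lambda>r. adj (S (r - t)) (Theta r (z r) - eta r (f r)))"
proof -
  have sub: "{t..T} \<subseteq> {0..T}" and t0: "0 \<le> t" "t \<le> T" "t \<in> {0..T}" using s t by auto
  have fc: "continuous_on {t..T} f" by (rule continuous_on_subset[OF f]) (use t in auto)
  have zt: "mild T S K t f (z t) z" by (rule mild_restart[OF T S K s _ _ f z]) (use t in auto)
  then have zc: "continuous_on {t..T} z" unfolding mild_def[OF T S K] by blast
  have c0: "continuous_on {t..T} (\<lambda>r. Theta r (z r) - eta r (f r))"
    by (intro continuous_intros Cs_apply[OF Theta zc sub] Cs_apply[OF eta fc sub])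
  show c: "continuous_on {t..T} (\<lambda>r. adj (S (r - t)) (Theta r (z r) - eta r (f r)))"
    by (rule adj_shift_continuous[OF t0(1) c0 order_refl])
  define g where "g r = K r (z r) + f r" for r
  have gc: "continuous_on {t..T} g" unfolding g_def by (intro continuous_intros Cs_apply[OF K zc sub] fc)
  have ze: "z r = S (r - t) (z t) + bint t r (\<lambda>u. S (r - u) (g u))" if "r \<in> {t..T}" for r
    unfolding g_def using zt that unfolding mild_def[OF T S K] by blast
  define Psi where "Psi r = Theta r + (eta r o\<^sub>L K r)" for r
  have Psi: "Psi \<in> Cs T" unfolding Psi_def by (intro Cs_add Cs_compose Theta eta K)
  have Psi': "Psi r x = Theta r x + eta r (K r x)" for r x by (simp add: Psi_def blinfun.bilinear_simps)
  have shc: "continuous_on D (\<lambda>p. S (q p) (u p))" if "continuous_on D q" "\<And>p. p \<in> D \<Longrightarrow> q p \<in> {0..T}" "continuous_on D u"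
    for D :: "'p::topological_space set" and q u
    by (rule Cs_shift[OF C0_semigroup_Cs[OF S] that])
  have "eta t (z t) \<bullet> y = (adj (S (T - t)) (eta T (z T)) + bint t T (\<lambda>r. adj (S (r - t)) (Theta r (z r) - eta r (f r)))) \<bullet> y" for y
  proof -
    define w where "w r = S (r - t) y" for r
    have wc: "continuous_on {t..T} w"
      unfolding w_def by (rule shc) (use t0 in \<open>auto intro!: continuous_intros\<close>)
    have ww: "S (r - u) (w u) = w r" if "t \<le> u" "u \<le> r" for u r
      using C0_semigroup_add[OF S, of "r - u" "u - t" y] that by (simp add: w_def)
    define h where "h u r = Psi r (S (r - u) (g u)) \<bullet> w r" for u r
    let ?D = "{(u, r). t \<le> u \<and> u \<le> r \<and> r \<le> T}"
    have hc: "continuous_on ?D (\<lambda>(u, r). h u r)"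
    proof -
      have "continuous_on ?D (\<lambda>p. Psi (snd p) (S (snd p - fst p) (g (fst p))))"
        using t0 by (intro Cs_shift[OF Psi] shc continuous_on_compose2[OF gc] continuous_intros) auto
      moreover have "continuous_on ?D (\<lambda>p. w (snd p))"
        by (intro continuous_on_compose2[OF wc] continuous_intros) auto
      ultimately show ?thesis unfolding h_def split_def by (rule continuous_on_inner)
    qed
    have intS: "set_integrable lborel {t..r} (\<lambda>u. S (r - u) (g u))" if r: "r \<in> {t..T}" for r
      by (intro continuous_set_integrable shc continuous_on_subset[OF gc] continuous_intros) (use r t0 in auto)
    have 1: "eta t (z t) \<bullet> y = eta T (S (T - t) (z t)) \<bullet> w T + bint t T (\<lambda>r. Psi r (S (r - t) (z t)) \<bullet> w r)"
      using weak[OF t0(3), of "z t" y] by (simp add: w_def Psi')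
    \<comment> \<open>The identity at the intermediate time \<open>u\<close>, tested with
      \<open>w u\<close>; the semigroup law turns \<open>S (r - u) (w u)\<close> into
      \<open>w r\<close>.\<close>
    have "bint t T (\<lambda>u. eta u (g u) \<bullet> w u) = bint t T (\<lambda>u. eta T (S (T - u) (g u)) \<bullet> w T + bint u T (h u))"
    proof (rule bint_cong)
      fix u assume u: "u \<in> {t..T}"
      have "bint u T (\<lambda>r. (Theta r (S (r - u) (g u)) + eta r (K r (S (r - u) (g u)))) \<bullet> S (r - u) (w u)) = bint u T (h u)"
        by (rule bint_cong) (use u ww in \<open>auto simp: h_def Psi'\<close>)
      then show "eta u (g u) \<bullet> w u = eta T (S (T - u) (g u)) \<bullet> w T + bint u T (h u)"
        using weak[of u "g u" "w u"] u sub ww[of u T] by auto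
    qed
    also have "\<dots> = bint t T (\<lambda>u. eta T (S (T - u) (g u)) \<bullet> w T) + bint t T (\<lambda>u. bint u T (h u))"
    proof (rule set_integral_add(2))
      show "set_integrable lborel {t..T} (\<lambda>u. eta T (S (T - u) (g u)) \<bullet> w T)"
        using set_integral_blinfun(1)[OF intS[of T], of "eta T"] t0 by (intro set_integral_inner(1)) auto
      \<comment> \<open>Continuity of the inner integral in its lower limit is read off the
        identity: it equals a difference of functions already known to be continuous.\<close>
      have "continuous_on {t..T} (\<lambda>u. eta u (g u) \<bullet> w u - eta T (S (T - u) (g u)) \<bullet> w T)"
        using t0 by (intro continuous_intros Cs_apply[OF eta gc sub] wc shc gc) auto
      moreover have "bint u T (h u) = eta u (g u) \<bullet> w u - eta T (S (T - u) (g u)) \<bullet> w T" if u: "u \<in> {t..T}" for u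
      proof -
        have "bint u T (\<lambda>r. (Theta r (S (r - u) (g u)) + eta r (K r (S (r - u) (g u)))) \<bullet> S (r - u) (w u)) = bint u T (h u)"
          by (rule bint_cong) (use u ww in \<open>auto simp: h_def Psi'\<close>)
        then show ?thesis using weak[of u "g u" "w u"] u sub ww[of u T] by auto
      qed
      ultimately have "continuous_on {t..T} (\<lambda>u. bint u T (h u))"
        using continuous_on_cong[OF refl, of "{t..T}" "\<lambda>u. bint u T (h u)"] by simp
      then show "set_integrable lborel {t..T} (\<lambda>u. bint u T (h u))" by (rule continuous_set_integrable)
    qed
    also have "bint t T (\<lambda>u. eta T (S (T - u) (g u)) \<bullet> w T) = eta T (bint t T (\<lambda>u. S (T - u) (g u))) \<bullet> w T"
      using t0 by (subst set_integral_blinfun(2)[OF intS], simp,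
        subst set_integral_inner(2)[OF set_integral_blinfun(1)[OF intS]]) auto
    \<comment> \<open>The exchange replaces the later effect of each forcing value by the
      accumulated effect at each time \<open>r\<close>, where variation of constants
      applies.\<close>
    also have "bint t T (\<lambda>u. bint u T (h u)) = bint t T (\<lambda>r. bint t r (\<lambda>u. h u r))"
      by (rule triangle_fubini[OF hc])
    also have "\<dots> = bint t T (\<lambda>r. Psi r (z r) \<bullet> w r - Psi r (S (r - t) (z t)) \<bullet> w r)"
    proof (rule bint_cong)
      fix r assume r: "r \<in> {t..T}"
      have "bint t r (\<lambda>u. h u r) = Psi r (bint t r (\<lambda>u. S (r - u) (g u))) \<bullet> w r"
        unfolding h_def
        by (subst set_integral_blinfun(2)[OF intS[OF r]],
          subst set_integral_inner(2)[OF set_integral_blinfun(1)[OF intS[OF r]]]) simp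
      also have "\<dots> = Psi r (z r) \<bullet> w r - Psi r (S (r - t) (z t)) \<bullet> w r"
        using ze[OF r] by (simp add: blinfun.bilinear_simps inner_add_left)
      finally show "bint t r (\<lambda>u. h u r) = Psi r (z r) \<bullet> w r - Psi r (S (r - t) (z t)) \<bullet> w r" .
    qed
    also have "\<dots> = bint t T (\<lambda>r. Psi r (z r) \<bullet> w r) - bint t T (\<lambda>r. Psi r (S (r - t) (z t)) \<bullet> w r)"
      using t0 by (intro set_integral_diff(2) continuous_set_integrable continuous_intros Cs_apply[OF Psi _ sub] shc zc wc) auto
    also have "eta T (bint t T (\<lambda>u. S (T - u) (g u))) = eta T (z T) - eta T (S (T - t) (z t))"
      using ze[of T] t0 by (simp add: blinfun.bilinear_simps)
    finally have 2: "bint t T (\<lambda>u. eta u (g u) \<bullet> w u) = (eta T (z T) - eta T (S (T - t) (z t))) \<bullet> w T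
      + (bint t T (\<lambda>r. Psi r (z r) \<bullet> w r) - bint t T (\<lambda>r. Psi r (S (r - t) (z t)) \<bullet> w r))" .
    have "bint t T (\<lambda>r. Psi r (z r) \<bullet> w r) - bint t T (\<lambda>u. eta u (g u) \<bullet> w u)
      = bint t T (\<lambda>r. Psi r (z r) \<bullet> w r - eta r (g r) \<bullet> w r)"
      by (intro set_integral_diff(2)[symmetric] continuous_set_integrable continuous_intros Cs_apply[OF Psi zc sub] Cs_apply[OF eta gc sub] wc)
    also have "\<dots> = bint t T (\<lambda>r. adj (S (r - t)) (Theta r (z r) - eta r (f r)) \<bullet> y)"
      by (intro bint_cong) (simp add: Psi' g_def adj_inner w_def blinfun.bilinear_simps inner_diff_left inner_add_left)
    also have "\<dots> = bint t T (\<lambda>r. adj (S (r - t)) (Theta r (z r) - eta r (f r))) \<bullet> y"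
      by (rule set_integral_inner(2)[OF continuous_set_integrable[OF c], symmetric])
    finally have "bint t T (\<lambda>r. Psi r (z r) \<bullet> w r) - bint t T (\<lambda>u. eta u (g u) \<bullet> w u)
      = bint t T (\<lambda>r. adj (S (r - t)) (Theta r (z r) - eta r (f r))) \<bullet> y" .
    moreover have "adj (S (T - t)) (eta T (z T)) \<bullet> y = eta T (z T) \<bullet> w T" by (simp add: adj_inner w_def)
    ultimately show ?thesis using 1 2 by (simp add: inner_add_left inner_diff_left)
  qed
  note inner_eq = this
  show "eta t (z t) = adj (S (T - t)) (eta T (z T)) + bint t T (\<lambda>r. adj (S (r - t)) (Theta r (z r) - eta r (f r)))"
    by (rule vector_eq_rdot[THEN iffD1]) (rule allI, rule inner_eq)
qed

text \<open>The response to an impulse \<open>v\<close> at time \<open>p\<close>. For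
  \<open>p\<close> in \<open>{0..T}\<close> it has the value \<open>v\<close> at \<open>p\<close>
  itself, so the path is right-continuous there.\<close>

abbreviation "jump p v r \<equiv> (if p \<le> r then evol T S K r p v else 0)"

text \<open>From \<open>p\<close> on the path is a mild solution and
  \<open>riccati_mild_solution\<close> applies. For \<open>t\<close> before \<open>p\<close> the
  path vanishes at \<open>t\<close>, and the identity at \<open>p\<close>, transported by
  \<open>adj (S (p - t))\<close>, shows which term is missing; at \<open>t = p\<close> nothing is
  missing, hence the strict inequality.\<close>

lemma jump_backward:
  assumes p: "p \<in> {0..T}" and t: "t \<in> {0..T}"
  shows "set_integrable lborel {t..T} (\<lambda>r. adj (S (r - t)) (Theta r (jump p v r)))"
    and "eta t (jump p v t) + (if t < p then adj (S (p - t)) (eta p v) else 0)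
      = adj (S (T - t)) (eta T (jump p v T)) + bint t T (\<lambda>r. adj (S (r - t)) (Theta r (jump p v r)))"
proof -
  have p0: "0 \<le> p" "p \<le> T" using p by auto
  let ?U = "\<lambda>r. evol T S K r p v"
  have eq: "(\<lambda>r. adj (S (r - t)) (Theta r (jump p v r))) = (\<lambda>r. if p \<le> r then adj (S (r - t)) (Theta r (?U r)) else 0)"
    by auto
  have Uc: "continuous_on {p..T} ?U" by (rule evol_continuous[OF T S K p0])
  have c: "set_integrable lborel {max t p..T} (\<lambda>r. adj (S (r - t)) (Theta r (?U r)))"
    using p t by (intro continuous_set_integrable adj_shift_continuous Cs_apply[OF Theta] continuous_on_subset[OF Uc]) auto
  show "set_integrable lborel {t..T} (\<lambda>r. adj (S (r - t)) (Theta r (jump p v r)))"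
    unfolding eq by (rule bint_if_ge(1)[OF c])
  have b: "bint t T (\<lambda>r. adj (S (r - t)) (Theta r (jump p v r))) = bint (max t p) T (\<lambda>r. adj (S (r - t)) (Theta r (?U r)))"
    unfolding eq using bint_if_ge(2)[OF c] by simp
  have m: "mild T S K p (\<lambda>_. 0) v ?U" by (rule evol_mild[OF T S K p0])
  note D = riccati_mild_solution[OF p0(1) continuous_on_const m, simplified]
  show "eta t (jump p v t) + (if t < p then adj (S (p - t)) (eta p v) else 0)
      = adj (S (T - t)) (eta T (jump p v T)) + bint t T (\<lambda>r. adj (S (r - t)) (Theta r (jump p v r)))"
  proof (cases "t < p")
    case False
    then show ?thesis unfolding b using D(2)[of t] t p by (simp add: max_absorb1)
  next
    case True
    have aa: "adj (S (p - t)) (adj (S (r - p)) x) = adj (S (r - t)) x" if "p \<le> r" for r x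
      using C0_semigroup_add[OF C0_semigroup_adj[OF S], of "p - t" "r - p" x] True that by simp
    have i: "set_integrable lborel {p..T} (\<lambda>r. adj (S (r - p)) (Theta r (?U r)))"
      using D(1)[of p] p by (intro continuous_set_integrable) auto
    have "adj (S (p - t)) (eta p v) = adj (S (p - t)) (eta p (?U p))" using evol_refl[OF T S K p0] by simp
    also have "eta p (?U p) = adj (S (T - p)) (eta T (?U T)) + bint p T (\<lambda>r. adj (S (r - p)) (Theta r (?U r)))"
      using D(2)[of p] p by simp
    also have "adj (S (p - t)) \<dots> = adj (S (T - t)) (eta T (?U T)) + bint p T (\<lambda>r. adj (S (p - t)) (adj (S (r - p)) (Theta r (?U r))))"
      using p by (simp add: blinfun.bilinear_simps aa set_integral_blinfun(2)[OF i])
    also have "bint p T (\<lambda>r. adj (S (p - t)) (adj (S (r - p)) (Theta r (?U r)))) = bint p T (\<lambda>r. adj (S (r - t)) (Theta r (?U r)))"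
      by (rule bint_cong) (simp add: aa)
    finally show ?thesis unfolding b using True p by (simp add: max_absorb2)
  qed
qed

end

section \<open>Mean-square calculus for the Wiener process\<close>

lemma real_gaussian_moments:
  assumes s: "0 \<le> s"
  shows "integrable (real_gaussian s) (\<lambda>x. x)" "integral\<^sup>L (real_gaussian s) (\<lambda>x. x) = 0"
    "integrable (real_gaussian s) (\<lambda>x. x\<^sup>2)" "integral\<^sup>L (real_gaussian s) (\<lambda>x. x\<^sup>2) = s"
proof -
  have "integrable (real_gaussian s) (\<lambda>x. x) \<and> integral\<^sup>L (real_gaussian s) (\<lambda>x. x) = 0
    \<and> integrable (real_gaussian s) (\<lambda>x. x\<^sup>2) \<and> integral\<^sup>L (real_gaussian s) (\<lambda>x. x\<^sup>2) = s"
  proof (cases "0 < s")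
    case True
    then have sg: "0 < sqrt s" by simp
    have 1: "has_bochner_integral lborel (\<lambda>x. normal_density 0 (sqrt s) x * x) 0"
      using normal_moment_nz_1[OF sg, of 0] .
    have 2: "has_bochner_integral lborel (\<lambda>x. normal_density 0 (sqrt s) x * x\<^sup>2) s"
      using normal_moment_even[OF sg, of 0 1] True by (simp add: power2_eq_square)
    show ?thesis
      using True 1 2 unfolding real_gaussian_def has_bochner_integral_iff
      by (simp add: integrable_density integral_density)
  next
    case False
    then have "s = 0" using s by simp
    have r: "real_gaussian s = return borel 0" using False unfolding real_gaussian_def by (rule if_not_P)
    have i: "integrable (return borel 0) f" "integral\<^sup>L (return borel 0) f = f 0"
      if "f \<in> borel_measurable borel" for f :: "real \<Rightarrow> real"
      using that by (simp_all add: integrable_iff_bounded nn_integral_return integral_return)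
    have "integrable (return borel 0) (\<lambda>x::real. x)" by (rule i(1)) simp
    moreover have "integral\<^sup>L (return borel 0) (\<lambda>x::real. x) = 0" by (rule i(2)) simp
    moreover have "integrable (return borel 0) (\<lambda>x::real. x\<^sup>2)" by (rule i(1)) simp
    moreover have "integral\<^sup>L (return borel 0) (\<lambda>x::real. x\<^sup>2) = s" unfolding \<open>s = 0\<close> by (subst i(2)) simp_all
    ultimately show ?thesis unfolding r by (intro conjI)
  qed
  note * = this
  show "integrable (real_gaussian s) (\<lambda>x. x)" by (rule *[THEN conjunct1])
  show "integral\<^sup>L (real_gaussian s) (\<lambda>x. x) = 0" by (rule *[THEN conjunct2, THEN conjunct1])
  show "integrable (real_gaussian s) (\<lambda>x. x\<^sup>2)" by (rule *[THEN conjunct2, THEN conjunct2, THEN conjunct1])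
  show "integral\<^sup>L (real_gaussian s) (\<lambda>x. x\<^sup>2) = s" by (rule *[THEN conjunct2, THEN conjunct2, THEN conjunct2])
qed

text \<open>The finite set of \<open>hs_sq_tail\<close> with a common smallness \<open>d\<close>:
  \<open>card F\<close> times the square of \<open>d\<close> is at most
  \<open>\<epsilon> / 2\<close>, and the tail takes the other half.\<close>

lemma hs_sq_small:
  fixes Q :: "'v::separable_hilbert \<Rightarrow>\<^sub>L 'v" and \<epsilon> C :: real
  assumes Q: "positive_trace_class Q" and e: "\<epsilon> > 0"
  shows "\<exists>F. finite F \<and> (\<exists>d>0. \<forall>L::'v \<Rightarrow>\<^sub>L 'h::separable_hilbert.
    norm L \<le> C \<longrightarrow> (\<forall>f\<in>F. norm (blinfun_apply L f) < d) \<longrightarrow> hs_sq Q L \<le> \<epsilon>)"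
proof -
  obtain F where F: "finite F" "\<And>L::'v \<Rightarrow>\<^sub>L 'h. norm L \<le> C \<Longrightarrow> hs_sq Q L \<le> (\<Sum>f\<in>F. (norm (L f))\<^sup>2) + \<epsilon> / 2"
    using hs_sq_tail[OF Q, of "\<epsilon> / 2" C] e by (auto simp del: sum_nonneg)
  define d where "d = sqrt (\<epsilon> / (2 * (real (card F) + 1)))"
  have d: "d > 0" "d\<^sup>2 = \<epsilon> / (2 * (real (card F) + 1))" using e by (auto simp: d_def)
  have "hs_sq Q L \<le> \<epsilon>" if L: "norm L \<le> C" "\<forall>f\<in>F. norm (blinfun_apply L f) < d" for L :: "'v \<Rightarrow>\<^sub>L 'h"
  proof -
    have "(\<Sum>f\<in>F. (norm (L f))\<^sup>2) \<le> (\<Sum>f\<in>F. d\<^sup>2)"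
      using L(2) by (intro sum_mono power_mono) (auto intro: less_imp_le)
    also have "\<dots> = real (card F) * (\<epsilon> / (2 * (real (card F) + 1)))" by (simp add: d(2))
    also have "\<dots> \<le> \<epsilon> / 2" using e by (simp add: field_simps)
    finally show ?thesis using F(2)[OF L(1)] by linarith
  qed
  then have "\<forall>L::'v \<Rightarrow>\<^sub>L 'h. norm L \<le> C \<longrightarrow> (\<forall>f\<in>F. norm (blinfun_apply L f) < d) \<longrightarrow> hs_sq Q L \<le> \<epsilon>"
    by (intro allI impI)
  then show ?thesis using F(1) d(1) by (intro exI conjI)
qed

text \<open>Replaces the filter of finite subsets by a sequence, so that Fatou can be applied to
  unordered sums.\<close>

lemma countable_finite_exhaustion:
  assumes "countable E"
  shows "\<exists>F. (\<forall>n. finite (F n) \<and> F n \<subseteq> E) \<and> filterlim F (finite_subsets_at_top E) sequentially"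
proof -
  define F where "F n = {e \<in> E. to_nat_on E e < n}" for n
  have inj: "inj_on (to_nat_on E) E" by (rule inj_on_to_nat_on[OF assms])
  have "finite (F n)" for n
    by (rule inj_on_finite[of "to_nat_on E" _ "{..<n}"]) (auto simp: F_def intro: inj_on_subset[OF inj])
  moreover have "F n \<subseteq> E" for n by (auto simp: F_def)
  moreover have "filterlim F (finite_subsets_at_top E) sequentially"
    unfolding filterlim_finite_subsets_at_top
  proof (intro allI impI)
    fix X assume X: "finite X \<and> X \<subseteq> E"
    then obtain N where N: "\<And>e. e \<in> X \<Longrightarrow> to_nat_on E e < N"
      using finite_nat_set_iff_bounded[of "to_nat_on E ` X"] by auto
    show "\<forall>\<^sub>F y in sequentially. finite (F y) \<and> X \<subseteq> F y \<and> F y \<subseteq> E"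
      unfolding eventually_sequentially
      using N X calculation by (intro exI[of _ N]) (force simp: F_def)
  qed
  ultimately show ?thesis by blast
qed

text \<open>Parseval writes the squared norm as a limit of finite coordinate sums, and Fatou passes
  the bound to the limit; second moments of vectors are thereby reduced to those of
  coordinates.\<close>

lemma (in prob_space) nn_integral_norm_sq_le:
  fixes Y :: "'a \<Rightarrow> 'h::separable_hilbert"
  assumes Y: "Y \<in> borel_measurable M"
    and le: "\<And>F. finite F \<Longrightarrow> pairwise orthogonal F \<Longrightarrow> \<forall>h\<in>F. norm h = 1 \<Longrightarrow>
      (\<integral>\<^sup>+\<omega>. ennreal (\<Sum>h\<in>F. (Y \<omega> \<bullet> h)\<^sup>2) \<partial>M) \<le> B"
  shows "(\<integral>\<^sup>+\<omega>. ennreal ((norm (Y \<omega>))\<^sup>2) \<partial>M) \<le> B"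
proof -
  obtain E :: "'h set" where E: "orthonormal_basis E" using orthonormal_basis_exists by blast
  then have on: "pairwise orthogonal E" "\<forall>e\<in>E. norm e = 1" unfolding orthonormal_basis_def by blast+
  obtain F where F: "\<And>n. finite (F n) \<and> F n \<subseteq> E" "filterlim F (finite_subsets_at_top E) sequentially"
    using countable_finite_exhaustion[OF orthonormal_countable[OF on]] by blast
  have lim: "(\<lambda>n. ennreal (\<Sum>h\<in>F n. (Y \<omega> \<bullet> h)\<^sup>2)) \<longlonglongrightarrow> ennreal ((norm (Y \<omega>))\<^sup>2)" for \<omega>
    using filterlim_compose[OF parseval[OF E, of "Y \<omega>", unfolded has_sum_def] F(2)] by (intro tendsto_ennrealI)
  have "(\<integral>\<^sup>+\<omega>. ennreal ((norm (Y \<omega>))\<^sup>2) \<partial>M) = (\<integral>\<^sup>+\<omega>. liminf (\<lambda>n. ennreal (\<Sum>h\<in>F n. (Y \<omega> \<bullet> h)\<^sup>2)) \<partial>M)"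
    by (intro nn_integral_cong) (simp add: lim_imp_Liminf[OF _ lim])
  also have "\<dots> \<le> liminf (\<lambda>n. \<integral>\<^sup>+\<omega>. ennreal (\<Sum>h\<in>F n. (Y \<omega> \<bullet> h)\<^sup>2) \<partial>M)"
    by (intro nn_integral_liminf measurable_compose[OF _ measurable_ennreal] borel_measurable_sum
      borel_measurable_power borel_measurable_inner Y borel_measurable_const)
  also have "\<dots> \<le> limsup (\<lambda>n. \<integral>\<^sup>+\<omega>. ennreal (\<Sum>h\<in>F n. (Y \<omega> \<bullet> h)\<^sup>2) \<partial>M)"
    by (rule Liminf_le_Limsup) simp
  also have "\<dots> \<le> B"
  proof (intro Limsup_bounded always_eventually allI le)
    fix n
    show "finite (F n)" "pairwise orthogonal (F n)" "\<forall>h\<in>F n. norm h = 1"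
      using F(1)[of n] on pairwise_subset[OF on(1), of "F n"] by blast+
  qed
  finally show ?thesis .
qed

context prob_space
begin

context
  fixes T :: real and Q :: "'v::separable_hilbert \<Rightarrow>\<^sub>L 'v" and W :: "real \<Rightarrow> 'a \<Rightarrow> 'v"
  assumes Q: "positive_trace_class Q" and W: "Q_wiener T M Q W"
begin

lemma wiener_measurable: "t \<in> {0..T} \<Longrightarrow> W t \<in> borel_measurable M"
  by (rule W[unfolded Q_wiener_def, THEN conjunct1, rule_format])

lemma Q_nonneg: "0 \<le> Q v \<bullet> v"
  by (rule Q[unfolded positive_trace_class_def positive_op_def, THEN conjunct1, THEN conjunct2, rule_format])

lemma wiener_increment:
  assumes st: "0 \<le> s" "s \<le> t" "t \<le> T"
  shows "integrable M (\<lambda>\<omega>. (W t \<omega> - W s \<omega>) \<bullet> v)" "expectation (\<lambda>\<omega>. (W t \<omega> - W s \<omega>) \<bullet> v) = 0"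
    "integrable M (\<lambda>\<omega>. ((W t \<omega> - W s \<omega>) \<bullet> v)\<^sup>2)"
    "expectation (\<lambda>\<omega>. ((W t \<omega> - W s \<omega>) \<bullet> v)\<^sup>2) = (t - s) * (Q v \<bullet> v)"
proof -
  let ?X = "\<lambda>\<omega>. (W t \<omega> - W s \<omega>) \<bullet> v"
  have m: "?X \<in> borel_measurable M"
    using wiener_measurable[of s] wiener_measurable[of t] st by simp
  have d: "distr M borel ?X = real_gaussian ((t - s) * (Q v \<bullet> v))"
    using W st unfolding Q_wiener_def by blast
  have nn: "0 \<le> (t - s) * (Q v \<bullet> v)" using st Q_nonneg by simp
  note g = real_gaussian_moments[OF nn, folded d]
  show "integrable M ?X" using g(1) integrable_distr_eq[OF m, of "\<lambda>x. x"] by simp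
  show "expectation ?X = 0" using g(2) integral_distr[OF m, of "\<lambda>x. x"] by simp
  show "integrable M (\<lambda>\<omega>. (?X \<omega>)\<^sup>2)" using g(3) integrable_distr_eq[OF m, of "\<lambda>x. x\<^sup>2"] by simp
  show "expectation (\<lambda>\<omega>. (?X \<omega>)\<^sup>2) = (t - s) * (Q v \<bullet> v)" using g(4) integral_distr[OF m, of "\<lambda>x. x\<^sup>2"] by simp
qed

text \<open>Independence and mean zero annihilate the mixed products, so only the variances of the
  individual increments remain.\<close>

lemma increment_sum_second_moment:
  fixes \<tau> :: "nat \<Rightarrow> real" and v :: "nat \<Rightarrow> 'v"
  assumes \<tau>: "\<And>i. i \<le> n \<Longrightarrow> \<tau> i \<in> {0..T}" "\<And>i. i < n \<Longrightarrow> \<tau> i \<le> \<tau> (Suc i)"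
  shows "integrable M (\<lambda>\<omega>. (\<Sum>i<n. (W (\<tau> (Suc i)) \<omega> - W (\<tau> i) \<omega>) \<bullet> v i)\<^sup>2)"
    "expectation (\<lambda>\<omega>. (\<Sum>i<n. (W (\<tau> (Suc i)) \<omega> - W (\<tau> i) \<omega>) \<bullet> v i)\<^sup>2) = (\<Sum>i<n. (\<tau> (Suc i) - \<tau> i) * (Q (v i) \<bullet> v i))"
proof -
  define X where "X i \<omega> = (W (\<tau> (Suc i)) \<omega> - W (\<tau> i) \<omega>) \<bullet> v i" for i \<omega>
  have inc: "integrable M (X i)" "expectation (X i) = 0" "integrable M (\<lambda>\<omega>. X i \<omega> * X i \<omega>)"
    "expectation (\<lambda>\<omega>. X i \<omega> * X i \<omega>) = (\<tau> (Suc i) - \<tau> i) * (Q (v i) \<bullet> v i)" if "i < n" for i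
  proof -
    have i: "i \<le> n" "Suc i \<le> n" using that by simp_all
    have "0 \<le> \<tau> i" "\<tau> i \<le> \<tau> (Suc i)" "\<tau> (Suc i) \<le> T"
      using \<tau>(1)[OF i(1)] \<tau>(1)[OF i(2)] \<tau>(2)[OF that] by simp_all
    note wi = wiener_increment[OF this, of "v i", unfolded power2_eq_square]
    show "integrable M (X i)" unfolding X_def by (rule wi(1))
    show "expectation (X i) = 0" unfolding X_def by (rule wi(2))
    show "integrable M (\<lambda>\<omega>. X i \<omega> * X i \<omega>)" unfolding X_def by (rule wi(3))
    show "expectation (\<lambda>\<omega>. X i \<omega> * X i \<omega>) = (\<tau> (Suc i) - \<tau> i) * (Q (v i) \<bullet> v i)"
      unfolding X_def by (rule wi(4))
  qed
  have "indep_vars (\<lambda>_. borel) (\<lambda>i \<omega>. W (\<tau> (Suc i)) \<omega> - W (\<tau> i) \<omega>) {..<n}"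
    by (rule W[unfolded Q_wiener_def, THEN conjunct2, THEN conjunct2, THEN conjunct2, THEN conjunct1, rule_format])
      (use \<tau> in blast)
  then have ind: "indep_vars (\<lambda>_. borel) X {..<n}"
    unfolding X_def by (rule indep_vars_compose2) simp
  have cross: "integrable M (\<lambda>\<omega>. X i \<omega> * X j \<omega>) \<and> expectation (\<lambda>\<omega>. X i \<omega> * X j \<omega>) = 0" if ij: "i < n" "j < n" "i \<noteq> j" for i j
  proof -
    have ind2: "indep_vars (\<lambda>_. borel) X {i, j}" by (rule indep_vars_subset[OF ind]) (use ij in auto)
    have int: "integrable M (X k)" if "k \<in> {i, j}" for k using that inc(1) ij by auto
    have "integrable M (\<lambda>\<omega>. \<Prod>k\<in>{i, j}. X k \<omega>)" "expectation (\<lambda>\<omega>. \<Prod>k\<in>{i, j}. X k \<omega>) = (\<Prod>k\<in>{i, j}. expectation (X k))"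
      by (rule indep_vars_integrable[OF _ ind2 int] indep_vars_lebesgue_integral[OF _ ind2 int], simp_all)+
    then show ?thesis using ij inc(2) by simp
  qed
  have sq: "(\<Sum>i<n. X i \<omega>)\<^sup>2 = (\<Sum>i<n. \<Sum>j<n. X i \<omega> * X j \<omega>)" for \<omega>
    by (simp add: power2_eq_square sum_product)
  have int: "integrable M (\<lambda>\<omega>. X i \<omega> * X j \<omega>)" if "i < n" "j < n" for i j
    using cross inc(3) that by (cases "i = j") auto
  show "integrable M (\<lambda>\<omega>. (\<Sum>i<n. (W (\<tau> (Suc i)) \<omega> - W (\<tau> i) \<omega>) \<bullet> v i)\<^sup>2)"
    unfolding X_def[symmetric] sq by (intro Bochner_Integration.integrable_sum int) auto
  have "expectation (\<lambda>\<omega>. \<Sum>i<n. \<Sum>j<n. X i \<omega> * X j \<omega>) = (\<Sum>i<n. \<Sum>j<n. expectation (\<lambda>\<omega>. X i \<omega> * X j \<omega>))"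
    by (subst Bochner_Integration.integral_sum, auto intro!: Bochner_Integration.integrable_sum int sum.cong
      Bochner_Integration.integral_sum)
  also have "\<dots> = (\<Sum>i<n. \<Sum>j<n. if j = i then (\<tau> (Suc i) - \<tau> i) * (Q (v i) \<bullet> v i) else 0)"
    by (intro sum.cong refl) (use cross inc(4) in auto)
  also have "\<dots> = (\<Sum>i<n. (\<tau> (Suc i) - \<tau> i) * (Q (v i) \<bullet> v i))" by simp
  finally show "expectation (\<lambda>\<omega>. (\<Sum>i<n. (W (\<tau> (Suc i)) \<omega> - W (\<tau> i) \<omega>) \<bullet> v i)\<^sup>2) = (\<Sum>i<n. (\<tau> (Suc i) - \<tau> i) * (Q (v i) \<bullet> v i))"
    unfolding X_def[symmetric] sq .
qed

text \<open>The upper half of the Ito isometry for deterministic step operators. Testing with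
  \<open>h\<close> turns the sum into scalar increments along \<open>adj (L i) h\<close>; after
  summing over a finite orthonormal set, \<open>sum_gram_le_hs_sq\<close> bounds the Gram
  sums.\<close>

lemma increment_sum_isometry:
  fixes \<tau> :: "nat \<Rightarrow> real" and L :: "nat \<Rightarrow> 'v \<Rightarrow>\<^sub>L 'h::separable_hilbert"
  assumes \<tau>: "\<And>i. i \<le> n \<Longrightarrow> \<tau> i \<in> {0..T}" "\<And>i. i < n \<Longrightarrow> \<tau> i \<le> \<tau> (Suc i)"
  shows "(\<integral>\<^sup>+\<omega>. ennreal ((norm (\<Sum>i<n. L i (W (\<tau> (Suc i)) \<omega> - W (\<tau> i) \<omega>)))\<^sup>2) \<partial>M)
    \<le> ennreal (\<Sum>i<n. (\<tau> (Suc i) - \<tau> i) * hs_sq Q (L i))"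
proof -
  define D where "D i \<omega> = W (\<tau> (Suc i)) \<omega> - W (\<tau> i) \<omega>" for i \<omega>
  define Y where "Y \<omega> = (\<Sum>i<n. L i (D i \<omega>))" for \<omega>
  have D: "D i \<in> borel_measurable M" if "i < n" for i
    unfolding D_def using that by (intro borel_measurable_diff wiener_measurable \<tau>(1)) simp_all
  have Y: "Y \<in> borel_measurable M"
    unfolding Y_def
    by (intro borel_measurable_sum borel_measurable_continuous_on[of "blinfun_apply (L _)"] D)
      (auto intro: linear_continuous_on blinfun.bounded_linear_right)
  have eq: "Y \<omega> \<bullet> h = (\<Sum>i<n. D i \<omega> \<bullet> adj (L i) h)" for h \<omega>
    by (simp add: Y_def inner_sum_left adj_inner)
  have mom: "integrable M (\<lambda>\<omega>. (Y \<omega> \<bullet> h)\<^sup>2)"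
    "expectation (\<lambda>\<omega>. (Y \<omega> \<bullet> h)\<^sup>2) = (\<Sum>i<n. (\<tau> (Suc i) - \<tau> i) * (Q (adj (L i) h) \<bullet> adj (L i) h))" for h
    unfolding eq D_def
    using increment_sum_second_moment[of n \<tau> "\<lambda>i. adj (L i) h", OF \<tau>] by simp_all
  have "(\<integral>\<^sup>+\<omega>. ennreal ((norm (Y \<omega>))\<^sup>2) \<partial>M) \<le> ennreal (\<Sum>i<n. (\<tau> (Suc i) - \<tau> i) * hs_sq Q (L i))"
  proof (rule nn_integral_norm_sq_le[OF Y])
    fix F :: "'h set" assume F: "finite F" "pairwise orthogonal F" "\<forall>h\<in>F. norm h = 1"
    have "(\<integral>\<^sup>+\<omega>. ennreal (\<Sum>h\<in>F. (Y \<omega> \<bullet> h)\<^sup>2) \<partial>M) = ennreal (expectation (\<lambda>\<omega>. \<Sum>h\<in>F. (Y \<omega> \<bullet> h)\<^sup>2))"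
      by (intro nn_integral_eq_integral Bochner_Integration.integrable_sum mom(1) AE_I2 sum_nonneg) simp
    also have "expectation (\<lambda>\<omega>. \<Sum>h\<in>F. (Y \<omega> \<bullet> h)\<^sup>2) = (\<Sum>h\<in>F. expectation (\<lambda>\<omega>. (Y \<omega> \<bullet> h)\<^sup>2))"
      by (rule Bochner_Integration.integral_sum) (rule mom(1))
    also have "\<dots> = (\<Sum>i<n. (\<tau> (Suc i) - \<tau> i) * (\<Sum>h\<in>F. Q (adj (L i) h) \<bullet> adj (L i) h))"
      unfolding mom(2) by (subst sum.swap) (simp add: sum_distrib_left)
    also have "\<dots> \<le> (\<Sum>i<n. (\<tau> (Suc i) - \<tau> i) * hs_sq Q (L i))"
      by (intro sum_mono mult_left_mono sum_gram_le_hs_sq[OF Q F]) (use \<tau>(2) in simp)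
    finally show "(\<integral>\<^sup>+\<omega>. ennreal (\<Sum>h\<in>F. (Y \<omega> \<bullet> h)\<^sup>2) \<partial>M)
      \<le> ennreal (\<Sum>i<n. (\<tau> (Suc i) - \<tau> i) * hs_sq Q (L i))" by (simp add: ennreal_leI)
  qed
  then show ?thesis unfolding Y_def D_def .
qed

end

end

section \<open>Mean-square limits\<close>

lemma ennreal_tendsto_0I:
  fixes u :: "nat \<Rightarrow> ennreal"
  assumes "\<And>\<epsilon>. \<epsilon> > 0 \<Longrightarrow> \<exists>m0. \<forall>m\<ge>m0. u m \<le> ennreal \<epsilon>"
  shows "u \<longlonglongrightarrow> 0"
proof (rule order_tendstoI)
  fix a :: ennreal assume "0 < a"
  then obtain z where z: "0 < z" "z < a" using dense by blast
  then obtain e where e: "z = ennreal e" "0 \<le> e" by (cases z) auto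
  then have "e > 0" using z(1) by (simp add: ennreal_less_zero_iff)
  from assms[OF this] obtain m0 where "\<forall>m\<ge>m0. u m \<le> ennreal e" by (rule exE)
  then show "\<forall>\<^sub>F m in sequentially. u m < a"
    unfolding eventually_sequentially using z(2) e(1) by (intro exI[of _ m0]) (auto intro: le_less_trans)
qed auto

lemma norm_add_sq_le:
  fixes x y :: "'a::real_normed_vector"
  shows "(norm (x + y))\<^sup>2 \<le> 2 * (norm x)\<^sup>2 + 2 * (norm y)\<^sup>2"
proof -
  have "(norm (x + y))\<^sup>2 \<le> (norm x + norm y)\<^sup>2" by (intro power_mono norm_triangle_ineq) simp
  also have "\<dots> \<le> 2 * (norm x)\<^sup>2 + 2 * (norm y)\<^sup>2"
    using sum_squares_bound[of "norm x" "norm y"] by (simp add: power2_sum)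
  finally show ?thesis .
qed

abbreviation l2sq :: "'w measure \<Rightarrow> ('w \<Rightarrow> 'h::separable_hilbert) \<Rightarrow> ennreal" where
  "l2sq P f \<equiv> (\<integral>\<^sup>+\<omega>. ennreal ((norm (f \<omega>))\<^sup>2) \<partial>P)"

lemma measurable_norm_sq:
  fixes f :: "'w \<Rightarrow> 'h::separable_hilbert"
  shows "f \<in> borel_measurable P \<Longrightarrow> (\<lambda>\<omega>. ennreal ((norm (f \<omega>))\<^sup>2)) \<in> borel_measurable P"
  by measurable

text \<open>Stands in for the triangle inequality while staying with squared norms; the price is a
  factor 2 each time, which fractions such as \<open>\<epsilon> / 4\<close> later
  compensate.\<close>

lemma l2sq_add_le:
  assumes "f \<in> borel_measurable P" "g \<in> borel_measurable P" "\<And>\<omega>. h \<omega> = f \<omega> + g \<omega>"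
    "l2sq P f \<le> ennreal a" "l2sq P g \<le> ennreal b" "0 \<le> a" "0 \<le> b"
  shows "l2sq P h \<le> ennreal (2 * a + 2 * b)"
proof -
  have "l2sq P h \<le> (\<integral>\<^sup>+\<omega>. 2 * ennreal ((norm (f \<omega>))\<^sup>2) + 2 * ennreal ((norm (g \<omega>))\<^sup>2) \<partial>P)"
  proof (rule nn_integral_mono)
    fix \<omega>
    have "ennreal ((norm (h \<omega>))\<^sup>2) \<le> ennreal (2 * (norm (f \<omega>))\<^sup>2 + 2 * (norm (g \<omega>))\<^sup>2)"
      unfolding assms(3) by (intro ennreal_leI norm_add_sq_le)
    then show "ennreal ((norm (h \<omega>))\<^sup>2) \<le> 2 * ennreal ((norm (f \<omega>))\<^sup>2) + 2 * ennreal ((norm (g \<omega>))\<^sup>2)"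
      by (simp add: ennreal_plus ennreal_mult)
  qed
  also have "\<dots> = 2 * l2sq P f + 2 * l2sq P g"
  proof -
    have [measurable]: "f \<in> borel_measurable P" "g \<in> borel_measurable P" by fact+
    have "(\<lambda>\<omega>. 2 * ennreal ((norm (f \<omega>))\<^sup>2)) \<in> borel_measurable P" "(\<lambda>\<omega>. 2 * ennreal ((norm (g \<omega>))\<^sup>2)) \<in> borel_measurable P"
      by measurable
    then show ?thesis
      by (subst nn_integral_add) (simp_all only: nn_integral_cmult[OF measurable_norm_sq[OF assms(1)]] nn_integral_cmult[OF measurable_norm_sq[OF assms(2)]])
  qed
  also have "\<dots> \<le> 2 * ennreal a + 2 * ennreal b" by (intro add_mono mult_left_mono assms) auto
  also have "\<dots> = ennreal (2 * a + 2 * b)" using assms(6,7) by (simp add: ennreal_plus ennreal_mult)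
  finally show ?thesis .
qed

lemma l2sq_limit_unique:
  fixes f g :: "'w \<Rightarrow> 'h::separable_hilbert"
  assumes m: "f \<in> borel_measurable P" "g \<in> borel_measurable P" "\<And>n::nat. F n \<in> borel_measurable P"
    and f: "\<And>\<epsilon>. \<epsilon> > 0 \<Longrightarrow> \<exists>m0. \<forall>m\<ge>m0. l2sq P (\<lambda>\<omega>. F m \<omega> - f \<omega>) \<le> ennreal \<epsilon>"
    and g: "\<And>\<epsilon>. \<epsilon> > 0 \<Longrightarrow> \<exists>m0. \<forall>m\<ge>m0. l2sq P (\<lambda>\<omega>. F m \<omega> - g \<omega>) \<le> ennreal \<epsilon>"
  shows "AE \<omega> in P. f \<omega> = g \<omega>"
proof -
  have "l2sq P (\<lambda>\<omega>. f \<omega> - g \<omega>) \<le> 0 + ennreal \<epsilon>" if e: "\<epsilon> > 0" for \<epsilon>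
  proof -
    from f[of "\<epsilon> / 4"] obtain m1 where m1: "\<forall>m\<ge>m1. l2sq P (\<lambda>\<omega>. F m \<omega> - f \<omega>) \<le> ennreal (\<epsilon> / 4)" using e by auto
    from g[of "\<epsilon> / 4"] obtain m2 where m2: "\<forall>m\<ge>m2. l2sq P (\<lambda>\<omega>. F m \<omega> - g \<omega>) \<le> ennreal (\<epsilon> / 4)" using e by auto
    let ?m = "max m1 m2"
    have 1: "l2sq P (\<lambda>\<omega>. f \<omega> - F ?m \<omega>) \<le> ennreal (\<epsilon> / 4)" using m1[rule_format, of ?m] by (simp add: norm_minus_commute)
    have 2: "l2sq P (\<lambda>\<omega>. F ?m \<omega> - g \<omega>) \<le> ennreal (\<epsilon> / 4)" using m2[rule_format, of ?m] by simp
    have "l2sq P (\<lambda>\<omega>. f \<omega> - g \<omega>) \<le> ennreal (2 * (\<epsilon> / 4) + 2 * (\<epsilon> / 4))"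
      by (rule l2sq_add_le[OF _ _ _ 1 2]) (use m e in auto)
    then show ?thesis using e by simp
  qed
  note le = this
  have "l2sq P (\<lambda>\<omega>. f \<omega> - g \<omega>) \<le> 0" by (rule ennreal_le_epsilon) (rule le)
  then have "l2sq P (\<lambda>\<omega>. f \<omega> - g \<omega>) = 0" by simp
  moreover have "(\<lambda>\<omega>. ennreal ((norm (f \<omega> - g \<omega>))\<^sup>2)) \<in> borel_measurable P"
    by (intro measurable_norm_sq borel_measurable_diff m)
  ultimately have "AE \<omega> in P. ennreal ((norm (f \<omega> - g \<omega>))\<^sup>2) = 0" by (simp add: nn_integral_0_iff_AE)
  then show ?thesis by eventually_elim simp
qed

text \<open>Completeness of mean-square convergence with two extra features: one subsequence serves
  all indices \<open>i\<close>, and the limit is the literal pointwise \<open>lim\<close> along it.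
  With time as index, the limit is then jointly measurable as soon as the approximants are.\<close>

lemma (in prob_space) l2sq_subseq_limit:
  fixes X :: "nat \<Rightarrow> 'i \<Rightarrow> 'a \<Rightarrow> 'h::separable_hilbert"
  assumes meas: "\<And>m i. i \<in> I \<Longrightarrow> X m i \<in> borel_measurable M"
    and cauchy: "\<And>\<epsilon>. \<epsilon> > 0 \<Longrightarrow> \<exists>m0. \<forall>i\<in>I. \<forall>m\<ge>m0. \<forall>m'\<ge>m. l2sq M (\<lambda>\<omega>. X m i \<omega> - X m' i \<omega>) \<le> ennreal \<epsilon>"
  shows "\<exists>r. strict_mono (r::nat \<Rightarrow> nat) \<and> (\<forall>\<epsilon>>0. \<exists>m0. \<forall>i\<in>I. \<forall>m\<ge>m0.
    l2sq M (\<lambda>\<omega>. X m i \<omega> - lim (\<lambda>k. X (r k) i \<omega>)) \<le> ennreal \<epsilon>)"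
proof -
  \<comment> \<open>A rate of \<open>(1/4)^k\<close> for the squares makes the first moments
    summable, at the rate \<open>(1/2)^k\<close>.\<close>
  have "\<exists>g. \<forall>k. \<forall>i\<in>I. \<forall>m\<ge>g k. \<forall>m'\<ge>m. l2sq M (\<lambda>\<omega>. X m i \<omega> - X m' i \<omega>) \<le> ennreal ((1/4)^k)"
    by (intro choice allI cauchy) simp
  then obtain g where g: "\<And>k i m m'. i \<in> I \<Longrightarrow> m \<ge> g k \<Longrightarrow> m' \<ge> m \<Longrightarrow> l2sq M (\<lambda>\<omega>. X m i \<omega> - X m' i \<omega>) \<le> ennreal ((1/4)^k)"
    by blast
  \<comment> \<open>Partial sums of \<open>g\<close> plus \<open>k\<close>: strictly increasing and
    above \<open>g k\<close>.\<close>
  define r where "r k = (\<Sum>j\<le>k. g j) + k" for k :: nat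
  have r: "strict_mono r" by (rule strict_monoI_Suc) (simp add: r_def)
  have rg: "g k \<le> r k" for k
  proof -
    have "g k \<le> (\<Sum>j\<le>k. g j)" by (rule member_le_sum) auto
    then show ?thesis by (simp add: r_def)
  qed
  have step: "l2sq M (\<lambda>\<omega>. X (r k) i \<omega> - X (r (Suc k)) i \<omega>) \<le> ennreal ((1/4)^k)" if "i \<in> I" for i k
    by (rule g[OF that rg]) (use r in \<open>simp add: strict_mono_less_eq\<close>)
  have conv: "AE \<omega> in M. (\<lambda>k. X (r k) i \<omega>) \<longlonglongrightarrow> lim (\<lambda>k. X (r k) i \<omega>)" if i: "i \<in> I" for i
  proof -
    define D where "D k \<omega> = norm (X (r (Suc k)) i \<omega> - X (r k) i \<omega>)" for k \<omega>
    have [measurable]: "X m i \<in> borel_measurable M" for m by (rule meas[OF i])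
    have D[measurable]: "D k \<in> borel_measurable M" for k unfolding D_def by measurable
    have Dk: "(\<integral>\<^sup>+\<omega>. ennreal (D k \<omega>) \<partial>M) \<le> ennreal ((1/2)^k)" for k
    proof -
      have "(\<integral>\<^sup>+\<omega>. ennreal (D k \<omega>) \<partial>M) \<le> (\<integral>\<^sup>+\<omega>. ennreal (2^k/2) * ennreal ((D k \<omega>)\<^sup>2) + ennreal ((1/2)^k/2) \<partial>M)"
      proof (rule nn_integral_mono)
        fix \<omega>
        \<comment> \<open>The expanded square is a weighted arithmetic-geometric inequality, with
          the weight balanced so that both parts of the first moment become half of
          \<open>(1/2)^k\<close>.\<close>
        have "0 \<le> 2^k / 2 * (D k \<omega> - (1/2)^k)\<^sup>2" by simp
        also have "\<dots> = 2^k/2 * (D k \<omega>)\<^sup>2 + (1/2)^k/2 - D k \<omega>"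
          by (simp add: power2_diff power2_eq_square algebra_simps power_one_over)
        finally have "ennreal (D k \<omega>) \<le> ennreal (2^k/2 * (D k \<omega>)\<^sup>2 + (1/2)^k/2)" by (intro ennreal_leI) simp
        also have "ennreal (2^k/2 * (D k \<omega>)\<^sup>2 + (1/2)^k/2) = ennreal (2^k/2) * ennreal ((D k \<omega>)\<^sup>2) + ennreal ((1/2)^k/2)"
          by (subst ennreal_plus) (simp_all del: times_divide_eq_left add: ennreal_mult)
        finally show "ennreal (D k \<omega>) \<le> ennreal (2^k/2) * ennreal ((D k \<omega>)\<^sup>2) + ennreal ((1/2)^k/2)" .
      qed
      also have "\<dots> = ennreal (2^k/2) * (\<integral>\<^sup>+\<omega>. ennreal ((D k \<omega>)\<^sup>2) \<partial>M) + ennreal ((1/2)^k/2)"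
        using D[of k] by (subst nn_integral_add) (auto simp: nn_integral_cmult emeasure_space_1)
      also have "\<dots> \<le> ennreal (2^k/2) * ennreal ((1/4)^k) + ennreal ((1/2)^k/2)"
        using step[OF i, of k] by (intro add_mono mult_left_mono) (auto simp: D_def norm_minus_commute)
      also have "\<dots> = ennreal (2^k/2 * (1/4)^k + (1/2)^k/2)"
        by (subst ennreal_plus) (simp_all del: times_divide_eq_left add: ennreal_mult)
      also have "2^k/2 * (1/4)^k + (1/2)^k/2 = ((1/2)^k :: real)"
        by (simp add: power_mult_distrib[symmetric])
      finally show ?thesis .
    qed
    have "(\<integral>\<^sup>+\<omega>. (\<Sum>k. ennreal (D k \<omega>)) \<partial>M) = (\<Sum>k. \<integral>\<^sup>+\<omega>. ennreal (D k \<omega>) \<partial>M)"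
      using D by (intro nn_integral_suminf) simp
    also have "\<dots> \<le> (\<Sum>k. ennreal ((1/2)^k))" by (intro suminf_le Dk) auto
    also have "\<dots> = ennreal (\<Sum>k. (1/2)^k)" by (intro suminf_ennreal2) auto
    also have "\<dots> < \<infinity>" by simp
    finally have "AE \<omega> in M. (\<Sum>k. ennreal (D k \<omega>)) \<noteq> \<infinity>"
      using D by (intro nn_integral_noteq_infinite) (auto intro!: borel_measurable_suminf)
    then show ?thesis
    proof eventually_elim
      case (elim \<omega>)
      then have "summable (\<lambda>k. D k \<omega>)" by (intro summable_suminf_not_top) (auto simp: D_def)
      then have "summable (\<lambda>k. X (r (Suc k)) i \<omega> - X (r k) i \<omega>)" unfolding D_def by (rule summable_norm_cancel)
      then have "(\<lambda>n. \<Sum>k<n. X (r (Suc k)) i \<omega> - X (r k) i \<omega>) \<longlonglongrightarrow> (\<Sum>k. X (r (Suc k)) i \<omega> - X (r k) i \<omega>)"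
        by (rule summable_LIMSEQ)
      then have "(\<lambda>n. X (r n) i \<omega> - X (r 0) i \<omega>) \<longlonglongrightarrow> (\<Sum>k. X (r (Suc k)) i \<omega> - X (r k) i \<omega>)"
        by (simp only: sum_lessThan_telescope[of "\<lambda>k. X (r k) i \<omega>"])
      then have "(\<lambda>n. (X (r n) i \<omega> - X (r 0) i \<omega>) + X (r 0) i \<omega>) \<longlonglongrightarrow> (\<Sum>k. X (r (Suc k)) i \<omega> - X (r k) i \<omega>) + X (r 0) i \<omega>"
        by (intro tendsto_add tendsto_const)
      then have "convergent (\<lambda>n. X (r n) i \<omega>)" unfolding convergent_def by auto
      then show ?case by (simp add: convergent_LIMSEQ_iff)
    qed
  qed
  have "\<exists>m0. \<forall>i\<in>I. \<forall>m\<ge>m0. l2sq M (\<lambda>\<omega>. X m i \<omega> - lim (\<lambda>k. X (r k) i \<omega>)) \<le> ennreal \<epsilon>" if e: "\<epsilon> > 0" for \<epsilon>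
  proof -
    from cauchy[OF e] obtain m0 where m0: "\<forall>i\<in>I. \<forall>m\<ge>m0. \<forall>m'\<ge>m. l2sq M (\<lambda>\<omega>. X m i \<omega> - X m' i \<omega>) \<le> ennreal \<epsilon>"
      by (rule exE)
    have "l2sq M (\<lambda>\<omega>. X m i \<omega> - lim (\<lambda>k. X (r k) i \<omega>)) \<le> ennreal \<epsilon>" if i: "i \<in> I" and m: "m \<ge> m0" for i m
    proof -
      \<comment> \<open>Fatou along the subsequence: all its late members are within the Cauchy
        bound of \<open>X m i\<close>.\<close>
      have "l2sq M (\<lambda>\<omega>. X m i \<omega> - lim (\<lambda>k. X (r k) i \<omega>))
          \<le> (\<integral>\<^sup>+\<omega>. liminf (\<lambda>k. ennreal ((norm (X m i \<omega> - X (r k) i \<omega>))\<^sup>2)) \<partial>M)"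
      proof (rule nn_integral_mono_AE)
        show "AE \<omega> in M. ennreal ((norm (X m i \<omega> - lim (\<lambda>k. X (r k) i \<omega>)))\<^sup>2)
            \<le> liminf (\<lambda>k. ennreal ((norm (X m i \<omega> - X (r k) i \<omega>))\<^sup>2))"
          using conv[OF i]
        proof eventually_elim
          case (elim \<omega>)
          then have "(\<lambda>k. ennreal ((norm (X m i \<omega> - X (r k) i \<omega>))\<^sup>2)) \<longlonglongrightarrow> ennreal ((norm (X m i \<omega> - lim (\<lambda>k. X (r k) i \<omega>)))\<^sup>2)"
            by (intro tendsto_ennrealI tendsto_intros)
          from lim_imp_Liminf[OF _ this] show ?case by (simp only: order_refl sequentially_bot not_False_eq_True)
        qed
      qed
      also have "\<dots> \<le> liminf (\<lambda>k. l2sq M (\<lambda>\<omega>. X m i \<omega> - X (r k) i \<omega>))"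
        by (intro nn_integral_liminf measurable_norm_sq borel_measurable_diff meas i)
      also have "\<dots> \<le> limsup (\<lambda>k. l2sq M (\<lambda>\<omega>. X m i \<omega> - X (r k) i \<omega>))" by (rule Liminf_le_Limsup) simp
      also have "\<dots> \<le> ennreal \<epsilon>"
      proof (rule Limsup_bounded)
        have "r k \<ge> m" if "k \<ge> m" for k using strict_mono_imp_increasing[OF r, of k] that by linarith
        then show "\<forall>\<^sub>F k in sequentially. l2sq M (\<lambda>\<omega>. X m i \<omega> - X (r k) i \<omega>) \<le> ennreal \<epsilon>"
          unfolding eventually_sequentially using m0 i m by (intro exI[of _ m]) blast
      qed
      finally show ?thesis .
    qed
    then show ?thesis by (intro exI[of _ m0] ballI allI impI)
  qed
  then show ?thesis using r by (intro exI[of _ r] conjI allI impI)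
qed

section \<open>Dyadic Wiener sums\<close>

definition dyad :: "real \<Rightarrow> nat \<Rightarrow> nat \<Rightarrow> real" where
  "dyad T m k = T * real k / 2 ^ m"

lemma dyad_Suc: "dyad T m (Suc k) - dyad T m k = T / 2 ^ m"
  by (simp add: dyad_def field_simps)

lemma dyad_mono: "0 \<le> T \<Longrightarrow> j \<le> k \<Longrightarrow> dyad T m j \<le> dyad T m k"
  by (simp add: dyad_def divide_right_mono mult_left_mono)

lemma dyad_range: "0 \<le> T \<Longrightarrow> k \<le> 2 ^ m \<Longrightarrow> dyad T m k \<in> {0..T}"
proof -
  assume T: "0 \<le> T" and k: "k \<le> 2 ^ m"
  have "real k \<le> 2 ^ m" using k by (metis of_nat_le_iff of_nat_numeral of_nat_power)
  then have "T * real k \<le> T * 2 ^ m" using T by (intro mult_left_mono)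
  then show ?thesis using T by (simp add: dyad_def divide_le_eq)
qed

lemma dyad_refine: "m \<le> m' \<Longrightarrow> dyad T m' (k * 2 ^ (m' - m)) = dyad T m k"
proof -
  assume "m \<le> m'"
  then have "(2::real) ^ m' = 2 ^ m * 2 ^ (m' - m)" by (metis le_add_diff_inverse power_add)
  then show ?thesis by (simp add: dyad_def)
qed

lemma sum_div_group:
  fixes g :: "nat \<Rightarrow> real"
  assumes "0 < d"
  shows "(\<Sum>j<n * d. g (j div d)) = real d * (\<Sum>k<n. g k)"
proof -
  have "(\<Sum>j<n * d. g (j div d)) = (\<Sum>k<n. \<Sum>j\<in>{k * d..<k * d + d}. g (j div d))"
    by (rule sum.nat_group[symmetric])
  also have "\<dots> = (\<Sum>k<n. \<Sum>j\<in>{k * d..<k * d + d}. g k)"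
  proof (intro sum.cong refl)
    fix k j assume "j \<in> {k * d..<k * d + d}"
    then have "j div d = k" by (intro div_nat_eqI) (auto simp: mult.commute)
    then show "g (j div d) = g k" by simp
  qed
  finally show ?thesis by (simp add: sum_distrib_left)
qed

text \<open>Cells of one grid have disjoint interiors, so at most one contains \<open>a\<close>
  inside. This limits the error at each end of a time window to a single cell.\<close>

lemma straddle_count:
  assumes T: "0 < T"
  shows "(\<Sum>k<n. of_bool (dyad T m k < a \<and> a < dyad T m (Suc k))) \<le> (1::real)"
proof -
  let ?A = "{k\<in>{..<n}. dyad T m k < a \<and> a < dyad T m (Suc k)}"
  have "j = k" if "j \<in> ?A" "k \<in> ?A" for j k
  proof (rule ccontr)
    assume "j \<noteq> k"
    then consider "Suc j \<le> k" | "Suc k \<le> j" by linarith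
    then show False
      using that dyad_mono[of T "Suc j" k m] dyad_mono[of T "Suc k" j m] T by cases auto
  qed
  then have "card ?A \<le> 1" by (simp add: card_le_Suc0_iff_eq)
  moreover have "(\<Sum>k<n. of_bool (dyad T m k < a \<and> a < dyad T m (Suc k))) = real (card ?A)"
    by (simp add: of_bool_def sum.If_cases Int_def)
  ultimately show ?thesis by simp
qed

lemma hs_sq_zero: "positive_trace_class Q \<Longrightarrow> hs_sq Q 0 = 0"
  by (simp add: hs_sq_def)

lemma hs_sq_minus: "positive_trace_class Q \<Longrightarrow> hs_sq Q (- L) = hs_sq Q L"
  by (simp add: hs_sq_def blinfun.bilinear_simps)

text \<open>Right end points are used as evaluation points: then the jump of the solution at
  \<open>dyad T m (Suc k)\<close> satisfies the mild equation exactly, without a discretisation error.\<close>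

definition wind :: "real \<Rightarrow> real \<Rightarrow> real \<Rightarrow> (real \<Rightarrow> 'v::separable_hilbert \<Rightarrow>\<^sub>L 'h::separable_hilbert) \<Rightarrow> nat \<Rightarrow> nat \<Rightarrow> 'v \<Rightarrow>\<^sub>L 'h" where
  "wind T a b \<Phi> m k = (if a \<le> dyad T m k \<and> dyad T m (Suc k) \<le> b then \<Phi> (dyad T m (Suc k)) else 0)"

text \<open>The modulus is given vector by vector, but finitely many vectors control
  \<open>hs_sq\<close> on a norm-bounded family, so the smallest of finitely many moduli works.
  Uniformity in \<open>i\<close> is carried along because the evolution family supplies one
  integrand for each end time.\<close>

lemma hs_sq_modulus:
  fixes \<Phi> :: "'i \<Rightarrow> real \<Rightarrow> 'v::separable_hilbert \<Rightarrow>\<^sub>L 'h::separable_hilbert"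
  assumes Q: "positive_trace_class Q"
    and C: "\<And>i r. i \<in> I \<Longrightarrow> r \<in> J i \<Longrightarrow> norm (\<Phi> i r) \<le> C"
    and mod: "\<And>v \<epsilon>. \<epsilon> > 0 \<Longrightarrow> \<exists>\<delta>>0. \<forall>i\<in>I. \<forall>r\<in>J i. \<forall>r'\<in>J i. \<bar>r - r'\<bar> < \<delta> \<longrightarrow> norm (\<Phi> i r v - \<Phi> i r' v) < \<epsilon>"
    and e: "\<epsilon> > 0"
  shows "\<exists>\<delta>>0. \<forall>i\<in>I. \<forall>r\<in>J i. \<forall>r'\<in>J i. \<bar>r - r'\<bar> < \<delta> \<longrightarrow> hs_sq Q (\<Phi> i r - \<Phi> i r') \<le> \<epsilon>"
proof -
  obtain F d where F: "finite F" "d > 0"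
    "\<And>L::'v \<Rightarrow>\<^sub>L 'h. norm L \<le> 2 * C \<Longrightarrow> (\<forall>f\<in>F. norm (blinfun_apply L f) < d) \<Longrightarrow> hs_sq Q L \<le> \<epsilon>"
    using hs_sq_small[OF Q e, of "2 * C", where 'h = 'h] by metis
  have "\<forall>v. \<exists>\<delta>. \<delta> > 0 \<and> (\<forall>i\<in>I. \<forall>r\<in>J i. \<forall>r'\<in>J i. \<bar>r - r'\<bar> < \<delta> \<longrightarrow> norm (\<Phi> i r v - \<Phi> i r' v) < d)"
    using mod[OF F(2)] by blast
  from choice[OF this] obtain \<delta> where \<delta>': "\<forall>v. \<delta> v > 0 \<and> (\<forall>i\<in>I. \<forall>r\<in>J i. \<forall>r'\<in>J i. \<bar>r - r'\<bar> < \<delta> v \<longrightarrow> norm (\<Phi> i r v - \<Phi> i r' v) < d)"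
    by (rule exE)
  note \<delta> = \<delta>'[rule_format, THEN conjunct1] \<delta>'[rule_format, THEN conjunct2, rule_format]
  define \<Delta> where "\<Delta> = Min (insert 1 (\<delta> ` F))"
  have \<Delta>: "\<Delta> > 0" "\<And>f. f \<in> F \<Longrightarrow> \<Delta> \<le> \<delta> f"
    unfolding \<Delta>_def using F(1) \<delta>(1) by (auto simp: Min_gr_iff)
  have "hs_sq Q (\<Phi> i r - \<Phi> i r') \<le> \<epsilon>"
    if i: "i \<in> I" and r: "r \<in> J i" "r' \<in> J i" "\<bar>r - r'\<bar> < \<Delta>" for i r r'
  proof (rule F(3))
    show "norm (\<Phi> i r - \<Phi> i r') \<le> 2 * C"
      using norm_triangle_ineq4[of "\<Phi> i r" "\<Phi> i r'"] C[OF i r(1)] C[OF i r(2)] by linarith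
    show "\<forall>f\<in>F. norm (blinfun_apply (\<Phi> i r - \<Phi> i r') f) < d"
    proof
      fix f assume f: "f \<in> F"
      have "\<bar>r - r'\<bar> < \<delta> f" using r(3) \<Delta>(2)[OF f] by linarith
      from \<delta>(2)[OF i r(1,2) this] show "norm (blinfun_apply (\<Phi> i r - \<Phi> i r') f) < d"
        by (simp add: blinfun.bilinear_simps)
    qed
  qed
  then show ?thesis using \<Delta>(1) by (intro exI[of _ \<Delta>] conjI ballI impI)
qed

context prob_space
begin

context
  fixes T :: real and Q :: "'v::separable_hilbert \<Rightarrow>\<^sub>L 'v" and W :: "real \<Rightarrow> 'a \<Rightarrow> 'v"
  assumes T: "0 < T" and Q: "positive_trace_class Q" and W: "Q_wiener T M Q W"
begin

definition incr :: "nat \<Rightarrow> nat \<Rightarrow> 'a \<Rightarrow> 'v" where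
  "incr m k \<omega> = W (dyad T m (Suc k)) \<omega> - W (dyad T m k) \<omega>"

definition dsum :: "nat \<Rightarrow> (nat \<Rightarrow> 'v \<Rightarrow>\<^sub>L 'h::separable_hilbert) \<Rightarrow> 'a \<Rightarrow> 'h" where
  "dsum m L \<omega> = (\<Sum>k<2^m. L k (incr m k \<omega>))"

lemma incr_measurable: "k < 2 ^ m \<Longrightarrow> incr m k \<in> borel_measurable M"
  unfolding incr_def[abs_def] using T
  by (intro borel_measurable_diff wiener_measurable[OF Q W] dyad_range) auto

lemma blinfun_measurable:
  fixes L :: "'b::separable_hilbert \<Rightarrow>\<^sub>L 'h::separable_hilbert"
  shows "f \<in> borel_measurable N \<Longrightarrow> (\<lambda>\<omega>. L (f \<omega>)) \<in> borel_measurable N"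
  by (rule borel_measurable_continuous_on[OF linear_continuous_on[OF blinfun.bounded_linear_right]])

lemma dsum_measurable: "dsum m L \<in> borel_measurable M"
  unfolding dsum_def[abs_def] by (intro borel_measurable_sum blinfun_measurable incr_measurable) auto

lemma dsum_bound: "l2sq M (dsum m L) \<le> ennreal (\<Sum>k<2^m. T / 2^m * hs_sq Q (L k))"
proof -
  have "l2sq M (dsum m L) \<le> ennreal (\<Sum>k<2^m. (dyad T m (Suc k) - dyad T m k) * hs_sq Q (L k))"
    unfolding dsum_def incr_def
    using T by (intro increment_sum_isometry[OF Q W] dyad_range dyad_mono) auto
  then show ?thesis by (simp only: dyad_Suc)
qed

lemma dsum_diff: "dsum m L \<omega> - dsum m L' \<omega> = dsum m (\<lambda>k. L k - L' k) \<omega>"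
  by (simp add: dsum_def sum_subtractf blinfun.bilinear_simps)

text \<open>Fine increments telescope to the coarse ones. A coarse sum is thus a fine sum whose
  operators are constant on coarse cells, and two levels can be compared on one grid.\<close>

lemma dsum_refine:
  assumes "m \<le> m'"
  shows "dsum m L \<omega> = dsum m' (\<lambda>j. L (j div 2 ^ (m' - m))) \<omega>"
proof -
  define d :: nat where "d = 2 ^ (m' - m)"
  have d: "0 < d" by (simp add: d_def)
  have nd: "2 ^ m * d = (2 ^ m' :: nat)" using assms by (simp add: d_def flip: power_add)
  have "(\<Sum>j\<in>{k * d..<k * d + d}. L (j div d) (incr m' j \<omega>)) = L k (incr m k \<omega>)" for k
  proof -
    have "(\<Sum>j\<in>{k * d..<k * d + d}. L (j div d) (incr m' j \<omega>)) = (\<Sum>j\<in>{k * d..<k * d + d}. L k (incr m' j \<omega>))"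
    proof (intro sum.cong refl)
      fix j assume "j \<in> {k * d..<k * d + d}"
      then have "j div d = k" by (intro div_nat_eqI) (auto simp: mult.commute)
      then show "L (j div d) (incr m' j \<omega>) = L k (incr m' j \<omega>)" by simp
    qed
    also have "\<dots> = L k (\<Sum>j\<in>{k * d..<k * d + d}. incr m' j \<omega>)" by (simp add: blinfun.sum_right)
    also have "(\<Sum>j\<in>{k * d..<k * d + d}. incr m' j \<omega>) = W (dyad T m' (k * d + d)) \<omega> - W (dyad T m' (k * d)) \<omega>"
      unfolding incr_def by (rule sum_Suc_diff') simp
    also have "\<dots> = incr m k \<omega>"
    proof -
      have s: "k * d + d = Suc k * d" by simp
      show ?thesis unfolding s unfolding incr_def d_def dyad_refine[OF assms] ..
    qed
    finally show ?thesis .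
  qed
  then have "dsum m L \<omega> = (\<Sum>k<2^m. \<Sum>j\<in>{k * d..<k * d + d}. L (j div d) (incr m' j \<omega>))" by (simp add: dsum_def)
  also have "\<dots> = (\<Sum>j<2^m * d. L (j div d) (incr m' j \<omega>))" by (rule sum.nat_group)
  finally show ?thesis unfolding nd by (simp add: dsum_def d_def)
qed

abbreviation "wint a b \<Phi> m \<equiv> dsum m (wind T a b \<Phi> m)"

text \<open>Both sums are compared on the finer grid. If the coarse cell lies in the window, the
  operators differ by the modulus \<epsilon>. If it does not but the fine cell does, the coarse cell
  has \<open>a\<close> or \<open>b\<close> in its interior; this happens for at most one coarse cell
  per end, at a cost of \<open>C\<close> times its length.\<close>

lemma wint_cauchy_bound:
  fixes \<Phi> :: "real \<Rightarrow> 'v \<Rightarrow>\<^sub>L 'h::separable_hilbert"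
  assumes C: "0 \<le> C" "\<And>r. r \<in> {a..b} \<Longrightarrow> hs_sq Q (\<Phi> r) \<le> C" and e: "0 \<le> \<epsilon>"
    "\<And>r r'. r \<in> {a..b} \<Longrightarrow> r' \<in> {a..b} \<Longrightarrow> \<bar>r - r'\<bar> \<le> T / 2^m \<Longrightarrow> hs_sq Q (\<Phi> r - \<Phi> r') \<le> \<epsilon>"
    and m: "m \<le> m'"
  shows "l2sq M (\<lambda>\<omega>. wint a b \<Phi> m \<omega> - wint a b \<Phi> m' \<omega>) \<le> ennreal (T * \<epsilon> + 2 * C * (T / 2^m))"
proof -
  define d :: nat where "d = 2 ^ (m' - m)"
  have d: "0 < d" by (simp add: d_def)
  have nd: "2 ^ m * d = (2 ^ m' :: nat)" using m by (simp add: d_def flip: power_add)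
  \<comment> \<open>Marks the coarse cell with \<open>c\<close> in its open interior; a window end
    on a grid point therefore causes no error.\<close>
  define st :: "real \<Rightarrow> nat \<Rightarrow> real" where "st c k = of_bool (dyad T m k < c \<and> c < dyad T m (Suc k))" for c :: real and k :: nat
  have le: "hs_sq Q (wind T a b \<Phi> m (j div d) - wind T a b \<Phi> m' j) \<le> \<epsilon> + C * (st a (j div d) + st b (j div d))" for j
  proof -
    define k where "k = j div d"
    have kj: "k * d \<le> j" "Suc j \<le> Suc k * d"
      using d unfolding k_def by (simp_all add: div_times_less_eq_dividend dividend_less_div_times less_eq_Suc_le[symmetric] add.commute)
    have 1: "dyad T m k \<le> dyad T m' j" "dyad T m' (Suc j) \<le> dyad T m (Suc k)"
      using dyad_mono[of T "k * d" j m'] dyad_mono[of T "Suc j" "Suc k * d" m'] kj T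
      by (simp_all add: d_def dyad_refine[OF m] del: mult_Suc)
    have 2: "dyad T m' j < dyad T m' (Suc j)" using dyad_Suc[of T m' j] T by (simp add: algebra_simps)
    have nn: "0 \<le> C * (st a k + st b k)" using C(1) by (simp add: st_def)
    show ?thesis unfolding k_def[symmetric]
    proof (cases "a \<le> dyad T m k \<and> dyad T m (Suc k) \<le> b")
      case True
      then have f: "a \<le> dyad T m' j \<and> dyad T m' (Suc j) \<le> b" using 1 by linarith
      have "\<bar>dyad T m (Suc k) - dyad T m' (Suc j)\<bar> \<le> T / 2^m"
        using 1 2 dyad_Suc[of T m k] by linarith
      then have "hs_sq Q (\<Phi> (dyad T m (Suc k)) - \<Phi> (dyad T m' (Suc j))) \<le> \<epsilon>"
        using True f 1 2 by (intro e(2)) auto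
      then show "hs_sq Q (wind T a b \<Phi> m k - wind T a b \<Phi> m' j) \<le> \<epsilon> + C * (st a k + st b k)"
        using True f nn by (simp add: wind_def)
    next
      case False
      show "hs_sq Q (wind T a b \<Phi> m k - wind T a b \<Phi> m' j) \<le> \<epsilon> + C * (st a k + st b k)"
      proof (cases "a \<le> dyad T m' j \<and> dyad T m' (Suc j) \<le> b")
        case True
        have "st a k = 1 \<or> st b k = 1"
          using False True 1 2 by (auto simp: st_def)
        then have "1 \<le> st a k + st b k" by (auto simp: st_def)
        then have "C * 1 \<le> C * (st a k + st b k)" using C(1) by (rule mult_left_mono)
        moreover have "hs_sq Q (\<Phi> (dyad T m' (Suc j))) \<le> C" using True 2 by (intro C(2)) auto
        moreover have "wind T a b \<Phi> m k - wind T a b \<Phi> m' j = - \<Phi> (dyad T m' (Suc j))"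
          using True by (simp only: wind_def False if_True if_False simp_thms diff_0)
        ultimately show ?thesis using e(1) by (simp only: hs_sq_minus[OF Q] mult_1_right)
      next
        case F2: False
        show ?thesis using False F2 e(1) nn by (auto simp: wind_def hs_sq_zero[OF Q])
      qed
    qed
  qed
  have "l2sq M (\<lambda>\<omega>. wint a b \<Phi> m \<omega> - wint a b \<Phi> m' \<omega>)
      = l2sq M (dsum m' (\<lambda>j. wind T a b \<Phi> m (j div d) - wind T a b \<Phi> m' j))"
    unfolding dsum_refine[OF m, of "wind T a b \<Phi> m"] dsum_diff d_def ..
  also have "\<dots> \<le> ennreal (\<Sum>j<2^m'. T / 2^m' * hs_sq Q (wind T a b \<Phi> m (j div d) - wind T a b \<Phi> m' j))"
    by (rule dsum_bound)
  also have "\<dots> \<le> ennreal (T * \<epsilon> + 2 * C * (T / 2^m))"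
  proof (rule ennreal_leI)
    have "(\<Sum>j<2^m'. T / 2^m' * hs_sq Q (wind T a b \<Phi> m (j div d) - wind T a b \<Phi> m' j))
        \<le> (\<Sum>j<2^m'. T / 2^m' * (\<epsilon> + C * (st a (j div d) + st b (j div d))))"
      using T by (intro sum_mono mult_left_mono le) auto
    also have "\<dots> = (\<Sum>j<2^m * d. T / 2^m' * (\<epsilon> + C * (st a (j div d) + st b (j div d))))" unfolding nd ..
    also have "\<dots> = real d * (\<Sum>k<2^m. T / 2^m' * (\<epsilon> + C * (st a k + st b k)))"
      by (rule sum_div_group[OF d])
    also have "\<dots> = T / 2^m * (\<Sum>k<2^m. \<epsilon> + C * (st a k + st b k))"
    proof -
      have "real (2 ^ m' :: nat) = real (2 ^ m :: nat) * real d" by (simp only: nd[symmetric] of_nat_mult)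
      then have r: "(2::real) ^ m' = 2 ^ m * real d" by simp
      show ?thesis using d unfolding sum_distrib_left[symmetric] r by (simp add: field_simps)
    qed
    also have "(\<Sum>k<2^m. \<epsilon> + C * (st a k + st b k)) = 2^m * \<epsilon> + C * ((\<Sum>k<2^m. st a k) + (\<Sum>k<2^m. st b k))"
      by (simp add: sum.distrib flip: sum_distrib_left)
    also have "T / 2^m * \<dots> \<le> T / 2^m * (2^m * \<epsilon> + C * (1 + 1))"
      using T C(1) straddle_count[OF T, where n = "2^m" and m = m] unfolding st_def
      by (intro mult_left_mono add_left_mono add_mono) auto
    also have "\<dots> = T * \<epsilon> + 2 * C * (T / 2^m)" by (simp add: field_simps)
    finally show "(\<Sum>j<2^m'. T / 2^m' * hs_sq Q (wind T a b \<Phi> m (j div d) - wind T a b \<Phi> m' j)) \<le> T * \<epsilon> + 2 * C * (T / 2^m)" .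
  qed
  finally show ?thesis .
qed

text \<open>The bound of \<open>wint_cauchy_bound\<close> depends on the integrand only through its
  size and its modulus, so common bounds for the family give one level \<open>m0\<close> for all
  indices and windows.\<close>

lemma wint_uniform_cauchy:
  fixes \<Phi> :: "'i \<Rightarrow> real \<Rightarrow> 'v \<Rightarrow>\<^sub>L 'h::separable_hilbert"
  assumes C: "\<And>i r. i \<in> I \<Longrightarrow> r \<in> {a i..b i} \<Longrightarrow> norm (\<Phi> i r) \<le> C"
    and mod: "\<And>v \<epsilon>. \<epsilon> > 0 \<Longrightarrow> \<exists>\<delta>>0. \<forall>i\<in>I. \<forall>r\<in>{a i..b i}. \<forall>r'\<in>{a i..b i}. \<bar>r - r'\<bar> < \<delta> \<longrightarrow> norm (\<Phi> i r v - \<Phi> i r' v) < \<epsilon>"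
    and e: "\<epsilon> > 0"
  shows "\<exists>m0. \<forall>i\<in>I. \<forall>m\<ge>m0. \<forall>m'\<ge>m. l2sq M (\<lambda>\<omega>. wint (a i) (b i) (\<Phi> i) m \<omega> - wint (a i) (b i) (\<Phi> i) m' \<omega>) \<le> ennreal \<epsilon>"
proof -
  obtain B where B: "B \<ge> 0" "\<And>L::'v \<Rightarrow>\<^sub>L 'h. hs_sq Q L \<le> B * (norm L)\<^sup>2" using hs_sq_bound[OF Q] by blast
  define C' where "C' = B * C\<^sup>2"
  have C': "0 \<le> C'" "i \<in> I \<Longrightarrow> r \<in> {a i..b i} \<Longrightarrow> hs_sq Q (\<Phi> i r) \<le> C'" for i r
  proof -
    show "0 \<le> C'" using B(1) by (simp add: C'_def)
    assume "i \<in> I" "r \<in> {a i..b i}"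
    from C[OF this] have "B * (norm (\<Phi> i r))\<^sup>2 \<le> B * C\<^sup>2" by (intro mult_left_mono power_mono B(1)) auto
    then show "hs_sq Q (\<Phi> i r) \<le> C'" unfolding C'_def using B(2) order_trans by blast
  qed
  \<comment> \<open>Half of \<epsilon> goes to the modulus and half to the two window ends; the
    \<open>+ 1\<close> in \<open>4 * C' + 1\<close> below guards against
    \<open>C' = 0\<close>.\<close>
  define e' where "e' = \<epsilon> / (2 * T)"
  have e': "e' > 0" "T * e' = \<epsilon> / 2" using e T by (auto simp: e'_def)
  obtain \<delta> where \<delta>: "\<delta> > 0" "\<forall>i\<in>I. \<forall>r\<in>{a i..b i}. \<forall>r'\<in>{a i..b i}. \<bar>r - r'\<bar> < \<delta> \<longrightarrow> hs_sq Q (\<Phi> i r - \<Phi> i r') \<le> e'"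
    using hs_sq_modulus[OF Q C mod e'(1)] by blast
  have "(\<lambda>m. T * (1 / 2) ^ m) \<longlonglongrightarrow> T * 0" by (intro tendsto_intros LIMSEQ_power_zero) simp
  then have lim: "(\<lambda>m. T / 2 ^ m) \<longlonglongrightarrow> 0" by (simp add: power_one_over)
  have "\<forall>\<^sub>F m in sequentially. T / 2 ^ m < \<delta> \<and> T / 2 ^ m < \<epsilon> / (4 * C' + 1)"
    using e C'(1) by (intro eventually_conj order_tendstoD(2)[OF lim] \<delta>(1)) simp
  then obtain m0 where m0: "\<And>m. m \<ge> m0 \<Longrightarrow> T / 2 ^ m < \<delta> \<and> T / 2 ^ m < \<epsilon> / (4 * C' + 1)"
    unfolding eventually_sequentially by blast
  have "l2sq M (\<lambda>\<omega>. wint (a i) (b i) (\<Phi> i) m \<omega> - wint (a i) (b i) (\<Phi> i) m' \<omega>) \<le> ennreal \<epsilon>"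
    if i: "i \<in> I" and m: "m \<ge> m0" "m' \<ge> m" for i m m'
  proof -
    have "l2sq M (\<lambda>\<omega>. wint (a i) (b i) (\<Phi> i) m \<omega> - wint (a i) (b i) (\<Phi> i) m' \<omega>) \<le> ennreal (T * e' + 2 * C' * (T / 2^m))"
    proof (rule wint_cauchy_bound[OF C'(1) C'(2)[OF i] _ _ m(2)])
      show "0 \<le> e'" using e'(1) by simp
      fix r r' assume "r \<in> {a i..b i}" "r' \<in> {a i..b i}" "\<bar>r - r'\<bar> \<le> T / 2^m"
      moreover from this have "\<bar>r - r'\<bar> < \<delta>" using m0[OF m(1)] by linarith
      ultimately show "hs_sq Q (\<Phi> i r - \<Phi> i r') \<le> e'" using \<delta>(2) i by blast
    qed
    also have "T * e' + 2 * C' * (T / 2^m) \<le> \<epsilon>"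
    proof -
      have "2 * C' * (T / 2^m) \<le> 2 * C' * (\<epsilon> / (4 * C' + 1))"
        using m0[OF m(1)] C'(1) by (intro mult_left_mono) auto
      also have "\<dots> \<le> \<epsilon> / 2" using e C'(1) by (simp add: field_simps)
      finally show ?thesis using e'(2) by linarith
    qed
    then have "ennreal (T * e' + 2 * C' * (T / 2^m)) \<le> ennreal \<epsilon>" by (rule ennreal_leI)
    finally show ?thesis .
  qed
  then show ?thesis by (intro exI[of _ m0] ballI allI impI)
qed

text \<open>At most one operator in the sum is nonzero. This disposes of the cell cut by a time
  \<open>t\<close> off the grid in the backward equation.\<close>

lemma straddle_bound:
  fixes L :: "nat \<Rightarrow> 'v \<Rightarrow>\<^sub>L 'h::separable_hilbert"
  assumes C: "0 \<le> C" "\<And>k. k < 2 ^ m \<Longrightarrow> dyad T m k < t \<Longrightarrow> t < dyad T m (Suc k) \<Longrightarrow> hs_sq Q (L k) \<le> C"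
  shows "l2sq M (dsum m (\<lambda>k. if dyad T m k < t \<and> t < dyad T m (Suc k) then L k else 0)) \<le> ennreal (C * (T / 2 ^ m))"
proof -
  let ?s = "\<lambda>k. dyad T m k < t \<and> t < dyad T m (Suc k)"
  have "l2sq M (dsum m (\<lambda>k. if ?s k then L k else 0)) \<le> ennreal (\<Sum>k<2^m. T / 2^m * hs_sq Q (if ?s k then L k else 0))"
    by (rule dsum_bound)
  also have "\<dots> \<le> ennreal (C * (T / 2 ^ m))"
  proof (rule ennreal_leI)
    have "(\<Sum>k<2^m. T / 2^m * hs_sq Q (if ?s k then L k else 0)) \<le> (\<Sum>k<2^m. T / 2^m * (C * of_bool (?s k)))"
      using T C by (intro sum_mono mult_left_mono) (auto simp: hs_sq_zero[OF Q])
    also have "\<dots> = T / 2^m * C * (\<Sum>k<2^m. of_bool (?s k))" by (simp only: sum_distrib_left mult.assoc)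
    also have "\<dots> \<le> T / 2^m * C * 1" using T C(1) by (intro mult_left_mono straddle_count) auto
    finally show "(\<Sum>k<2^m. T / 2^m * hs_sq Q (if ?s k then L k else 0)) \<le> C * (T / 2 ^ m)" by (simp add: mult.commute)
  qed
  finally show ?thesis .
qed

end

end

section \<open>Joint measurability and time integrals of processes\<close>

lemma sum_list_filter_upt:
  fixes f :: "'b \<Rightarrow> 'c::comm_monoid_add"
  shows "sum_list (map f (map g (filter P [0..<n]))) = (\<Sum>k<n. if P k then f (g k) else 0)"
  by (induction n) auto

lemma space_aug_filtration: "space (aug_filtration P W t) = space P"
  by (simp add: aug_filtration_def space_measure_of_conv)

lemma dyad_bracket:
  assumes T: "0 < T" and r: "0 < r" "r \<le> T"
  shows "\<exists>k<2 ^ m. dyad T m k < r \<and> r \<le> dyad T m (Suc k)"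
proof -
  define h where "h = T / 2 ^ m"
  have h: "0 < h" using T by (simp add: h_def)
  have d: "dyad T m k = h * real k" for k by (simp add: dyad_def h_def)
  define n where "n = nat \<lceil>r / h\<rceil>"
  have "0 < r / h" using r h by simp
  then have n: "real n - 1 < r / h" "r / h \<le> real n" "0 < n"
    unfolding n_def by (auto simp: ceiling_correct[of "r / h", THEN conjunct1] le_of_int_ceiling of_nat_nat)
  obtain k where k: "n = Suc k" using n(3) by (cases n) auto
  have 1: "h * real k < r" "r \<le> h * real (Suc k)"
    using n(1,2) h unfolding k by (simp_all add: field_simps)
  have "k < 2 ^ m"
  proof (rule ccontr)
    assume "\<not> k < 2 ^ m"
    then have "(2::real) ^ m \<le> real k" by (metis not_less of_nat_le_iff of_nat_numeral of_nat_power)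
    then have "h * 2 ^ m \<le> h * real k" using h by simp
    then show False using 1(1) r(2) by (simp add: h_def)
  qed
  then show ?thesis using 1 by (intro exI[of _ k]) (simp add: d)
qed

text \<open>The indicator confines time to the closed set \<open>A\<close>, so joint continuity on
  \<open>A\<close> times the state space is enough for measurability on the product.
  \<open>R\<close> is left abstract to cover both the full line and the restrictions to
  \<open>{0..t}\<close> in progressive measurability.\<close>

lemma joint_measurable:
  fixes f :: "real \<Rightarrow> 'h::separable_hilbert \<Rightarrow> 'h"
  assumes A: "closed A" and f: "continuous_on (A \<times> UNIV) (\<lambda>p. f (fst p) (snd p))"
    and R: "(\<lambda>r. r) \<in> measurable R borel" and Z: "Z \<in> borel_measurable (R \<Otimes>\<^sub>M N)"
  shows "(\<lambda>p. indicator A (fst p) *\<^sub>R f (fst p) (Z p)) \<in> borel_measurable (R \<Otimes>\<^sub>M N)"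
proof -
  have "A \<times> (UNIV::'h set) \<in> sets borel" using A by (intro borel_closed closed_Times) auto
  then have "(\<lambda>p. indicator (A \<times> UNIV) p *\<^sub>R f (fst p) (snd p)) \<in> borel_measurable borel"
    by (rule borel_measurable_continuous_on_indicator[OF _ f])
  moreover have "(\<lambda>p. (fst p, Z p)) \<in> borel_measurable (R \<Otimes>\<^sub>M N)"
    by (intro borel_measurable_Pair measurable_compose[OF measurable_fst R] Z)
  ultimately have "(\<lambda>p. indicator (A \<times> UNIV) (fst p, Z p) *\<^sub>R f (fst (fst p, Z p)) (snd (fst p, Z p))) \<in> borel_measurable (R \<Otimes>\<^sub>M N)"
    by (rule measurable_compose[rotated])
  then show ?thesis by (simp add: indicator_def)
qed

text \<open>Cauchy-Schwarz in time. For a non-integrable \<open>f\<close> the integral is 0 by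
  convention and the bound is trivial, so the estimate can be integrated over all sample
  points.\<close>

lemma bint_norm_sq_le:
  fixes f :: "real \<Rightarrow> 'h::separable_hilbert" and y :: "real \<Rightarrow> 'g::separable_hilbert"
  assumes ab: "0 \<le> a" "b \<le> T" and T: "0 \<le> T" and C: "0 \<le> C" and y: "y \<in> borel_measurable borel"
    and le: "\<And>r. r \<in> {a..b} \<Longrightarrow> norm (f r) \<le> C * norm (y r)"
  shows "ennreal ((norm (bint a b f))\<^sup>2) \<le> ennreal (C\<^sup>2 * T) * (\<integral>\<^sup>+r\<in>{0..T}. ennreal ((norm (y r))\<^sup>2) \<partial>lborel)"
proof (cases "set_integrable lborel {a..b} f")
  case False
  then show ?thesis by (simp add: set_lebesgue_integral_def set_integrable_def not_integrable_integral_eq)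
next
  case True
  have [measurable]: "y \<in> borel_measurable borel" by (rule y)
  have "ennreal (norm (bint a b f)) \<le> (\<integral>\<^sup>+r. ennreal (norm (indicator {a..b} r *\<^sub>R f r)) \<partial>lborel)"
    using True unfolding set_lebesgue_integral_def set_integrable_def by (rule integral_norm_bound_ennreal)
  also have "\<dots> \<le> (\<integral>\<^sup>+r. ennreal (C * norm (y r) * indicator {0..T} r) * ennreal (indicator {0..T} r) \<partial>lborel)"
  proof (rule nn_integral_mono)
    fix r show "ennreal (norm (indicator {a..b} r *\<^sub>R f r)) \<le> ennreal (C * norm (y r) * indicator {0..T} r) * ennreal (indicator {0..T} r)"
      using le[of r] ab by (auto simp: indicator_def intro!: ennreal_leI)
  qed
  finally have "(ennreal (norm (bint a b f)))\<^sup>2 \<le> (\<integral>\<^sup>+r. ennreal (C * norm (y r) * indicator {0..T} r) * ennreal (indicator {0..T} r) \<partial>lborel)\<^sup>2"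
    by (rule power_mono) simp
  also have "\<dots> \<le> (\<integral>\<^sup>+r. (ennreal (C * norm (y r) * indicator {0..T} r))\<^sup>2 \<partial>lborel) * (\<integral>\<^sup>+r. (ennreal (indicator {0..T} r))\<^sup>2 \<partial>lborel)"
    by (rule Cauchy_Schwarz_nn_integral) measurable
  also have "(\<integral>\<^sup>+r. (ennreal (indicator {0..T} r))\<^sup>2 \<partial>lborel) = ennreal T"
  proof -
    have "(\<integral>\<^sup>+r. (ennreal (indicator {0..T} r))\<^sup>2 \<partial>lborel) = (\<integral>\<^sup>+r. indicator {0..T} r \<partial>lborel)"
      by (intro nn_integral_cong) (auto simp: indicator_def)
    then show ?thesis using T by simp
  qed
  also have "(\<integral>\<^sup>+r. (ennreal (C * norm (y r) * indicator {0..T} r))\<^sup>2 \<partial>lborel) = (\<integral>\<^sup>+r. ennreal (C\<^sup>2) * (ennreal ((norm (y r))\<^sup>2) * indicator {0..T} r) \<partial>lborel)"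
    using C by (intro nn_integral_cong) (auto simp: indicator_def ennreal_power power_mult_distrib ennreal_mult)
  also have "\<dots> = ennreal (C\<^sup>2) * (\<integral>\<^sup>+r\<in>{0..T}. ennreal ((norm (y r))\<^sup>2) \<partial>lborel)"
    by (intro nn_integral_cmult) measurable
  finally show ?thesis using T C by (simp add: ennreal_power ennreal_mult mult_ac)
qed

context prob_space
begin

lemma nn_integral_time_le:
  fixes y :: "real \<Rightarrow> 'a \<Rightarrow> 'h::separable_hilbert"
  assumes y: "(\<lambda>p. y (fst p) (snd p)) \<in> borel_measurable (borel \<Otimes>\<^sub>M M)" and T: "0 \<le> T" and e: "0 \<le> \<epsilon>"
    and le: "\<And>r. r \<in> {0..T} \<Longrightarrow> l2sq M (y r) \<le> ennreal \<epsilon>"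
  shows "(\<integral>\<^sup>+\<omega>. (\<integral>\<^sup>+r\<in>{0..T}. ennreal ((norm (y r \<omega>))\<^sup>2) \<partial>lborel) \<partial>M) \<le> ennreal (T * \<epsilon>)"
proof -
  interpret pair_sigma_finite lborel M ..
  have [measurable]: "(\<lambda>p. y (fst p) (snd p)) \<in> borel_measurable (lborel \<Otimes>\<^sub>M M)"
    using y by (subst measurable_cong_sets[OF sets_pair_measure_cong[OF sets_lborel refl] refl])
  have "(\<lambda>p. ennreal ((norm (y (fst p) (snd p)))\<^sup>2) * indicator {0..T} (fst p)) \<in> borel_measurable (lborel \<Otimes>\<^sub>M M)"
    by measurable
  from Fubini[OF this]
  have "(\<integral>\<^sup>+\<omega>. (\<integral>\<^sup>+r\<in>{0..T}. ennreal ((norm (y r \<omega>))\<^sup>2) \<partial>lborel) \<partial>M)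
      = (\<integral>\<^sup>+r. (\<integral>\<^sup>+\<omega>. ennreal ((norm (y r \<omega>))\<^sup>2) * indicator {0..T} r \<partial>M) \<partial>lborel)" by simp
  also have "\<dots> \<le> (\<integral>\<^sup>+r. ennreal \<epsilon> * indicator {0..T} r \<partial>lborel)"
  proof (rule nn_integral_mono)
    fix r
    show "(\<integral>\<^sup>+\<omega>. ennreal ((norm (y r \<omega>))\<^sup>2) * indicator {0..T} r \<partial>M) \<le> ennreal \<epsilon> * indicator {0..T} r"
      using le[of r] by (cases "r \<in> {0..T}") simp_all
  qed
  also have "\<dots> = ennreal \<epsilon> * emeasure lborel {0..T}" by (rule nn_integral_cmult_indicator) simp
  also have "\<dots> = ennreal (T * \<epsilon>)" using T e by (simp add: ennreal_mult mult.commute)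
  finally show ?thesis .
qed

text \<open>The process is only jointly measurable and bounded in mean square, and its paths may be
  irregular. Almost sure integrability in time therefore comes from Fubini, and the second moment of
  the integral from Cauchy-Schwarz in time and Tonelli.\<close>

lemma bint_process:
  fixes y :: "real \<Rightarrow> 'a \<Rightarrow> 'h::separable_hilbert" and G :: "real \<Rightarrow> 'h \<Rightarrow>\<^sub>L 'h"
  assumes y: "(\<lambda>p. y (fst p) (snd p)) \<in> borel_measurable (borel \<Otimes>\<^sub>M M)" and T: "0 \<le> T" and e: "0 \<le> \<epsilon>"
    and le: "\<And>r. r \<in> {0..T} \<Longrightarrow> l2sq M (y r) \<le> ennreal \<epsilon>"
    and ab: "0 \<le> a" "b \<le> T" and G: "\<And>v. continuous_on {a..b} (\<lambda>r. G r v)"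
    and C: "0 \<le> C" "\<And>r. r \<in> {a..b} \<Longrightarrow> norm (G r) \<le> C"
  shows "(\<lambda>\<omega>. bint a b (\<lambda>r. G r (y r \<omega>))) \<in> borel_measurable M"
    and "l2sq M (\<lambda>\<omega>. bint a b (\<lambda>r. G r (y r \<omega>))) \<le> ennreal (C\<^sup>2 * T * (T * \<epsilon>))"
    and "AE \<omega> in M. set_integrable lborel {a..b} (\<lambda>r. G r (y r \<omega>))"
proof -
  have "continuous_on ({a..b} \<times> UNIV) (\<lambda>p. G (fst p) (snd p))"
    by (rule continuous_on_blinfun_apply_strong[where C = C])
      (auto intro!: continuous_intros C(2) continuous_on_compose2[OF G])
  from joint_measurable[OF _ this _ y]
  have Gm0: "(\<lambda>p. indicator {a..b} (fst p) *\<^sub>R G (fst p) (y (fst p) (snd p))) \<in> borel_measurable (borel \<Otimes>\<^sub>M M)"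
    by simp
  have eqs: "sets (borel \<Otimes>\<^sub>M M) = sets (lborel \<Otimes>\<^sub>M M)" by (rule sets_pair_measure_cong) simp_all
  have Gm: "(\<lambda>p. indicator {a..b} (fst p) *\<^sub>R G (fst p) (y (fst p) (snd p))) \<in> borel_measurable (lborel \<Otimes>\<^sub>M M)"
    using Gm0 measurable_cong_sets[OF eqs refl] by blast
  have "(\<lambda>(\<omega>, r). indicator {a..b} r *\<^sub>R G r (y r \<omega>)) \<in> borel_measurable (M \<Otimes>\<^sub>M lborel)"
    using measurable_compose[OF measurable_pair_swap' Gm] by (simp add: split_def)
  from lborel.borel_measurable_lebesgue_integral[OF this]
  show m: "(\<lambda>\<omega>. bint a b (\<lambda>r. G r (y r \<omega>))) \<in> borel_measurable M"
    unfolding set_lebesgue_integral_def .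
  have yr: "(\<lambda>r. y r \<omega>) \<in> borel_measurable borel" if "\<omega> \<in> space M" for \<omega>
    using measurable_compose[OF measurable_Pair2'[OF that, of borel] y] by simp
  have nG: "norm (G r v) \<le> C * norm v" if "r \<in> {a..b}" for r v
    by (intro order_trans[OF norm_blinfun] mult_right_mono C(2) that) simp
  have "l2sq M (\<lambda>\<omega>. bint a b (\<lambda>r. G r (y r \<omega>))) \<le> (\<integral>\<^sup>+\<omega>. ennreal (C\<^sup>2 * T) * (\<integral>\<^sup>+r\<in>{0..T}. ennreal ((norm (y r \<omega>))\<^sup>2) \<partial>lborel) \<partial>M)"
    by (intro nn_integral_mono bint_norm_sq_le[OF ab T C(1)] yr nG)
  also have "\<dots> \<le> ennreal (C\<^sup>2 * T) * (\<integral>\<^sup>+\<omega>. (\<integral>\<^sup>+r\<in>{0..T}. ennreal ((norm (y r \<omega>))\<^sup>2) \<partial>lborel) \<partial>M)"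
  proof (rule eq_refl, rule nn_integral_cmult)
    have "(\<lambda>p. ennreal ((norm (y (fst p) (snd p)))\<^sup>2) * indicator {0..T} (fst p)) \<in> borel_measurable (borel \<Otimes>\<^sub>M M)"
      using y by measurable
    then have "(\<lambda>p. ennreal ((norm (y (fst p) (snd p)))\<^sup>2) * indicator {0..T} (fst p)) \<in> borel_measurable (lborel \<Otimes>\<^sub>M M)"
      using measurable_cong_sets[OF eqs refl] by blast
    from measurable_compose[OF measurable_pair_swap' this]
    show "(\<lambda>\<omega>. \<integral>\<^sup>+r\<in>{0..T}. ennreal ((norm (y r \<omega>))\<^sup>2) \<partial>lborel) \<in> borel_measurable M"
      by (intro lborel.borel_measurable_nn_integral) (simp add: split_def)
  qed
  also have "\<dots> \<le> ennreal (C\<^sup>2 * T) * ennreal (T * \<epsilon>)"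
    by (intro mult_left_mono nn_integral_time_le[OF y T e le]) auto
  also have "\<dots> = ennreal (C\<^sup>2 * T * (T * \<epsilon>))" using T e by (simp add: ennreal_mult)
  finally show "l2sq M (\<lambda>\<omega>. bint a b (\<lambda>r. G r (y r \<omega>))) \<le> ennreal (C\<^sup>2 * T * (T * \<epsilon>))" .
  have fin: "(\<integral>\<^sup>+p. ennreal (norm (indicator {a..b} (fst p) *\<^sub>R G (fst p) (y (fst p) (snd p)))) \<partial>(lborel \<Otimes>\<^sub>M M)) < \<infinity>"
  proof -
    have mm: "(\<lambda>p. ennreal (norm (indicator {a..b} (fst p) *\<^sub>R G (fst p) (y (fst p) (snd p))))) \<in> borel_measurable (lborel \<Otimes>\<^sub>M M)"
      using Gm by measurable
    have "(\<integral>\<^sup>+p. ennreal (norm (indicator {a..b} (fst p) *\<^sub>R G (fst p) (y (fst p) (snd p)))) \<partial>(lborel \<Otimes>\<^sub>M M))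
        = (\<integral>\<^sup>+r. \<integral>\<^sup>+\<omega>. ennreal (norm (indicator {a..b} r *\<^sub>R G r (y r \<omega>))) \<partial>M \<partial>lborel)"
      using nn_integral_fst[OF mm] by simp
    also have "\<dots> \<le> (\<integral>\<^sup>+r. ennreal (C * (1 + \<epsilon>)) * indicator {a..b} r \<partial>lborel)"
    proof (rule nn_integral_mono)
      fix r
      show "(\<integral>\<^sup>+\<omega>. ennreal (norm (indicator {a..b} r *\<^sub>R G r (y r \<omega>))) \<partial>M) \<le> ennreal (C * (1 + \<epsilon>)) * indicator {a..b} r"
      proof (cases "r \<in> {a..b}")
        case True
        then have r: "r \<in> {0..T}" using ab by auto
        have m: "y r \<in> borel_measurable M" using measurable_compose[OF measurable_Pair1'[of r borel M] y] by simp
        have "(\<integral>\<^sup>+\<omega>. ennreal (norm (indicator {a..b} r *\<^sub>R G r (y r \<omega>))) \<partial>M) \<le> (\<integral>\<^sup>+\<omega>. ennreal C * (1 + ennreal ((norm (y r \<omega>))\<^sup>2)) \<partial>M)"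
        proof (rule nn_integral_mono)
          fix \<omega>
          \<comment> \<open>Bounds the norm by one plus its square, which is enough for a finite
            first moment.\<close>
          have "0 \<le> (norm (y r \<omega>) - 1/2)\<^sup>2" by simp
          then have "norm (y r \<omega>) \<le> 1 + (norm (y r \<omega>))\<^sup>2" by (simp add: power2_eq_square algebra_simps)
          then have "norm (G r (y r \<omega>)) \<le> C * (1 + (norm (y r \<omega>))\<^sup>2)"
            using nG[OF True, of "y r \<omega>"] C(1) by (meson mult_left_mono order_trans)
          then have "ennreal (norm (G r (y r \<omega>))) \<le> ennreal (C * (1 + (norm (y r \<omega>))\<^sup>2))" by (rule ennreal_leI)
          then show "ennreal (norm (indicator {a..b} r *\<^sub>R G r (y r \<omega>))) \<le> ennreal C * (1 + ennreal ((norm (y r \<omega>))\<^sup>2))"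
            using True C(1) by (simp add: ennreal_mult ennreal_plus)
        qed
        also have "\<dots> = ennreal C * (1 + l2sq M (y r))"
          using m by (subst nn_integral_cmult) (auto simp: nn_integral_add emeasure_space_1)
        also have "\<dots> \<le> ennreal C * (1 + ennreal \<epsilon>)" by (intro mult_left_mono add_left_mono le r) simp
        finally show ?thesis using True C(1) e by (simp add: ennreal_mult ennreal_plus)
      qed simp
    qed
    also have "\<dots> = ennreal (C * (1 + \<epsilon>)) * emeasure lborel {a..b}" by (rule nn_integral_cmult_indicator) simp
    also have "\<dots> < \<infinity>" by (simp add: ennreal_mult_less_top emeasure_lborel_Icc_eq)
    finally show ?thesis .
  qed
  interpret pair_sigma_finite lborel M ..
  have "integrable (lborel \<Otimes>\<^sub>M M) (\<lambda>p. indicator {a..b} (fst p) *\<^sub>R G (fst p) (y (fst p) (snd p)))"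
    using Gm fin unfolding integrable_iff_bounded by blast
  from integrable_product_swap[OF this]
  have "integrable (M \<Otimes>\<^sub>M lborel) (\<lambda>p. indicator {a..b} (snd p) *\<^sub>R G (snd p) (y (snd p) (fst p)))"
    by (simp add: split_def)
  note swapped = this
  interpret sw: pair_sigma_finite M lborel ..
  from swapped have "AE \<omega> in M. integrable lborel (\<lambda>r. indicator {a..b} r *\<^sub>R G r (y r \<omega>))"
    using sw.AE_integrable_fst'[of "\<lambda>p. indicator {a..b} (snd p) *\<^sub>R G (snd p) (y (snd p) (fst p))"] by simp
  then
  show "AE \<omega> in M. set_integrable lborel {a..b} (\<lambda>r. G r (y r \<omega>))"
    unfolding set_integrable_def by simp
qed

end

section \<open>Ito integrals of deterministic integrands\<close>

context prob_space
begin

context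
  fixes T :: real and Q :: "'v::separable_hilbert \<Rightarrow>\<^sub>L 'v" and W :: "real \<Rightarrow> 'a \<Rightarrow> 'v"
  assumes T: "0 < T" and Q: "positive_trace_class Q" and W: "Q_wiener T M Q W"
begin

lemma aug_generators: "{W s -` B \<inter> space M | s B. s \<in> {0..t} \<and> B \<in> sets borel} \<union> null_sets M \<subseteq> Pow (space M)"
  using sets.sets_into_space by (auto simp: null_sets_def)

lemma wiener_aug_measurable: "s \<in> {0..t} \<Longrightarrow> W s \<in> borel_measurable (aug_filtration M W t)"
proof (rule measurableI)
  fix B :: "'v set" assume s: "s \<in> {0..t}" and "B \<in> sets borel"
  then show "W s -` B \<inter> space (aug_filtration M W t) \<in> sets (aug_filtration M W t)"
    unfolding space_aug_filtration unfolding aug_filtration_def sets_measure_of[OF aug_generators]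
    by (intro sigma_sets.Basic) auto
qed simp

lemma incr_aug_measurable: "k < 2 ^ m \<Longrightarrow> dyad T m (Suc k) \<le> t \<Longrightarrow> incr T W m k \<in> borel_measurable (aug_filtration M W t)"
  unfolding incr_def[OF T Q W, abs_def] using dyad_range[of T k m] dyad_range[of T "Suc k" m] dyad_mono[of T k "Suc k" m] T
  by (intro borel_measurable_diff wiener_aug_measurable) auto

text \<open>The integrand does not depend on the sample point, so progressive measurability reduces
  to measurability in time, which follows from Hilbert-Schmidt continuity.\<close>

lemma restrict_VQ_M2:
  fixes \<Phi> :: "real \<Rightarrow> 'v \<Rightarrow>\<^sub>L 'h::separable_hilbert"
  assumes C: "0 \<le> C" "\<And>r. r \<in> {a..b} \<Longrightarrow> hs_sq Q (\<Phi> r) \<le> C"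
    and mod: "\<And>\<epsilon>. \<epsilon> > 0 \<Longrightarrow> \<exists>\<delta>>0. \<forall>r\<in>{a..b}. \<forall>r'\<in>{a..b}. \<bar>r - r'\<bar> < \<delta> \<longrightarrow> hs_sq Q (\<Phi> r - \<Phi> r') \<le> \<epsilon>"
  shows "(\<lambda>r \<omega>. restrict_VQ Q (\<Phi> r)) \<in> M2 a b M F (HS_borel Q) (HS_norm Q)"
  unfolding M2_def
proof (intro CollectI conjI ballI)
  fix t assume t: "t \<in> {a..b}"
  have "(\<lambda>r. restrict_VQ Q (\<Phi> r)) \<in> restrict_space borel {a..t} \<rightarrow>\<^sub>M HS_borel Q"
  proof (rule restrict_VQ_measurable[OF Q])
    fix r \<epsilon> :: real assume r: "r \<in> {a..t}" and e: "\<epsilon> > 0"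
    obtain \<delta> where d: "\<delta> > 0" "\<forall>r\<in>{a..b}. \<forall>r'\<in>{a..b}. \<bar>r - r'\<bar> < \<delta> \<longrightarrow> hs_sq Q (\<Phi> r - \<Phi> r') \<le> \<epsilon> / 2"
      using mod[of "\<epsilon> / 2"] e by auto
    have "hs_sq Q (\<Phi> r' - \<Phi> r) < \<epsilon>" if "r' \<in> {a..t}" "\<bar>r' - r\<bar> < \<delta>" for r'
    proof -
      have "hs_sq Q (\<Phi> r' - \<Phi> r) \<le> \<epsilon> / 2" using d(2)[rule_format, of r' r] that r t by simp
      then show ?thesis using e by simp
    qed
    then show "\<exists>\<delta>>0. \<forall>r'\<in>{a..t}. \<bar>r' - r\<bar> < \<delta> \<longrightarrow> hs_sq Q (\<Phi> r' - \<Phi> r) < \<epsilon>" using d(1) by blast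
  qed
  from measurable_compose[OF measurable_fst this]
  show "(\<lambda>(r, \<omega>). restrict_VQ Q (\<Phi> r)) \<in> restrict_space borel {a..t} \<Otimes>\<^sub>M F t \<rightarrow>\<^sub>M HS_borel Q"
    by (simp add: split_def)
next
  have "(\<integral>\<^sup>+r\<in>{a..b}. ennreal ((HS_norm Q (restrict_VQ Q (\<Phi> r)))\<^sup>2) \<partial>lborel) \<le> (\<integral>\<^sup>+r. ennreal C * indicator {a..b} r \<partial>lborel)"
    unfolding HS_norm_restrict_VQ[OF Q]
    using C by (intro nn_integral_mono) (auto simp: indicator_def intro!: ennreal_leI)
  also have "\<dots> = ennreal C * emeasure lborel {a..b}" by (rule nn_integral_cmult_indicator) simp
  also have "\<dots> < \<infinity>" by (simp add: ennreal_mult_less_top emeasure_lborel_Icc_eq)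
  finally show "(\<integral>\<^sup>+\<omega>. (\<integral>\<^sup>+r\<in>{a..b}. ennreal ((HS_norm Q (restrict_VQ Q (\<Phi> r)))\<^sup>2) \<partial>lborel) \<partial>M) < \<infinity>"
    by (simp add: emeasure_space_1)
qed

text \<open>A dyadic sum is the integral of an elementary process whose events are all the sure
  event. The value of \<Phi> at the right end of a cell is admissible because it is a fixed
  operator: adaptedness is demanded of the events only. Convergence of these processes to \<Phi>
  then identifies the mean-square limit of the sums as the Ito integral.\<close>

lemma wint_has_ito_integral:
  fixes \<Phi> :: "real \<Rightarrow> 'v \<Rightarrow>\<^sub>L 'h::separable_hilbert"
  assumes ab: "a \<in> {0..T}" "b \<in> {0..T}"
    and C: "0 \<le> C" "\<And>r. r \<in> {a..b} \<Longrightarrow> hs_sq Q (\<Phi> r) \<le> C"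
    and mod: "\<And>\<epsilon>. \<epsilon> > 0 \<Longrightarrow> \<exists>\<delta>>0. \<forall>r\<in>{a..b}. \<forall>r'\<in>{a..b}. \<bar>r - r'\<bar> < \<delta> \<longrightarrow> hs_sq Q (\<Phi> r - \<Phi> r') \<le> \<epsilon>"
    and I: "I \<in> borel_measurable M"
      "\<And>\<epsilon>. \<epsilon> > 0 \<Longrightarrow> \<exists>m0. \<forall>m\<ge>m0. l2sq M (\<lambda>\<omega>. dsum T W m (wind T a b \<Phi> m) \<omega> - I \<omega>) \<le> ennreal \<epsilon>"
  shows "has_ito_integral M (aug_filtration M W) Q W a b (\<lambda>r \<omega>. restrict_VQ Q (\<Phi> r)) I"
proof -
  define cond where "cond m k \<longleftrightarrow> a \<le> dyad T m k \<and> dyad T m (Suc k) \<le> b" for m k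
  define g where "g m k = (dyad T m k, dyad T m (Suc k), space M, \<Phi> (dyad T m (Suc k)))" for m k
  define E where "E m = map (g m) (filter (cond m) [0..<2^m])" for m
  have el: "elementary_on a b (aug_filtration M W) (E m)" for m
  proof -
    have "dyad T m k \<le> dyad T m (Suc k)" for k using T by (intro dyad_mono) auto
    moreover have "space M \<in> sets (aug_filtration M W s)" for s
      using sets.top[of "aug_filtration M W s"] by (simp add: space_aug_filtration)
    ultimately show ?thesis unfolding elementary_on_def E_def g_def cond_def by auto
  qed
  have int: "elementary_integral W (E m) \<omega> = dsum T W m (wind T a b \<Phi> m) \<omega>" if "\<omega> \<in> space M" for m \<omega>
    unfolding elementary_integral_def E_def map_map sum_list_filter_upt[where g = "\<lambda>k. k", unfolded map_ident] dsum_def[OF T Q W]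
    using that by (intro sum.cong refl) (simp add: g_def cond_def wind_def incr_def[OF T Q W])
  have proc: "elementary_process (E m) r \<omega> = (\<Sum>k<2^m. if cond m k \<and> r \<in> {dyad T m k<..dyad T m (Suc k)} then \<Phi> (dyad T m (Suc k)) else 0)"
    if "\<omega> \<in> space M" for m r \<omega>
    unfolding elementary_process_def E_def sum_list_filter_upt
    using that by (intro sum.cong refl) (simp add: g_def indicator_def)
  have uniq: "j = k" if "r \<in> {dyad T m j<..dyad T m (Suc j)}" "r \<in> {dyad T m k<..dyad T m (Suc k)}" for j k m r
  proof (rule ccontr)
    assume "j \<noteq> k"
    then consider "Suc j \<le> k" | "Suc k \<le> j" by linarith
    then show False
      using that dyad_mono[of T "Suc j" k m] dyad_mono[of T "Suc k" j m] T by cases auto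
  qed
  have approx: "\<exists>m0. \<forall>m\<ge>m0. (\<integral>\<^sup>+\<omega>. (\<integral>\<^sup>+r\<in>{a..b}. ennreal ((HS_norm Q
      (\<lambda>v. restrict_VQ Q (elementary_process (E m) r \<omega>) v - restrict_VQ Q (\<Phi> r) v))\<^sup>2) \<partial>lborel) \<partial>M) \<le> ennreal \<epsilon>"
    if e: "\<epsilon> > 0" for \<epsilon>
  proof -
    define e' where "e' = \<epsilon> / (2 * T)"
    have e': "e' > 0" "e' * T = \<epsilon> / 2" using e T by (auto simp: e'_def)
    obtain \<delta> where \<delta>: "\<delta> > 0" "\<forall>r\<in>{a..b}. \<forall>r'\<in>{a..b}. \<bar>r - r'\<bar> < \<delta> \<longrightarrow> hs_sq Q (\<Phi> r - \<Phi> r') \<le> e'"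
      using mod[OF e'(1)] by blast
    have "(\<lambda>m. T * (1 / 2) ^ m) \<longlonglongrightarrow> T * 0" by (intro tendsto_intros LIMSEQ_power_zero) simp
    then have lim: "(\<lambda>m. T / 2 ^ m) \<longlonglongrightarrow> 0" by (simp add: power_one_over)
    have "\<forall>\<^sub>F m in sequentially. T / 2 ^ m < \<delta> \<and> T / 2 ^ m < \<epsilon> / (4 * C + 1)"
      using e C(1) by (intro eventually_conj order_tendstoD(2)[OF lim] \<delta>(1)) simp
    then obtain m0 where m0: "\<And>m. m \<ge> m0 \<Longrightarrow> T / 2 ^ m < \<delta> \<and> T / 2 ^ m < \<epsilon> / (4 * C + 1)"
      unfolding eventually_sequentially by blast
    have "(\<integral>\<^sup>+\<omega>. (\<integral>\<^sup>+r\<in>{a..b}. ennreal ((HS_norm Q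
      (\<lambda>v. restrict_VQ Q (elementary_process (E m) r \<omega>) v - restrict_VQ Q (\<Phi> r) v))\<^sup>2) \<partial>lborel) \<partial>M) \<le> ennreal \<epsilon>"
      if m: "m \<ge> m0" for m
    proof -
      define h where "h = T / 2 ^ m"
      have h: "0 < h" "h < \<delta>" "h < \<epsilon> / (4 * C + 1)" using m0[OF m] T by (auto simp: h_def)
      have step: "dyad T m (Suc k) - dyad T m k = h" for k unfolding h_def by (rule dyad_Suc)
      \<comment> \<open>In a cell contained in the window the error is the modulus over a distance
        below \<open>h\<close>. Otherwise the elementary process is 0 and \<Phi> itself is the
        error, but then \<open>r\<close> is within \<open>h\<close> of an end of the window.\<close>
      have pt: "hs_sq Q (elementary_process (E m) r \<omega> - \<Phi> r) \<le> e' + C * indicator ({a..a + h} \<union> {b - h..b}) r"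
        if r: "r \<in> {a..b}" and w: "\<omega> \<in> space M" for r \<omega>
      proof (cases "\<exists>k<2^m. cond m k \<and> r \<in> {dyad T m k<..dyad T m (Suc k)}")
        case True
        then obtain k where k: "k < 2^m" "cond m k" "r \<in> {dyad T m k<..dyad T m (Suc k)}" by (elim exE conjE)
        have "elementary_process (E m) r \<omega> = (\<Sum>j<2^m. if j = k then \<Phi> (dyad T m (Suc k)) else 0)"
          unfolding proc[OF w]
        proof (intro sum.cong refl)
          fix j
          show "(if cond m j \<and> r \<in> {dyad T m j<..dyad T m (Suc j)} then \<Phi> (dyad T m (Suc j)) else 0) = (if j = k then \<Phi> (dyad T m (Suc k)) else 0)"
          proof (cases "j = k")
            case True
            then show ?thesis using k(2,3) by simp
          next
            case False
            then have "r \<notin> {dyad T m j<..dyad T m (Suc j)}" using uniq[OF _ k(3)] by metis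
            then show ?thesis using False by (auto simp only: if_False simp_thms)
          qed
        qed
        then have eq: "elementary_process (E m) r \<omega> = \<Phi> (dyad T m (Suc k))" using k(1) by simp
        have "\<bar>dyad T m (Suc k) - r\<bar> < \<delta>" using k(3) step[of k] h by auto
        moreover have "dyad T m (Suc k) \<in> {a..b}" using k(2,3) r unfolding cond_def by auto
        ultimately have "hs_sq Q (elementary_process (E m) r \<omega> - \<Phi> r) \<le> e'" unfolding eq using \<delta>(2)[rule_format, of "dyad T m (Suc k)" r] r by simp
        moreover have "0 \<le> C * indicator ({a..a + h} \<union> {b - h..b}) r" using C(1) by simp
        ultimately show ?thesis by linarith
      next
        case False
        then have "elementary_process (E m) r \<omega> = 0" unfolding proc[OF w] by (intro sum.neutral) auto
        then have "hs_sq Q (elementary_process (E m) r \<omega> - \<Phi> r) \<le> C" using C(2)[OF r] by (simp add: hs_sq_minus[OF Q])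
        moreover have "r \<in> {a..a + h} \<union> {b - h..b}"
        proof (rule ccontr)
          assume n: "r \<notin> {a..a + h} \<union> {b - h..b}"
          then have "a + h < r" "r < b - h" using r by auto
          moreover from this have "0 < r" "r \<le> T" using ab h(1) by auto
          from dyad_bracket[OF T this, of m] obtain k where "k < 2^m" "dyad T m k < r" "r \<le> dyad T m (Suc k)" by blast
          ultimately show False using False step[of k] unfolding cond_def by force
        qed
        ultimately show ?thesis using e'(1) by simp
      qed
      have "(\<integral>\<^sup>+\<omega>. (\<integral>\<^sup>+r\<in>{a..b}. ennreal ((HS_norm Q
          (\<lambda>v. restrict_VQ Q (elementary_process (E m) r \<omega>) v - restrict_VQ Q (\<Phi> r) v))\<^sup>2) \<partial>lborel) \<partial>M) \<le> (\<integral>\<^sup>+\<omega>. ennreal \<epsilon> \<partial>M)"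
      proof (rule nn_integral_mono)
        fix \<omega> assume w: "\<omega> \<in> space M"
        have "(\<integral>\<^sup>+r\<in>{a..b}. ennreal ((HS_norm Q
          (\<lambda>v. restrict_VQ Q (elementary_process (E m) r \<omega>) v - restrict_VQ Q (\<Phi> r) v))\<^sup>2) \<partial>lborel)
          \<le> (\<integral>\<^sup>+r. ennreal e' * indicator {0..T} r + (ennreal C * indicator {a..a + h} r + ennreal C * indicator {b - h..b} r) \<partial>lborel)"
          unfolding restrict_VQ_diff[OF Q] HS_norm_restrict_VQ[OF Q]
        proof (rule nn_integral_mono)
          fix r
          show "ennreal (hs_sq Q (elementary_process (E m) r \<omega> - \<Phi> r)) * indicator {a..b} r
            \<le> ennreal e' * indicator {0..T} r + (ennreal C * indicator {a..a + h} r + ennreal C * indicator {b - h..b} r)"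
          proof (cases "r \<in> {a..b}")
            case True
            then have r0: "r \<in> {0..T}" using ab by auto
            have "ennreal (hs_sq Q (elementary_process (E m) r \<omega> - \<Phi> r)) \<le> ennreal (e' + C * indicator ({a..a + h} \<union> {b - h..b}) r)"
              by (intro ennreal_leI pt True w)
            also have "\<dots> \<le> ennreal e' + (ennreal C * indicator {a..a + h} r + ennreal C * indicator {b - h..b} r)"
              using e'(1) C(1) by (auto simp: indicator_def ennreal_plus)
            finally show ?thesis using True r0 by simp
          qed simp
        qed
        also have "\<dots> = ennreal e' * emeasure lborel {0..T} + (ennreal C * emeasure lborel {a..a + h} + ennreal C * emeasure lborel {b - h..b})"
          by (simp add: nn_integral_add nn_integral_cmult_indicator del: emeasure_lborel_Icc_eq)
        also have "\<dots> = ennreal (e' * T + (C * h + C * h))"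
        proof -
          have "emeasure lborel {0..T} = ennreal T" "emeasure lborel {a..a + h} = ennreal h" "emeasure lborel {b - h..b} = ennreal h"
            using T h(1) by (simp_all add: emeasure_lborel_Icc_eq)
          moreover have "ennreal (e' * T) = ennreal e' * ennreal T" "ennreal (C * h) = ennreal C * ennreal h"
            using T h(1) C(1) e'(1) by (auto intro!: ennreal_mult)
          moreover have "0 \<le> e' * T" "0 \<le> C * h" using T h(1) C(1) e'(1) by simp_all
          ultimately show ?thesis by (simp only: ennreal_plus add_nonneg_nonneg)
        qed
        also have "\<dots> \<le> ennreal \<epsilon>"
        proof (rule ennreal_leI)
          have "C * h \<le> C * (\<epsilon> / (4 * C + 1))" by (rule mult_left_mono[OF less_imp_le[OF h(3)] C(1)])
          also have "\<dots> \<le> \<epsilon> / 4"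
          proof -
            have "C / (4 * C + 1) \<le> 1 / 4" using C(1) by (simp add: divide_simps)
            then have "\<epsilon> * (C / (4 * C + 1)) \<le> \<epsilon> * (1 / 4)" using e by (intro mult_left_mono) simp_all
            then show ?thesis by (simp add: mult.commute)
          qed
          finally show "e' * T + (C * h + C * h) \<le> \<epsilon>" unfolding e'(2) by linarith
        qed
        finally show "(\<integral>\<^sup>+r\<in>{a..b}. ennreal ((HS_norm Q
          (\<lambda>v. restrict_VQ Q (elementary_process (E m) r \<omega>) v - restrict_VQ Q (\<Phi> r) v))\<^sup>2) \<partial>lborel) \<le> ennreal \<epsilon>" .
      qed
      then show ?thesis by (simp add: emeasure_space_1)
    qed
    then show ?thesis by (intro exI[of _ m0] allI impI)
  qed
  have intlim: "\<exists>m0. \<forall>m\<ge>m0. (\<integral>\<^sup>+\<omega>. ennreal ((norm (elementary_integral W (E m) \<omega> - I \<omega>))\<^sup>2) \<partial>M) \<le> ennreal \<epsilon>"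
    if e: "\<epsilon> > 0" for \<epsilon>
  proof -
    have "(\<integral>\<^sup>+\<omega>. ennreal ((norm (elementary_integral W (E m) \<omega> - I \<omega>))\<^sup>2) \<partial>M)
        = l2sq M (\<lambda>\<omega>. dsum T W m (wind T a b \<Phi> m) \<omega> - I \<omega>)" for m
      by (intro nn_integral_cong) (simp add: int)
    then show ?thesis using I(2)[OF e] by simp
  qed
  show ?thesis
    unfolding has_ito_integral_def
    by (intro conjI exI[of _ E] restrict_VQ_M2[OF C mod] I(1) allI el ennreal_tendsto_0I approx intlim)
qed

end

end

section \<open>The decoupling field\<close>

text \<open>\<open>Lam\<close> is given only as a function. The equation expresses it through the
  derivative of \<open>X\<close>, a pointwise limit of difference quotients that are operators:
  uniform boundedness makes the limit bounded linear, and continuity of the derivative gives strong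
  continuity.\<close>

lemma derivative_operator_family:
  fixes X R :: "real \<Rightarrow> 'h::separable_hilbert \<Rightarrow>\<^sub>L 'h" and Lam :: "real \<Rightarrow> 'h \<Rightarrow> 'h"
  assumes T: "0 < T" and R: "R \<in> Cs T"
    and eq: "\<And>x. \<exists>d. continuous_on {0..T} d \<and>
      (\<forall>t\<in>{0..T}. ((\<lambda>s. X s x) has_vector_derivative d t) (at t within {0..T}) \<and> d t + R t x + Lam t x = 0)"
  shows "\<exists>L\<in>Cs T. \<forall>t\<in>{0..T}. \<forall>x. blinfun_apply (L t) x = Lam t x"
proof -
  define D where "D t x = - (R t x + Lam t x)" for t x
  have D: "continuous_on {0..T} (\<lambda>t. D t x) \<and> (\<forall>t\<in>{0..T}. ((\<lambda>s. X s x) has_vector_derivative D t x) (at t within {0..T}))" for x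
  proof -
    obtain d where d: "continuous_on {0..T} d"
      "\<forall>t\<in>{0..T}. ((\<lambda>s. X s x) has_vector_derivative d t) (at t within {0..T}) \<and> d t + R t x + Lam t x = 0"
      using eq[of x] by (elim exE conjE)
    have "d t = D t x" if "t \<in> {0..T}" for t
      using d(2)[rule_format, OF that, THEN conjunct2] unfolding D_def by (simp only: eq_neg_iff_add_eq_0 add.assoc)
    moreover from this have "continuous_on {0..T} (\<lambda>t. D t x)" by (rule continuous_on_eq[OF d(1)])
    ultimately show ?thesis using d(2) by simp
  qed
  have uniq: "d = D t x" if "t \<in> {0..T}" "((\<lambda>s. X s x) has_vector_derivative d) (at t within {0..T})" for t x d
    by (rule vector_derivative_unique_within[OF _ that(2) D[THEN conjunct2, rule_format, OF that(1)]])
      (use T that(1) in \<open>simp add: trivial_limit_within islimpt_Icc\<close>)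
  have lin: "bounded_linear (D t)" if t: "t \<in> {0..T}" for t
  proof -
    note Dt = D[THEN conjunct2, rule_format, OF t]
    have "t islimpt {0..T}" using t T by (simp add: islimpt_Icc)
    \<comment> \<open>Any sequence in the interval approaching \<open>t\<close> without meeting it
      will do; \<open>t\<close> may be an end point, where the derivative is one-sided.\<close>
    then obtain s where s: "\<And>k::nat. s k \<in> {0..T} - {t}" "s \<longlonglongrightarrow> t" unfolding islimpt_sequential by blast
    define q where "q k = (1 / (s k - t)) *\<^sub>R (X (s k) - X t)" for k
    have s': "filterlim s (at t within {0..T}) sequentially"
      using s unfolding filterlim_at by auto
    have q: "(\<lambda>k. q k x) \<longlonglongrightarrow> D t x" for x
    proof (rule tendstoI)
      fix e :: real assume e: "e > 0"
      then have "\<forall>\<^sub>F r in at t within {0..T}. norm (X r x - X t x - (r - t) *\<^sub>R D t x) \<le> e / 2 * \<bar>r - t\<bar>"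
        by (intro Dt[of x, unfolded has_vector_derivative_within_eps, rule_format]) simp
      from eventually_compose_filterlim[OF this s']
      have "\<forall>\<^sub>F k in sequentially. norm (X (s k) x - X t x - (s k - t) *\<^sub>R D t x) \<le> e / 2 * \<bar>s k - t\<bar>" .
      then show "\<forall>\<^sub>F k in sequentially. dist (q k x) (D t x) < e"
      proof eventually_elim
        case (elim k)
        have ne: "s k - t \<noteq> 0" using s(1)[of k] by auto
        have "q k x - D t x = (1 / (s k - t)) *\<^sub>R (X (s k) x - X t x - (s k - t) *\<^sub>R D t x)"
          using ne by (simp add: q_def blinfun.bilinear_simps scaleR_diff_right)
        then have "dist (q k x) (D t x) = \<bar>1 / (s k - t)\<bar> * norm (X (s k) x - X t x - (s k - t) *\<^sub>R D t x)"
          by (simp add: dist_norm)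
        also have "\<dots> \<le> \<bar>1 / (s k - t)\<bar> * (e / 2 * \<bar>s k - t\<bar>)" by (intro mult_left_mono elim) simp
        also have "\<dots> = e / 2" using ne by (simp add: field_simps)
        finally show ?case using e by simp
      qed
    qed
    have "\<exists>C\<ge>0. \<forall>k\<in>UNIV. norm (q k) \<le> C"
    proof (rule uniform_boundedness)
      fix x
      have "Bseq (\<lambda>k. q k x)" using q[of x] by (intro convergent_imp_Bseq) (auto simp: convergent_def)
      then show "\<exists>C. \<forall>k\<in>UNIV. norm (q k x) \<le> C" unfolding Bseq_def by blast
    qed
    then obtain C where C: "\<And>k. norm (q k) \<le> C" by auto
    show ?thesis
    proof (rule bounded_linear_intro)
      fix x y :: 'h and c :: real
      have "((\<lambda>s. X s (x + y)) has_vector_derivative D t x + D t y) (at t within {0..T})"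
        unfolding blinfun.add_right by (rule has_vector_derivative_add[OF Dt Dt])
      from uniq[OF t this] show "D t (x + y) = D t x + D t y" by simp
      have "((\<lambda>s. X s (c *\<^sub>R x)) has_vector_derivative c *\<^sub>R D t x) (at t within {0..T})"
        unfolding blinfun.scaleR_right using bounded_linear.has_vector_derivative[OF bounded_linear_scaleR_right Dt] .
      from uniq[OF t this] show "D t (c *\<^sub>R x) = c *\<^sub>R D t x" by simp
      have "norm (q k x) \<le> C * norm x" for k
        by (rule order_trans[OF norm_blinfun mult_right_mono[OF C norm_ge_zero]])
      then show "norm (D t x) \<le> norm x * C"
        by (intro LIMSEQ_le_const2[OF tendsto_norm[OF q[of x]]]) (simp add: mult.commute)
    qed
  qed
  define L where "L t = - (R t + Blinfun (D t))" for t
  have L: "L t x = Lam t x" if "t \<in> {0..T}" for t x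
  proof -
    have "Blinfun (D t) x = D t x" using bounded_linear_Blinfun_apply[OF lin[OF that]] by simp
    then show ?thesis by (simp add: L_def blinfun.bilinear_simps D_def)
  qed
  have "continuous_on {0..T} (\<lambda>t. L t x)" for x
  proof -
    have "continuous_on {0..T} (\<lambda>t. - (R t x + D t x))"
      using R[unfolded Cs_def, THEN CollectD, rule_format, of x] D[THEN conjunct1, of x]
      by (intro continuous_on_minus continuous_on_add)
    then show ?thesis by (rule continuous_on_eq) (simp add: L D_def)
  qed
  then show ?thesis using L unfolding Cs_def by blast
qed

lemma bint_reverse:
  fixes f :: "real \<Rightarrow> 'a::{banach, second_countable_topology}"
  shows "bint 0 (T - t) f = bint t T (\<lambda>r. f (T - r))"
proof -
  have "bint 0 (T - t) f = (\<integral>r. indicator {0..T - t} (T + (- 1) * r) *\<^sub>R f (T + (- 1) * r) \<partial>lborel)"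
    unfolding set_lebesgue_integral_def by (subst lborel_integral_real_affine[of "- 1" _ T]) auto
  also have "\<dots> = bint t T (\<lambda>r. f (T - r))"
    unfolding set_lebesgue_integral_def by (intro Bochner_Integration.integral_cong refl) (auto simp: indicator_def)
  finally show ?thesis .
qed

text \<open>Time reversal turns the backward equation into a forward one for the adjoint semigroup
  with coefficients \<open>K (T - r)\<close>, started at 0.\<close>

lemma backward_mild_exists:
  fixes S K :: "real \<Rightarrow> 'h::separable_hilbert \<Rightarrow>\<^sub>L 'h"
  assumes T: "0 \<le> T" and S: "C0_semigroup S" and K: "K \<in> Cs T"
  shows "\<exists>\<phi>. continuous_on {0..T} \<phi> \<and> (\<forall>t\<in>{0..T}. \<phi> t = bint t T (\<lambda>r. adj (S (r - t)) (K r (\<phi> r) + d)))"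
proof -
  note S' = C0_semigroup_adj[OF S]
  have K': "(\<lambda>r. K (T - r)) \<in> Cs T"
    unfolding Cs_def
  proof (intro CollectI allI)
    fix x
    have "continuous_on {0..T} (\<lambda>r. K r x)" using K unfolding Cs_def by simp
    then show "continuous_on {0..T} (\<lambda>r. K (T - r) x)"
      by (rule continuous_on_compose2) (auto intro!: continuous_intros)
  qed
  obtain z where z: "mild T (\<lambda>t. adj (S t)) (\<lambda>r. K (T - r)) 0 (\<lambda>_. d) 0 z"
    using mild_exists[OF T S' K' order_refl T continuous_on_const] by (rule exE)
  then have zc: "continuous_on {0..T} z"
    and ze: "\<And>t. t \<in> {0..T} \<Longrightarrow> z t = bint 0 t (\<lambda>r. adj (S (t - r)) (K (T - r) (z r) + d))"
    unfolding mild_def[OF T S' K'] by (auto simp: blinfun.zero_right)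
  define \<phi> where "\<phi> t = z (T - t)" for t
  have "continuous_on {0..T} \<phi>"
    unfolding \<phi>_def by (auto intro!: continuous_on_compose2[OF zc] continuous_intros)
  moreover have "\<phi> t = bint t T (\<lambda>r. adj (S (r - t)) (K r (\<phi> r) + d))" if t: "t \<in> {0..T}" for t
  proof -
    have "\<phi> t = bint 0 (T - t) (\<lambda>r. adj (S (T - t - r)) (K (T - r) (z r) + d))"
      unfolding \<phi>_def using t by (intro ze) auto
    also have "\<dots> = bint t T (\<lambda>r. adj (S (T - t - (T - r))) (K (T - (T - r)) (z (T - r)) + d))" by (rule bint_reverse)
    also have "\<dots> = bint t T (\<lambda>r. adj (S (r - t)) (K r (\<phi> r) + d))" by (simp add: \<phi>_def)
    finally show ?thesis .
  qed
  ultimately show ?thesis by blast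
qed

text \<open>The bounded part of the limit equation is split as \<open>L - Pi N eta\<close> plus
  \<open>eta\<close> times \<open>F - N Pi - N eta\<close>. Putting the quadratic term into the
  second factor makes that factor the drift of the decoupled forward equation, as
  \<open>riccati_mild_solution\<close> requires.\<close>

lemma decoupling_field:
  fixes S :: "real \<Rightarrow> 'h::separable_hilbert \<Rightarrow>\<^sub>L 'h" and N F G :: "'h \<Rightarrow>\<^sub>L 'h"
    and Pi eta :: "real \<Rightarrow> 'h \<Rightarrow>\<^sub>L 'h" and etan :: "nat \<Rightarrow> real \<Rightarrow> 'h \<Rightarrow>\<^sub>L 'h" and Lam :: "real \<Rightarrow> 'h \<Rightarrow> 'h"
  assumes T: "0 < T" and gen: "generates DA A S"
    and res: "\<And>n. n \<ge> n0 \<Longrightarrow> real n \<in> resolvent_set DA A"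
    and Pi: "Pi \<in> Cs T" and etan: "\<And>n. n \<ge> n0 \<Longrightarrow> etan n \<in> Cs T"
    and eq: "\<And>n x. n \<ge> n0 \<Longrightarrow> \<exists>d. continuous_on {0..T} d \<and>
      (\<forall>t\<in>{0..T}. ((\<lambda>s. etan n s x) has_vector_derivative d t) (at t within {0..T}) \<and>
        d t + etan n t (yosida DA A n x - N (Pi t x)) + (adj (yosida DA A n) (etan n t x) - Pi t (N (etan n t x)))
          + etan n t (F x) - etan n t (N (etan n t x)) + Lam t x = 0)"
    and final: "\<And>n. n \<ge> n0 \<Longrightarrow> etan n T = G"
    and bound: "\<exists>C. \<forall>n\<ge>n0. \<forall>t\<in>{0..T}. norm (etan n t) \<le> C"
    and eta: "eta \<in> Cs T" and lim: "\<And>t x. t \<in> {0..T} \<Longrightarrow> (\<lambda>n. etan n t x) \<longlonglongrightarrow> eta t x"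
  shows "\<exists>L\<in>Cs T. (\<forall>t\<in>{0..T}. \<forall>x. blinfun_apply (L t) x = Lam t x) \<and> eta T = G \<and>
    (\<forall>x y. \<forall>t\<in>{0..T}. eta t x \<bullet> y = eta T (S (T - t) x) \<bullet> S (T - t) y + bint t T (\<lambda>r.
      (blinfun_apply (L r - (Pi r o\<^sub>L N o\<^sub>L eta r)) (S (r - t) x)
        + eta r (blinfun_apply (F - (N o\<^sub>L Pi r) - (N o\<^sub>L eta r)) (S (r - t) x))) \<bullet> S (r - t) y))"
proof -
  \<comment> \<open>The bounded terms of the Riccati equation other than \<open>Lam\<close> and
    those with the Yosida approximation.\<close>
  define R where "R n t = (etan n t o\<^sub>L (F - (N o\<^sub>L Pi t))) - (Pi t o\<^sub>L N o\<^sub>L etan n t) - (etan n t o\<^sub>L N o\<^sub>L etan n t)" for n t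
  have RCs: "R n \<in> Cs T" if "n \<ge> n0" for n
    unfolding R_def by (intro Cs_compose Cs_diff Cs_const Pi etan that)
  have Rx: "R n t x = etan n t (F x) - etan n t (N (Pi t x)) - Pi t (N (etan n t x)) - etan n t (N (etan n t x))" for n t x
    by (simp add: R_def blinfun.bilinear_simps)
  define Y where "Y n t = (etan n t o\<^sub>L yosida DA A n) + (adj (yosida DA A n) o\<^sub>L etan n t)" for n t
  have YCs: "Y n \<in> Cs T" if "n \<ge> n0" for n
    unfolding Y_def by (intro Cs_compose Cs_add Cs_const etan that)
  have eq': "\<exists>d. continuous_on {0..T} d \<and>
      (\<forall>t\<in>{0..T}. ((\<lambda>s. etan n s x) has_vector_derivative d t) (at t within {0..T}) \<and> d t + (Y n t + R n t) x + Lam t x = 0)"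
    if n: "n \<ge> n0" for n x
  proof -
    have key: "c + etan n t (yosida DA A n x - N (Pi t x)) + (adj (yosida DA A n) (etan n t x) - Pi t (N (etan n t x)))
          + etan n t (F x) - etan n t (N (etan n t x)) + Lam t x = c + (Y n t + R n t) x + Lam t x" for c t
      by (simp add: Y_def Rx blinfun.bilinear_simps algebra_simps)
    show ?thesis using eq[OF n, of x] unfolding key .
  qed
  \<comment> \<open>A single equation, the one at index \<open>n0\<close>, is enough to recognise
    \<open>Lam\<close> as an operator family.\<close>
  have "\<exists>L\<in>Cs T. \<forall>t\<in>{0..T}. \<forall>x. blinfun_apply (L t) x = Lam t x"
    by (rule derivative_operator_family[OF T Cs_add[OF YCs RCs] eq', OF order_refl order_refl order_refl])
  then obtain L where L: "L \<in> Cs T" "\<And>t x. t \<in> {0..T} \<Longrightarrow> L t x = Lam t x" by blast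
  have etaT: "eta T = G"
  proof (rule blinfun_eqI)
    fix x
    have "\<forall>\<^sub>F n in sequentially. etan n T x = G x" by (rule eventually_mono[OF eventually_ge_at_top[of n0]]) (simp add: final)
    then have "(\<lambda>n. etan n T x) \<longlonglongrightarrow> G x" by (rule tendsto_eventually)
    then show "eta T x = G x" using LIMSEQ_unique lim[of T x] T by auto
  qed
  obtain C where C: "\<And>n t. n \<ge> n0 \<Longrightarrow> t \<in> {0..T} \<Longrightarrow> norm (etan n t) \<le> C" using bound by blast
  have C0: "0 \<le> C" by (rule order_trans[OF norm_ge_zero C[of n0 T]]) (use T in auto)
  obtain CP where CP: "0 \<le> CP" "\<And>t. t \<in> {0..T} \<Longrightarrow> norm (Pi t) \<le> CP" using Cs_bound[OF Pi] by blast
  obtain CL where CL: "0 \<le> CL" "\<And>t. t \<in> {0..T} \<Longrightarrow> norm (L t) \<le> CL" using Cs_bound[OF L(1)] by blast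
  define Psin where "Psin n t = R n t + L t" for n t
  define Psi where "Psi t = (eta t o\<^sub>L (F - (N o\<^sub>L Pi t))) - (Pi t o\<^sub>L N o\<^sub>L eta t) - (eta t o\<^sub>L N o\<^sub>L eta t) + L t" for t
  have cmp: "norm (a o\<^sub>L b) \<le> x * y" if "norm a \<le> x" "norm b \<le> y" for a b :: "'h \<Rightarrow>\<^sub>L 'h" and x y
    using order_trans[OF norm_blinfun_compose mult_mono[OF that order_trans[OF norm_ge_zero that(1)] norm_ge_zero]] .
  have sub: "norm (a - b) \<le> x + y" if "norm a \<le> x" "norm b \<le> y" for a b :: "'h \<Rightarrow>\<^sub>L 'h" and x y
    using order_trans[OF norm_triangle_ineq4 add_mono[OF that]] .
  have "eta t x \<bullet> y = eta T (S (T - t) x) \<bullet> S (T - t) y + bint t T (\<lambda>r. Psi r (S (r - t) x) \<bullet> S (r - t) y)"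
    if t: "t \<in> {0..T}" for t x y
  proof (rule riccati_limit[OF gen res etan _ _ C _ eta _ lim _ t])
    show "Psin n \<in> Cs T" if "n \<ge> n0" for n unfolding Psin_def by (intro Cs_add RCs that L(1))
    show "Psi \<in> Cs T" unfolding Psi_def by (intro Cs_compose Cs_diff Cs_add Cs_const Pi eta L(1))
    show "((\<lambda>s. etan n s x) has_vector_derivative
      - (etan n r (yosida DA A n x) + adj (yosida DA A n) (etan n r x) + Psin n r x)) (at r within {0..T})"
      if n: "n \<ge> n0" and r: "r \<in> {0..T}" for n x r
    proof -
      obtain d where d: "((\<lambda>s. etan n s x) has_vector_derivative d r) (at r within {0..T})"
        "d r + (Y n r + R n r) x + Lam r x = 0" using eq'[OF n, of x] r by blast
      have "d r = - ((Y n r + R n r) x + Lam r x)" using d(2) by (simp only: eq_neg_iff_add_eq_0 add.assoc)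
      also have "\<dots> = - (etan n r (yosida DA A n x) + adj (yosida DA A n) (etan n r x) + Psin n r x)"
        using L(2)[OF r] by (simp add: Y_def Psin_def blinfun.bilinear_simps)
      finally show ?thesis using d(1) by simp
    qed
    show "norm (Psin n r) \<le> C * (norm F + norm N * CP) + CP * norm N * C + C * norm N * C + CL" if "n \<ge> n0" "r \<in> {0..T}" for n r
      unfolding Psin_def R_def
      by (rule order_trans[OF norm_triangle_ineq add_mono]) (intro sub cmp order_refl C CP CL that)+
    show "(\<lambda>n. Psin n r x) \<longlonglongrightarrow> Psi r x" if r: "r \<in> {0..T}" for r x
    proof -
      have st: "(\<lambda>n. etan (n + n0) r (v n)) \<longlonglongrightarrow> eta r v'" if "v \<longlonglongrightarrow> v'" for v v'
        by (rule tendsto_blinfun_strong[where C = C, OF _ _ that]) (use LIMSEQ_ignore_initial_segment[OF lim[OF r]] C r in auto)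
      have "(\<lambda>n. Psin (n + n0) r x) \<longlonglongrightarrow> Psi r x"
        unfolding Psin_def R_def Psi_def blinfun.bilinear_simps blinfun_apply_blinfun_compose
        by (intro tendsto_intros st)
      then show ?thesis by (rule LIMSEQ_offset)
    qed
  qed
  note weak = this
  have Psi_eq: "Psi r v = blinfun_apply (L r - (Pi r o\<^sub>L N o\<^sub>L eta r)) v + eta r (blinfun_apply (F - (N o\<^sub>L Pi r) - (N o\<^sub>L eta r)) v)" for r v
    by (simp add: Psi_def blinfun.bilinear_simps)
  show ?thesis
    by (intro bexI[of _ L] conjI allI ballI L etaT weak[unfolded Psi_eq])
qed

section \<open>The forward process\<close>

lemma ennreal_tendsto_0I':
  fixes u :: "'i \<Rightarrow> ennreal"
  assumes "\<And>\<epsilon>. \<epsilon> > 0 \<Longrightarrow> \<forall>\<^sub>F i in F. u i \<le> ennreal \<epsilon>"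
  shows "(u \<longlongrightarrow> 0) F"
proof (rule order_tendstoI)
  fix a :: ennreal assume "0 < a"
  then obtain z where z: "0 < z" "z < a" using dense by blast
  then obtain e where e: "z = ennreal e" "0 \<le> e" by (cases z) auto
  then have "e > 0" using z(1) by (simp add: ennreal_less_zero_iff)
  from assms[OF this] show "\<forall>\<^sub>F i in F. u i < a"
    by (rule eventually_mono) (use z(2) e(1) in \<open>auto intro: le_less_trans\<close>)
qed auto

lemma bint_sum:
  fixes f :: "'i \<Rightarrow> real \<Rightarrow> 'a::{banach, second_countable_topology}"
  assumes "\<And>i. i \<in> I \<Longrightarrow> set_integrable lborel {a..b} (f i)"
  shows "set_integrable lborel {a..b} (\<lambda>r. \<Sum>i\<in>I. f i r)"
    and "bint a b (\<lambda>r. \<Sum>i\<in>I. f i r) = (\<Sum>i\<in>I. bint a b (f i))"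
  using assms unfolding set_integrable_def set_lebesgue_integral_def scaleR_sum_right
  by (auto intro!: Bochner_Integration.integrable_sum Bochner_Integration.integral_sum)

context prob_space
begin

text \<open>The noise of each cell is concentrated into one impulse at its right end, when the
  increment is known; \<open>xh\<close> is the noise-free part. Indicators rather than conditionals
  give every summand the shape of \<open>joint_measurable\<close>.\<close>

definition approximant :: "real \<Rightarrow> (real \<Rightarrow> 'a \<Rightarrow> 'v::separable_hilbert) \<Rightarrow> (real \<Rightarrow> 'h \<Rightarrow>\<^sub>L 'h) \<Rightarrow> (real \<Rightarrow> 'h \<Rightarrow>\<^sub>L 'h) \<Rightarrow>
    ('v \<Rightarrow>\<^sub>L 'h::separable_hilbert) \<Rightarrow> (real \<Rightarrow> 'h) \<Rightarrow> nat \<Rightarrow> real \<Rightarrow> 'a \<Rightarrow> 'h" where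
  "approximant T W S K sig xh m r \<omega> = indicator {0..T} r *\<^sub>R xh r + (\<Sum>k<2^m. indicator {dyad T m (Suc k)..T} r *\<^sub>R
     evol T S K r (dyad T m (Suc k)) (sig (incr T W m k \<omega>)))"

text \<open>One sequence of levels for all times is fixed by choice, so that
  \<open>forward_process\<close> is a definite function of time and sample point rather than a class
  chosen separately for each time.\<close>

definition approximant_idx :: "real \<Rightarrow> (real \<Rightarrow> 'a \<Rightarrow> 'v::separable_hilbert) \<Rightarrow> (real \<Rightarrow> 'h \<Rightarrow>\<^sub>L 'h) \<Rightarrow> (real \<Rightarrow> 'h \<Rightarrow>\<^sub>L 'h) \<Rightarrow>
    ('v \<Rightarrow>\<^sub>L 'h::separable_hilbert) \<Rightarrow> (real \<Rightarrow> 'h) \<Rightarrow> nat \<Rightarrow> nat" where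
  "approximant_idx T W S K sig xh = (SOME j. \<forall>\<epsilon>>0. \<exists>m0. \<forall>i\<in>{0..T}. \<forall>m\<ge>m0. l2sq M (\<lambda>\<omega>.
     approximant T W S K sig xh m i \<omega> - lim (\<lambda>k. approximant T W S K sig xh (j k) i \<omega>)) \<le> ennreal \<epsilon>)"

text \<open>A literal limit, with whatever value \<open>lim\<close> takes where there is no
  convergence. Such limits of measurable functions are measurable, so joint and progressive
  measurability are inherited.\<close>

definition forward_process :: "real \<Rightarrow> (real \<Rightarrow> 'a \<Rightarrow> 'v::separable_hilbert) \<Rightarrow> (real \<Rightarrow> 'h \<Rightarrow>\<^sub>L 'h) \<Rightarrow> (real \<Rightarrow> 'h \<Rightarrow>\<^sub>L 'h) \<Rightarrow>
    ('v \<Rightarrow>\<^sub>L 'h::separable_hilbert) \<Rightarrow> (real \<Rightarrow> 'h) \<Rightarrow> real \<Rightarrow> 'a \<Rightarrow> 'h" where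
  "forward_process T W S K sig xh r \<omega> = lim (\<lambda>k. approximant T W S K sig xh (approximant_idx T W S K sig xh k) r \<omega>)"

context
  fixes T :: real and Q :: "'v::separable_hilbert \<Rightarrow>\<^sub>L 'v" and W :: "real \<Rightarrow> 'a \<Rightarrow> 'v"
  assumes T: "0 < T" and Q: "positive_trace_class Q" and W: "Q_wiener T M Q W"
begin

text \<open>Strong continuity is uniform on the compact interval, which feeds the Cauchy estimate.
  Convergence of the dyadic sums is kept in the conclusion next to the integral, because the mild
  equations are obtained by passing to the limit in these very sums.\<close>

lemma ito_integral_exists:
  fixes \<Phi> :: "real \<Rightarrow> 'v \<Rightarrow>\<^sub>L 'h::separable_hilbert"
  assumes ab: "a \<in> {0..T}" "b \<in> {0..T}" and \<Phi>: "\<And>v. continuous_on {a..b} (\<lambda>r. \<Phi> r v)"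
  shows "\<exists>I. I \<in> borel_measurable M \<and>
    (\<forall>\<epsilon>>0. \<exists>m0. \<forall>m\<ge>m0. l2sq M (\<lambda>\<omega>. dsum T W m (wind T a b \<Phi> m) \<omega> - I \<omega>) \<le> ennreal \<epsilon>) \<and>
    has_ito_integral M (aug_filtration M W) Q W a b (\<lambda>r \<omega>. restrict_VQ Q (\<Phi> r)) I"
proof -
  have "\<exists>C\<ge>0. \<forall>r\<in>{a..b}. norm (\<Phi> r) \<le> C"
  proof (rule uniform_boundedness)
    fix v
    have "bounded ((\<lambda>r. \<Phi> r v) ` {a..b})" by (intro compact_imp_bounded compact_continuous_image \<Phi> compact_Icc)
    then show "\<exists>C. \<forall>r\<in>{a..b}. norm (\<Phi> r v) \<le> C" unfolding bounded_iff by simp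
  qed
  then obtain C where C: "0 \<le> C" "\<And>r. r \<in> {a..b} \<Longrightarrow> norm (\<Phi> r) \<le> C" by blast
  have "\<exists>D\<ge>0. \<forall>L::'v \<Rightarrow>\<^sub>L 'h. hs_sq Q L \<le> D * (norm L)\<^sup>2" by (rule hs_sq_bound[OF Q])
  then obtain D where D: "0 \<le> D" "\<And>L::'v \<Rightarrow>\<^sub>L 'h. hs_sq Q L \<le> D * (norm L)\<^sup>2" by (elim exE conjE) simp
  have mod: "\<exists>\<delta>>0. \<forall>i\<in>{()}. \<forall>r\<in>{a..b}. \<forall>r'\<in>{a..b}. \<bar>r - r'\<bar> < \<delta> \<longrightarrow> norm (\<Phi> r v - \<Phi> r' v) < \<epsilon>"
    if "\<epsilon> > 0" for v \<epsilon>
  proof -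
    have "uniformly_continuous_on {a..b} (\<lambda>r. \<Phi> r v)" by (rule compact_uniformly_continuous[OF \<Phi> compact_Icc])
    then obtain d where d: "d > 0" "\<forall>r\<in>{a..b}. \<forall>r'\<in>{a..b}. dist r' r < d \<longrightarrow> dist (\<Phi> r' v) (\<Phi> r v) < \<epsilon>"
      unfolding uniformly_continuous_on_def using \<open>\<epsilon> > 0\<close> by meson
    have "norm (\<Phi> r v - \<Phi> r' v) < \<epsilon>" if "r \<in> {a..b}" "r' \<in> {a..b}" "\<bar>r - r'\<bar> < d" for r r'
      using d(2)[rule_format, of r' r] that by (simp add: dist_norm dist_real_def)
    then show ?thesis using d(1) by blast
  qed
  have hmod: "\<exists>\<delta>>0. \<forall>r\<in>{a..b}. \<forall>r'\<in>{a..b}. \<bar>r - r'\<bar> < \<delta> \<longrightarrow> hs_sq Q (\<Phi> r - \<Phi> r') \<le> \<epsilon>" if "\<epsilon> > 0" for \<epsilon>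
  proof -
    have "\<exists>\<delta>>0. \<forall>i\<in>{()}. \<forall>r\<in>{a..b}. \<forall>r'\<in>{a..b}. \<bar>r - r'\<bar> < \<delta> \<longrightarrow> hs_sq Q (\<Phi> r - \<Phi> r') \<le> \<epsilon>"
      by (rule hs_sq_modulus[OF Q C(2) mod that])
    then show ?thesis by simp
  qed
  \<comment> \<open>The Cauchy and limit lemmas speak of indexed families; the one-point index type
    adapts them to a single integral.\<close>
  define Y where "Y m (i::unit) = dsum T W m (wind T a b \<Phi> m)" for m i
  have cau: "\<exists>m0. \<forall>i\<in>{()}. \<forall>m\<ge>m0. \<forall>m'\<ge>m. l2sq M (\<lambda>\<omega>. Y m i \<omega> - Y m' i \<omega>) \<le> ennreal \<epsilon>" if "\<epsilon> > 0" for \<epsilon>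
    unfolding Y_def by (rule wint_uniform_cauchy[OF T Q W C(2) mod that])
  have Y: "Y m i \<in> borel_measurable M" for m i unfolding Y_def by (rule dsum_measurable[OF T Q W])
  have "\<exists>r. strict_mono (r::nat \<Rightarrow> nat) \<and>
      (\<forall>\<epsilon>>0. \<exists>m0. \<forall>i\<in>{()}. \<forall>m\<ge>m0. l2sq M (\<lambda>\<omega>. Y m i \<omega> - lim (\<lambda>k. Y (r k) i \<omega>)) \<le> ennreal \<epsilon>)"
    by (rule l2sq_subseq_limit[OF Y cau])
  then obtain r where r: "\<forall>\<epsilon>>0. \<exists>m0. \<forall>i\<in>{()}. \<forall>m\<ge>m0. l2sq M (\<lambda>\<omega>. Y m i \<omega> - lim (\<lambda>k. Y (r k) i \<omega>)) \<le> ennreal \<epsilon>"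
    by (elim exE conjE)
  define I where "I \<omega> = lim (\<lambda>k. Y (r k) () \<omega>)" for \<omega>
  have I: "I \<in> borel_measurable M" unfolding I_def[abs_def] by (intro borel_measurable_lim_metric Y)
  have conv: "\<exists>m0. \<forall>m\<ge>m0. l2sq M (\<lambda>\<omega>. dsum T W m (wind T a b \<Phi> m) \<omega> - I \<omega>) \<le> ennreal \<epsilon>" if "\<epsilon> > 0" for \<epsilon>
    using r[rule_format, OF that] by (simp add: I_def Y_def)
  have hs: "hs_sq Q (\<Phi> r) \<le> D * C\<^sup>2" if "r \<in> {a..b}" for r
    by (rule order_trans[OF D(2) mult_left_mono[OF power_mono[OF C(2)[OF that] norm_ge_zero] D(1)]])
  have "has_ito_integral M (aug_filtration M W) Q W a b (\<lambda>r \<omega>. restrict_VQ Q (\<Phi> r)) I"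
    by (rule wint_has_ito_integral[OF T Q W ab _ hs hmod I conv]) (use D C in simp)
  with I conv show ?thesis by blast
qed

section \<open>Dyadic approximation of the forward process\<close>

context
  fixes S :: "real \<Rightarrow> 'h::separable_hilbert \<Rightarrow>\<^sub>L 'h" and K :: "real \<Rightarrow> 'h \<Rightarrow>\<^sub>L 'h" and sig :: "'v \<Rightarrow>\<^sub>L 'h" and xh :: "real \<Rightarrow> 'h"
  assumes S: "C0_semigroup S" and K: "K \<in> Cs T" and xh: "continuous_on {0..T} xh"
begin

abbreviation "appr \<equiv> approximant T W S K sig xh"
abbreviation "fwd \<equiv> forward_process T W S K sig xh"

lemma appr_jump: "r \<in> {0..T} \<Longrightarrow> appr m r \<omega> = xh r + (\<Sum>k<2^m. jump T S K (dyad T m (Suc k)) (sig (incr T W m k \<omega>)) r)"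
  unfolding approximant_def by (auto simp: indicator_def intro!: sum.cong)

text \<open>Variation of constants: the impulses up to time \<open>r\<close>, placed at right ends
  of cells, form the dyadic sum whose integrand is the evolution to \<open>r\<close> as a function
  of its start time, composed with \<open>sig\<close>.\<close>

lemma appr_dsum:
  assumes r: "r \<in> {0..T}"
  shows "appr m r \<omega> = xh r + dsum T W m (wind T 0 r (\<lambda>s. evol T S K r s o\<^sub>L sig) m) \<omega>"
proof -
  have "0 \<le> dyad T m k" for k using T by (simp add: dyad_def)
  then show ?thesis
    unfolding appr_jump[OF r] dsum_def[OF T Q W] by (auto simp: wind_def intro!: sum.cong)
qed

text \<open>An impulse later than all times of \<open>R\<close> contributes 0, which is why the
  hypothesis is a disjunction: with \<open>N\<close> the filtration at \<open>t\<close>, only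
  increments completed by \<open>t\<close> are measurable, and the others do not show up.\<close>

lemma appr_joint_measurable:
  assumes R: "(\<lambda>r. r) \<in> measurable R borel"
    and incr: "\<And>k. k < 2^m \<Longrightarrow> (\<forall>r\<in>space R. r < dyad T m (Suc k)) \<or> incr T W m k \<in> borel_measurable N"
  shows "(\<lambda>p. appr m (fst p) (snd p)) \<in> borel_measurable (R \<Otimes>\<^sub>M N)"
  unfolding approximant_def
proof (intro borel_measurable_add borel_measurable_sum)
  have "continuous_on ({0..T} \<times> (UNIV::'h set)) (\<lambda>p. xh (fst p))"
    by (rule continuous_on_compose2[OF xh]) (auto intro!: continuous_intros)
  then show "(\<lambda>p. indicator {0..T} (fst p) *\<^sub>R xh (fst p)) \<in> borel_measurable (R \<Otimes>\<^sub>M N)"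
    by (rule joint_measurable[OF closed_atLeastAtMost _ R, of _ _ "\<lambda>r _. xh r" "\<lambda>_. 0"]) simp
next
  fix k :: nat assume "k \<in> {..<2^m}"
  then have k: "k < 2^m" by simp
  define p where "p = dyad T m (Suc k)"
  have p: "0 \<le> p" "p \<le> T" using dyad_range[of T "Suc k" m] k T unfolding p_def by auto
  show "(\<lambda>q. indicator {dyad T m (Suc k)..T} (fst q) *\<^sub>R evol T S K (fst q) (dyad T m (Suc k)) (sig (incr T W m k (snd q)))) \<in> borel_measurable (R \<Otimes>\<^sub>M N)"
    unfolding p_def[symmetric]
  proof (cases "\<forall>r\<in>space R. r < p")
    case True
    have "(\<lambda>q. 0::'h) \<in> borel_measurable (R \<Otimes>\<^sub>M N)" by simp
    moreover have zero: "indicator {p..T} (fst q) *\<^sub>R evol T S K (fst q) p (sig (incr T W m k (snd q))) = 0" if "q \<in> space (R \<Otimes>\<^sub>M N)" for q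
    proof -
      have "fst q < p" using True that by (auto simp: space_pair_measure)
      then show ?thesis by simp
    qed
    moreover from zero have "(\<lambda>q. indicator {p..T} (fst q) *\<^sub>R evol T S K (fst q) p (sig (incr T W m k (snd q)))) \<in> borel_measurable (R \<Otimes>\<^sub>M N)
      \<longleftrightarrow> (\<lambda>q. 0::'h) \<in> borel_measurable (R \<Otimes>\<^sub>M N)"
      by (rule measurable_cong)
    ultimately show "(\<lambda>q. indicator {p..T} (fst q) *\<^sub>R evol T S K (fst q) p (sig (incr T W m k (snd q)))) \<in> borel_measurable (R \<Otimes>\<^sub>M N)"
      by (simp only:)
  next
    case False
    then have i: "incr T W m k \<in> borel_measurable N" using incr[OF k] unfolding p_def by blast
    have "\<exists>C\<ge>1. \<forall>s t. 0 \<le> s \<longrightarrow> t \<in> {s..T} \<longrightarrow> norm (evol T S K t s) \<le> C" by (rule evol_bound[OF less_imp_le[OF T] S K])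
    then obtain C where C: "\<And>s t. 0 \<le> s \<Longrightarrow> t \<in> {s..T} \<Longrightarrow> norm (evol T S K t s) \<le> C" by (elim exE conjE) metis
    have "continuous_on ({p..T} \<times> UNIV) (\<lambda>q. evol T S K (fst q) p (snd q))"
    proof (rule continuous_on_blinfun_apply_strong[where C = C])
      show "continuous_on ({p..T} \<times> UNIV) (\<lambda>q. evol T S K (fst q) p v)" for v
        by (rule continuous_on_compose2[OF evol_continuous[OF less_imp_le[OF T] S K p]]) (auto intro!: continuous_intros)
      show "norm (evol T S K (fst q) p) \<le> C" if "q \<in> {p..T} \<times> (UNIV :: 'h set)" for q
        using that p by (intro C) auto
    qed (intro continuous_intros)
    then show "(\<lambda>q. indicator {p..T} (fst q) *\<^sub>R evol T S K (fst q) p (sig (incr T W m k (snd q)))) \<in> borel_measurable (R \<Otimes>\<^sub>M N)"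
      by (rule joint_measurable[OF closed_atLeastAtMost _ R, of _ _ "\<lambda>r. evol T S K r p" "\<lambda>q. sig (incr T W m k (snd q))"])
        (intro blinfun_measurable[OF T Q W] measurable_compose[OF measurable_snd i])
  qed
qed

lemma appr_measurable: "(\<lambda>p. appr m (fst p) (snd p)) \<in> borel_measurable (borel \<Otimes>\<^sub>M M)" "appr m r \<in> borel_measurable M"
proof -
  show 1: "(\<lambda>p. appr m (fst p) (snd p)) \<in> borel_measurable (borel \<Otimes>\<^sub>M M)"
    by (intro appr_joint_measurable disjI2 incr_measurable[OF T Q W]) simp_all
  show "appr m r \<in> borel_measurable M" using measurable_compose[OF measurable_Pair1'[of r borel M] 1] by simp
qed

lemma appr_progressive:
  assumes t: "t \<in> {0..T}"
  shows "(\<lambda>p. appr m (fst p) (snd p)) \<in> borel_measurable (restrict_space borel {0..t} \<Otimes>\<^sub>M aug_filtration M W t)"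
proof (rule appr_joint_measurable)
  fix k :: nat assume k: "k < 2^m"
  show "(\<forall>r\<in>space (restrict_space borel {0..t}). r < dyad T m (Suc k)) \<or> incr T W m k \<in> borel_measurable (aug_filtration M W t)"
  proof (cases "dyad T m (Suc k) \<le> t")
    case True
    then show ?thesis using incr_aug_measurable[OF T Q W k] by blast
  qed (auto simp: space_restrict_space)
qed (auto intro!: measurable_restrict_space1)

text \<open>For \<open>r \<le> r'\<close> the difference of the evolutions to \<open>i\<close> is
  the evolution from \<open>r'\<close> to \<open>i\<close> applied to \<open>evol r' r\<close> minus
  the identity. The near-diagonal estimate and the uniform bound give a modulus independent of
  \<open>i\<close>, which lets one subsequence serve all times.\<close>

lemma appr_cauchy:
  assumes e: "\<epsilon> > 0"
  shows "\<exists>m0. \<forall>r\<in>{0..T}. \<forall>m\<ge>m0. \<forall>m'\<ge>m. l2sq M (\<lambda>\<omega>. appr m r \<omega> - appr m' r \<omega>) \<le> ennreal \<epsilon>"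
proof -
  have "\<exists>C\<ge>1. \<forall>s t. 0 \<le> s \<longrightarrow> t \<in> {s..T} \<longrightarrow> norm (evol T S K t s) \<le> C" by (rule evol_bound[OF less_imp_le[OF T] S K])
  then obtain C where C: "1 \<le> C" "\<And>s t. 0 \<le> s \<Longrightarrow> t \<in> {s..T} \<Longrightarrow> norm (evol T S K t s) \<le> C" by (elim exE conjE) simp
  have bd: "norm (evol T S K i r o\<^sub>L sig) \<le> C * norm sig" if "i \<in> {0..T}" "r \<in> {0..i}" for i r
    by (rule order_trans[OF norm_blinfun_compose mult_right_mono[OF C(2) norm_ge_zero]]) (use that in auto)
  have mod: "\<exists>\<delta>>0. \<forall>i\<in>{0..T}. \<forall>r\<in>{0..i}. \<forall>r'\<in>{0..i}. \<bar>r - r'\<bar> < \<delta> \<longrightarrow>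
      norm ((evol T S K i r o\<^sub>L sig) v - (evol T S K i r' o\<^sub>L sig) v) < e" if "e > 0" for v e
  proof -
    have "\<exists>\<delta>>0. \<forall>s s'. 0 \<le> s \<and> s \<le> s' \<and> s' \<le> T \<and> s' - s < \<delta> \<longrightarrow> norm (evol T S K s' s (sig v) - sig v) < e / C"
      by (rule evol_near_diagonal[OF less_imp_le[OF T] S K]) (use that C(1) in simp)
    then obtain \<delta> where d: "\<delta> > 0" "\<And>s s'. 0 \<le> s \<Longrightarrow> s \<le> s' \<Longrightarrow> s' \<le> T \<Longrightarrow> s' - s < \<delta> \<Longrightarrow> norm (evol T S K s' s (sig v) - sig v) < e / C"
      by (elim exE conjE) simp
    have *: "norm (evol T S K i r (sig v) - evol T S K i r' (sig v)) < e"
      if r: "0 \<le> r" "r \<le> r'" "r' \<le> i" "i \<le> T" "r' - r < \<delta>" for i r r'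
    proof -
      have "evol T S K i r (sig v) - evol T S K i r' (sig v) = evol T S K i r' (evol T S K r' r (sig v) - sig v)"
        using evol_evol[OF less_imp_le[OF T] S K r(1,2), of i "sig v"] r by (simp add: blinfun.diff_right)
      also have "norm \<dots> \<le> C * norm (evol T S K r' r (sig v) - sig v)"
        by (rule order_trans[OF norm_blinfun mult_right_mono[OF C(2) norm_ge_zero]]) (use r in auto)
      also have "\<dots> < C * (e / C)" using d(2)[of r r'] r C(1) by (intro mult_strict_left_mono) auto
      finally show ?thesis using C(1) by simp
    qed
    have "norm ((evol T S K i r o\<^sub>L sig) v - (evol T S K i r' o\<^sub>L sig) v) < e"
      if "i \<in> {0..T}" "r \<in> {0..i}" "r' \<in> {0..i}" "\<bar>r - r'\<bar> < \<delta>" for i r r'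
    proof (cases "r \<le> r'")
      case True
      then show ?thesis using *[of r r' i] that by simp
    next
      case False
      then show ?thesis using *[of r' r i] that by (simp add: norm_minus_commute)
    qed
    then show ?thesis using d(1) by blast
  qed
  have "\<exists>m0. \<forall>i\<in>{0..T}. \<forall>m\<ge>m0. \<forall>m'\<ge>m. l2sq M (\<lambda>\<omega>. dsum T W m (wind T 0 i (\<lambda>s. evol T S K i s o\<^sub>L sig) m) \<omega>
      - dsum T W m' (wind T 0 i (\<lambda>s. evol T S K i s o\<^sub>L sig) m') \<omega>) \<le> ennreal \<epsilon>"
    by (rule wint_uniform_cauchy[OF T Q W bd mod e])
  then obtain m0 where m0: "\<forall>i\<in>{0..T}. \<forall>m\<ge>m0. \<forall>m'\<ge>m. l2sq M (\<lambda>\<omega>. dsum T W m (wind T 0 i (\<lambda>s. evol T S K i s o\<^sub>L sig) m) \<omega>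
      - dsum T W m' (wind T 0 i (\<lambda>s. evol T S K i s o\<^sub>L sig) m') \<omega>) \<le> ennreal \<epsilon>"
    by (rule exE)
  have eq: "l2sq M (\<lambda>\<omega>. appr m r \<omega> - appr m' r \<omega>) = l2sq M (\<lambda>\<omega>. dsum T W m (wind T 0 r (\<lambda>s. evol T S K r s o\<^sub>L sig) m) \<omega>
      - dsum T W m' (wind T 0 r (\<lambda>s. evol T S K r s o\<^sub>L sig) m') \<omega>)" if "r \<in> {0..T}" for r m m'
    unfolding appr_dsum[OF that] by simp
  show ?thesis
  proof (intro exI ballI allI impI)
    fix r and m m' :: nat assume "r \<in> {0..T}" "m0 \<le> m" "m \<le> m'"
    then show "l2sq M (\<lambda>\<omega>. appr m r \<omega> - appr m' r \<omega>) \<le> ennreal \<epsilon>"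
      using m0[rule_format, of r m m'] eq[of r m m'] by (simp only:)
  qed
qed

lemma fwd_approx:
  assumes "\<epsilon> > 0"
  shows "\<exists>m0. \<forall>i\<in>{0..T}. \<forall>m\<ge>m0. l2sq M (\<lambda>\<omega>. appr m i \<omega> - fwd i \<omega>) \<le> ennreal \<epsilon>"
proof -
  have "\<exists>j. strict_mono (j::nat \<Rightarrow> nat) \<and> (\<forall>\<epsilon>>0. \<exists>m0. \<forall>i\<in>{0..T}. \<forall>m\<ge>m0. l2sq M (\<lambda>\<omega>. appr m i \<omega> - lim (\<lambda>k. appr (j k) i \<omega>)) \<le> ennreal \<epsilon>)"
    by (rule l2sq_subseq_limit[OF appr_measurable(2) appr_cauchy])
  then have "\<exists>j. \<forall>\<epsilon>>0. \<exists>m0. \<forall>i\<in>{0..T}. \<forall>m\<ge>m0. l2sq M (\<lambda>\<omega>. appr m i \<omega> - lim (\<lambda>k. appr (j k) i \<omega>)) \<le> ennreal \<epsilon>"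
    by (elim exE conjE) (rule exI)
  from someI_ex[OF this] show ?thesis using assms unfolding forward_process_def approximant_idx_def[symmetric] by simp
qed

lemma fwd_measurable:
  shows "(\<lambda>p. fwd (fst p) (snd p)) \<in> borel_measurable (borel \<Otimes>\<^sub>M M)" "fwd r \<in> borel_measurable M"
    and "t \<in> {0..T} \<Longrightarrow> (\<lambda>p. fwd (fst p) (snd p)) \<in> borel_measurable (restrict_space borel {0..t} \<Otimes>\<^sub>M aug_filtration M W t)"
    and "t \<in> {0..T} \<Longrightarrow> fwd t \<in> borel_measurable (aug_filtration M W t)"
proof -
  show "(\<lambda>p. fwd (fst p) (snd p)) \<in> borel_measurable (borel \<Otimes>\<^sub>M M)" "fwd r \<in> borel_measurable M"
    unfolding forward_process_def[abs_def] by (intro borel_measurable_lim_metric appr_measurable)+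
  assume t: "t \<in> {0..T}"
  show 1: "(\<lambda>p. fwd (fst p) (snd p)) \<in> borel_measurable (restrict_space borel {0..t} \<Otimes>\<^sub>M aug_filtration M W t)"
    unfolding forward_process_def[abs_def] by (intro borel_measurable_lim_metric appr_progressive t)
  have "t \<in> space (restrict_space borel {0..t})" using t by (simp add: space_restrict_space)
  from measurable_compose[OF measurable_Pair1'[OF this] 1] show "fwd t \<in> borel_measurable (aug_filtration M W t)" by simp
qed

lemma appr_l2_bound: "\<exists>c\<ge>0. \<forall>r\<in>{0..T}. l2sq M (appr m r) \<le> ennreal c"
proof -
  have "\<exists>C\<ge>1. \<forall>s t. 0 \<le> s \<longrightarrow> t \<in> {s..T} \<longrightarrow> norm (evol T S K t s) \<le> C" by (rule evol_bound[OF less_imp_le[OF T] S K])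
  then obtain C where C: "1 \<le> C" "\<And>s t. 0 \<le> s \<Longrightarrow> t \<in> {s..T} \<Longrightarrow> norm (evol T S K t s) \<le> C" by (elim exE conjE) simp
  have "\<exists>D\<ge>0. \<forall>L::'v \<Rightarrow>\<^sub>L 'h. hs_sq Q L \<le> D * (norm L)\<^sup>2" by (rule hs_sq_bound[OF Q])
  then obtain D where D: "0 \<le> D" "\<And>L::'v \<Rightarrow>\<^sub>L 'h. hs_sq Q L \<le> D * (norm L)\<^sup>2" by (elim exE conjE) simp
  have "bounded (xh ` {0..T})" by (intro compact_imp_bounded compact_continuous_image xh compact_Icc)
  then have "\<exists>B. \<forall>r\<in>{0..T}. norm (xh r) \<le> B" unfolding bounded_iff by simp
  then obtain B where B: "\<And>r. r \<in> {0..T} \<Longrightarrow> norm (xh r) \<le> B" by blast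
  define d where "d = (\<Sum>k<(2::nat)^m. T / 2^m * (D * (C * norm sig)\<^sup>2))"
  have d: "0 \<le> d" unfolding d_def using T D(1) by (intro sum_nonneg) simp
  have "l2sq M (appr m r) \<le> ennreal (2 * B\<^sup>2 + 2 * d)" if r: "r \<in> {0..T}" for r
  proof (rule l2sq_add_le[OF _ _ appr_dsum[OF r]])
    have "(norm (xh r))\<^sup>2 \<le> B\<^sup>2" by (rule power_mono[OF B[OF r] norm_ge_zero])
    then show "l2sq M (\<lambda>\<omega>. xh r) \<le> ennreal (B\<^sup>2)" by (simp add: emeasure_space_1 ennreal_leI)
    have "hs_sq Q (wind T 0 r (\<lambda>s. evol T S K r s o\<^sub>L sig) m k) \<le> D * (C * norm sig)\<^sup>2" for k
    proof (cases "0 \<le> dyad T m k \<and> dyad T m (Suc k) \<le> r")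
      case True
      then have "0 \<le> dyad T m (Suc k)" using dyad_mono[OF less_imp_le[OF T], of k "Suc k" m] by simp
      then have "norm (evol T S K r (dyad T m (Suc k)) o\<^sub>L sig) \<le> C * norm sig"
        by (intro order_trans[OF norm_blinfun_compose mult_right_mono[OF C(2) norm_ge_zero]]) (use True r in auto)
      then have "(norm (evol T S K r (dyad T m (Suc k)) o\<^sub>L sig))\<^sup>2 \<le> (C * norm sig)\<^sup>2" by (rule power_mono) simp
      then have "hs_sq Q (evol T S K r (dyad T m (Suc k)) o\<^sub>L sig) \<le> D * (C * norm sig)\<^sup>2"
        by (intro order_trans[OF D(2) mult_left_mono[OF _ D(1)]])
      then show ?thesis using True by (simp add: wind_def)
    next
      case False
      have "hs_sq Q (0 :: 'v \<Rightarrow>\<^sub>L 'h) = 0" by (rule hs_sq_zero[OF Q])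
      moreover have "0 \<le> D * (C * norm sig)\<^sup>2" using D(1) by simp
      ultimately show ?thesis using False by (auto simp: wind_def)
    qed
    then show "l2sq M (dsum T W m (wind T 0 r (\<lambda>s. evol T S K r s o\<^sub>L sig) m)) \<le> ennreal d"
      unfolding d_def by (intro order_trans[OF dsum_bound[OF T Q W]] ennreal_leI sum_mono mult_left_mono) (use T in auto)
  qed (use d dsum_measurable[OF T Q W] in auto)
  then show ?thesis using d by (intro exI[of _ "2 * B\<^sup>2 + 2 * d"]) simp
qed

lemma fwd_l2_bound: "\<exists>c\<ge>0. \<forall>r\<in>{0..T}. l2sq M (fwd r) \<le> ennreal c"
proof -
  obtain m where m: "\<forall>i\<in>{0..T}. \<forall>m'\<ge>m. l2sq M (\<lambda>\<omega>. appr m' i \<omega> - fwd i \<omega>) \<le> ennreal 1"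
    using fwd_approx[OF zero_less_one] by (rule exE)
  obtain c where c: "0 \<le> c" "\<forall>r\<in>{0..T}. l2sq M (appr m r) \<le> ennreal c" using appr_l2_bound[of m] by (elim exE conjE)
  have "l2sq M (fwd r) \<le> ennreal (2 * c + 2 * 1)" if r: "r \<in> {0..T}" for r
  proof (rule l2sq_add_le[of "appr m r" _ "\<lambda>\<omega>. fwd r \<omega> - appr m r \<omega>"])
    show "l2sq M (\<lambda>\<omega>. fwd r \<omega> - appr m r \<omega>) \<le> ennreal 1"
      using m[rule_format, OF r order_refl] by (simp add: norm_minus_commute)
  qed (use c r appr_measurable(2) fwd_measurable(2) in auto)
  then show ?thesis using c(1) by (intro exI[of _ "2 * c + 2 * 1"]) simp
qed

text \<open>All terms depend linearly and boundedly on the approximants, so both sides converge in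
  mean square and the limits agree almost surely. The free \<open>L\<close>, \<open>H\<close> and
  \<open>c\<close> cover both equations: the identity and 0 for the forward one,
  \<open>eta t\<close> and the transported terminal operator for the backward one.\<close>

lemma pass_to_limit:
  fixes L H :: "'h \<Rightarrow>\<^sub>L 'h" and G :: "real \<Rightarrow> 'h \<Rightarrow>\<^sub>L 'h"
  assumes ab: "0 \<le> a" "b \<le> T" and t: "t \<in> {0..T}" and G: "\<And>v. continuous_on {a..b} (\<lambda>r. G r v)"
    and id: "\<And>m \<omega>. L (appr m t \<omega>) = H (appr m T \<omega>) + c + bint a b (\<lambda>r. G r (appr m r \<omega>)) + Z m \<omega>"
    and J: "\<And>m. Z m \<in> borel_measurable M" "J \<in> borel_measurable M"
      "\<And>\<epsilon>. \<epsilon> > 0 \<Longrightarrow> \<exists>m0. \<forall>m\<ge>m0. l2sq M (\<lambda>\<omega>. Z m \<omega> - J \<omega>) \<le> ennreal \<epsilon>"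
  shows "AE \<omega> in M. set_integrable lborel {a..b} (\<lambda>r. G r (fwd r \<omega>)) \<and>
    L (fwd t \<omega>) = H (fwd T \<omega>) + c + bint a b (\<lambda>r. G r (fwd r \<omega>)) + J \<omega>"
proof -
  have "\<exists>C\<ge>0. \<forall>r\<in>{a..b}. norm (G r) \<le> C"
  proof (rule uniform_boundedness)
    fix v
    have "bounded ((\<lambda>r. G r v) ` {a..b})" by (intro compact_imp_bounded compact_continuous_image G compact_Icc)
    then show "\<exists>C. \<forall>r\<in>{a..b}. norm (G r v) \<le> C" unfolding bounded_iff by simp
  qed
  then obtain C where C: "0 \<le> C" "\<And>r. r \<in> {a..b} \<Longrightarrow> norm (G r) \<le> C" by (elim exE conjE) simp
  obtain cx where cx: "0 \<le> cx" "\<And>r. r \<in> {0..T} \<Longrightarrow> l2sq M (fwd r) \<le> ennreal cx"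
    using fwd_l2_bound by (elim exE conjE) simp
  have px: "(\<lambda>\<omega>. bint a b (\<lambda>r. G r (fwd r \<omega>))) \<in> borel_measurable M"
      "AE \<omega> in M. set_integrable lborel {a..b} (\<lambda>r. G r (fwd r \<omega>))"
    by (rule bint_process(1)[OF fwd_measurable(1) less_imp_le[OF T] cx ab G C] bint_process(3)[OF fwd_measurable(1) less_imp_le[OF T] cx ab G C]; assumption)+
  define g where "g \<omega> = H (fwd T \<omega>) + c + bint a b (\<lambda>r. G r (fwd r \<omega>)) + J \<omega>" for \<omega>
  have Tin: "T \<in> {0..T}" using T by simp
  have gm: "g \<in> borel_measurable M"
    unfolding g_def[abs_def] by (intro borel_measurable_add px(1) J(2) borel_measurable_const blinfun_measurable[OF T Q W] fwd_measurable(2))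
  have conv: "\<exists>m0. \<forall>m\<ge>m0. l2sq M (\<lambda>\<omega>. L (appr m t \<omega>) - g \<omega>) \<le> ennreal \<epsilon>" if e: "\<epsilon> > 0" for \<epsilon>
  proof -
    \<comment> \<open>Collects the factors of the inner and outer use of \<open>l2sq_add_le\<close>;
      the \<open>+ 1\<close> keeps it positive.\<close>
    define w where "w = 2 * (2 * (norm H)\<^sup>2 + 2 * (C\<^sup>2 * T * T)) + 1"
    have w: "w > 0" unfolding w_def using T by (intro add_nonneg_pos mult_nonneg_nonneg add_nonneg_nonneg) auto
    define e1 where "e1 = \<epsilon> / (2 * w)"
    have e1: "e1 > 0" using e w by (simp add: e1_def)
    obtain m1 where m1: "\<forall>i\<in>{0..T}. \<forall>m\<ge>m1. l2sq M (\<lambda>\<omega>. appr m i \<omega> - fwd i \<omega>) \<le> ennreal e1"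
      using fwd_approx[OF e1] by (rule exE)
    obtain m2 where m2: "\<forall>m\<ge>m2. l2sq M (\<lambda>\<omega>. Z m \<omega> - J \<omega>) \<le> ennreal (\<epsilon> / 4)"
      using J(3)[of "\<epsilon> / 4"] e by auto
    have "l2sq M (\<lambda>\<omega>. L (appr m t \<omega>) - g \<omega>) \<le> ennreal \<epsilon>" if m: "m \<ge> max m1 m2" for m
    proof -
      define y where "y r \<omega> = appr m r \<omega> - fwd r \<omega>" for r \<omega>
      have y: "(\<lambda>p. y (fst p) (snd p)) \<in> borel_measurable (borel \<Otimes>\<^sub>M M)"
        unfolding y_def by (intro borel_measurable_diff appr_measurable fwd_measurable)
      have yT: "y T \<in> borel_measurable M" unfolding y_def[abs_def] by (intro borel_measurable_diff appr_measurable fwd_measurable)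
      have ly: "l2sq M (y r) \<le> ennreal e1" if "r \<in> {0..T}" for r
        using m1[rule_format, OF that, of m] m unfolding y_def by simp
      have py: "(\<lambda>\<omega>. bint a b (\<lambda>r. G r (y r \<omega>))) \<in> borel_measurable M"
          "l2sq M (\<lambda>\<omega>. bint a b (\<lambda>r. G r (y r \<omega>))) \<le> ennreal (C\<^sup>2 * T * (T * e1))"
          "AE \<omega> in M. set_integrable lborel {a..b} (\<lambda>r. G r (y r \<omega>))"
        by (rule bint_process(1)[OF y less_imp_le[OF T] less_imp_le[OF e1] ly ab G C] bint_process(2)[OF y less_imp_le[OF T] less_imp_le[OF e1] ly ab G C]
          bint_process(3)[OF y less_imp_le[OF T] less_imp_le[OF e1] ly ab G C]; assumption)+
      \<comment> \<open>The time integral can be split only where both integrands are integrable,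
        hence almost surely.\<close>
      have "AE \<omega> in M. L (appr m t \<omega>) - g \<omega> = (H (y T \<omega>) + bint a b (\<lambda>r. G r (y r \<omega>))) + (Z m \<omega> - J \<omega>)"
        using px(2) py(3)
      proof eventually_elim
        case (elim \<omega>)
        have "bint a b (\<lambda>r. G r (appr m r \<omega>)) = bint a b (\<lambda>r. G r (y r \<omega>) + G r (fwd r \<omega>))"
          by (simp add: y_def blinfun.diff_right)
        also have "\<dots> = bint a b (\<lambda>r. G r (y r \<omega>)) + bint a b (\<lambda>r. G r (fwd r \<omega>))"
          by (rule set_integral_add(2)[OF elim(2,1)])
        finally show ?case unfolding id g_def by (simp add: y_def blinfun.diff_right)
      qed
      then have "l2sq M (\<lambda>\<omega>. L (appr m t \<omega>) - g \<omega>) = l2sq M (\<lambda>\<omega>. (H (y T \<omega>) + bint a b (\<lambda>r. G r (y r \<omega>))) + (Z m \<omega> - J \<omega>))"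
        by (intro nn_integral_cong_AE) (auto elim!: eventually_mono)
      also have "\<dots> \<le> ennreal (2 * (2 * ((norm H)\<^sup>2 * e1) + 2 * (C\<^sup>2 * T * (T * e1))) + 2 * (\<epsilon> / 4))"
      proof (rule l2sq_add_le[OF _ _ refl])
        show "l2sq M (\<lambda>\<omega>. H (y T \<omega>) + bint a b (\<lambda>r. G r (y r \<omega>))) \<le> ennreal (2 * ((norm H)\<^sup>2 * e1) + 2 * (C\<^sup>2 * T * (T * e1)))"
        proof (rule l2sq_add_le[OF _ _ refl])
          have "l2sq M (\<lambda>\<omega>. H (y T \<omega>)) \<le> (\<integral>\<^sup>+\<omega>. ennreal ((norm H)\<^sup>2) * ennreal ((norm (y T \<omega>))\<^sup>2) \<partial>M)"
            by (intro nn_integral_mono) (auto simp: ennreal_mult[symmetric] power_mult_distrib[symmetric] intro!: ennreal_leI power_mono norm_blinfun)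
          also have "\<dots> = ennreal ((norm H)\<^sup>2) * l2sq M (y T)" using yT by (intro nn_integral_cmult) simp
          also have "\<dots> \<le> ennreal ((norm H)\<^sup>2) * ennreal e1" by (intro mult_left_mono ly Tin) simp
          finally show "l2sq M (\<lambda>\<omega>. H (y T \<omega>)) \<le> ennreal ((norm H)\<^sup>2 * e1)" using e1 by (simp add: ennreal_mult)
        qed (use py(1,2) e1 T blinfun_measurable[OF T Q W yT] in auto)
        show "l2sq M (\<lambda>\<omega>. Z m \<omega> - J \<omega>) \<le> ennreal (\<epsilon> / 4)" using m2 m by simp
        show "(\<lambda>\<omega>. H (y T \<omega>) + bint a b (\<lambda>r. G r (y r \<omega>))) \<in> borel_measurable M"
          by (intro borel_measurable_add py(1) blinfun_measurable[OF T Q W yT])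
        show "0 \<le> 2 * ((norm H)\<^sup>2 * e1) + 2 * (C\<^sup>2 * T * (T * e1))" using e1 T by simp
      qed (use J e in auto)
      also have "\<dots> \<le> ennreal \<epsilon>"
      proof (rule ennreal_leI)
        have "2 * (2 * ((norm H)\<^sup>2 * e1) + 2 * (C\<^sup>2 * T * (T * e1))) \<le> w * e1"
          unfolding w_def using e1 by (simp add: algebra_simps)
        also have "w * e1 = \<epsilon> / 2" using w by (simp add: e1_def)
        finally show "2 * (2 * ((norm H)\<^sup>2 * e1) + 2 * (C\<^sup>2 * T * (T * e1))) + 2 * (\<epsilon> / 4) \<le> \<epsilon>" by simp
      qed
      finally show ?thesis .
    qed
    then show ?thesis by blast
  qed
  have conv': "\<exists>m0. \<forall>m\<ge>m0. l2sq M (\<lambda>\<omega>. L (appr m t \<omega>) - L (fwd t \<omega>)) \<le> ennreal \<epsilon>" if e: "\<epsilon> > 0" for \<epsilon>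
  proof -
    define e1 where "e1 = \<epsilon> / ((norm L)\<^sup>2 + 1)"
    have n1: "(norm L)\<^sup>2 + 1 > 0" by (intro add_nonneg_pos) auto
    have e1: "e1 > 0" using e n1 by (simp add: e1_def)
    obtain m1 where m1: "\<forall>i\<in>{0..T}. \<forall>m\<ge>m1. l2sq M (\<lambda>\<omega>. appr m i \<omega> - fwd i \<omega>) \<le> ennreal e1"
      using fwd_approx[OF e1] by (rule exE)
    have "l2sq M (\<lambda>\<omega>. L (appr m t \<omega>) - L (fwd t \<omega>)) \<le> ennreal \<epsilon>" if m: "m \<ge> m1" for m
    proof -
      have mm: "(\<lambda>\<omega>. appr m t \<omega> - fwd t \<omega>) \<in> borel_measurable M" by (intro borel_measurable_diff appr_measurable fwd_measurable)
      have "l2sq M (\<lambda>\<omega>. L (appr m t \<omega>) - L (fwd t \<omega>)) \<le> (\<integral>\<^sup>+\<omega>. ennreal ((norm L)\<^sup>2) * ennreal ((norm (appr m t \<omega> - fwd t \<omega>))\<^sup>2) \<partial>M)"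
        unfolding blinfun.diff_right[symmetric]
        by (intro nn_integral_mono) (auto simp: ennreal_mult[symmetric] power_mult_distrib[symmetric] intro!: ennreal_leI power_mono norm_blinfun)
      also have "\<dots> = ennreal ((norm L)\<^sup>2) * l2sq M (\<lambda>\<omega>. appr m t \<omega> - fwd t \<omega>)" using mm by (intro nn_integral_cmult) simp
      also have "\<dots> \<le> ennreal ((norm L)\<^sup>2) * ennreal e1" using m1 t m by (intro mult_left_mono) auto
      also have "\<dots> = ennreal ((norm L)\<^sup>2 * e1)" using e1 by (simp add: ennreal_mult)
      also have "\<dots> \<le> ennreal (((norm L)\<^sup>2 + 1) * e1)" using e1 by (intro ennreal_leI mult_right_mono) auto
      also have "((norm L)\<^sup>2 + 1) * e1 = \<epsilon>" using n1 by (simp add: e1_def)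
      finally show ?thesis .
    qed
    then show ?thesis by blast
  qed
  have "AE \<omega> in M. L (fwd t \<omega>) = g \<omega>"
    by (rule l2sq_limit_unique[OF blinfun_measurable[OF T Q W fwd_measurable(2)] gm blinfun_measurable[OF T Q W appr_measurable(2)] conv' conv])
  then show ?thesis using px(2) unfolding g_def by eventually_elim simp
qed

end

end

end

section \<open>The two mild equations\<close>

context
  fixes T :: real and S :: "real \<Rightarrow> 'h::separable_hilbert \<Rightarrow>\<^sub>L 'h" and K :: "real \<Rightarrow> 'h \<Rightarrow>\<^sub>L 'h"
  assumes T: "0 \<le> T" and S: "C0_semigroup S" and K: "K \<in> Cs T"
begin

text \<open>From \<open>p\<close> on the path is the evolution of \<open>v\<close> and satisfies its
  mild equation; for \<open>t\<close> before \<open>p\<close> both sides vanish, the integral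
  because the impulse has not acted yet.\<close>

lemma jump_forward:
  assumes p: "p \<in> {0..T}" and t: "t \<in> {0..T}"
  shows "set_integrable lborel {0..t} (\<lambda>r. S (t - r) (K r (jump T S K p v r)))"
    and "jump T S K p v t = (if p \<le> t then S (t - p) v else 0) + bint 0 t (\<lambda>r. S (t - r) (K r (jump T S K p v r)))"
proof -
  have p0: "0 \<le> p" "p \<le> T" using p by auto
  have eq: "(\<lambda>r. S (t - r) (K r (jump T S K p v r))) = (\<lambda>r. if p \<le> r then S (t - r) (K r (evol T S K r p v)) else 0)"
    by auto
  have c: "set_integrable lborel {max 0 p..t} (\<lambda>r. S (t - r) (K r (evol T S K r p v)))"
    using forcing_continuous(1)[OF T S K p0(1) evol_continuous[OF T S K p0] continuous_on_const[of _ 0], of t v] t p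
    by (intro continuous_set_integrable) (simp add: max_absorb2)
  show "set_integrable lborel {0..t} (\<lambda>r. S (t - r) (K r (jump T S K p v r)))"
    unfolding eq by (rule bint_if_ge(1)[OF c])
  have b: "bint 0 t (\<lambda>r. S (t - r) (K r (jump T S K p v r))) = bint p t (\<lambda>r. S (t - r) (K r (evol T S K r p v)))"
    unfolding eq using bint_if_ge(2)[OF c] p0 by (simp add: max_absorb2)
  show "jump T S K p v t = (if p \<le> t then S (t - p) v else 0) + bint 0 t (\<lambda>r. S (t - r) (K r (jump T S K p v r)))"
  proof (cases "p \<le> t")
    case True
    then show ?thesis unfolding b using evol_eq[OF T S K p0(1), of t v] t by simp
  next
    case False
    then have "bint p t (\<lambda>r. S (t - r) (K r (evol T S K r p v))) = 0" by (simp add: set_lebesgue_integral_def)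
    then show ?thesis unfolding b using False by simp
  qed
qed

end

context prob_space
begin

context
  fixes T :: real and Q :: "'v::separable_hilbert \<Rightarrow>\<^sub>L 'v" and W :: "real \<Rightarrow> 'a \<Rightarrow> 'v"
    and S K :: "real \<Rightarrow> 'h::separable_hilbert \<Rightarrow>\<^sub>L 'h" and sig :: "'v \<Rightarrow>\<^sub>L 'h" and xh :: "real \<Rightarrow> 'h"
  assumes T: "0 < T" and Q: "positive_trace_class Q" and W: "Q_wiener T M Q W"
    and S: "C0_semigroup S" and K: "K \<in> Cs T" and xh: "continuous_on {0..T} xh"
begin

abbreviation "X \<equiv> approximant T W S K sig xh"
abbreviation "x \<equiv> forward_process T W S K sig xh"

text \<open>At a fixed level the approximant is mean-square continuous except for jumps at grid
  points. A jump exactly at \<open>t\<close> does not fade as \<open>s\<close> tends to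
  \<open>t\<close>, but its second moment is of the size of one cell. So the level is chosen first,
  making this jump and the uniform approximation error small, and the neighbourhood of
  \<open>t\<close> afterwards.\<close>

lemma fwd_L2_continuous:
  assumes t: "t \<in> {0..T}"
  shows "((\<lambda>s. l2sq M (\<lambda>\<omega>. x s \<omega> - x t \<omega>)) \<longlongrightarrow> 0) (at t within {0..T})"
proof (rule ennreal_tendsto_0I')
  fix \<epsilon> :: real assume "\<epsilon> > 0"
  \<comment> \<open>The nested uses of \<open>l2sq_add_le\<close> at the end add up to
    \<open>30 * e\<close>.\<close>
  define e where "e = \<epsilon> / 30"
  have e: "e > 0" using \<open>\<epsilon> > 0\<close> by (simp add: e_def)
  have T0: "0 \<le> T" using T by simp
  have "\<exists>C\<ge>1. \<forall>s t. 0 \<le> s \<longrightarrow> t \<in> {s..T} \<longrightarrow> norm (evol T S K t s) \<le> C" by (rule evol_bound[OF T0 S K])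
  then obtain C where C: "1 \<le> C" "\<And>s t. 0 \<le> s \<Longrightarrow> t \<in> {s..T} \<Longrightarrow> norm (evol T S K t s) \<le> C" by (elim exE conjE) simp
  have "\<exists>D\<ge>0. \<forall>L::'v \<Rightarrow>\<^sub>L 'h. hs_sq Q L \<le> D * (norm L)\<^sup>2" by (rule hs_sq_bound[OF Q])
  then obtain D where D: "0 \<le> D" "\<And>L::'v \<Rightarrow>\<^sub>L 'h. hs_sq Q L \<le> D * (norm L)\<^sup>2" by (elim exE conjE) simp
  define c where "c = D * (C * norm sig + C * norm sig)\<^sup>2"
  have c: "0 \<le> c" using D(1) by (simp add: c_def)
  have "(\<lambda>m. T * c * (1 / 2) ^ m) \<longlonglongrightarrow> T * c * 0" by (intro tendsto_intros LIMSEQ_power_zero) simp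
  then have "\<forall>\<^sub>F m in sequentially. T * c * (1 / 2) ^ m < e" using order_tendstoD(2)[of _ 0 sequentially e] e by simp
  then obtain m2 where m2: "\<And>m. m \<ge> m2 \<Longrightarrow> T * c * (1 / 2) ^ m < e" unfolding eventually_sequentially by blast
  obtain m1 where m1: "\<forall>i\<in>{0..T}. \<forall>m\<ge>m1. l2sq M (\<lambda>\<omega>. X m i \<omega> - x i \<omega>) \<le> ennreal e"
    using fwd_approx[OF T Q W S K xh e] by (rule exE)
  define m where "m = max m1 m2"
  have small: "T / 2 ^ m * c \<le> e" using m2[of m] by (simp add: m_def power_one_over field_simps)
  have approx: "l2sq M (\<lambda>\<omega>. X m i \<omega> - x i \<omega>) \<le> ennreal e" if "i \<in> {0..T}" for i
    using m1[rule_format, OF that, of m] by (simp add: m_def)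
  define p where "p k = dyad T m (Suc k)" for k
  have p0: "0 \<le> p k" for k using T by (simp add: p_def dyad_def)
  have p_inj: "p j = p k \<Longrightarrow> j = k" for j k using T by (simp add: p_def dyad_def)
  \<comment> \<open>The operator that the approximant at time \<open>s\<close> applies to the
    increment \<open>k\<close>; as a function of \<open>s\<close> it jumps only at
    \<open>p k\<close>.\<close>
  define L where "L k s = (if p k \<le> s then evol T S K s (p k) o\<^sub>L sig else 0)" for k s
  have XL: "X m s \<omega> = xh s + dsum T W m (\<lambda>k. L k s) \<omega>" if "s \<in> {0..T}" for s \<omega>
  proof -
    have "0 \<le> dyad T m k" for k using T by (simp add: dyad_def)
    then have "wind T 0 s (\<lambda>u. evol T S K s u o\<^sub>L sig) m = (\<lambda>k. L k s)" by (auto simp: wind_def L_def p_def)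
    then show ?thesis using appr_dsum[OF T Q W S K xh that, of sig m \<omega>] by simp
  qed
  have nL: "norm (L k s) \<le> C * norm sig" if "s \<in> {0..T}" for k s
  proof (cases "p k \<le> s")
    case True
    then have "norm (evol T S K s (p k) o\<^sub>L sig) \<le> C * norm sig"
      by (intro order_trans[OF norm_blinfun_compose mult_right_mono[OF C(2) norm_ge_zero]]) (use p0 that in auto)
    then show ?thesis using True by (simp add: L_def)
  qed (use C(1) in \<open>simp add: L_def\<close>)
  have jump_bound: "hs_sq Q (L k s - L k t) \<le> c" if s: "s \<in> {0..T}" for k s
  proof -
    have "norm (L k s - L k t) \<le> C * norm sig + C * norm sig"
      by (rule order_trans[OF norm_triangle_ineq4 add_mono[OF nL[OF s] nL[OF t]]])
    then show ?thesis unfolding c_def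
      by (intro order_trans[OF D(2) mult_left_mono[OF power_mono D(1)]]) auto
  qed
  have hs0: "hs_sq Q (0 :: 'v \<Rightarrow>\<^sub>L 'h) = 0" by (rule hs_sq_zero[OF Q])
  \<comment> \<open>If the impulse lies in the past of \<open>t\<close>, the evolution is continuous
    in its end time and \<open>hs_sq_modulus\<close> applies; if it lies in the future, both
    operators are 0 near \<open>t\<close>.\<close>
  have ev: "\<forall>\<^sub>F s in at t within {0..T}. hs_sq Q (L k s - L k t) \<le> e / T" if ne: "p k \<noteq> t" for k
  proof (cases "p k < t")
    case True
    then have pk: "0 \<le> p k" "p k \<le> T" using p0[of k] t by auto
    have "\<exists>\<delta>>0. \<forall>i\<in>{()}. \<forall>r\<in>{p k..T}. \<forall>r'\<in>{p k..T}. \<bar>r - r'\<bar> < \<delta> \<longrightarrow>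
        hs_sq Q ((evol T S K r (p k) o\<^sub>L sig) - (evol T S K r' (p k) o\<^sub>L sig)) \<le> e / T"
    proof (rule hs_sq_modulus[OF Q])
      show "norm (evol T S K r (p k) o\<^sub>L sig) \<le> C * norm sig" if "r \<in> {p k..T}" for r
        by (intro order_trans[OF norm_blinfun_compose mult_right_mono[OF C(2) norm_ge_zero]]) (use p0 that in auto)
      fix v and \<epsilon> :: real assume "\<epsilon> > 0"
      have "uniformly_continuous_on {p k..T} (\<lambda>r. evol T S K r (p k) (sig v))"
        by (rule compact_uniformly_continuous[OF evol_continuous[OF T0 S K pk] compact_Icc])
      then obtain d where d: "d > 0" "\<forall>r\<in>{p k..T}. \<forall>r'\<in>{p k..T}. dist r' r < d \<longrightarrow> dist (evol T S K r' (p k) (sig v)) (evol T S K r (p k) (sig v)) < \<epsilon>"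
        unfolding uniformly_continuous_on_def using \<open>\<epsilon> > 0\<close> by meson
      have "norm ((evol T S K r (p k) o\<^sub>L sig) v - (evol T S K r' (p k) o\<^sub>L sig) v) < \<epsilon>"
        if "r \<in> {p k..T}" "r' \<in> {p k..T}" "\<bar>r - r'\<bar> < d" for r r'
        using d(2)[rule_format, of r' r] that by (simp add: dist_norm dist_real_def)
      then show "\<exists>\<delta>>0. \<forall>i\<in>{()}. \<forall>r\<in>{p k..T}. \<forall>r'\<in>{p k..T}. \<bar>r - r'\<bar> < \<delta> \<longrightarrow>
          norm ((evol T S K r (p k) o\<^sub>L sig) v - (evol T S K r' (p k) o\<^sub>L sig) v) < \<epsilon>"
        using d(1) by blast
    qed (use e T in simp)
    then obtain \<delta> where \<delta>: "\<delta> > 0" "\<And>r r'. r \<in> {p k..T} \<Longrightarrow> r' \<in> {p k..T} \<Longrightarrow> \<bar>r - r'\<bar> < \<delta> \<Longrightarrow>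
        hs_sq Q ((evol T S K r (p k) o\<^sub>L sig) - (evol T S K r' (p k) o\<^sub>L sig)) \<le> e / T" by (elim exE conjE) simp
    have "hs_sq Q (L k s - L k t) \<le> e / T" if "s \<in> {0..T}" "dist s t < min \<delta> (t - p k)" for s
    proof -
      have "p k \<le> s" "\<bar>s - t\<bar> < \<delta>" using that by (auto simp: dist_real_def)
      then show ?thesis using \<delta>(2)[of s t] True t that(1) by (simp add: L_def)
    qed
    then show ?thesis unfolding eventually_at using \<delta>(1) True by (intro exI[of _ "min \<delta> (t - p k)"]) auto
  next
    case False
    then have lt: "t < p k" using ne by simp
    have "hs_sq Q (L k s - L k t) \<le> e / T" if "dist s t < p k - t" for s
    proof -
      have "s < p k" using that lt by (auto simp: dist_real_def)
      then show ?thesis using lt hs0 e T by (simp add: L_def)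
    qed
    then show ?thesis unfolding eventually_at using lt by (intro exI[of _ "p k - t"]) auto
  qed
  have ev_all: "\<forall>\<^sub>F s in at t within {0..T}. \<forall>k\<in>{..<2^m}. p k \<noteq> t \<longrightarrow> hs_sq Q (L k s - L k t) \<le> e / T"
  proof (rule eventually_ball_finite[OF finite_lessThan], rule ballI)
    fix k :: nat
    show "\<forall>\<^sub>F s in at t within {0..T}. p k \<noteq> t \<longrightarrow> hs_sq Q (L k s - L k t) \<le> e / T"
      using ev[of k] by (cases "p k = t") auto
  qed
  have "((\<lambda>s. (norm (xh s - xh t))\<^sup>2) \<longlongrightarrow> (norm (xh t - xh t))\<^sup>2) (at t within {0..T})"
    using xh t unfolding continuous_on_def by (intro tendsto_intros) auto
  then have ev_xh: "\<forall>\<^sub>F s in at t within {0..T}. (norm (xh s - xh t))\<^sup>2 < e"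
    by (rule order_tendstoD(2)) (simp add: e)
  have "\<forall>\<^sub>F s in at t within {0..T}. s \<in> {0..T}" by (simp add: eventually_at_filter)
  with ev_all ev_xh show "\<forall>\<^sub>F s in at t within {0..T}. l2sq M (\<lambda>\<omega>. x s \<omega> - x t \<omega>) \<le> ennreal \<epsilon>"
  proof eventually_elim
    case (elim s)
    note s = elim(3)
    \<comment> \<open>Every cell may spend \<open>e / 2^m\<close>; at most one, whose right end is
      \<open>t\<close>, also contributes the jump.\<close>
    have "(\<Sum>k<2^m. T / 2^m * hs_sq Q (L k s - L k t)) \<le> (\<Sum>k<(2::nat)^m. e / 2^m + (if p k = t then T / 2^m * c else 0))"
    proof (rule sum_mono)
      fix k :: nat assume k: "k \<in> {..<2^m}"
      show "T / 2^m * hs_sq Q (L k s - L k t) \<le> e / 2^m + (if p k = t then T / 2^m * c else 0)"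
      proof (cases "p k = t")
        case True
        have "T / 2^m * hs_sq Q (L k s - L k t) \<le> T / 2^m * c" using T by (intro mult_left_mono jump_bound[OF s]) simp
        moreover have "0 \<le> e / 2^m" using e by simp
        ultimately show ?thesis using True by simp
      next
        case False
        have "T / 2^m * hs_sq Q (L k s - L k t) \<le> T / 2^m * (e / T)"
          using T elim(1)[rule_format, OF k False] by (intro mult_left_mono) simp_all
        then show ?thesis using False T by simp
      qed
    qed
    also have "\<dots> = e + (\<Sum>k<(2::nat)^m. if p k = t then T / 2^m * c else 0)" by (simp add: sum.distrib)
    also have "(\<Sum>k<(2::nat)^m. if p k = t then T / 2^m * c else 0) \<le> e"
    proof (cases "\<exists>k0<2^m. p k0 = t")
      case True
      then obtain k0 where k0: "k0 < 2^m" "p k0 = t" by blast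
      have "(\<Sum>k<(2::nat)^m. if p k = t then T / 2^m * c else 0) = (\<Sum>k<(2::nat)^m. if k = k0 then T / 2^m * c else 0)"
        using k0(2) p_inj by (intro sum.cong refl) auto
      then show ?thesis using k0(1) small by simp
    next
      case False
      then have "(\<Sum>k<(2::nat)^m. if p k = t then T / 2^m * c else 0) = 0" by (intro sum.neutral) auto
      then show ?thesis using e by simp
    qed
    finally have sums: "(\<Sum>k<2^m. T / 2^m * hs_sq Q (L k s - L k t)) \<le> 2 * e" by simp
    have Xd: "l2sq M (\<lambda>\<omega>. X m s \<omega> - X m t \<omega>) \<le> ennreal (2 * e + 2 * (2 * e))"
    proof (rule l2sq_add_le[of "\<lambda>\<omega>. xh s - xh t" _ "dsum T W m (\<lambda>k. L k s - L k t)"])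
      show "X m s \<omega> - X m t \<omega> = (xh s - xh t) + dsum T W m (\<lambda>k. L k s - L k t) \<omega>" for \<omega>
        unfolding XL[OF s] XL[OF t] dsum_diff[OF T Q W, symmetric] by simp
      show "l2sq M (\<lambda>\<omega>. xh s - xh t) \<le> ennreal e" using elim(2) by (simp add: emeasure_space_1 ennreal_leI)
      show "l2sq M (dsum T W m (\<lambda>k. L k s - L k t)) \<le> ennreal (2 * e)"
        by (rule order_trans[OF dsum_bound[OF T Q W] ennreal_leI[OF sums]])
    qed (use e dsum_measurable[OF T Q W] in auto)
    note meas = appr_measurable(2)[OF T Q W S K xh] fwd_measurable(2)[OF T Q W S K xh]
    have "l2sq M (\<lambda>\<omega>. x s \<omega> - x t \<omega>) \<le> ennreal (2 * e + 2 * (2 * (2 * e + 2 * (2 * e)) + 2 * e))"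
    proof (rule l2sq_add_le[of "\<lambda>\<omega>. x s \<omega> - X m s \<omega>" _ "\<lambda>\<omega>. (X m s \<omega> - X m t \<omega>) + (X m t \<omega> - x t \<omega>)"])
      show "l2sq M (\<lambda>\<omega>. x s \<omega> - X m s \<omega>) \<le> ennreal e" using approx[OF s] by (simp add: norm_minus_commute)
      show "l2sq M (\<lambda>\<omega>. (X m s \<omega> - X m t \<omega>) + (X m t \<omega> - x t \<omega>)) \<le> ennreal (2 * (2 * e + 2 * (2 * e)) + 2 * e)"
        by (rule l2sq_add_le[OF _ _ refl Xd approx[OF t]]) (use e meas in auto)
    qed (use e meas in auto)
    also have "2 * e + 2 * (2 * (2 * e + 2 * (2 * e)) + 2 * e) = \<epsilon>" by (simp add: e_def)
    finally show ?case .
  qed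
qed

lemma fwd_adapted_L2_continuous: "adapted_L2_continuous T M (aug_filtration M W) x"
proof -
  obtain c where c: "\<forall>r\<in>{0..T}. l2sq M (x r) \<le> ennreal c" using fwd_l2_bound[OF T Q W S K xh, of sig] by (elim exE conjE)
  have "l2sq M (x t) < \<infinity>" if "t \<in> {0..T}" for t
    using c[rule_format, OF that] by (auto intro: le_less_trans)
  then show ?thesis
    unfolding adapted_L2_continuous_def
    by (intro conjI ballI fwd_measurable(4)[OF T Q W S K xh] fwd_L2_continuous) auto
qed

section \<open>The forward and the backward equation\<close>

context
  fixes f :: "real \<Rightarrow> 'h" and xi :: 'h
  assumes f: "continuous_on {0..T} f" and mild: "mild T S K 0 f xi xh"
begin

text \<open>The noise-free part satisfies its mild equation and each impulse satisfies
  \<open>jump_forward\<close>; by linearity the approximants satisfy the equation on every path,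
  with the free terms of the impulses forming the dyadic sum for \<open>S (t - s)\<close> composed
  with \<open>sig\<close>. Only the limit remains.\<close>

lemma forward_equation:
  assumes t: "t \<in> {0..T}"
  shows "\<exists>J. has_ito_integral M (aug_filtration M W) Q W 0 t (\<lambda>r \<omega>. restrict_VQ Q (S (t - r) o\<^sub>L sig)) J \<and>
    (AE \<omega> in M. set_integrable lborel {0..t} (\<lambda>r. S (t - r) (K r (x r \<omega>) + f r)) \<and>
      x t \<omega> = S t xi + bint 0 t (\<lambda>r. S (t - r) (K r (x r \<omega>) + f r)) + J \<omega>)"
proof -
  have T0: "0 \<le> T" using T by simp
  have Sc: "continuous_on {0..t} (\<lambda>r. S (t - r) (g r))" if "continuous_on {0..t} g" for g
    by (rule Cs_shift[OF C0_semigroup_Cs[OF S, of T] _ _ that]) (use t in \<open>auto intro!: continuous_intros\<close>)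
  have sub: "{0..t} \<subseteq> {0..T}" using t by auto
  have fi: "set_integrable lborel {0..t} (\<lambda>r. S (t - r) (f r))"
    by (intro continuous_set_integrable Sc continuous_on_subset[OF f sub])
  have xi': "set_integrable lborel {0..t} (\<lambda>r. S (t - r) (K r (xh r)))"
    by (intro continuous_set_integrable Sc Cs_apply[OF K _ sub] continuous_on_subset[OF xh sub])
  \<comment> \<open>The shape of \<open>pass_to_limit\<close> with the identity for \<open>L\<close>
    and 0 for \<open>H\<close>.\<close>
  have id: "id_blinfun (X m t \<omega>) = (0::'h \<Rightarrow>\<^sub>L 'h) (X m T \<omega>) + (S t xi + bint 0 t (\<lambda>r. S (t - r) (f r)))
      + bint 0 t (\<lambda>r. (S (t - r) o\<^sub>L K r) (X m r \<omega>)) + dsum T W m (wind T 0 t (\<lambda>s. S (t - s) o\<^sub>L sig) m) \<omega>" for m \<omega>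
  proof -
    define p where "p k = dyad T m (Suc k)" for k
    define v where "v k = sig (incr T W m k \<omega>)" for k
    define J where "J k r = jump T S K (p k) (v k) r" for k r
    have p: "p k \<in> {0..T}" if "k < 2^m" for k unfolding p_def using that T by (intro dyad_range) auto
    have XJ: "X m r \<omega> = xh r + (\<Sum>k<2^m. J k r)" if "r \<in> {0..T}" for r
      unfolding appr_jump[OF T Q W S K xh that] J_def p_def v_def ..
    have Ji: "set_integrable lborel {0..t} (\<lambda>r. S (t - r) (K r (J k r)))" if "k < 2^m" for k
      unfolding J_def by (rule jump_forward(1)[OF T0 S K p[OF that] t])
    have Jsum: "set_integrable lborel {0..t} (\<lambda>r. \<Sum>k<2^m. S (t - r) (K r (J k r)))"
        "bint 0 t (\<lambda>r. \<Sum>k<2^m. S (t - r) (K r (J k r))) = (\<Sum>k<2^m. bint 0 t (\<lambda>r. S (t - r) (K r (J k r))))"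
      by (rule bint_sum, simp add: Ji)+
    have "bint 0 t (\<lambda>r. (S (t - r) o\<^sub>L K r) (X m r \<omega>))
        = bint 0 t (\<lambda>r. S (t - r) (K r (xh r)) + (\<Sum>k<2^m. S (t - r) (K r (J k r))))"
    proof (rule bint_cong)
      fix r assume "r \<in> {0..t}"
      then have "r \<in> {0..T}" using sub by blast
      then show "(S (t - r) o\<^sub>L K r) (X m r \<omega>) = S (t - r) (K r (xh r)) + (\<Sum>k<2^m. S (t - r) (K r (J k r)))"
        by (simp only: XJ blinfun_apply_blinfun_compose blinfun.add_right blinfun.sum_right)
    qed
    also have "\<dots> = bint 0 t (\<lambda>r. S (t - r) (K r (xh r))) + (\<Sum>k<2^m. bint 0 t (\<lambda>r. S (t - r) (K r (J k r))))"
      unfolding set_integral_add(2)[OF xi' Jsum(1)] Jsum(2) ..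
    finally have b: "bint 0 t (\<lambda>r. (S (t - r) o\<^sub>L K r) (X m r \<omega>))
      = bint 0 t (\<lambda>r. S (t - r) (K r (xh r))) + (\<Sum>k<2^m. bint 0 t (\<lambda>r. S (t - r) (K r (J k r))))" .
    have "xh t = S t xi + bint 0 t (\<lambda>r. S (t - r) (K r (xh r) + f r))"
      using mild t unfolding mild_def[OF T0 S K] by auto
    also have "bint 0 t (\<lambda>r. S (t - r) (K r (xh r) + f r)) = bint 0 t (\<lambda>r. S (t - r) (K r (xh r))) + bint 0 t (\<lambda>r. S (t - r) (f r))"
      unfolding blinfun.add_right by (rule set_integral_add(2)[OF xi' fi])
    finally have xt: "xh t = S t xi + (bint 0 t (\<lambda>r. S (t - r) (K r (xh r))) + bint 0 t (\<lambda>r. S (t - r) (f r)))" .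
    have "J k t = (if p k \<le> t then S (t - p k) (v k) else 0) + bint 0 t (\<lambda>r. S (t - r) (K r (J k r)))" if "k < 2^m" for k
      unfolding J_def by (rule jump_forward(2)[OF T0 S K p[OF that] t])
    then have "(\<Sum>k<2^m. J k t) = (\<Sum>k<2^m. (if p k \<le> t then S (t - p k) (v k) else 0) + bint 0 t (\<lambda>r. S (t - r) (K r (J k r))))"
      by (intro sum.cong refl) simp
    also have "\<dots> = (\<Sum>k<2^m. if p k \<le> t then S (t - p k) (v k) else 0) + (\<Sum>k<2^m. bint 0 t (\<lambda>r. S (t - r) (K r (J k r))))"
      by (rule sum.distrib)
    also have "(\<Sum>k<2^m. if p k \<le> t then S (t - p k) (v k) else 0) = dsum T W m (wind T 0 t (\<lambda>s. S (t - s) o\<^sub>L sig) m) \<omega>"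
    proof -
      have "0 \<le> dyad T m k" for k using T by (simp add: dyad_def)
      then show ?thesis unfolding dsum_def[OF T Q W] by (intro sum.cong refl) (simp add: wind_def p_def v_def)
    qed
    finally show ?thesis unfolding b XJ[OF t] xt by (simp add: algebra_simps)
  qed
  have Gc: "continuous_on {0..t} (\<lambda>r. (S (t - r) o\<^sub>L K r) v)" for v
    unfolding blinfun_apply_blinfun_compose by (intro Sc Cs_apply[OF K _ sub] continuous_on_const)
  have \<Phi>c: "continuous_on {0..t} (\<lambda>r. (S (t - r) o\<^sub>L sig) v)" for v
    unfolding blinfun_apply_blinfun_compose by (intro Sc continuous_on_const)
  have "0 \<in> {0..T}" using T by simp
  from ito_integral_exists[OF T Q W this t \<Phi>c]
  obtain J where J: "J \<in> borel_measurable M"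
    "\<forall>\<epsilon>>0. \<exists>m0. \<forall>m\<ge>m0. l2sq M (\<lambda>\<omega>. dsum T W m (wind T 0 t (\<lambda>s. S (t - s) o\<^sub>L sig) m) \<omega> - J \<omega>) \<le> ennreal \<epsilon>"
    "has_ito_integral M (aug_filtration M W) Q W 0 t (\<lambda>r \<omega>. restrict_VQ Q (S (t - r) o\<^sub>L sig)) J" by (elim exE conjE)
  have "t \<le> T" using t by simp
  from pass_to_limit[OF T Q W S K xh order_refl this t Gc id dsum_measurable[OF T Q W] J(1) J(2)[rule_format]]
  have "AE \<omega> in M. set_integrable lborel {0..t} (\<lambda>r. (S (t - r) o\<^sub>L K r) (x r \<omega>)) \<and> id_blinfun (x t \<omega>) = (0::'h \<Rightarrow>\<^sub>L 'h) (x T \<omega>)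
      + (S t xi + bint 0 t (\<lambda>r. S (t - r) (f r))) + bint 0 t (\<lambda>r. (S (t - r) o\<^sub>L K r) (x r \<omega>)) + J \<omega>" .
  then have "AE \<omega> in M. set_integrable lborel {0..t} (\<lambda>r. S (t - r) (K r (x r \<omega>) + f r)) \<and>
      x t \<omega> = S t xi + bint 0 t (\<lambda>r. S (t - r) (K r (x r \<omega>) + f r)) + J \<omega>"
  proof eventually_elim
    case (elim \<omega>)
    then have i: "set_integrable lborel {0..t} (\<lambda>r. S (t - r) (K r (x r \<omega>)))"
      and e: "x t \<omega> = S t xi + bint 0 t (\<lambda>r. S (t - r) (f r)) + bint 0 t (\<lambda>r. S (t - r) (K r (x r \<omega>))) + J \<omega>"
      by simp_all
    show ?case unfolding blinfun.add_right
      using set_integral_add[OF i fi] by (auto simp: e)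
  qed
  with J(3) show ?thesis by blast
qed

text \<open>The noise-free part obeys \<open>riccati_mild_solution\<close> and each impulse
  \<open>jump_backward\<close>. The impulses after \<open>t\<close> form the dyadic sum over the
  window \<open>{t..T}\<close>, except for the impulse of a cell that has \<open>t\<close> in its
  interior; that term vanishes in the limit.\<close>

lemma backward_equation:
  fixes eta Theta :: "real \<Rightarrow> 'h \<Rightarrow>\<^sub>L 'h"
  assumes eta: "eta \<in> Cs T" and Theta: "Theta \<in> Cs T"
    and weak: "\<And>x y t. t \<in> {0..T} \<Longrightarrow> eta t x \<bullet> y = eta T (S (T - t) x) \<bullet> S (T - t) y
      + bint t T (\<lambda>r. (Theta r (S (r - t) x) + eta r (K r (S (r - t) x))) \<bullet> S (r - t) y)"
    and t: "t \<in> {0..T}"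
  shows "\<exists>I. has_ito_integral M (aug_filtration M W) Q W t T (\<lambda>r \<omega>. restrict_VQ Q (- (adj (S (r - t)) o\<^sub>L eta r o\<^sub>L sig))) I \<and>
    (AE \<omega> in M. set_integrable lborel {t..T} (\<lambda>r. adj (S (r - t)) (Theta r (x r \<omega>) - eta r (f r))) \<and>
      eta t (x t \<omega>) = adj (S (T - t)) (eta T (x T \<omega>))
        + bint t T (\<lambda>r. adj (S (r - t)) (Theta r (x r \<omega>) - eta r (f r))) + I \<omega>)"
proof -
  have T0: "0 \<le> T" using T by simp
  have sub: "{t..T} \<subseteq> {0..T}" and t0: "0 \<le> t" "t \<le> T" using t by auto
  have Sc: "continuous_on {t..T} (\<lambda>r. adj (S (r - t)) (g r))" if "continuous_on {t..T} g" for g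
    by (rule Cs_shift[OF C0_semigroup_Cs[OF C0_semigroup_adj[OF S], of T] _ _ that]) (use t in \<open>auto intro!: continuous_intros\<close>)
  define c where "c = - bint t T (\<lambda>r. adj (S (r - t)) (eta r (f r)))"
  have fi: "set_integrable lborel {t..T} (\<lambda>r. adj (S (r - t)) (eta r (f r)))"
    by (intro continuous_set_integrable Sc Cs_apply[OF eta _ sub] continuous_on_subset[OF f sub])
  have xi': "set_integrable lborel {t..T} (\<lambda>r. adj (S (r - t)) (Theta r (xh r)))"
    by (intro continuous_set_integrable Sc Cs_apply[OF Theta _ sub] continuous_on_subset[OF xh sub])
  \<comment> \<open>The sign arises because the impulse terms of \<open>jump_backward\<close> move
    to the right side of the identity.\<close>
  define \<Phi> where "\<Phi> s = - (adj (S (s - t)) o\<^sub>L eta s o\<^sub>L sig)" for s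
  \<comment> \<open>The impulse of the cell cut by \<open>t\<close>: it occurs after
    \<open>t\<close>, so \<open>jump_backward\<close> counts it, but its cell is not contained in
    the window, so \<open>wind\<close> omits it.\<close>
  define str where "str m = dsum T W m (\<lambda>k. if dyad T m k < t \<and> t < dyad T m (Suc k)
    then adj (S (dyad T m (Suc k) - t)) o\<^sub>L eta (dyad T m (Suc k)) o\<^sub>L sig else 0)" for m
  have id: "eta t (X m t \<omega>) = (adj (S (T - t)) o\<^sub>L eta T) (X m T \<omega>) + c
      + bint t T (\<lambda>r. (adj (S (r - t)) o\<^sub>L Theta r) (X m r \<omega>)) + (dsum T W m (wind T t T \<Phi> m) \<omega> - str m \<omega>)" for m \<omega>
  proof -
    define p where "p k = dyad T m (Suc k)" for k
    define v where "v k = sig (incr T W m k \<omega>)" for k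
    define J where "J k r = jump T S K (p k) (v k) r" for k r
    define a where "a k = adj (S (p k - t)) (eta (p k) (v k))" for k
    have p: "p k \<in> {0..T}" if "k < 2^m" for k unfolding p_def using that T by (intro dyad_range) auto
    have XJ: "X m r \<omega> = xh r + (\<Sum>k<2^m. J k r)" if "r \<in> {0..T}" for r
      unfolding appr_jump[OF T Q W S K xh that] J_def p_def v_def ..
    have Ji: "set_integrable lborel {t..T} (\<lambda>r. adj (S (r - t)) (Theta r (J k r)))" if "k < 2^m" for k
      unfolding J_def by (rule jump_backward(1)[OF T0 S K eta Theta weak p[OF that] t])
    have Jsum: "set_integrable lborel {t..T} (\<lambda>r. \<Sum>k<2^m. adj (S (r - t)) (Theta r (J k r)))"
        "bint t T (\<lambda>r. \<Sum>k<2^m. adj (S (r - t)) (Theta r (J k r))) = (\<Sum>k<2^m. bint t T (\<lambda>r. adj (S (r - t)) (Theta r (J k r))))"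
      by (rule bint_sum, simp add: Ji)+
    have "bint t T (\<lambda>r. (adj (S (r - t)) o\<^sub>L Theta r) (X m r \<omega>))
        = bint t T (\<lambda>r. adj (S (r - t)) (Theta r (xh r)) + (\<Sum>k<2^m. adj (S (r - t)) (Theta r (J k r))))"
    proof (rule bint_cong)
      fix r assume "r \<in> {t..T}"
      then have "r \<in> {0..T}" using sub by blast
      then show "(adj (S (r - t)) o\<^sub>L Theta r) (X m r \<omega>) = adj (S (r - t)) (Theta r (xh r)) + (\<Sum>k<2^m. adj (S (r - t)) (Theta r (J k r)))"
        by (simp only: XJ blinfun_apply_blinfun_compose blinfun.add_right blinfun.sum_right)
    qed
    also have "\<dots> = bint t T (\<lambda>r. adj (S (r - t)) (Theta r (xh r))) + (\<Sum>k<2^m. bint t T (\<lambda>r. adj (S (r - t)) (Theta r (J k r))))"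
      unfolding set_integral_add(2)[OF xi' Jsum(1)] Jsum(2) ..
    finally have b: "bint t T (\<lambda>r. (adj (S (r - t)) o\<^sub>L Theta r) (X m r \<omega>))
      = bint t T (\<lambda>r. adj (S (r - t)) (Theta r (xh r))) + (\<Sum>k<2^m. bint t T (\<lambda>r. adj (S (r - t)) (Theta r (J k r))))" .
    have "eta t (xh t) = adj (S (T - t)) (eta T (xh T)) + bint t T (\<lambda>r. adj (S (r - t)) (Theta r (xh r) - eta r (f r)))"
      by (rule riccati_mild_solution(2)[OF T0 S K eta Theta weak order_refl f mild t])
    also have "bint t T (\<lambda>r. adj (S (r - t)) (Theta r (xh r) - eta r (f r))) = bint t T (\<lambda>r. adj (S (r - t)) (Theta r (xh r))) + c"
      unfolding blinfun.diff_right c_def by (subst set_integral_diff(2)[OF xi' fi]) simp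
    finally have xt: "eta t (xh t) = adj (S (T - t)) (eta T (xh T)) + (bint t T (\<lambda>r. adj (S (r - t)) (Theta r (xh r))) + c)" .
    have Jt: "eta t (J k t) + (if t < p k then a k else 0)
        = adj (S (T - t)) (eta T (J k T)) + bint t T (\<lambda>r. adj (S (r - t)) (Theta r (J k r)))" if "k < 2^m" for k
      unfolding J_def a_def by (rule jump_backward(2)[OF T0 S K eta Theta weak p[OF that] t])
    have "(\<Sum>k<2^m. eta t (J k t)) + (\<Sum>k<2^m. if t < p k then a k else 0)
        = (\<Sum>k<2^m. adj (S (T - t)) (eta T (J k T))) + (\<Sum>k<2^m. bint t T (\<lambda>r. adj (S (r - t)) (Theta r (J k r))))"
      unfolding sum.distrib[symmetric] by (intro sum.cong refl Jt) simp
    moreover have "(\<Sum>k<2^m. if t < p k then a k else 0) = str m \<omega> - dsum T W m (wind T t T \<Phi> m) \<omega>"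
      unfolding str_def dsum_def[OF T Q W] sum_subtractf[symmetric]
    proof (intro sum.cong refl)
      fix k :: nat assume "k \<in> {..<2^m}"
      moreover have "0 < T / 2^m" using T by simp
      ultimately have "p k \<le> T" "dyad T m k < p k" using p[of k] dyad_Suc[of T m k] by (auto simp: p_def)
      then show "(if t < p k then a k else 0) = blinfun_apply (if dyad T m k < t \<and> t < dyad T m (Suc k)
          then adj (S (dyad T m (Suc k) - t)) o\<^sub>L eta (dyad T m (Suc k)) o\<^sub>L sig else 0) (incr T W m k \<omega>)
          - wind T t T \<Phi> m k (incr T W m k \<omega>)"
        unfolding p_def[symmetric] wind_def \<Phi>_def a_def v_def
        by (cases "dyad T m k < t") (auto simp: blinfun.minus_left)
    qed
    moreover have "eta t (X m t \<omega>) = eta t (xh t) + (\<Sum>k<2^m. eta t (J k t))"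
      unfolding XJ[OF t] by (simp only: blinfun.add_right blinfun.sum_right)
    moreover have "(adj (S (T - t)) o\<^sub>L eta T) (X m T \<omega>) = adj (S (T - t)) (eta T (xh T)) + (\<Sum>k<2^m. adj (S (T - t)) (eta T (J k T)))"
    proof -
      have "T \<in> {0..T}" using T by simp
      then show ?thesis by (simp only: XJ blinfun_apply_blinfun_compose blinfun.add_right blinfun.sum_right)
    qed
    ultimately show ?thesis unfolding b xt by (simp add: algebra_simps)
  qed
  have Gc: "continuous_on {t..T} (\<lambda>r. (adj (S (r - t)) o\<^sub>L Theta r) v)" for v
    unfolding blinfun_apply_blinfun_compose by (intro Sc Cs_apply[OF Theta _ sub] continuous_on_const)
  have \<Phi>c: "continuous_on {t..T} (\<lambda>r. \<Phi> r v)" for v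
    unfolding \<Phi>_def blinfun.minus_left blinfun_apply_blinfun_compose
    by (intro continuous_on_minus Sc Cs_apply[OF eta _ sub] continuous_on_const)
  have "T \<in> {0..T}" using T by simp
  from ito_integral_exists[OF T Q W t this \<Phi>c]
  obtain I where I: "I \<in> borel_measurable M"
    "\<forall>\<epsilon>>0. \<exists>m0. \<forall>m\<ge>m0. l2sq M (\<lambda>\<omega>. dsum T W m (wind T t T \<Phi> m) \<omega> - I \<omega>) \<le> ennreal \<epsilon>"
    "has_ito_integral M (aug_filtration M W) Q W t T (\<lambda>r \<omega>. restrict_VQ Q (\<Phi> r)) I" by (elim exE conjE)
  obtain CS where CS: "1 \<le> CS" "\<forall>t\<in>{0..T}. norm (S t) \<le> CS" using C0_semigroup_bound[OF S, of T] by (elim exE conjE)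
  obtain CE where CE: "0 \<le> CE" "\<forall>t\<in>{0..T}. norm (eta t) \<le> CE" using Cs_bound[OF eta] by (elim exE conjE)
  have "\<exists>D\<ge>0. \<forall>L::'v \<Rightarrow>\<^sub>L 'h. hs_sq Q L \<le> D * (norm L)\<^sup>2" by (rule hs_sq_bound[OF Q])
  then obtain D where D: "0 \<le> D" "\<And>L::'v \<Rightarrow>\<^sub>L 'h. hs_sq Q L \<le> D * (norm L)\<^sup>2" by (elim exE conjE) simp
  define d where "d = D * (CS * CE * norm sig)\<^sup>2"
  have d: "0 \<le> d" using D(1) by (simp add: d_def)
  have str_le: "l2sq M (str m) \<le> ennreal (d * (T / 2 ^ m))" for m
    unfolding str_def
  proof (rule straddle_bound[OF T Q W d])
    fix k assume k: "k < 2 ^ m" "dyad T m k < t" "t < dyad T m (Suc k)"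
    define p where "p = dyad T m (Suc k)"
    have p: "p \<in> {0..T}" "p - t \<in> {0..T}" using dyad_range[of T "Suc k" m] T k t unfolding p_def by auto
    have "norm (adj (S (p - t)) o\<^sub>L eta p o\<^sub>L sig) \<le> (CS * CE) * norm sig"
    proof (rule order_trans[OF norm_blinfun_compose mult_right_mono[OF _ norm_ge_zero]])
      have "norm (adj (S (p - t))) \<le> CS" by (rule order_trans[OF adj_inner(3)]) (use CS(2) p(2) in blast)
      moreover have "norm (eta p) \<le> CE" using CE(2) p(1) by blast
      ultimately show "norm (adj (S (p - t)) o\<^sub>L eta p) \<le> CS * CE"
        using CS(1) by (intro order_trans[OF norm_blinfun_compose mult_mono]) auto
    qed
    then show "hs_sq Q (adj (S (dyad T m (Suc k) - t)) o\<^sub>L eta (dyad T m (Suc k)) o\<^sub>L sig) \<le> d"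
      unfolding d_def p_def[symmetric] by (intro order_trans[OF D(2) mult_left_mono[OF power_mono D(1)]]) auto
  qed
  have Zm: "(\<lambda>\<omega>. dsum T W m (wind T t T \<Phi> m) \<omega> - str m \<omega>) \<in> borel_measurable M" for m
    unfolding str_def by (intro borel_measurable_diff dsum_measurable[OF T Q W])
  have Z: "\<exists>m0. \<forall>m\<ge>m0. l2sq M (\<lambda>\<omega>. (dsum T W m (wind T t T \<Phi> m) \<omega> - str m \<omega>) - I \<omega>) \<le> ennreal \<epsilon>" if e: "\<epsilon> > 0" for \<epsilon>
  proof -
    have "\<epsilon> / 4 > 0" using e by simp
    from I(2)[rule_format, OF this] obtain m1 where
      m1: "\<forall>m\<ge>m1. l2sq M (\<lambda>\<omega>. dsum T W m (wind T t T \<Phi> m) \<omega> - I \<omega>) \<le> ennreal (\<epsilon> / 4)" by (rule exE)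
    have "(\<lambda>m. d * T * (1 / 2) ^ m) \<longlonglongrightarrow> d * T * 0" by (intro tendsto_intros LIMSEQ_power_zero) simp
    then have "\<forall>\<^sub>F m in sequentially. d * T * (1 / 2) ^ m < \<epsilon> / 4" using order_tendstoD(2)[of _ 0 sequentially "\<epsilon> / 4"] e by simp
    then obtain m2 where m2: "\<And>m. m \<ge> m2 \<Longrightarrow> d * T * (1 / 2) ^ m < \<epsilon> / 4" unfolding eventually_sequentially by blast
    have "l2sq M (\<lambda>\<omega>. (dsum T W m (wind T t T \<Phi> m) \<omega> - str m \<omega>) - I \<omega>) \<le> ennreal (2 * (\<epsilon> / 4) + 2 * (\<epsilon> / 4))" if m: "m \<ge> max m1 m2" for m
    proof (rule l2sq_add_le[of "\<lambda>\<omega>. dsum T W m (wind T t T \<Phi> m) \<omega> - I \<omega>" _ "\<lambda>\<omega>. - str m \<omega>"])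
      have "d * (T / 2 ^ m) \<le> \<epsilon> / 4" using m2[of m] m by (simp add: power_one_over field_simps)
      then have "l2sq M (str m) \<le> ennreal (\<epsilon> / 4)" by (intro order_trans[OF str_le ennreal_leI])
      then show "l2sq M (\<lambda>\<omega>. - str m \<omega>) \<le> ennreal (\<epsilon> / 4)" by simp
      show "(\<lambda>\<omega>. dsum T W m (wind T t T \<Phi> m) \<omega> - I \<omega>) \<in> borel_measurable M"
        by (intro borel_measurable_diff dsum_measurable[OF T Q W] I(1))
      show "(\<lambda>\<omega>. - str m \<omega>) \<in> borel_measurable M"
        unfolding str_def by (intro borel_measurable_uminus dsum_measurable[OF T Q W])
    qed (use m m1 e in auto)
    then have "l2sq M (\<lambda>\<omega>. (dsum T W m (wind T t T \<Phi> m) \<omega> - str m \<omega>) - I \<omega>) \<le> ennreal \<epsilon>" if "m \<ge> max m1 m2" for m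
      using that by simp
    then show ?thesis by (intro exI[of _ "max m1 m2"] allI impI)
  qed
  from pass_to_limit[OF T Q W S K xh t0(1) order_refl t Gc id Zm I(1) Z]
  have "AE \<omega> in M. set_integrable lborel {t..T} (\<lambda>r. (adj (S (r - t)) o\<^sub>L Theta r) (x r \<omega>)) \<and>
      eta t (x t \<omega>) = (adj (S (T - t)) o\<^sub>L eta T) (x T \<omega>) + c + bint t T (\<lambda>r. (adj (S (r - t)) o\<^sub>L Theta r) (x r \<omega>)) + I \<omega>" .
  then have "AE \<omega> in M. set_integrable lborel {t..T} (\<lambda>r. adj (S (r - t)) (Theta r (x r \<omega>) - eta r (f r))) \<and>
      eta t (x t \<omega>) = adj (S (T - t)) (eta T (x T \<omega>))
        + bint t T (\<lambda>r. adj (S (r - t)) (Theta r (x r \<omega>) - eta r (f r))) + I \<omega>"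
  proof eventually_elim
    case (elim \<omega>)
    then have i: "set_integrable lborel {t..T} (\<lambda>r. adj (S (r - t)) (Theta r (x r \<omega>)))"
      and e: "eta t (x t \<omega>) = adj (S (T - t)) (eta T (x T \<omega>)) + c + bint t T (\<lambda>r. adj (S (r - t)) (Theta r (x r \<omega>))) + I \<omega>"
      by simp_all
    show ?case unfolding blinfun.diff_right
      using set_integral_diff[OF i fi] by (simp add: e c_def)
  qed
  with I(3) show ?thesis unfolding \<Phi>_def by blast
qed

end

end

end

section \<open>Existence of a mild solution\<close>

theorem theorem5p3:
  fixes T :: real
    and P :: "'w measure"
    and Q Q0 :: "'v::separable_hilbert \<Rightarrow>\<^sub>L 'v"
    and W0 :: "real \<Rightarrow> 'w \<Rightarrow> 'v"
    and DA :: "'h::separable_hilbert set" and A :: "'h \<Rightarrow> 'h" and S :: "real \<Rightarrow> 'h \<Rightarrow>\<^sub>L 'h"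
    and B :: "'u::separable_hilbert \<Rightarrow>\<^sub>L 'h"
    and F1 Fh1 Fh2 M G :: "'h \<Rightarrow>\<^sub>L 'h"
    and D F2 :: "'h \<Rightarrow> 'v \<Rightarrow> 'h"
    and \<sigma> \<sigma>0 :: "'v \<Rightarrow>\<^sub>L 'h"
    and \<xi> :: 'h
    and \<Pi>\<^sub>R \<eta> :: "real \<Rightarrow> 'h \<Rightarrow>\<^sub>L 'h"
    and \<Lambda> :: "real \<Rightarrow> 'h \<Rightarrow> 'h"
    and \<eta>n :: "nat \<Rightarrow> real \<Rightarrow> 'h \<Rightarrow>\<^sub>L 'h"
    and n0 :: nat
  assumes T: "0 < T"
    and P: "prob_space P"
    and Q: "positive_trace_class Q" and Q0: "positive_trace_class Q0"
    and W0: "Q_wiener T P Q0 W0"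
    and A: "generates DA A S"
    and D: "bounded_into_HS Q D" and F2: "bounded_into_HS Q F2"
    and M: "positive_op M" and G: "positive_op G"
    \<comment> \<open>the Riccati equation solved by \<open>\<Pi>\<close> (written \<open>\<Pi>\<^sub>R\<close>)\<close>
    and PiR_Cs: "\<Pi>\<^sub>R \<in> Cs T"
    and PiR_pos: "\<And>t. t \<in> {0..T} \<Longrightarrow> positive_op (\<Pi>\<^sub>R t)"
    and PiR_eq: "\<And>x t. x \<in> DA \<Longrightarrow> t \<in> {0..T} \<Longrightarrow>
      ((\<lambda>s. \<Pi>\<^sub>R s x \<bullet> x) has_real_derivative
        - 2 * (\<Pi>\<^sub>R t x \<bullet> A x) + \<Pi>\<^sub>R t (B (adj B (\<Pi>\<^sub>R t x))) \<bullet> x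
        - HS_adj Q D (\<lambda>v. \<Pi>\<^sub>R t (D x v)) \<bullet> x - M x \<bullet> x) (at t within {0..T})"
    and PiR_T: "\<Pi>\<^sub>R T = G"
    and \<Lambda>: "\<And>t x. t \<in> {0..T} \<Longrightarrow>
      \<Lambda> t x = HS_adj Q D (\<lambda>v. \<Pi>\<^sub>R t (F2 x v)) + \<Pi>\<^sub>R t (F1 x) - M (Fh1 x)"
    \<comment> \<open>hypothesis (a), for all \<open>n\<close> large enough\<close>
    and resolvent: "\<And>n. n \<ge> n0 \<Longrightarrow> real n \<in> resolvent_set DA A"
    and \<eta>n_Cs: "\<And>n. n \<ge> n0 \<Longrightarrow> \<eta>n n \<in> Cs T"
    and \<eta>n_eq: "\<And>n x. n \<ge> n0 \<Longrightarrow>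
      \<exists>d. continuous_on {0..T} d \<and>
        (\<forall>t\<in>{0..T}. ((\<lambda>s. \<eta>n n s x) has_vector_derivative d t) (at t within {0..T}) \<and>
          d t + \<eta>n n t (yosida DA A n x - B (adj B (\<Pi>\<^sub>R t x)))
            + (adj (yosida DA A n) (\<eta>n n t x) - \<Pi>\<^sub>R t (B (adj B (\<eta>n n t x))))
            + \<eta>n n t (F1 x) - \<eta>n n t (B (adj B (\<eta>n n t x))) + \<Lambda> t x = 0)"
    and \<eta>n_T: "\<And>n. n \<ge> n0 \<Longrightarrow> \<eta>n n T = - (G o\<^sub>L Fh2)"
    and \<eta>n_bound: "\<exists>C. \<forall>n\<ge>n0. \<forall>t\<in>{0..T}. norm (\<eta>n n t) \<le> C"
    \<comment> \<open>hypothesis (b)\<close>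
    and \<eta>_Cs: "\<eta> \<in> Cs T"
    and \<eta>_lim: "\<And>x. uniform_limit {0..T} (\<lambda>n t. \<eta>n n t x) (\<lambda>t. \<eta> t x) sequentially"
  shows "\<exists>(x :: real \<Rightarrow> 'w \<Rightarrow> 'h) (q :: real \<Rightarrow> 'w \<Rightarrow> 'h) (qt :: real \<Rightarrow> 'w \<Rightarrow> 'v \<Rightarrow> 'h).
    adapted_L2_continuous T P (aug_filtration P W0) x \<and>
    q \<in> M2 0 T P (aug_filtration P W0) borel norm \<and>
    qt \<in> M2 0 T P (aug_filtration P W0) (HS_borel Q0) (HS_norm Q0) \<and>
    (\<forall>t\<in>{0..T}.
      (\<exists>I. has_ito_integral P (aug_filtration P W0) Q0 W0 t T
             (\<lambda>r \<omega> v. adj (S (r - t)) (qt r \<omega> v)) I \<and>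
        (AE \<omega> in P.
          set_integrable lborel {t..T} (\<lambda>r. adj (S (r - t))
            (\<Pi>\<^sub>R r (B (adj B (q r \<omega>))) + \<Lambda> r (x r \<omega>) + HS_adj Q D (restrict_VQ Q \<sigma>))) \<and>
          q t \<omega> = adj (S (T - t)) (G (Fh2 (x T \<omega>)))
            - set_lebesgue_integral lborel {t..T} (\<lambda>r. adj (S (r - t))
                (\<Pi>\<^sub>R r (B (adj B (q r \<omega>))) + \<Lambda> r (x r \<omega>) + HS_adj Q D (restrict_VQ Q \<sigma>)))
            - I \<omega>)) \<and>
      (\<exists>J. has_ito_integral P (aug_filtration P W0) Q0 W0 0 t
             (\<lambda>r \<omega>. restrict_VQ Q0 (S (t - r) o\<^sub>L \<sigma>0)) J \<and>
        (AE \<omega> in P.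
          set_integrable lborel {0..t} (\<lambda>r. S (t - r)
            ((B (adj B (\<Pi>\<^sub>R r (x r \<omega>))) - F1 (x r \<omega>)) - B (adj B (q r \<omega>)))) \<and>
          x t \<omega> = S t \<xi>
            - set_lebesgue_integral lborel {0..t} (\<lambda>r. S (t - r)
                ((B (adj B (\<Pi>\<^sub>R r (x r \<omega>))) - F1 (x r \<omega>)) - B (adj B (q r \<omega>))))
            + J \<omega>)))"
proof -
  interpret prob_space P by (rule P)
  have T0: "0 \<le> T" and Tin: "T \<in> {0..T}" using T by simp_all
  have S: "C0_semigroup S" using A unfolding generates_def by (rule conjunct1)
  define N where "N = B o\<^sub>L adj B"
  have N: "B (adj B y) = N y" for y by (simp add: N_def)
  \<comment> \<open>The terminal value of \<eta>; its sign cancels the one in the ansatz and leaves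
    \<open>G (Fh2 (x T \<omega>))\<close> in the equation for \<open>q\<close>.\<close>
  define G' where "G' = - (G o\<^sub>L Fh2)"
  have lim: "(\<lambda>n. \<eta>n n t y) \<longlonglongrightarrow> \<eta> t y" if "t \<in> {0..T}" for t y
    by (rule tendsto_uniform_limitI[OF \<eta>_lim that])
  \<comment> \<open>From here on the function \<Lambda> is represented on \<open>{0..T}\<close> by
    the operator family \<open>L\<close>.\<close>
  have "\<exists>L\<in>Cs T. (\<forall>t\<in>{0..T}. \<forall>y. blinfun_apply (L t) y = \<Lambda> t y) \<and> \<eta> T = G' \<and>
    (\<forall>x y. \<forall>t\<in>{0..T}. \<eta> t x \<bullet> y = \<eta> T (S (T - t) x) \<bullet> S (T - t) y + bint t T (\<lambda>r.
      (blinfun_apply (L r - (\<Pi>\<^sub>R r o\<^sub>L N o\<^sub>L \<eta> r)) (S (r - t) x)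
        + \<eta> r (blinfun_apply (F1 - (N o\<^sub>L \<Pi>\<^sub>R r) - (N o\<^sub>L \<eta> r)) (S (r - t) x))) \<bullet> S (r - t) y))"
    by (rule decoupling_field[OF T A resolvent PiR_Cs \<eta>n_Cs \<eta>n_eq[unfolded N] \<eta>n_T[folded G'_def] \<eta>n_bound \<eta>_Cs lim])
  then obtain L where L: "L \<in> Cs T" "\<forall>t\<in>{0..T}. \<forall>y. blinfun_apply (L t) y = \<Lambda> t y" and \<eta>T: "\<eta> T = G'"
    and weak: "\<forall>x y. \<forall>t\<in>{0..T}. \<eta> t x \<bullet> y = \<eta> T (S (T - t) x) \<bullet> S (T - t) y + bint t T (\<lambda>r.
      (blinfun_apply (L r - (\<Pi>\<^sub>R r o\<^sub>L N o\<^sub>L \<eta> r)) (S (r - t) x)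
        + \<eta> r (blinfun_apply (F1 - (N o\<^sub>L \<Pi>\<^sub>R r) - (N o\<^sub>L \<eta> r)) (S (r - t) x))) \<bullet> S (r - t) y)"
    by (elim bexE conjE)
  define K where "K r = F1 - (N o\<^sub>L \<Pi>\<^sub>R r) - (N o\<^sub>L \<eta> r)" for r
  define \<Theta> where "\<Theta> r = L r - (\<Pi>\<^sub>R r o\<^sub>L N o\<^sub>L \<eta> r)" for r
  have K: "K \<in> Cs T" unfolding K_def by (intro Cs_diff Cs_compose Cs_const PiR_Cs \<eta>_Cs)
  have \<Theta>: "\<Theta> \<in> Cs T" unfolding \<Theta>_def by (intro Cs_diff Cs_compose Cs_const PiR_Cs \<eta>_Cs L(1))
  have weak': "\<eta> t x \<bullet> y = \<eta> T (S (T - t) x) \<bullet> S (T - t) y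
      + bint t T (\<lambda>r. (\<Theta> r (S (r - t) x) + \<eta> r (K r (S (r - t) x))) \<bullet> S (r - t) y)" if "t \<in> {0..T}" for x y t
    unfolding \<Theta>_def K_def by (rule weak[rule_format, OF that])
  define d where "d = HS_adj Q D (restrict_VQ Q \<sigma>)"
  \<comment> \<open>The coefficient of \<open>\<phi>\<close>. The part with
    \<open>\<Pi>\<^sub>R\<close> comes from the contribution of \<open>\<phi>\<close> to
    \<open>q\<close> in the driver; the part with \<eta> offsets the forcing \<open>f\<close>, which
    enters the backward identity as \<open>- \<eta> r (f r)\<close>.\<close>
  define R where "R r = 0 - ((\<Pi>\<^sub>R r + \<eta> r) o\<^sub>L N)" for r
  have "R \<in> Cs T" unfolding R_def by (intro Cs_diff Cs_add Cs_compose Cs_const PiR_Cs \<eta>_Cs)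
  from backward_mild_exists[OF T0 S this, of d]
  obtain \<phi> where \<phi>: "continuous_on {0..T} \<phi>" "\<forall>t\<in>{0..T}. \<phi> t = bint t T (\<lambda>r. adj (S (r - t)) (R r (\<phi> r) + d))"
    by (elim exE conjE)
  \<comment> \<open>The part of \<open>N q\<close> that does not depend on the state; it becomes the
    forcing of the forward equation.\<close>
  define f where "f r = - N (\<phi> r)" for r
  have f: "continuous_on {0..T} f"
    unfolding f_def by (intro continuous_on_minus bounded_linear.continuous_on[OF blinfun.bounded_linear_right] \<phi>(1))
  obtain xh where mild: "mild T S K 0 f \<xi> xh" using mild_exists[OF T0 S K order_refl T0 f] by (rule exE)
  then have xh: "continuous_on {0..T} xh" unfolding mild_def[OF T0 S K] by (rule conjunct1)
  define x where "x = forward_process T W0 S K \<sigma>0 xh"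
  \<comment> \<open>The indicator makes \<open>q\<close> jointly measurable on the whole line, since
    nothing is known about \<eta> and \<open>\<phi>\<close> outside \<open>{0..T}\<close>.\<close>
  define q where "q r \<omega> = indicator {0..T} r *\<^sub>R (- (\<eta> r (x r \<omega>) + \<phi> r))" for r \<omega>
  define qt where "qt r \<omega> = restrict_VQ Q0 (- (\<eta> r o\<^sub>L \<sigma>0))" for r and \<omega> :: 'w
  have q_eq: "q r \<omega> = - (\<eta> r (x r \<omega>) + \<phi> r)" if "r \<in> {0..T}" for r \<omega> using that by (simp add: q_def)
  note x_meas = fwd_measurable[OF T Q0 W0 S K xh, where sig = \<sigma>0, folded x_def]
  have q_joint: "(\<lambda>p. q (fst p) (snd p)) \<in> borel_measurable (R' \<Otimes>\<^sub>M N')"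
    if "(\<lambda>r. r) \<in> measurable R' borel" "(\<lambda>p. x (fst p) (snd p)) \<in> borel_measurable (R' \<Otimes>\<^sub>M N')" for R' N'
  proof -
    obtain CE where CE: "0 \<le> CE" "\<forall>t\<in>{0..T}. norm (\<eta> t) \<le> CE" using Cs_bound[OF \<eta>_Cs] by (elim exE conjE)
    have "continuous_on ({0..T} \<times> UNIV) (\<lambda>p. \<eta> (fst p) (snd p))"
    proof (rule continuous_on_blinfun_apply_strong[where C = CE])
      fix v
      have "continuous_on {0..T} (\<lambda>r. \<eta> r v)" using \<eta>_Cs unfolding Cs_def by simp
      then show "continuous_on ({0..T} \<times> UNIV) (\<lambda>p. \<eta> (fst p) v)"
        by (rule continuous_on_compose2) (auto intro!: continuous_intros)
    qed (use CE in \<open>auto intro!: continuous_intros\<close>)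
    moreover have "continuous_on ({0..T} \<times> (UNIV :: 'h set)) (\<lambda>p. \<phi> (fst p))"
      by (rule continuous_on_compose2[OF \<phi>(1)]) (auto intro!: continuous_intros)
    ultimately have "continuous_on ({0..T} \<times> UNIV) (\<lambda>p. - (\<eta> (fst p) (snd p) + \<phi> (fst p)))"
      by (intro continuous_on_minus continuous_on_add)
    from joint_measurable[OF closed_atLeastAtMost this that] show ?thesis unfolding q_def .
  qed
  have q_M2: "q \<in> M2 0 T P (aug_filtration P W0) borel norm"
    unfolding M2_def
  proof (intro CollectI conjI ballI)
    fix t assume t: "t \<in> {0..T}"
    have "(\<lambda>p. q (fst p) (snd p)) \<in> borel_measurable (restrict_space borel {0..t} \<Otimes>\<^sub>M aug_filtration P W0 t)"
      by (rule q_joint[OF _ x_meas(3)[OF t]]) (auto intro!: measurable_restrict_space1)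
    then show "(\<lambda>(r, \<omega>). q r \<omega>) \<in> borel_measurable (restrict_space borel {0..t} \<Otimes>\<^sub>M aug_filtration P W0 t)"
      by (simp add: split_def)
  next
    obtain c where c: "0 \<le> c" "\<forall>r\<in>{0..T}. l2sq P (x r) \<le> ennreal c"
      using fwd_l2_bound[OF T Q0 W0 S K xh, where sig = \<sigma>0] unfolding x_def by (elim exE conjE)
    obtain CE where CE: "0 \<le> CE" "\<forall>t\<in>{0..T}. norm (\<eta> t) \<le> CE" using Cs_bound[OF \<eta>_Cs] by (elim exE conjE)
    have "bounded (\<phi> ` {0..T})" by (intro compact_imp_bounded compact_continuous_image \<phi>(1) compact_Icc)
    then have "\<exists>b. \<forall>r\<in>{0..T}. norm (\<phi> r) \<le> b" unfolding bounded_iff by simp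
    then obtain b where b: "\<forall>r\<in>{0..T}. norm (\<phi> r) \<le> b" by (rule exE)
    have "l2sq P (q r) \<le> ennreal (2 * (CE\<^sup>2 * c) + 2 * b\<^sup>2)" if r: "r \<in> {0..T}" for r
    proof (rule l2sq_add_le[of "\<lambda>\<omega>. - \<eta> r (x r \<omega>)" _ "\<lambda>\<omega>. - \<phi> r"])
      have "l2sq P (\<lambda>\<omega>. - \<eta> r (x r \<omega>)) \<le> (\<integral>\<^sup>+\<omega>. ennreal (CE\<^sup>2) * ennreal ((norm (x r \<omega>))\<^sup>2) \<partial>P)"
      proof (rule nn_integral_mono)
        fix \<omega>
        have "norm (\<eta> r (x r \<omega>)) \<le> CE * norm (x r \<omega>)"
          by (rule order_trans[OF norm_blinfun mult_right_mono[OF _ norm_ge_zero]]) (use CE(2) r in blast)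
        then have "(norm (\<eta> r (x r \<omega>)))\<^sup>2 \<le> CE\<^sup>2 * (norm (x r \<omega>))\<^sup>2"
          unfolding power_mult_distrib[symmetric] by (rule power_mono) simp
        then show "ennreal ((norm (- \<eta> r (x r \<omega>)))\<^sup>2) \<le> ennreal (CE\<^sup>2) * ennreal ((norm (x r \<omega>))\<^sup>2)"
          by (simp add: ennreal_mult[symmetric] ennreal_leI)
      qed
      also have "\<dots> = ennreal (CE\<^sup>2) * l2sq P (x r)" using x_meas(2) by (intro nn_integral_cmult) simp
      also have "\<dots> \<le> ennreal (CE\<^sup>2) * ennreal c" using c(2) r by (intro mult_left_mono) auto
      finally show "l2sq P (\<lambda>\<omega>. - \<eta> r (x r \<omega>)) \<le> ennreal (CE\<^sup>2 * c)" using c(1) by (simp add: ennreal_mult)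
      have "(norm (\<phi> r))\<^sup>2 \<le> b\<^sup>2" using b r by (intro power_mono) auto
      then show "l2sq P (\<lambda>\<omega>. - \<phi> r) \<le> ennreal (b\<^sup>2)" by (simp add: emeasure_space_1 ennreal_leI)
      show "(\<lambda>\<omega>. - \<eta> r (x r \<omega>)) \<in> borel_measurable P"
        by (intro borel_measurable_uminus blinfun_measurable[OF T Q0 W0] x_meas(2))
    qed (use r c(1) in \<open>auto simp: q_eq\<close>)
    moreover have "(\<lambda>p. q (fst p) (snd p)) \<in> borel_measurable (borel \<Otimes>\<^sub>M P)" by (rule q_joint[OF _ x_meas(1)]) simp
    ultimately have "(\<integral>\<^sup>+\<omega>. (\<integral>\<^sup>+r\<in>{0..T}. ennreal ((norm (q r \<omega>))\<^sup>2) \<partial>lborel) \<partial>P) \<le> ennreal (T * (2 * (CE\<^sup>2 * c) + 2 * b\<^sup>2))"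
      using c(1) by (intro nn_integral_time_le T0) auto
    then show "(\<integral>\<^sup>+\<omega>. (\<integral>\<^sup>+r\<in>{0..T}. ennreal ((norm (q r \<omega>))\<^sup>2) \<partial>lborel) \<partial>P) < \<infinity>"
      by (rule le_less_trans) simp
  qed
  have qt_M2: "qt \<in> M2 0 T P (aug_filtration P W0) (HS_borel Q0) (HS_norm Q0)"
  proof -
    have "continuous_on {0..T} (\<lambda>r. (- (\<eta> r o\<^sub>L \<sigma>0)) v)" for v
      using \<eta>_Cs unfolding Cs_def blinfun.minus_left blinfun_apply_blinfun_compose by (auto intro!: continuous_on_minus)
    then have "continuous_on {0..T} (\<lambda>r. blinfun_apply (- (\<eta> r o\<^sub>L \<sigma>0)) v)" for v by simp
    \<comment> \<open>Membership in \<open>M2\<close> is part of having an Ito integral over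
      \<open>{0..T}\<close>.\<close>
    from ito_integral_exists[OF T Q0 W0 _ Tin this] T0
    show ?thesis unfolding has_ito_integral_def qt_def by auto
  qed
  show ?thesis
  proof (rule exI[of _ x], rule exI[of _ q], rule exI[of _ qt], intro conjI ballI q_M2 qt_M2)
    show "adapted_L2_continuous T P (aug_filtration P W0) x"
      unfolding x_def by (rule fwd_adapted_L2_continuous[OF T Q0 W0 S K xh])
  next
    fix t assume t: "t \<in> {0..T}"
    have ss: "{t..T} \<subseteq> {0..T}" using t by auto
    \<comment> \<open>The adjoint semigroup maps the default value 0 outside \<open>VQ Q0\<close> to
      0, so composing with it commutes with the restriction.\<close>
    have qt_eq: "(\<lambda>r \<omega> v. adj (S (r - t)) (qt r \<omega> v)) = (\<lambda>r \<omega>. restrict_VQ Q0 (- (adj (S (r - t)) o\<^sub>L \<eta> r o\<^sub>L \<sigma>0)))"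
      by (intro ext) (simp add: qt_def restrict_VQ_def blinfun.bilinear_simps)
    have "\<exists>I. has_ito_integral P (aug_filtration P W0) Q0 W0 t T (\<lambda>r \<omega>. restrict_VQ Q0 (- (adj (S (r - t)) o\<^sub>L \<eta> r o\<^sub>L \<sigma>0))) I \<and>
      (AE \<omega> in P. set_integrable lborel {t..T} (\<lambda>r. adj (S (r - t)) (\<Theta> r (x r \<omega>) - \<eta> r (f r))) \<and>
        \<eta> t (x t \<omega>) = adj (S (T - t)) (\<eta> T (x T \<omega>)) + bint t T (\<lambda>r. adj (S (r - t)) (\<Theta> r (x r \<omega>) - \<eta> r (f r))) + I \<omega>)"
      unfolding x_def by (rule backward_equation[OF T Q0 W0 S K xh f mild \<eta>_Cs \<Theta> weak' t])
    then obtain I where I: "has_ito_integral P (aug_filtration P W0) Q0 W0 t T (\<lambda>r \<omega>. restrict_VQ Q0 (- (adj (S (r - t)) o\<^sub>L \<eta> r o\<^sub>L \<sigma>0))) I"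
      "AE \<omega> in P. set_integrable lborel {t..T} (\<lambda>r. adj (S (r - t)) (\<Theta> r (x r \<omega>) - \<eta> r (f r))) \<and>
        \<eta> t (x t \<omega>) = adj (S (T - t)) (\<eta> T (x T \<omega>)) + bint t T (\<lambda>r. adj (S (r - t)) (\<Theta> r (x r \<omega>) - \<eta> r (f r))) + I \<omega>"
      by (elim exE conjE)
    have "continuous_on {t..T} (\<lambda>r. adj (S (r - t)) (R r (\<phi> r) + d))"
    proof (rule Cs_shift[OF C0_semigroup_Cs[OF C0_semigroup_adj[OF S], of T]])
      show "continuous_on {t..T} (\<lambda>r. R r (\<phi> r) + d)"
        by (intro continuous_on_add continuous_on_const Cs_apply[OF \<open>R \<in> Cs T\<close> continuous_on_subset[OF \<phi>(1) ss] ss])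
    qed (use t in \<open>auto intro!: continuous_intros\<close>)
    then have \<phi>i: "set_integrable lborel {t..T} (\<lambda>r. adj (S (r - t)) (R r (\<phi> r) + d))" by (rule continuous_set_integrable)
    show "\<exists>I. has_ito_integral P (aug_filtration P W0) Q0 W0 t T (\<lambda>r \<omega> v. adj (S (r - t)) (qt r \<omega> v)) I \<and>
        (AE \<omega> in P.
          set_integrable lborel {t..T} (\<lambda>r. adj (S (r - t))
            (\<Pi>\<^sub>R r (B (adj B (q r \<omega>))) + \<Lambda> r (x r \<omega>) + HS_adj Q D (restrict_VQ Q \<sigma>))) \<and>
          q t \<omega> = adj (S (T - t)) (G (Fh2 (x T \<omega>)))
            - set_lebesgue_integral lborel {t..T} (\<lambda>r. adj (S (r - t))
                (\<Pi>\<^sub>R r (B (adj B (q r \<omega>))) + \<Lambda> r (x r \<omega>) + HS_adj Q D (restrict_VQ Q \<sigma>)))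
            - I \<omega>)"
    proof (intro exI[of _ I] conjI)
      show "has_ito_integral P (aug_filtration P W0) Q0 W0 t T (\<lambda>r \<omega> v. adj (S (r - t)) (qt r \<omega> v)) I"
        unfolding qt_eq by (rule I(1))
      show "AE \<omega> in P.
          set_integrable lborel {t..T} (\<lambda>r. adj (S (r - t))
            (\<Pi>\<^sub>R r (B (adj B (q r \<omega>))) + \<Lambda> r (x r \<omega>) + HS_adj Q D (restrict_VQ Q \<sigma>))) \<and>
          q t \<omega> = adj (S (T - t)) (G (Fh2 (x T \<omega>)))
            - set_lebesgue_integral lborel {t..T} (\<lambda>r. adj (S (r - t))
                (\<Pi>\<^sub>R r (B (adj B (q r \<omega>))) + \<Lambda> r (x r \<omega>) + HS_adj Q D (restrict_VQ Q \<sigma>)))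
            - I \<omega>"
        using I(2)
      proof eventually_elim
        case (elim \<omega>)
        let ?g = "\<lambda>r. adj (S (r - t)) (\<Pi>\<^sub>R r (B (adj B (q r \<omega>))) + \<Lambda> r (x r \<omega>) + HS_adj Q D (restrict_VQ Q \<sigma>))"
        \<comment> \<open>The integrand from the identity for \<eta> plus the one for
          \<open>\<phi>\<close>. The terms in which \<eta> acts on \<open>N (\<phi> r)\<close>
          cancel, and the terms with \<open>\<Pi>\<^sub>R\<close> combine to
          \<open>\<Pi>\<^sub>R r (N (q r \<omega>))\<close>.\<close>
        let ?h = "\<lambda>r. adj (S (r - t)) (\<Theta> r (x r \<omega>) - \<eta> r (f r)) + adj (S (r - t)) (R r (\<phi> r) + d)"
        have gh: "?g r = ?h r" if "r \<in> {t..T}" for r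
        proof -
          have r: "r \<in> {0..T}" using that ss by blast
          have "\<Lambda> r (x r \<omega>) = L r (x r \<omega>)" using L(2) r by simp
          then show ?thesis
            by (simp add: N q_eq[OF r] \<Theta>_def R_def f_def d_def[symmetric] blinfun.bilinear_simps algebra_simps)
        qed
        note sum = set_integral_add[OF conjunct1[OF elim] \<phi>i]
        have gi: "set_integrable lborel {t..T} ?g"
          using sum(1) by (subst set_integrable_cong[OF refl refl gh]) auto
        have "bint t T ?g = bint t T ?h" by (rule bint_cong) (rule gh)
        also have "\<dots> = bint t T (\<lambda>r. adj (S (r - t)) (\<Theta> r (x r \<omega>) - \<eta> r (f r))) + \<phi> t"
          using \<phi>(2) t by (simp only: sum(2))
        finally have "q t \<omega> = adj (S (T - t)) (G (Fh2 (x T \<omega>))) - bint t T ?g - I \<omega>"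
          using conjunct2[OF elim] by (simp add: q_eq[OF t] \<eta>T G'_def blinfun.minus_left blinfun.minus_right)
        with gi show ?case by (rule conjI)
      qed
    qed
    obtain J where J: "has_ito_integral P (aug_filtration P W0) Q0 W0 0 t (\<lambda>r \<omega>. restrict_VQ Q0 (S (t - r) o\<^sub>L \<sigma>0)) J"
      "AE \<omega> in P. set_integrable lborel {0..t} (\<lambda>r. S (t - r) (K r (x r \<omega>) + f r)) \<and>
        x t \<omega> = S t \<xi> + bint 0 t (\<lambda>r. S (t - r) (K r (x r \<omega>) + f r)) + J \<omega>"
      using forward_equation[OF T Q0 W0 S K xh f mild t, where sig = \<sigma>0] unfolding x_def by (elim exE conjE)
    show "\<exists>J. has_ito_integral P (aug_filtration P W0) Q0 W0 0 t (\<lambda>r \<omega>. restrict_VQ Q0 (S (t - r) o\<^sub>L \<sigma>0)) J \<and>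
        (AE \<omega> in P.
          set_integrable lborel {0..t} (\<lambda>r. S (t - r)
            ((B (adj B (\<Pi>\<^sub>R r (x r \<omega>))) - F1 (x r \<omega>)) - B (adj B (q r \<omega>)))) \<and>
          x t \<omega> = S t \<xi>
            - set_lebesgue_integral lborel {0..t} (\<lambda>r. S (t - r)
                ((B (adj B (\<Pi>\<^sub>R r (x r \<omega>))) - F1 (x r \<omega>)) - B (adj B (q r \<omega>))))
            + J \<omega>)"
    proof (intro exI[of _ J] conjI J(1))
      show "AE \<omega> in P.
          set_integrable lborel {0..t} (\<lambda>r. S (t - r)
            ((B (adj B (\<Pi>\<^sub>R r (x r \<omega>))) - F1 (x r \<omega>)) - B (adj B (q r \<omega>)))) \<and>
          x t \<omega> = S t \<xi>
            - set_lebesgue_integral lborel {0..t} (\<lambda>r. S (t - r)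
                ((B (adj B (\<Pi>\<^sub>R r (x r \<omega>))) - F1 (x r \<omega>)) - B (adj B (q r \<omega>))))
            + J \<omega>"
        using J(2)
      proof eventually_elim
        case (elim \<omega>)
        let ?g = "\<lambda>r. S (t - r) ((B (adj B (\<Pi>\<^sub>R r (x r \<omega>))) - F1 (x r \<omega>)) - B (adj B (q r \<omega>)))"
        \<comment> \<open>The conclusion carries the drift with the opposite sign of
          \<open>K r (x r \<omega>) + f r\<close>.\<close>
        let ?h = "\<lambda>r. - S (t - r) (K r (x r \<omega>) + f r)"
        have gh: "?g r = ?h r" if "r \<in> {0..t}" for r
        proof -
          have r: "r \<in> {0..T}" using that t by auto
          show ?thesis by (simp add: N q_eq[OF r] K_def f_def blinfun.bilinear_simps algebra_simps)
        qed
        have hi: "set_integrable lborel {0..t} ?h" and hb: "bint 0 t ?h = - bint 0 t (\<lambda>r. S (t - r) (K r (x r \<omega>) + f r))"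
          using conjunct1[OF elim] unfolding set_integrable_def set_lebesgue_integral_def by simp_all
        have gi: "set_integrable lborel {0..t} ?g"
          using hi by (subst set_integrable_cong[OF refl refl gh]) auto
        have "bint 0 t ?g = - bint 0 t (\<lambda>r. S (t - r) (K r (x r \<omega>) + f r))"
          unfolding hb[symmetric] by (rule bint_cong) (rule gh)
        then have "x t \<omega> = S t \<xi> - bint 0 t ?g + J \<omega>" using conjunct2[OF elim] by simp
        with gi show ?case by (rule conjI)
      qed
    qed
  qed
qed


end
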